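(* Let $\mathbb K=\mathbb R$ or $\mathbb C$ and let $G:\mathbb K^2\to\mathbb K$, $G[x,y]=\sum_{\alpha,\beta\ge0}c_{\alpha\beta}x^\alpha y^\beta$, be analytic near $(0,0)$ with $G[0,0]=0$ and convenient Newton polygon with segments $S_1,\dots,S_\tau$, $\tau\ge1$. With the data $m,n,r,p,q,N,A,A_S,\phi$ of a segment as defined in the context: (i) Every linear factor $aX+bY$ ($a,b\in\mathbb K\setminus\{0\}$) of multiplicity $1$ of the homogeneous polynomial $\phi(X,Y)$ of a segment $S$ defines a solution curve of $G[x,y]=0$ of the form $$\begin{pmatrix} x \\ y \end{pmatrix}=\begin{pmatrix}\varepsilon^nv_0+O(|\varepsilon|^{n+1})\\ \varepsilon^mw_0\end{pmatrix}\ \text{ if } n\ge m,\qquad \begin{pmatrix} x \\ y \end{pmatrix}=\begin{pmatrix}\varepsilon^nv_0\\ \varepsilon^mw_0+O(|\varepsilon|^{m+1})\end{pmatrix}\ \text{ if } m> n,$$ where $v_0,w_0\in\mathbb K\setminus\{0\}$ satisfy $av_0^m+bw_0^n=0$, and this curve has $k$-regularity of minimal degree $$k=N-\max(m,n)=2A-\max(m,n).$$ (ii) If the homogeneous polynomial $\phi(\cdot,\cdot)$ of segment $S$ factorizes completely over $\mathbb K$ into linear factors with multiplicities $1$, then $r$ different solution curves arise, each having minimal $k$-degree $k=N-\max(m,n)$, and summing up to $$r\cdot k=2A_S-\max(p,q).$$ (iii) If the homogeneous polynomials $\phi_i(\cdot,\cdot)$, $i=1,\dots,\tau$, of all segments (with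 data $m_i,n_i,r_i,N_i$) factorize completely over $\mathbb K$ into linear factors with multiplicities $1$, then $r_1+\cdots+r_\tau$ different solution curves exist and the Milnor number $\mu$ of the singularity can be calculated by $$\mu=\sum_{i=1}^\tau r_i\cdot k_i-ord(G)+1,\qquad k_i=N_i-\max(m_i,n_i),$$ where $ord(G)$ denotes the lowest degree $\alpha+\beta$ of a monomial with $c_{\alpha\beta}\ne0$.
   Context: Newton polygon: the union of the compact edges (segments) of the convex hull of $\bigcup_{c_{\alpha\beta}\ne0}\big((\alpha,\beta)+\mathbb R_{\ge0}^2\big)$ in the $(\alpha,\beta)$-plane. It is convenient if it meets both coordinate axes, i.e. $c_{\alpha0}\ne0$ for some $\alpha\ge 1$ and $c_{0\beta}\ne0$ for some $\beta\ge 1$ (solutions $x\equiv0$, $y\equiv0$ have been split off). Data of a segment $S$: let $(\alpha_1,\beta_1)$ be its upper-left and $(\alpha_S,\beta_S)$ its lower-right endpoint, $p=\beta_1-\beta_S$, $q=\alpha_S-\alpha_1$, $r=\gcd(p,q)\ge1$, $p=rn$, $q=rm$ with $\gcd(n,m)=1$, and $N=n\alpha_S+m\beta_S$ (the quasi-homogeneous degree of the monomials on $S$ with weights $n$ for $x$ and $m$ for $y$). $\phi(X,Y)=\sum_{i=0}^{r}c_{\alpha_1+im,\,\beta_1-in}X^iY^{r-i}$, so that $G[\varepsilon^nv,\varepsilon^mw]=\varepsilon^N\{v^{\alpha_1}w^{\beta_S}\phi(v^m,w^n)+O(|\varepsilon|)\}$. $A_S$ is the area of the triangle formed by the origin and the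 two endpoints of $S$; $A$ is the area of the triangle formed by the origin and two neighbouring points $(\alpha_1+im,\beta_1-in)$, $(\alpha_1+(i+1)m,\beta_1-(i+1)n)$ of $S$. Solution curves are regarded as different if they have different orbits (images) near the origin. $k$-regularity for $G:\mathbb K^2\to\mathbb K$: let $z(\varepsilon)=\sum_{j\ge1}\frac1{j!}\varepsilon^j\bar z_j$ be a solution curve of $G[z]=0$. In this scalar case the minimal degree of regularity $k$ of the curve is the smallest $k\ge0$ such that $S_{k+1}\neq[0\ 0]$ (i.e. $S_{k+1}$ is surjective onto $\mathbb K$), where, as long as $S_1=\cdots=S_k=0$, $S_{k+1}\in L[\mathbb K^2,\mathbb K]$ equals $\frac{(2k)!}{k!}$ times the coefficient of $\varepsilon^k$ in the expansion of $G'[z(\varepsilon)]$ (e.g. $S_1=G'[0]$, $S_2=2G''[0]\bar z_1$, $S_3=6G''[0]\bar z_2+6G'''[0]\bar z_1^2$). For $k\ge 1$ this means that $[\bar z_1,\dots,\bar z_k]$ is regular of degree $k$ with $k$ minimal. Milnor number: $\mu=\dim_{\mathbb K}\mathbb K\{x,y\}/(G_x,G_y)$. *)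

theory Defs
  imports
    "HOL-Analysis.Analysis"
    "HOL-Computational_Algebra.Computational_Algebra"
    "HOL-Library.Landau_Symbols"
    "HOL-Algebra.QuotRing"
    "HOL-Algebra.Embedded_Algebras"
begin

text \<open>
  The ground field is a type \<open>'k :: {real_normed_field, euclidean_space}\<close>.  Both \<open>real\<close> and
  \<open>complex\<close> are instances, and up to isomorphism there are no others (Frobenius).
  A function \<open>G\<close> of two variables is given together with its Taylor coefficients
  \<open>c \<alpha> \<beta>\<close> at the origin.
\<close>

definition has_power_series_at_0 ::
    "('k :: {real_normed_field, euclidean_space} \<times> 'k \<Rightarrow> 'k) \<Rightarrow> (nat \<Rightarrow> nat \<Rightarrow> 'k) \<Rightarrow> bool" where
  "has_power_series_at_0 G c \<longleftrightarrow>
     (\<forall>\<^sub>F z in nhds (0, 0).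
        ((\<lambda>(\<alpha>, \<beta>). c \<alpha> \<beta> * fst z ^ \<alpha> * snd z ^ \<beta>) has_sum G z) UNIV)"

definition series_order :: "(nat \<Rightarrow> nat \<Rightarrow> 'k :: zero) \<Rightarrow> nat" where
  "series_order c = (LEAST d. \<exists>\<alpha> \<beta>. c \<alpha> \<beta> \<noteq> 0 \<and> d = \<alpha> + \<beta>)"

definition lattice_point :: "nat \<Rightarrow> nat \<Rightarrow> real ^ 2" where
  "lattice_point \<alpha> \<beta> = vector [real \<alpha>, real \<beta>]"

definition newton_region :: "(nat \<Rightarrow> nat \<Rightarrow> 'k :: zero) \<Rightarrow> (real ^ 2) set" where
  "newton_region c =
     convex hull {lattice_point \<alpha> \<beta> + u | \<alpha> \<beta> u. c \<alpha> \<beta> \<noteq> 0 \<and> 0 \<le> u $ 1 \<and> 0 \<le> u $ 2}"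

definition newton_segments :: "(nat \<Rightarrow> nat \<Rightarrow> 'k :: zero) \<Rightarrow> (real ^ 2) set set" where
  "newton_segments c = {E. E edge_of newton_region c \<and> compact E}"

definition convenient :: "(nat \<Rightarrow> nat \<Rightarrow> 'k :: zero) \<Rightarrow> bool" where
  "convenient c \<longleftrightarrow> (\<exists>\<alpha>\<ge>1. c \<alpha> 0 \<noteq> 0) \<and> (\<exists>\<beta>\<ge>1. c 0 \<beta> \<noteq> 0)"

text \<open>
  The endpoints of a compact edge are lattice points; they are returned as
  (upper-left endpoint, lower-right endpoint).
\<close>

definition endpoints :: "(real ^ 2) set \<Rightarrow> (nat \<times> nat) \<times> (nat \<times> nat)" where
  "endpoints E = (THE e. case e of ((\<alpha>\<^sub>1, \<beta>\<^sub>1), (\<alpha>\<^sub>2, \<beta>\<^sub>2)) \<Rightarrow>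
     E = closed_segment (lattice_point \<alpha>\<^sub>1 \<beta>\<^sub>1) (lattice_point \<alpha>\<^sub>2 \<beta>\<^sub>2) \<and> \<alpha>\<^sub>1 < \<alpha>\<^sub>2 \<and> \<beta>\<^sub>2 < \<beta>\<^sub>1)"

definition left_\<alpha> :: "(real ^ 2) set \<Rightarrow> nat" where "left_\<alpha> E = fst (fst (endpoints E))"
definition left_\<beta> :: "(real ^ 2) set \<Rightarrow> nat" where "left_\<beta> E = snd (fst (endpoints E))"
definition right_\<alpha> :: "(real ^ 2) set \<Rightarrow> nat" where "right_\<alpha> E = fst (snd (endpoints E))"
definition right_\<beta> :: "(real ^ 2) set \<Rightarrow> nat" where "right_\<beta> E = snd (snd (endpoints E))"

definition seg_p :: "(real ^ 2) set \<Rightarrow> nat" where "seg_p E = left_\<beta> E - right_\<beta> E"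
definition seg_q :: "(real ^ 2) set \<Rightarrow> nat" where "seg_q E = right_\<alpha> E - left_\<alpha> E"
definition seg_r :: "(real ^ 2) set \<Rightarrow> nat" where "seg_r E = gcd (seg_p E) (seg_q E)"
definition seg_n :: "(real ^ 2) set \<Rightarrow> nat" where "seg_n E = seg_p E div seg_r E"
definition seg_m :: "(real ^ 2) set \<Rightarrow> nat" where "seg_m E = seg_q E div seg_r E"
definition seg_N :: "(real ^ 2) set \<Rightarrow> nat" where
  "seg_N E = seg_n E * right_\<alpha> E + seg_m E * right_\<beta> E"

definition segment_area :: "(real ^ 2) set \<Rightarrow> real" where
  "segment_area E = measure lborel (convex hull
     {0, lattice_point (left_\<alpha> E) (left_\<beta> E), lattice_point (right_\<alpha> E) (right_\<beta> E)})"

definition point_on_segment :: "(real ^ 2) set \<Rightarrow> nat \<Rightarrow> real ^ 2" where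
  "point_on_segment E i = lattice_point (left_\<alpha> E + i * seg_m E) (left_\<beta> E - i * seg_n E)"

text \<open>The value does not depend on the choice of the neighbouring points, i.e. on \<open>i < seg_r E\<close>.\<close>

definition elementary_area :: "(real ^ 2) set \<Rightarrow> nat \<Rightarrow> real" where
  "elementary_area E i =
     measure lborel (convex hull {0, point_on_segment E i, point_on_segment E (Suc i)})"

text \<open>
  \<open>'k[X, Y]\<close> is represented by \<open>'k poly poly\<close>: \<open>X\<close> is the inner and \<open>Y\<close> the outer variable.
\<close>

definition seg_poly :: "(nat \<Rightarrow> nat \<Rightarrow> 'k :: field) \<Rightarrow> (real ^ 2) set \<Rightarrow> 'k poly poly" where
  "seg_poly c E = (\<Sum>i = 0..seg_r E.
     Polynomial.monom (Polynomial.monom (c (left_\<alpha> E + i * seg_m E) (left_\<beta> E - i * seg_n E)) i) (seg_r E - i))"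

definition linear_form :: "'k :: field \<Rightarrow> 'k \<Rightarrow> 'k poly poly" where
  "linear_form a b = Polynomial.monom (Polynomial.monom a 1) 0 + Polynomial.monom (Polynomial.monom b 0) 1"

definition simple_linear_factor :: "'k :: field \<Rightarrow> 'k \<Rightarrow> 'k poly poly \<Rightarrow> bool" where
  "simple_linear_factor a b \<phi> \<longleftrightarrow> linear_form a b dvd \<phi> \<and> \<not> linear_form a b ^ 2 dvd \<phi>"

definition splits_simply :: "'k :: field poly poly \<Rightarrow> bool" where
  "splits_simply \<phi> \<longleftrightarrow>
     (\<exists>L. \<phi> = prod_list (map (\<lambda>(a, b). linear_form a b) L) \<and>
          (\<forall>(a, b) \<in> set L. simple_linear_factor a b \<phi>))"

text \<open>A curve is given by the pair of power series of its components.\<close>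

definition curve_at ::
    "'k :: {real_normed_field, euclidean_space} fps \<times> 'k fps \<Rightarrow> 'k \<Rightarrow> 'k \<times> 'k" where
  "curve_at z \<epsilon> = (eval_fps (fst z) \<epsilon>, eval_fps (snd z) \<epsilon>)"

definition solution_curve ::
    "('k :: {real_normed_field, euclidean_space} \<times> 'k \<Rightarrow> 'k) \<Rightarrow> 'k fps \<times> 'k fps \<Rightarrow> bool" where
  "solution_curve G z \<longleftrightarrow>
     fps_conv_radius (fst z) > 0 \<and> fps_conv_radius (snd z) > 0 \<and>
     fps_nth (fst z) 0 = 0 \<and> fps_nth (snd z) 0 = 0 \<and>
     (\<forall>\<^sub>F \<epsilon> in nhds 0. G (curve_at z \<epsilon>) = 0)"

definition leading_form ::
    "(real ^ 2) set \<Rightarrow> 'k \<Rightarrow> 'k \<Rightarrow> 'k :: {real_normed_field, euclidean_space} fps \<times> 'k fps \<Rightarrow> bool" where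
  "leading_form E v\<^sub>0 w\<^sub>0 z \<longleftrightarrow>
     (let n = seg_n E; m = seg_m E; x = eval_fps (fst z); y = eval_fps (snd z) in
      if n \<ge> m
      then (\<lambda>\<epsilon>. x \<epsilon> - \<epsilon> ^ n * v\<^sub>0) \<in> O[at 0](\<lambda>\<epsilon>. \<epsilon> ^ (n + 1)) \<and> (\<forall>\<^sub>F \<epsilon> in nhds 0. y \<epsilon> = \<epsilon> ^ m * w\<^sub>0)
      else (\<forall>\<^sub>F \<epsilon> in nhds 0. x \<epsilon> = \<epsilon> ^ n * v\<^sub>0) \<and> (\<lambda>\<epsilon>. y \<epsilon> - \<epsilon> ^ m * w\<^sub>0) \<in> O[at 0](\<lambda>\<epsilon>. \<epsilon> ^ (m + 1)))"

text \<open>Two curves have the same orbit near the origin if their images of small balls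
  agree as germs of sets.\<close>

definition same_orbit ::
    "('k :: {real_normed_field, euclidean_space} fps \<times> 'k fps) rel" where
  "same_orbit = {(z, w). \<forall>\<delta>>0. \<exists>\<delta>'>0.
     curve_at z ` ball 0 \<delta>' \<subseteq> curve_at w ` ball 0 \<delta> \<and>
     curve_at w ` ball 0 \<delta>' \<subseteq> curve_at z ` ball 0 \<delta>}"

definition segment_curves ::
    "('k :: {real_normed_field, euclidean_space} \<times> 'k \<Rightarrow> 'k) \<Rightarrow> (nat \<Rightarrow> nat \<Rightarrow> 'k) \<Rightarrow>
     (real ^ 2) set \<Rightarrow> ('k fps \<times> 'k fps) set" where
  "segment_curves G c E = {z. solution_curve G z \<and>
     (\<exists>a b v\<^sub>0 w\<^sub>0. a \<noteq> 0 \<and> b \<noteq> 0 \<and> simple_linear_factor a b (seg_poly c E) \<and>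
        v\<^sub>0 \<noteq> 0 \<and> w\<^sub>0 \<noteq> 0 \<and> a * v\<^sub>0 ^ seg_m E + b * w\<^sub>0 ^ seg_n E = 0 \<and>
        leading_form E v\<^sub>0 w\<^sub>0 z)}"

definition partial_x ::
    "('k :: {real_normed_field, euclidean_space} \<times> 'k \<Rightarrow> 'k) \<Rightarrow> 'k \<times> 'k \<Rightarrow> 'k" where
  "partial_x G z = deriv (\<lambda>x. G (x, snd z)) (fst z)"

definition partial_y ::
    "('k :: {real_normed_field, euclidean_space} \<times> 'k \<Rightarrow> 'k) \<Rightarrow> 'k \<times> 'k \<Rightarrow> 'k" where
  "partial_y G z = deriv (\<lambda>y. G (fst z, y)) (snd z)"

text \<open>
  If \<open>[P Q]\<close> is the expansion of \<open>G'[z(\<epsilon>)] = [G\<^sub>x G\<^sub>y]\<close>, then \<open>regularity_op P Q k\<close> is the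
  row vector of \<open>S\<^sub>k\<^sub>+\<^sub>1\<close>, provided that \<open>S\<^sub>1, \<dots>, S\<^sub>k\<close> vanish.
\<close>

definition regularity_op :: "'k :: real_normed_field fps \<Rightarrow> 'k fps \<Rightarrow> nat \<Rightarrow> 'k \<times> 'k" where
  "regularity_op P Q k =
     (fact (2 * k) / fact k * fps_nth P k, fact (2 * k) / fact k * fps_nth Q k)"

definition has_minimal_regularity_degree ::
    "('k :: {real_normed_field, euclidean_space} \<times> 'k \<Rightarrow> 'k) \<Rightarrow> 'k fps \<times> 'k fps \<Rightarrow> nat \<Rightarrow> bool" where
  "has_minimal_regularity_degree G z k \<longleftrightarrow>
     (\<exists>P Q. (\<lambda>\<epsilon>. partial_x G (curve_at z \<epsilon>)) has_fps_expansion P \<and>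
            (\<lambda>\<epsilon>. partial_y G (curve_at z \<epsilon>)) has_fps_expansion Q \<and>
            (\<forall>j<k. regularity_op P Q j = (0, 0)) \<and> regularity_op P Q k \<noteq> (0, 0))"

text \<open>
  \<open>'k{x, y}\<close> is a ring of double power series \<open>'k fps fps\<close>, where \<open>x\<close> is the outer and \<open>y\<close>
  the inner variable.
\<close>

definition convergent_series ::
    "'k :: {real_normed_field, euclidean_space} fps fps \<Rightarrow> bool" where
  "convergent_series f \<longleftrightarrow>
     (\<exists>\<rho>>0. (\<lambda>(\<alpha>, \<beta>). norm (fps_nth (fps_nth f \<alpha>) \<beta>) * \<rho> ^ (\<alpha> + \<beta>)) summable_on UNIV)"

definition convergent_ring :: "'k :: {real_normed_field, euclidean_space} fps fps ring" where
  "convergent_ring =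
     \<lparr>carrier = {f. convergent_series f}, mult = (*), one = 1, zero = 0, add = (+)\<rparr>"

definition series_of :: "(nat \<Rightarrow> nat \<Rightarrow> 'k) \<Rightarrow> 'k :: field fps fps" where
  "series_of c = Abs_fps (\<lambda>\<alpha>. Abs_fps (\<lambda>\<beta>. c \<alpha> \<beta>))"

definition series_dx :: "'k :: field fps fps \<Rightarrow> 'k fps fps" where
  "series_dx f = fps_deriv f"

definition series_dy :: "'k :: field fps fps \<Rightarrow> 'k fps fps" where
  "series_dy f = Abs_fps (\<lambda>\<alpha>. fps_deriv (fps_nth f \<alpha>))"

definition jacobian_ideal ::
    "(nat \<Rightarrow> nat \<Rightarrow> 'k :: {real_normed_field, euclidean_space}) \<Rightarrow> 'k fps fps set" where
  "jacobian_ideal c = Idl\<^bsub>convergent_ring\<^esub> {series_dx (series_of c), series_dy (series_of c)}"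

text \<open>
  The quotient ring has finite dimension \<open>\<mu>\<close> over the image of the field of constants.
\<close>

definition has_milnor_number ::
    "(nat \<Rightarrow> nat \<Rightarrow> 'k :: {real_normed_field, euclidean_space}) \<Rightarrow> nat \<Rightarrow> bool" where
  "has_milnor_number c \<mu> \<longleftrightarrow>
     ring.dimension (convergent_ring Quot jacobian_ideal c) \<mu>
       ((\<lambda>a. jacobian_ideal c +>\<^bsub>convergent_ring\<^esub> fps_const (fps_const a)) ` UNIV)
       (carrier (convergent_ring Quot jacobian_ideal c))"

end

(* Proof idea.  Part (i): substituting x = e^n (v + u), y = e^m w and dividing by e^N leaves an
   equation in (e, u) whose u-derivative at the origin is nonzero exactly when the root of the edge
   polynomial is simple; its formal solution is the limit of a contracting iteration and converges.
   The expansions of G_x and G_y along the curve begin at the orders N - n and N - m.  Curves are told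
   apart by the limits of x^m / y^n.
   Part (iii): let f = x G_x and g = y G_y.  In the weight filtration H(u) = min over edges of the
   normalised weights, simplicity of the roots makes the Koszul complex of (f, g) exact edge by edge, so
   dim K{x,y}/(f,g) is a second difference of lattice point counts, namely the sum of r_i N_i.  Dividing
   out x and y costs the two axis intercepts, whose sum telescopes over the edges to the sum of
   max(p_i, q_i) plus the order of G. *)
theory Submission
 imports Defs
begin

text \<open>Multiplying the partial derivatives by x and y keeps both generators supported within
  the support of G, so they start at one common level \<open>L\<close> on every edge. On a single
  edge they are a1 psi + m t psi' and b1 psi - n t psi', where psi is the dehomogenised edge
  polynomial; the determinant of these combinations is N up to sign, so a common nonzero root would
  be a double root of psi. Solutions found edge by edge must agree where cones meet: on the ray of a
  common vertex the value is already forced by one nonzero coefficient of f, which is what makes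
  gluing possible. The ring of convergent series is not complete, hence exactness is only used up to
  finite levels. The count then shows that (f, g) + {H >= D + 2 L} has a codimension independent of
  D, and Nakayama's lemma turns this stability into the inclusion of {H >= 2 L} in (f, g). For the
  curves the field may be real: coprimality of n and m replaces the extraction of roots, both in
  solving v^m = t w^n and in showing that all solutions for one root t give the same orbit.\<close>

section \<open>Relative dimension of nested subspaces\<close>

locale scalar_space = vector_space scale
 for scale :: "'a::field => 'b::ab_group_add => 'b"
begin

definition line_sum :: "'b set => 'b => 'b set" where
 "line_sum W v = {w + scale k v | w k. w \<in> W}"

text \<open>Codimension as the length of a chain of one-dimensional extensions. The spaces of series
  are infinite-dimensional, so only dimensions relative to \<open>U\<close> are finite. The chain
  has the same shape as the \<open>dimension\<close> predicate of the quotient ring, into which it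
  is finally translated.\<close>

inductive rel_dim :: "'b set => 'b set => nat => bool" for U where
 rel_dim_0: "subspace U ==> rel_dim U U 0"
| rel_dim_Suc: "rel_dim U W n ==> v \<notin> W ==> rel_dim U (line_sum W v) (Suc n)"

lemma line_sum_iff: "x \<in> line_sum W v \<longleftrightarrow> (\<exists>k. x - scale k v \<in> W)"
proof
 assume "\<exists>k. x - scale k v \<in> W"
 then obtain k where k: "x - scale k v \<in> W" ..
 have "x = (x - scale k v) + scale k v" by simp
 with k show "x \<in> line_sum W v" unfolding line_sum_def by blast
next
 assume "x \<in> line_sum W v"
 then obtain w k where "x = w + scale k v" "w \<in> W" by (auto simp: line_sum_def)
 then have "x - scale k v \<in> W" by simp
 then show "\<exists>k. x - scale k v \<in> W" ..
qed

lemma subspace_line_sum: assumes "subspace W" shows "subspace (line_sum W v)"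
proof (rule subspaceI)
 show "0 \<in> line_sum W v"
  unfolding line_sum_iff using subspace_0[OF assms] by (intro exI[of _ 0]) simp
next
 fix x y assume "x \<in> line_sum W v" "y \<in> line_sum W v"
 then obtain k l where "x - scale k v \<in> W" "y - scale l v \<in> W" by (auto simp: line_sum_iff)
 from subspace_add[OF assms this] show "x + y \<in> line_sum W v"
  unfolding line_sum_iff by (intro exI[of _ "k + l"]) (simp add: scale_left_distrib algebra_simps)
next
 fix c x assume "x \<in> line_sum W v"
 then obtain k where "x - scale k v \<in> W" by (auto simp: line_sum_iff)
 from subspace_scale[OF assms this, of c] show "scale c x \<in> line_sum W v"
  unfolding line_sum_iff by (intro exI[of _ "c * k"]) (simp add: scale_right_diff_distrib)
qed

lemma rel_dim_subspace: "rel_dim U W n ==> subspace U \<and> subspace W \<and> U \<subseteq> W"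
proof (induction rule: rel_dim.induct)
 case (rel_dim_Suc W n v)
 have "W \<subseteq> line_sum W v"
  unfolding line_sum_iff by (auto simp: line_sum_iff intro!: exI[of _ 0])
 with rel_dim_Suc subspace_line_sum show ?case by blast
qed auto

lemma rel_dim_trans: "rel_dim V W m ==> rel_dim U V n ==> rel_dim U W (n + m)"
 by (induction rule: rel_dim.induct) (auto intro: rel_dim.intros)

text \<open>Since \<open>x\<close> is outside \<open>W\<close>, writing it as an element of
  \<open>W\<close> plus a multiple of \<open>v\<close> takes a nonzero multiple, so \<open>v\<close>
  can be solved for inside \<open>V\<close>.\<close>

lemma subspace_between_line_sum:
 assumes W: "subspace W" "subspace V" "W \<subseteq> V" and x: "x \<in> V" "x \<notin> W" "V \<subseteq> line_sum W v"
 shows "V = line_sum W v"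
proof -
 obtain k where k: "x - scale k v \<in> W" using x line_sum_iff by blast
 have "k ~= 0" using k x by auto
 have "scale k v \<in> V"
  using subspace_diff[OF W(2) x(1), of "x - scale k v"] k W(3) by auto
 hence v: "v \<in> V" using subspace_scale[OF W(2), of "scale k v" "inverse k"] \<open>k ~= 0\<close> by simp
 have "line_sum W v \<subseteq> V"
  unfolding line_sum_def using v W by (auto intro: subspace_add subspace_scale)
 with x show ?thesis by auto
qed

lemma rel_dim_same: "rel_dim U U n ==> n = 0"
proof (cases n)
 case (Suc m)
 assume "rel_dim U U n"
 then show ?thesis
 proof cases
  case (rel_dim_Suc W n v)
  note sub = rel_dim_subspace[OF rel_dim_Suc(3)]
  have "v \<in> line_sum W v"
   unfolding line_sum_iff using sub subspace_0[of W] by (intro exI[of _ 1]) auto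
  then have False using rel_dim_Suc sub by auto
  then show ?thesis ..
 qed
qed auto

text \<open>The last step of a chain starts from a space between \<open>W\<close> and the line sum;
  if that space were larger than \<open>W\<close> it would already be everything and the step would
  add nothing.\<close>

lemma rel_dim_1:
 assumes "rel_dim W (line_sum W v) n" "v \<notin> W" shows "n = 1"
proof -
 have W: "subspace W" using rel_dim_subspace[OF assms(1)] by auto
 have v: "v \<in> line_sum W v" unfolding line_sum_iff using subspace_0[OF W] by (intro exI[of _ 1]) simp
 from assms(1) show ?thesis
 proof cases
  case rel_dim_0
  then show ?thesis using v assms by auto
 next
  case (rel_dim_Suc V m x)
  have V: "subspace V" "W \<subseteq> V" using rel_dim_subspace[OF rel_dim_Suc(3)] by auto
  have xV: "x \<in> line_sum V x" unfolding line_sum_iff using subspace_0[OF V(1)] by (intro exI[of _ 1]) simp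
  have "V \<subseteq> line_sum V x" by (auto simp: line_sum_iff intro!: exI[of _ 0])
  have "V = W"
  proof (rule ccontr)
   assume "V ~= W"
   then obtain y where "y \<in> V" "y \<notin> W" using V by auto
   from subspace_between_line_sum[OF W V(1,2) this, of v] have "V = line_sum W v"
    using \<open>V \<subseteq> line_sum V x\<close> rel_dim_Suc(1) by (simp only:)
   with rel_dim_Suc(1) xV have "x \<in> V" by (simp only:)
   then show False using rel_dim_Suc(4) by contradiction
  qed
  then have "m = 0" using rel_dim_same[of W m] rel_dim_Suc(3) by (simp only:)
  then show ?thesis using rel_dim_Suc(2) by simp
 qed
qed

end

locale scalar_space_pair = vs1: scalar_space s1 + vs2: scalar_space s2
 for s1 :: "'a::field => 'b::ab_group_add => 'b" and s2 :: "'a => 'c::ab_group_add => 'c"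

text \<open>The isomorphism theorem in chain form: the membership condition says that
  \<open>T\<close> induces an injection of W/U into the target modulo \<open>Z\<close>, so every
  step of the chain maps to a genuine step. Later transfers of dimension along linear maps rest on
  this.\<close>

lemma (in scalar_space_pair) rel_dim_image:
 assumes T: "Vector_Spaces.linear s1 s2 T" and Z: "vs2.subspace Z"
 shows "vs1.rel_dim U W n ==> (\<And>x. x \<in> W ==> T x \<in> Z \<longleftrightarrow> x \<in> U)
   ==> vs2.rel_dim Z {z + T x | z x. z \<in> Z \<and> x \<in> W} n"
proof (induction rule: vs1.rel_dim.induct)
 interpret T: Vector_Spaces.linear s1 s2 T by fact
 case rel_dim_0
 have "{z + T x | z x. z \<in> Z \<and> x \<in> U} = Z"
 proof (intro equalityI subsetI)
  fix y assume "y \<in> Z"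
  then have "y = y + T 0" "y \<in> Z" "0 \<in> U" using rel_dim_0 vs1.subspace_0 by (auto simp: T.zero)
  then show "y \<in> {z + T x | z x. z \<in> Z \<and> x \<in> U}" by blast
 qed (use rel_dim_0 vs2.subspace_add[OF Z] in auto)
 then show ?case using Z by (simp add: vs2.rel_dim_0)
next
 interpret T: Vector_Spaces.linear s1 s2 T by fact
 case (rel_dim_Suc W n v)
 let ?W = "{z + T x | z x. z \<in> Z \<and> x \<in> W}"
 note sub = vs1.rel_dim_subspace[OF rel_dim_Suc(1)]
 have v: "v \<in> vs1.line_sum W v" unfolding vs1.line_sum_iff using vs1.subspace_0 sub by (intro exI[of _ 1]) simp
 have WW: "W \<subseteq> vs1.line_sum W v" by (auto simp: vs1.line_sum_iff intro!: exI[of _ 0])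
 have IH: "vs2.rel_dim Z ?W n" using rel_dim_Suc(3) rel_dim_Suc(4) WW by blast
 have "T v \<notin> ?W"
 proof
  assume "T v \<in> ?W"
  then obtain z x where zx: "T v = z + T x" "z \<in> Z" "x \<in> W" by auto
  then have "T (v - x) \<in> Z" by (simp add: T.diff)
  moreover have "v - x \<in> vs1.line_sum W v"
   using v zx WW vs1.subspace_diff[OF vs1.subspace_line_sum] sub by blast
  ultimately have "v - x \<in> U" using rel_dim_Suc by blast
  then have "v - x + x \<in> W" using sub zx vs1.subspace_add by blast
  then show False using rel_dim_Suc by simp
 qed
 have "{z + T x | z x. z \<in> Z \<and> x \<in> vs1.line_sum W v} = vs2.line_sum ?W (T v)"
 proof (intro equalityI subsetI)
  fix y assume "y \<in> {z + T x | z x. z \<in> Z \<and> x \<in> vs1.line_sum W v}"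
  then obtain z w k where "y = z + T (w + s1 k v)" "z \<in> Z" "w \<in> W" unfolding vs1.line_sum_def by blast
  then have "y = (z + T w) + s2 k (T v)" "z + T w \<in> ?W" by (auto simp: T.add T.scale)
  then show "y \<in> vs2.line_sum ?W (T v)" unfolding vs2.line_sum_def by blast
 next
  fix y assume "y \<in> vs2.line_sum ?W (T v)"
  then obtain z w k where "y = (z + T w) + s2 k (T v)" "z \<in> Z" "w \<in> W" unfolding vs2.line_sum_def by blast
  then have "y = z + T (w + s1 k v)" "z \<in> Z" "w + s1 k v \<in> vs1.line_sum W v"
   by (auto simp: T.add T.scale vs1.line_sum_def)
  then show "y \<in> {z + T x | z x. z \<in> Z \<and> x \<in> vs1.line_sum W v}" by blast
 qed
 then show ?case using vs2.rel_dim_Suc[OF IH \<open>T v \<notin> ?W\<close>] by simp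
qed

context scalar_space
begin

text \<open>Additivity of codimension, by induction on the chain: intersect \<open>V\<close> with
  the last but one space. The final line is consumed either on the way to \<open>V\<close> or on the
  way from \<open>V\<close> to the top.\<close>

lemma rel_dim_split:
 assumes "rel_dim U W n" "subspace V" "U \<subseteq> V" "V \<subseteq> W"
 shows "\<exists>m\<le>n. rel_dim U V m \<and> rel_dim V W (n - m)"
 using assms
proof (induction arbitrary: V rule: rel_dim.induct)
 case rel_dim_0
 then show ?case using rel_dim.rel_dim_0 by auto
next
 case (rel_dim_Suc W n v)
 note sub = rel_dim_subspace[OF rel_dim_Suc(1)]
 have VW: "subspace (V \<inter> W)" using rel_dim_Suc sub by (intro subspace_inter) auto
 obtain m where m: "m <= n" "rel_dim U (V \<inter> W) m" "rel_dim (V \<inter> W) W (n - m)"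
  using rel_dim_Suc.IH[OF VW] sub rel_dim_Suc by auto
 show ?case
 proof (cases "V \<subseteq> W")
  case True
  then have "V \<inter> W = V" by auto
  with m rel_dim.rel_dim_Suc[of V W "n - m" v] rel_dim_Suc(2) show ?thesis
   by (intro exI[of _ m]) (auto simp: Suc_diff_le)
 next
  case False
  then obtain x where x: "x \<in> V" "x \<notin> W" by auto
  have Vx: "line_sum (V \<inter> W) x = V"
  proof (intro equalityI subsetI)
   fix y assume "y \<in> line_sum (V \<inter> W) x"
   then show "y \<in> V" unfolding line_sum_def using rel_dim_Suc x
    by (auto intro!: subspace_add subspace_scale)
  next
   fix y assume y: "y \<in> V"
   obtain k l where k: "x - scale k v \<in> W" "y - scale l v \<in> W"
    using x y rel_dim_Suc by (meson line_sum_iff subsetD)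
   have "k ~= 0" using k x by auto
   \<comment> \<open>The combination is chosen so that the multiples of \<open>v\<close> cancel,
     which exhibits \<open>y\<close> modulo \<open>W\<close> as a multiple of
     \<open>x\<close>.\<close>
   have "(y - scale l v) - scale (l / k) (x - scale k v) \<in> W"
    using k sub by (blast intro: subspace_diff subspace_scale)
   then have "y - scale (l / k) x \<in> W" using \<open>k ~= 0\<close>
    by (simp add: scale_right_diff_distrib)
   moreover have "y - scale (l / k) x \<in> V" using x y rel_dim_Suc
    by (intro subspace_diff subspace_scale) auto
   ultimately show "y \<in> line_sum (V \<inter> W) x" unfolding line_sum_iff by blast
  qed
  have "rel_dim U V (Suc m)" using rel_dim.rel_dim_Suc[OF m(2), of x] x Vx by auto
  interpret scalar_space_pair scale scale ..
  \<comment> \<open>The sum of \<open>V\<close> and \<open>W\<close> will turn out to be the whole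
    line sum, so the identity map carries the chain from the intersection to \<open>W\<close> over
    to a chain starting at \<open>V\<close>.\<close>
  have "rel_dim V {z + id x | z x. z \<in> V \<and> x \<in> W} (n - m)"
   using rel_dim_Suc by (intro rel_dim_image[OF _ _ m(3)] linear_id) auto
  also have "{z + id x | z x. z \<in> V \<and> x \<in> W} = line_sum W v"
  proof -
   have 1: "W \<subseteq> {z + id x | z x. z \<in> V \<and> x \<in> W}"
   proof
    fix w assume "w \<in> W"
    then have "w = 0 + id w" "0 \<in> V" "w \<in> W" using subspace_0[OF rel_dim_Suc(4)] by auto
    then show "w \<in> {z + id x | z x. z \<in> V \<and> x \<in> W}" by blast
   qed
   have 2: "x \<in> {z + id x | z x. z \<in> V \<and> x \<in> W}"
   proof -
    have "x = x + id 0" "x \<in> V" "0 \<in> W" using subspace_0[of W] sub x by auto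
    then show ?thesis by blast
   qed
   have 3: "subspace {z + id x | z x. z \<in> V \<and> x \<in> W}"
    using subspace_sums[OF rel_dim_Suc(4), of W] sub by simp
   have 4: "{z + id x | z x. z \<in> V \<and> x \<in> W} \<subseteq> line_sum W v"
   proof -
    have "W \<subseteq> line_sum W v" by (auto simp: line_sum_iff intro!: exI[of _ 0])
    then show ?thesis using rel_dim_Suc(6) subspace_add[OF subspace_line_sum] sub by fastforce
   qed
   show ?thesis using subspace_between_line_sum[OF _ 3 1 2 x(2) 4] sub by auto
  qed
  finally show ?thesis using \<open>rel_dim U V (Suc m)\<close> m by (intro exI[of _ "Suc m"]) auto
 qed
qed

text \<open>The second chain is cut at the last but one space of the first; what remains above it
  has length one.\<close>

lemma rel_dim_unique: "rel_dim U W n ==> rel_dim U W m ==> m = n"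
proof (induction arbitrary: m rule: rel_dim.induct)
 case rel_dim_0
 then show ?case using rel_dim_same by auto
next
 case (rel_dim_Suc W n v)
 note sub = rel_dim_subspace[OF rel_dim_Suc(1)]
 have "W \<subseteq> line_sum W v" by (auto simp: line_sum_iff intro!: exI[of _ 0])
 then obtain k where "k <= m" "rel_dim U W k" "rel_dim W (line_sum W v) (m - k)"
  using rel_dim_split[OF rel_dim_Suc(4), of W] sub by auto
 then show ?case using rel_dim_Suc rel_dim_1 by fastforce
qed

lemma rel_dim_diff:
 assumes "rel_dim U W n" "rel_dim U V m" "V \<subseteq> W"
 shows "m <= n \<and> rel_dim V W (n - m)"
 using rel_dim_split[OF assms(1) _ _ assms(3)] rel_dim_subspace[OF assms(2)] rel_dim_unique[OF assms(2)]
 by auto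

lemma rel_dim_diff_upper:
 assumes "rel_dim U W n" "rel_dim V W m" "U \<subseteq> V"
 shows "m <= n \<and> rel_dim U V (n - m)"
 using rel_dim_split[OF assms(1) _ assms(3)] rel_dim_subspace[OF assms(2)] rel_dim_unique[OF assms(2)]
 by (metis diff_diff_cancel diff_le_self)

end

section \<open>Truncated majorant norms and convergent double series\<close>

text \<open>The left side runs over the triangle i + j <= K, the right side over the whole
  square.\<close>

lemma sum_conv_le:
 fixes p q :: "nat => real"
 assumes "\<And>i. 0 <= p i" "\<And>i. 0 <= q i"
 shows "(\<Sum>k\<le>K. \<Sum>i\<le>k. p i * q (k - i)) <= (\<Sum>i\<le>K. p i) * (\<Sum>j\<le>K. q j)"
proof -
 have "(\<Sum>k\<le>K. \<Sum>i\<le>k. p i * q (k - i)) = (\<Sum>(i,j)\<in>{(i,j). i + j <= K}. p i * q j)"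
  by (simp add: sum.triangle_reindex_eq)
 also have "\<dots> <= (\<Sum>(i,j)\<in>{..K} \<times> {..K}. p i * q j)"
  using assms by (intro sum_mono2) auto
 also have "\<dots> = (\<Sum>i\<le>K. p i) * (\<Sum>j\<le>K. q j)"
  by (simp add: sum_product sum.cartesian_product)
 finally show ?thesis .
qed

text \<open>A weighted sum norm cut off at degree \<open>K\<close>. It remains submultiplicative
  after truncation, so convergence becomes a bound uniform in \<open>K\<close>, and absorption
  arguments never meet a possibly infinite norm.\<close>

definition fps_nrm :: "real => nat => 'k::real_normed_field fps => real" where
 "fps_nrm \<rho> K F = (\<Sum>k\<le>K. norm (fps_nth F k) * \<rho> ^ k)"

lemma fps_nrm_nonneg: "0 <= \<rho> ==> 0 <= fps_nrm \<rho> K F"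
 unfolding fps_nrm_def by (intro sum_nonneg) auto

lemma fps_nrm_mult:
 assumes "0 <= \<rho>" shows "fps_nrm \<rho> K (F * G) <= fps_nrm \<rho> K F * fps_nrm \<rho> K G"
proof -
 have "fps_nrm \<rho> K (F * G) <= (\<Sum>k\<le>K. \<Sum>i\<le>k. (norm (fps_nth F i) * \<rho> ^ i) * (norm (fps_nth G (k - i)) * \<rho> ^ (k - i)))"
  unfolding fps_nrm_def
 proof (rule sum_mono)
  fix k
  have "norm (fps_nth (F * G) k) <= (\<Sum>i\<le>k. norm (fps_nth F i) * norm (fps_nth G (k - i)))"
   unfolding fps_mult_nth atLeast0AtMost by (rule order_trans[OF norm_sum]) (simp add: norm_mult)
  then have "norm (fps_nth (F * G) k) * \<rho> ^ k <= (\<Sum>i\<le>k. norm (fps_nth F i) * norm (fps_nth G (k - i))) * \<rho> ^ k"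
   using assms by (intro mult_right_mono) auto
  also have "\<dots> = (\<Sum>i\<le>k. (norm (fps_nth F i) * \<rho> ^ i) * (norm (fps_nth G (k - i)) * \<rho> ^ (k - i)))"
   unfolding sum_distrib_right by (intro sum.cong refl) (auto simp: power_add[symmetric])
  finally show "norm (fps_nth (F * G) k) * \<rho> ^ k <= (\<Sum>i\<le>k. (norm (fps_nth F i) * \<rho> ^ i) * (norm (fps_nth G (k - i)) * \<rho> ^ (k - i)))" .
 qed
 also have "\<dots> <= fps_nrm \<rho> K F * fps_nrm \<rho> K G"
  unfolding fps_nrm_def using assms by (intro sum_conv_le) auto
 finally show ?thesis .
qed

lemma fps_nrm_add: "0 <= \<rho> ==> fps_nrm \<rho> K (F + G) <= fps_nrm \<rho> K F + fps_nrm \<rho> K G"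
 unfolding fps_nrm_def sum.distrib[symmetric]
 by (intro sum_mono) (auto simp flip: distrib_right intro!: mult_right_mono norm_triangle_ineq)

lemma fps_nrm_sum: "0 <= \<rho> ==> fps_nrm \<rho> K (sum F A) <= (\<Sum>i\<in>A. fps_nrm \<rho> K (F i))"
proof (induction A rule: infinite_finite_induct)
 case (insert x A)
 then show ?case using fps_nrm_add[of \<rho> K "F x" "sum F A"] by auto
qed (auto simp: fps_nrm_def)

lemma fps_nrm_power: "0 <= \<rho> ==> fps_nrm \<rho> K (F ^ j) <= fps_nrm \<rho> K F ^ j"
proof (induction j)
 case 0
 have "fps_nrm \<rho> K (1 :: 'a fps) = (\<Sum>k\<le>K. if k = 0 then 1 else 0)"
  unfolding fps_nrm_def by (intro sum.cong) auto
 then show ?case by simp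
next
 case (Suc j)
 have "fps_nrm \<rho> K (F ^ Suc j) <= fps_nrm \<rho> K F * fps_nrm \<rho> K (F ^ j)"
  using Suc fps_nrm_mult by auto
 also have "\<dots> <= fps_nrm \<rho> K F * fps_nrm \<rho> K F ^ j"
  using Suc fps_nrm_nonneg by (intro mult_left_mono) auto
 finally show ?case by simp
qed

abbreviation cf :: "'k::zero fps fps => nat => nat => 'k" where
 "cf f \<alpha> \<beta> \<equiv> fps_nth (fps_nth f \<alpha>) \<beta>"

lemma cf_eqI: "(\<And>a b. cf f a b = cf g a b) ==> f = g"
 by (simp add: fps_eq_iff)

lemma cf_mult: "cf (f * g) a b = (\<Sum>i\<le>a. \<Sum>j\<le>b. cf f i j * cf g (a - i) (b - j))"
 by (simp add: fps_mult_nth fps_sum_nth atLeast0AtMost)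

definition nrm :: "real => nat => 'k::real_normed_field fps fps => real" where
 "nrm \<rho> K f = (\<Sum>\<alpha>\<le>K. fps_nrm \<rho> K (fps_nth f \<alpha>) * \<rho> ^ \<alpha>)"

lemma nrm_eq: "nrm \<rho> K f = (\<Sum>(\<alpha>,\<beta>)\<in>{..K}\<times>{..K}. norm (cf f \<alpha> \<beta>) * \<rho> ^ (\<alpha> + \<beta>))"
 unfolding nrm_def fps_nrm_def sum_distrib_right sum.cartesian_product[symmetric]
 by (simp add: power_add mult_ac)

lemma nrm_nonneg: "0 <= \<rho> ==> 0 <= nrm \<rho> K f"
 unfolding nrm_def by (intro sum_nonneg) (auto simp: fps_nrm_nonneg)

lemma nrm_add: "0 <= \<rho> ==> nrm \<rho> K (f + g) <= nrm \<rho> K f + nrm \<rho> K g"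
 unfolding nrm_def sum.distrib[symmetric]
 by (intro sum_mono) (auto simp flip: distrib_right intro!: mult_right_mono fps_nrm_add)

lemma nrm_mult:
 assumes "0 <= \<rho>" shows "nrm \<rho> K (f * g) <= nrm \<rho> K f * nrm \<rho> K g"
proof -
 have "nrm \<rho> K (f * g) <= (\<Sum>k\<le>K. \<Sum>i\<le>k. (fps_nrm \<rho> K (fps_nth f i) * \<rho> ^ i) * (fps_nrm \<rho> K (fps_nth g (k - i)) * \<rho> ^ (k - i)))"
  unfolding nrm_def
 proof (rule sum_mono)
  fix k
  have "fps_nrm \<rho> K (fps_nth (f * g) k) <= (\<Sum>i\<le>k. fps_nrm \<rho> K (fps_nth f i) * fps_nrm \<rho> K (fps_nth g (k - i)))"
   unfolding fps_mult_nth atLeast0AtMost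
   by (rule order_trans[OF fps_nrm_sum[OF assms]]) (intro sum_mono fps_nrm_mult assms)
  then have "fps_nrm \<rho> K (fps_nth (f * g) k) * \<rho> ^ k <= (\<Sum>i\<le>k. fps_nrm \<rho> K (fps_nth f i) * fps_nrm \<rho> K (fps_nth g (k - i))) * \<rho> ^ k"
   using assms by (intro mult_right_mono) auto
  also have "\<dots> = (\<Sum>i\<le>k. (fps_nrm \<rho> K (fps_nth f i) * \<rho> ^ i) * (fps_nrm \<rho> K (fps_nth g (k - i)) * \<rho> ^ (k - i)))"
   unfolding sum_distrib_right by (intro sum.cong refl) (auto simp: power_add[symmetric])
  finally show "fps_nrm \<rho> K (fps_nth (f * g) k) * \<rho> ^ k <= (\<Sum>i\<le>k. (fps_nrm \<rho> K (fps_nth f i) * \<rho> ^ i) * (fps_nrm \<rho> K (fps_nth g (k - i)) * \<rho> ^ (k - i)))" .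
 qed
 also have "\<dots> <= nrm \<rho> K f * nrm \<rho> K g"
  unfolding nrm_def using assms by (intro sum_conv_le) (auto simp: fps_nrm_nonneg)
 finally show ?thesis .
qed

lemma nrm_mono_cf:
 assumes "0 <= \<rho>" "\<And>a b. norm (cf f a b) <= norm (cf g a b)"
 shows "nrm \<rho> K f <= nrm \<rho> K g"
 unfolding nrm_eq using assms by (intro sum_mono) (auto intro!: mult_right_mono)

lemma nrm_mono_radius: "0 <= \<rho> ==> \<rho> <= \<rho>' ==> nrm \<rho> K f <= nrm \<rho>' K f"
 unfolding nrm_eq by (intro sum_mono) (auto intro!: mult_left_mono power_mono)

text \<open>Without constant term every monomial has positive degree and gains at least one factor
  \<open>t\<close>; this makes the norm small on a small radius.\<close>

lemma nrm_scale_radius: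
 assumes "cf f 0 0 = 0" "0 <= \<rho>" "0 <= t" "t <= 1"
 shows "nrm (t * \<rho>) K f <= t * nrm \<rho> K f"
 unfolding nrm_eq sum_distrib_left
proof (intro sum_mono, clarify)
 fix a b
 have "t ^ (a + b) * norm (cf f a b) <= t * norm (cf f a b)"
 proof (cases "a + b")
  case (Suc d)
  have "t * t ^ d <= t * 1" using assms by (intro mult_left_mono power_le_one) auto
  then have "t ^ (a + b) <= t" using Suc by simp
  then show ?thesis by (intro mult_right_mono) auto
 qed (use assms in auto)
 then have "(t ^ (a + b) * norm (cf f a b)) * \<rho> ^ (a + b) <= (t * norm (cf f a b)) * \<rho> ^ (a + b)"
  using assms by (intro mult_right_mono[of "t ^ (a + b) * norm (cf f a b)" "t * norm (cf f a b)"]) auto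
 then show "norm (cf f a b) * (t * \<rho>) ^ (a + b) <= t * (norm (cf f a b) * \<rho> ^ (a + b))"
  by (simp add: power_mult_distrib mult_ac)
qed

text \<open>Every finite index set lies in some square, so bounded square sums bound all finite
  sums.\<close>

lemma convergent_series_iff:
 "convergent_series f \<longleftrightarrow> (\<exists>\<rho>>0. \<exists>B. \<forall>K. nrm \<rho> K f <= B)"
proof
 assume "convergent_series f"
 then obtain \<rho> where \<rho>: "\<rho> > 0" "(%(\<alpha>, \<beta>). norm (cf f \<alpha> \<beta>) * \<rho> ^ (\<alpha> + \<beta>)) summable_on UNIV"
  unfolding convergent_series_def by auto
 have "nrm \<rho> K f <= infsum (%(\<alpha>, \<beta>). norm (cf f \<alpha> \<beta>) * \<rho> ^ (\<alpha> + \<beta>)) UNIV" for K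
  unfolding nrm_eq using \<rho> by (intro finite_sum_le_infsum) auto
 with \<rho> show "\<exists>\<rho>>0. \<exists>B. \<forall>K. nrm \<rho> K f <= B" by auto
next
 assume "\<exists>\<rho>>0. \<exists>B. \<forall>K. nrm \<rho> K f <= B"
 then obtain \<rho> B where \<rho>: "\<rho> > 0" "\<And>K. nrm \<rho> K f <= B" by auto
 have "(%(\<alpha>, \<beta>). norm (cf f \<alpha> \<beta>) * \<rho> ^ (\<alpha> + \<beta>)) summable_on UNIV"
 proof (intro nonneg_bdd_above_summable_on bdd_aboveI)
  fix s assume "s \<in> sum (%(\<alpha>, \<beta>). norm (cf f \<alpha> \<beta>) * \<rho> ^ (\<alpha> + \<beta>)) ` {F. F \<subseteq> UNIV \<and> finite F}"
  then obtain F where F: "finite F" "s = (\<Sum>(\<alpha>, \<beta>)\<in>F. norm (cf f \<alpha> \<beta>) * \<rho> ^ (\<alpha> + \<beta>))" by auto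
  define K where "K = Max (insert 0 (fst ` F \<union> snd ` F))"
  have "F \<subseteq> {..K} \<times> {..K}" unfolding K_def using F(1) by (force intro!: Max_ge)
  then have "s <= nrm \<rho> K f" unfolding F nrm_eq using \<rho> by (intro sum_mono2) auto
  with \<rho> show "s <= B" using order_trans by blast
 qed (use \<rho> in auto)
 with \<rho> show "convergent_series f" unfolding convergent_series_def by auto
qed

lemma convergent_seriesI: "\<rho> > 0 ==> (\<And>K. nrm \<rho> K f <= B) ==> convergent_series f"
 unfolding convergent_series_iff by auto

lemma convergent_series_add:
 assumes "convergent_series f" "convergent_series g" shows "convergent_series (f + g)"
proof -
 obtain \<rho> B \<rho>' B' where 1: "\<rho> > 0" "\<And>K. nrm \<rho> K f <= B" "\<rho>' > 0" "\<And>K. nrm \<rho>' K g <= B'"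
  using assms by (auto simp: convergent_series_iff)
 have "nrm (min \<rho> \<rho>') K (f + g) <= B + B'" for K
  using nrm_add[of "min \<rho> \<rho>'" K f g] nrm_mono_radius[of "min \<rho> \<rho>'" \<rho> K f]
   nrm_mono_radius[of "min \<rho> \<rho>'" \<rho>' K g] 1(1,3) 1(2)[of K] 1(4)[of K] by simp
 then show ?thesis using 1 by (intro convergent_seriesI[of "min \<rho> \<rho>'"]) auto
qed

lemma convergent_series_mult:
 assumes "convergent_series f" "convergent_series g" shows "convergent_series (f * g)"
proof -
 obtain \<rho> B \<rho>' B' where 1: "\<rho> > 0" "\<And>K. nrm \<rho> K f <= B" "\<rho>' > 0" "\<And>K. nrm \<rho>' K g <= B'"
  using assms by (auto simp: convergent_series_iff)
 have "nrm (min \<rho> \<rho>') K (f * g) <= B * B'" for K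
 proof -
  have "nrm (min \<rho> \<rho>') K (f * g) <= nrm (min \<rho> \<rho>') K f * nrm (min \<rho> \<rho>') K g"
   using 1 by (intro nrm_mult) auto
  also have "\<dots> <= B * B'"
   using nrm_mono_radius[of "min \<rho> \<rho>'" \<rho> K f]
   nrm_mono_radius[of "min \<rho> \<rho>'" \<rho>' K g] 1(1,3) 1(2)[of K] 1(4)[of K]
   nrm_nonneg[of "min \<rho> \<rho>'" K f] nrm_nonneg[of "min \<rho> \<rho>'" K g] by (intro mult_mono) auto
  finally show ?thesis .
 qed
 then show ?thesis using 1 by (intro convergent_seriesI[of "min \<rho> \<rho>'"]) auto
qed

lemma convergent_series_dominated:
 assumes "convergent_series g" "\<And>a b. norm (cf f a b) <= norm (cf g a b)"
 shows "convergent_series f"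
proof -
 obtain \<rho> B where 1: "\<rho> > 0" "\<And>K. nrm \<rho> K g <= B" using assms by (auto simp: convergent_series_iff)
 show ?thesis
  using 1 by (intro convergent_seriesI[of \<rho> _ B] order_trans[OF nrm_mono_cf[of \<rho> f g] 1(2)] assms(2)) auto
qed

lemma convergent_series_finite_support:
 assumes "finite {(a,b). cf f a b ~= 0}"
 shows "convergent_series f"
proof -
 have "(%(\<alpha>, \<beta>). norm (cf f \<alpha> \<beta>) * 1 ^ (\<alpha> + \<beta>)) summable_on {(a,b). cf f a b ~= 0}"
  using assms by (rule summable_on_finite)
 then have "(%(\<alpha>, \<beta>). norm (cf f \<alpha> \<beta>) * 1 ^ (\<alpha> + \<beta>)) summable_on UNIV"
  by (subst (asm) summable_on_cong_neutral[where T = UNIV and g = "%(\<alpha>, \<beta>). norm (cf f \<alpha> \<beta>) * 1 ^ (\<alpha> + \<beta>)"]) auto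
 then show ?thesis unfolding convergent_series_def by (intro exI[of _ 1]) auto
qed

lemma cf_const [simp]: "cf (fps_const (fps_const k)) a b = (if a = 0 \<and> b = 0 then k else 0)"
 by simp

lemma cf_scale [simp]: "cf (fps_const (fps_const k) * f) a b = (k :: 'k :: comm_ring_1) * cf f a b"
 by simp

lemma convergent_series_const: "convergent_series (fps_const (fps_const k))"
 by (rule convergent_series_finite_support, rule finite_subset[of _ "{(0,0)}"]) (auto split: if_splits)

lemma convergent_series_0: "convergent_series 0"
 by (rule convergent_series_finite_support) auto

lemma convergent_series_1: "convergent_series 1"
 using convergent_series_const[of 1] by simp

lemma convergent_series_uminus: "convergent_series f ==> convergent_series (- f)"
 by (rule convergent_series_dominated[of f]) auto

lemma convergent_series_diff: "convergent_series f ==> convergent_series g ==> convergent_series (f - g)"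
 using convergent_series_add[of f "- g"] convergent_series_uminus[of g] by simp

definition mon :: "nat => nat => 'k::comm_ring_1 fps fps" where
 "mon a b = fps_X ^ a * fps_const (fps_X ^ b)"

lemma cf_mon_mult: "cf (mon a b * f) i j = (if a <= i \<and> b <= j then cf f (i - a) (j - b) else 0)"
 unfolding mon_def mult.assoc by (simp add: fps_X_power_mult_nth)

lemma cf_mon: "cf (mon a b) i j = (if i = a \<and> j = b then 1 else 0)"
 using cf_mon_mult[of a b 1 i j] by (auto simp: fps_one_nth)

lemma mon_mult: "mon a b * mon i j = mon (a + i) (b + j)"
 by (rule cf_eqI) (auto simp: cf_mon_mult cf_mon)

lemma convergent_series_mon: "convergent_series (mon a b)"
 by (rule convergent_series_finite_support, rule finite_subset[of _ "{(a,b)}"]) (auto simp: cf_mon split: if_splits)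

text \<open>Cancelling a monomial costs only the constant factor
  \<open>\<rho> ^ (a + b)\<close>.\<close>

lemma convergent_series_shift:
 assumes "convergent_series f" "\<And>i j. norm (cf g i j) <= norm (cf f (i + a) (j + b))"
 shows "convergent_series g"
proof -
 obtain \<rho> B where 1: "\<rho> > 0" "\<And>K. nrm \<rho> K f <= B" using assms by (auto simp: convergent_series_iff)
 have "nrm \<rho> K g <= B / \<rho> ^ (a + b)" for K
 proof -
  have "nrm \<rho> K g <= (\<Sum>(i,j)\<in>{..K}\<times>{..K}. norm (cf f (i + a) (j + b)) * \<rho> ^ (i + j))"
   unfolding nrm_eq using assms(2) 1 by (intro sum_mono) (auto intro!: mult_right_mono)
  also have "\<dots> = (\<Sum>(i,j)\<in>(%(i,j). (i + a, j + b)) ` ({..K}\<times>{..K}). norm (cf f i j) * \<rho> ^ (i + j) / \<rho> ^ (a + b))"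
   using 1 by (subst sum.reindex) (auto simp: inj_on_def power_add mult_ac intro!: sum.cong)
  also have "\<dots> <= (\<Sum>(i,j)\<in>{..K + a + b}\<times>{..K + a + b}. norm (cf f i j) * \<rho> ^ (i + j) / \<rho> ^ (a + b))"
   using 1 by (intro sum_mono2) auto
  also have "\<dots> = nrm \<rho> (K + a + b) f / \<rho> ^ (a + b)"
   unfolding nrm_eq sum_divide_distrib by (intro sum.cong) auto
  also have "\<dots> <= B / \<rho> ^ (a + b)" using 1 by (intro divide_right_mono) auto
  finally show ?thesis .
 qed
 then show ?thesis using 1 by (intro convergent_seriesI[of \<rho>]) auto
qed

lemma of_nat_le_power2: "real (Suc n) <= 2 ^ n"
 by (induction n) auto

lemma cf_dx: "cf (series_dx f) i j = of_nat (Suc i) * cf f (Suc i) j"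
 by (simp add: series_dx_def flip: fps_of_nat del: of_nat_Suc)

lemma cf_dy: "cf (series_dy f) i j = of_nat (Suc j) * cf f i (Suc j)"
 by (simp add: series_dy_def del: of_nat_Suc)

lemma convergent_series_deriv:
 assumes "convergent_series f"
 shows "convergent_series (series_dx f)" "convergent_series (series_dy f)"
proof -
 obtain \<rho> B where 1: "\<rho> > 0" "\<And>K. nrm \<rho> K f <= B" using assms by (auto simp: convergent_series_iff)
 \<comment> \<open>The factor 2 ^ (i + j) costs half of the radius and dominates the factors
   \<open>Suc i\<close> and \<open>Suc j\<close> that differentiation produces.\<close>
 define h where "h = Abs_fps (%i. Abs_fps (%j. 2 ^ (i + j) * cf f i j))"
 have "nrm (\<rho> / 2) K h = nrm \<rho> K f" for K
  unfolding nrm_eq h_def by (intro sum.cong) (auto simp: norm_mult norm_power power_divide)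
 then have h: "convergent_series h" using 1 by (intro convergent_seriesI[of "\<rho> / 2"]) auto
 have *: "real (Suc i) <= 2 ^ (Suc i + j)" "real (Suc i) <= 2 ^ (j + Suc i)" for i j
 proof -
  show "real (Suc i) <= 2 ^ (Suc i + j)"
   using of_nat_le_power2[of i] power_increasing[of i "Suc i + j" "2::real"] by simp
  then show "real (Suc i) <= 2 ^ (j + Suc i)" by (simp add: add.commute)
 qed
 show "convergent_series (series_dx f)"
 proof (rule convergent_series_shift[OF h, of _ 1 0])
  fix i j
  have "norm (cf (series_dx f) i j) = real (Suc i) * norm (cf f (Suc i) j)"
   by (simp only: cf_dx norm_mult norm_of_nat)
  also have "\<dots> <= 2 ^ (Suc i + j) * norm (cf f (Suc i) j)"
   by (intro mult_right_mono *) simp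
  also have "\<dots> = norm (cf h (i + 1) (j + 0))" by (simp add: h_def norm_mult norm_power)
  finally show "norm (cf (series_dx f) i j) <= norm (cf h (i + 1) (j + 0))" .
 qed
 show "convergent_series (series_dy f)"
 proof (rule convergent_series_shift[OF h, of _ 0 1])
  fix i j
  have "norm (cf (series_dy f) i j) = real (Suc j) * norm (cf f i (Suc j))"
   by (simp only: cf_dy norm_mult norm_of_nat)
  also have "\<dots> <= 2 ^ (i + Suc j) * norm (cf f i (Suc j))"
   by (intro mult_right_mono *) simp
  also have "\<dots> = norm (cf h (i + 0) (j + 1))" by (simp add: h_def norm_mult norm_power)
  finally show "norm (cf (series_dy f) i j) <= norm (cf h (i + 0) (j + 1))" .
 qed
qed

text \<open>The formal inverse exists because the constant term is invertible; the point is its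
  convergence. After normalising, \<open>e' = 1 + w * e'\<close> with \<open>w\<close> free of
  constant term. On a radius where \<open>w\<close> has norm at most 1/2, half of the norm of
  \<open>e'\<close> is absorbed and the truncated norms stay below 2.\<close>

lemma series_unit:
 fixes u :: "'k :: {real_normed_field, euclidean_space} fps fps"
 assumes u: "convergent_series u" "cf u 0 0 ~= 0"
 shows "\<exists>e. convergent_series e \<and> u * e = 1"
proof -
 have "fps_nth u 0 * inverse (fps_nth u 0) = 1" using u(2) by (simp add: inverse_mult_eq_1')
 then have "u * fps_right_inverse u (inverse (fps_nth u 0)) = 1" by (rule fps_right_inverse)
 then obtain e where e: "u * e = 1" by blast
 define k where "k = cf u 0 0"
 define w where "w = 1 - fps_const (fps_const (1 / k)) * u"
 define e' where "e' = fps_const (fps_const k) * e"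
 have "fps_const (fps_const (1 / k)) * fps_const (fps_const k) = 1"
  using u(2) by (simp add: k_def)
 moreover have "(fps_const (fps_const (1 / k)) * u) * e' = (fps_const (fps_const (1 / k)) * fps_const (fps_const k)) * (u * e)"
  unfolding e'_def by (simp only: mult_ac)
 ultimately have "(fps_const (fps_const (1 / k)) * u) * e' = 1" using e by (simp only: mult_1)
 then have we: "e' = 1 + w * e'" unfolding w_def by (simp add: algebra_simps)
 have w0: "cf w 0 0 = 0" using u(2) by (simp add: w_def k_def)
 have "convergent_series w" unfolding w_def
  by (intro convergent_series_diff convergent_series_mult convergent_series_1 convergent_series_const u)
 then obtain \<rho> B where 1: "\<rho> > 0" "\<And>K. nrm \<rho> K w <= B" by (auto simp: convergent_series_iff)
 have B: "B >= 0" using 1(2)[of 0] nrm_nonneg[of \<rho> 0 w] 1(1) by linarith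
 \<comment> \<open>Shrinking the radius by this factor brings the bound \<open>B\<close> for
   \<open>w\<close> down to 1/2.\<close>
 define t where "t = 1 / (2 * (B + 1))"
 have t: "0 < t" "t <= 1" "t * B <= 1 / 2" using B by (auto simp: t_def field_simps)
 have nw: "nrm (t * \<rho>) K w <= 1 / 2" for K
  using nrm_scale_radius[OF w0, of \<rho> t K] mult_left_mono[OF 1(2)[of K], of t] 1 t by linarith
 have "nrm (t * \<rho>) K e' <= 2" for K
 proof -
  have p: "0 <= t * \<rho>" using t 1 by simp
  have "nrm (t * \<rho>) K (1 :: 'k fps fps) = (\<Sum>x\<in>{..K}\<times>{..K}. if x = (0,0) then 1 else 0)"
   unfolding nrm_eq by (intro sum.cong) (auto simp: fps_one_nth split: if_splits)
  also have "\<dots> = 1" by simp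
  finally have n1: "nrm (t * \<rho>) K (1 :: 'k fps fps) = 1" .
  have "nrm (t * \<rho>) K e' <= nrm (t * \<rho>) K (1 :: 'k fps fps) + nrm (t * \<rho>) K (w * e')"
   by (subst we) (rule nrm_add[OF p])
  also have "nrm (t * \<rho>) K (w * e') <= nrm (t * \<rho>) K w * nrm (t * \<rho>) K e'" by (rule nrm_mult[OF p])
  also have "\<dots> <= 1 / 2 * nrm (t * \<rho>) K e'" by (intro mult_right_mono nw nrm_nonneg[OF p])
  finally show ?thesis using n1 by simp
 qed
 then have "convergent_series e'" using t 1 by (intro convergent_seriesI[of "t * \<rho>"]) auto
 moreover have "e = fps_const (fps_const (1 / k)) * e'" unfolding e'_def using u(2)
  by (simp add: k_def flip: mult.assoc)
 ultimately have "convergent_series e" using convergent_series_mult convergent_series_const by blast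
 with e show ?thesis by auto
qed

definition conv_ideal :: "'k :: {real_normed_field, euclidean_space} fps fps set => bool" where
 "conv_ideal I \<longleftrightarrow> I \<subseteq> {f. convergent_series f} \<and> 0 \<in> I \<and> (\<forall>x\<in>I. \<forall>y\<in>I. x + y \<in> I) \<and>
   (\<forall>x\<in>I. \<forall>r. convergent_series r --> r * x \<in> I)"

lemma conv_ideal_add: "conv_ideal I ==> x \<in> I ==> y \<in> I ==> x + y \<in> I"
 and conv_ideal_mult: "conv_ideal I ==> x \<in> I ==> convergent_series r ==> r * x \<in> I"
 and conv_ideal_0: "conv_ideal I ==> 0 \<in> I"
 and conv_ideal_conv: "conv_ideal I ==> x \<in> I ==> convergent_series x"
 unfolding conv_ideal_def by auto

lemma conv_ideal_sum: "conv_ideal I ==> (\<And>i. i \<in> A ==> f i \<in> I) ==> sum f A \<in> I"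
 by (induction A rule: infinite_finite_induct) (auto simp: conv_ideal_add conv_ideal_0)

text \<open>Nakayama's lemma by elimination instead of determinants: a generator \<open>x\<close>
  occurring on its own right-hand side with coefficient \<open>w x\<close> is removed because
  \<open>1 - w x\<close> is a unit, and the relations among the remaining generators again have
  coefficients in the maximal ideal.\<close>

lemma nakayama:
 fixes U :: "'k :: {real_normed_field, euclidean_space} fps fps set"
 assumes I: "conv_ideal I" and "finite U"
  and "\<And>u. u \<in> U ==> \<exists>i\<in>I. \<exists>w. (\<forall>v\<in>U. convergent_series (w v) \<and> cf (w v) 0 0 = 0) \<and>
       u = i + (\<Sum>v\<in>U. w v * v)"
 shows "U \<subseteq> I"
 using assms(2,3)
proof (induction U rule: finite_induct)
 case (insert x U)
 obtain i w where iw: "i \<in> I" "\<And>v. v \<in> insert x U ==> convergent_series (w v) \<and> cf (w v) 0 0 = 0"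
  "x = i + (\<Sum>v\<in>insert x U. w v * v)" using insert(4)[of x] by auto
 obtain e where e: "convergent_series e" "(1 - w x) * e = 1"
  using series_unit[of "1 - w x"] iw(2)[of x] convergent_series_diff[OF convergent_series_1] by auto
 have "(1 - w x) * x = i + (\<Sum>v\<in>U. w v * v)"
  using iw(3) insert(1,2) by (simp add: algebra_simps)
 then have "e * ((1 - w x) * x) = e * (i + (\<Sum>v\<in>U. w v * v))" by simp
 moreover have "e * ((1 - w x) * x) = ((1 - w x) * e) * x" by (simp only: mult_ac)
 ultimately have x: "x = e * i + (\<Sum>v\<in>U. (e * w v) * v)"
  using e(2) by (simp add: distrib_left sum_distrib_left mult.assoc)
 have "U \<subseteq> I"
 proof (rule insert.IH)
  fix u assume u: "u \<in> U"
  then obtain i' w' where iw': "i' \<in> I" "\<And>v. v \<in> insert x U ==> convergent_series (w' v) \<and> cf (w' v) 0 0 = 0"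
   "u = i' + (\<Sum>v\<in>insert x U. w' v * v)" using insert(4)[of u] by auto
  have "u = i' + w' x * x + (\<Sum>v\<in>U. w' v * v)" using iw'(3) insert(1,2) by (simp add: algebra_simps)
  also have "w' x * x = w' x * e * i + (\<Sum>v\<in>U. (w' x * e * w v) * v)"
   by (subst x) (simp add: distrib_left sum_distrib_left mult.assoc)
  also have "i' + (w' x * e * i + (\<Sum>v\<in>U. (w' x * e * w v) * v)) + (\<Sum>v\<in>U. w' v * v)
    = (i' + w' x * e * i) + (\<Sum>v\<in>U. (w' x * e * w v + w' v) * v)"
   by (simp add: distrib_right sum.distrib)
  finally have "u = (i' + w' x * e * i) + (\<Sum>v\<in>U. (w' x * e * w v + w' v) * v)" .
  moreover have "i' + w' x * e * i \<in> I"
   using I iw(1) iw'(1) iw'(2)[of x] e by (intro conv_ideal_add conv_ideal_mult convergent_series_mult) auto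
  moreover have "convergent_series (w' x * e * w v + w' v) \<and> cf (w' x * e * w v + w' v) 0 0 = 0" if "v \<in> U" for v
   using that iw(2)[of v] iw'(2)[of v] iw'(2)[of x] e
   by (auto intro!: convergent_series_add convergent_series_mult)
  ultimately show "\<exists>i\<in>I. \<exists>w. (\<forall>v\<in>U. convergent_series (w v) \<and> cf (w v) 0 0 = 0) \<and> u = i + (\<Sum>v\<in>U. w v * v)"
   by (intro bexI[of _ "i' + w' x * e * i"] exI[of _ "%v. w' x * e * w v + w' v"]) auto
 qed
 moreover have "x \<in> I"
 proof -
  have "(\<Sum>v\<in>U. (e * w v) * v) \<in> I" using I \<open>U \<subseteq> I\<close> e iw(2)
   by (intro conv_ideal_sum conv_ideal_mult convergent_series_mult) auto
  moreover have "e * i \<in> I" using I iw e by (intro conv_ideal_mult) auto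
  ultimately show ?thesis by (subst x) (rule conv_ideal_add[OF I])
 qed
 ultimately show ?case by auto
qed auto

lemma homogeneous_decomposition:
 fixes f :: "'k :: {real_normed_field, euclidean_space} fps fps"
 assumes f: "convergent_series f" "\<And>a b. a + b < d ==> cf f a b = 0"
 shows "\<exists>w. (\<forall>i\<le>d. convergent_series (w i) \<and> cf (w i) 0 0 = cf f i (d - i)) \<and> f = (\<Sum>i\<le>d. w i * mon i (d - i))"
proof -
 \<comment> \<open>The monomial x^a y^b is assigned to the index min a d, so each monomial is used
   exactly once; only the index \<open>d\<close> collects higher powers of x.\<close>
 define w where "w i = (if i = d then Abs_fps (%a. Abs_fps (%b. cf f (a + d) b))
   else Abs_fps (%a. Abs_fps (%b. if a = 0 then cf f i (b + (d - i)) else 0)))" for i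
 have "convergent_series (w i)" if "i <= d" for i
  by (rule convergent_series_shift[OF f(1), of _ i "d - i"]) (auto simp: w_def)
 moreover have "cf (w i) 0 0 = cf f i (d - i)" for i by (auto simp: w_def)
 moreover have "f = (\<Sum>i\<le>d. w i * mon i (d - i))"
 proof (rule cf_eqI)
  fix a b
  have "cf (\<Sum>i\<le>d. w i * mon i (d - i)) a b = (\<Sum>i\<le>d. cf (mon i (d - i) * w i) a b)"
   by (simp add: fps_sum_nth mult.commute)
  also have "\<dots> = (\<Sum>i\<le>d. if i = min a d then cf f a b else 0)"
  proof (intro sum.cong refl)
   fix i assume "i \<in> {..d}"
   then show "cf (mon i (d - i) * w i) a b = (if i = min a d then cf f a b else 0)"
    using f(2)[of a b] by (auto simp: cf_mon_mult w_def min_def)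
  qed
  also have "\<dots> = cf f a b" by simp
  finally show "cf f a b = cf (\<Sum>i\<le>d. w i * mon i (d - i)) a b" by simp
 qed
 ultimately show ?thesis by blast
qed

section \<open>Compact edges as integer inequalities\<close>

no_notation fps_nth (infixl "$" 75)

lemma inner_real2: "(a :: real ^ 2) \<bullet> x = a $ 1 * x $ 1 + a $ 2 * x $ 2"
 by (simp add: inner_vec_def UNIV_2)

lemma vec2_eq_iff: "(a :: real ^ 2) = b \<longleftrightarrow> a $ 1 = b $ 1 \<and> a $ 2 = b $ 2"
 by (simp add: vec_eq_iff forall_2)

lemma lattice_point_nth [simp]: "lattice_point a b $ 1 = real a" "lattice_point a b $ 2 = real b"
 by (simp_all add: lattice_point_def)

lemma lattice_point_inject [simp]: "lattice_point a b = lattice_point a' b' \<longleftrightarrow> a = a' \<and> b = b'"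
 by (simp add: vec2_eq_iff)

text \<open>The weights (b1 - b2, a2 - a1) form the inner normal of the segment. The last clause
  confines the support points on its line to the segment, so that it is the full face and not a
  piece of it. The strict inequalities make the natural subtractions exact.\<close>

definition newton_edge :: "(nat => nat => 'k :: zero) => nat => nat => nat => nat => bool" where
 "newton_edge c a1 b1 a2 b2 \<longleftrightarrow> c a1 b1 ~= 0 \<and> c a2 b2 ~= 0 \<and> a1 < a2 \<and> b2 < b1 \<and>
   (\<forall>a b. c a b ~= 0 --> (b1 - b2) * a + (a2 - a1) * b >= (b1 - b2) * a1 + (a2 - a1) * b1 \<and>
    ((b1 - b2) * a + (a2 - a1) * b = (b1 - b2) * a1 + (a2 - a1) * b1 --> a1 <= a \<and> a <= a2))"

abbreviation newton_generators :: "(nat => nat => 'k :: zero) => (real ^ 2) set" where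
 "newton_generators c \<equiv> {lattice_point \<alpha> \<beta> + u | \<alpha> \<beta> u. c \<alpha> \<beta> ~= 0 \<and> 0 <= u $ 1 \<and> 0 <= u $ 2}"

lemma convex_newton_region: "convex (newton_region c)"
 by (simp add: newton_region_def convex_convex_hull)

lemma newton_region_generator: "c a b ~= 0 ==> 0 <= u $ 1 ==> 0 <= u $ 2 ==> lattice_point a b + u \<in> newton_region c"
 unfolding newton_region_def by (intro hull_inc) auto

lemma newton_region_lattice_point: "c a b ~= 0 ==> lattice_point a b \<in> newton_region c"
 using newton_region_generator[of c a b 0] by simp

lemma newton_region_add:
 assumes "x \<in> newton_region c" "0 <= u $ 1" "0 <= u $ 2"
 shows "x + u \<in> newton_region c"
proof -
 have "(+) u ` newton_generators c \<subseteq> newton_generators c"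
 proof
  fix z assume "z \<in> (+) u ` newton_generators c"
  then obtain a b v where "z = u + (lattice_point a b + v)" "c a b ~= 0" "0 <= v $ 1" "0 <= v $ 2" by blast
  then have "z = lattice_point a b + (u + v)" "c a b ~= 0" "0 <= (u + v) $ 1" "0 <= (u + v) $ 2"
   using assms by (auto simp: algebra_simps)
  then show "z \<in> newton_generators c" by blast
 qed
 then have "convex hull ((+) u ` newton_generators c) \<subseteq> newton_region c"
  unfolding newton_region_def by (rule hull_mono)
 then have "(+) u ` newton_region c \<subseteq> newton_region c"
  by (simp add: convex_hull_translation newton_region_def)
 then have "u + x \<in> newton_region c" using assms by auto
 then show ?thesis by (simp add: add.commute)
qed

text \<open>The set \<open>Q\<close> contains the generators of the hull, and it is convex although
  the extra bound holds only on the boundary line, because a proper convex combination lies on that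
  line only if both points do.\<close>

lemma newton_region_supporting_line:
 fixes w1 w2 k l r :: real and c :: "nat => nat => 'k :: zero"
 assumes w: "0 < w1" "0 < w2"
  and ge: "\<And>a b. c a b ~= 0 ==> k <= w1 * a + w2 * b"
  and eq: "\<And>a b. c a b ~= 0 ==> w1 * a + w2 * b = k ==> l <= a \<and> a <= r"
  and x: "x \<in> newton_region c"
 shows "k <= w1 * x $ 1 + w2 * x $ 2"
  and "w1 * x $ 1 + w2 * x $ 2 = k ==> l <= x $ 1 \<and> x $ 1 <= r"
proof -
 define Q where "Q = {x :: real ^ 2. k <= w1 * x $ 1 + w2 * x $ 2 \<and> (w1 * x $ 1 + w2 * x $ 2 = k --> l <= x $ 1 \<and> x $ 1 <= r)}"
 have "newton_generators c \<subseteq> Q"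
 proof
  fix z assume "z \<in> newton_generators c"
  then obtain a b u where z: "z = lattice_point a b + u" "c a b ~= 0" "0 <= u $ 1" "0 <= u $ 2" by blast
  have "w1 * z $ 1 + w2 * z $ 2 = (w1 * a + w2 * b) + (w1 * u $ 1 + w2 * u $ 2)"
   by (simp add: z algebra_simps)
  moreover have p: "0 <= w1 * u $ 1" "0 <= w2 * u $ 2" using z w by auto
  ultimately have 1: "k <= w1 * z $ 1 + w2 * z $ 2"
   and 2: "w1 * z $ 1 + w2 * z $ 2 = k ==> w1 * u $ 1 = 0 \<and> w1 * a + w2 * b = k" using ge[OF z(2)] by linarith+
  have "l <= z $ 1 \<and> z $ 1 <= r" if "w1 * z $ 1 + w2 * z $ 2 = k"
  proof -
   have "u $ 1 = 0" "w1 * a + w2 * b = k" using 2[OF that] w by auto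
   then show ?thesis using eq[OF z(2)] by (simp add: z(1))
  qed
  then show "z \<in> Q" unfolding Q_def using 1 by simp
 qed
 moreover have "convex Q"
 proof (rule convexI)
  fix x y u v assume xy: "x \<in> Q" "y \<in> Q" and uv: "(0::real) <= u" "0 <= v" "u + v = 1"
  show "u *\<^sub>R x + v *\<^sub>R y \<in> Q"
  proof (cases "u = 0 \<or> v = 0")
   case True
   then show ?thesis using xy uv by auto
  next
   case False
   then have uv': "0 < u" "0 < v" using uv by auto
   define X where "X = w1 * x $ 1 + w2 * x $ 2 - k"
   define Y where "Y = w1 * y $ 1 + w2 * y $ 2 - k"
   have X: "0 <= X" "X = 0 ==> l <= x $ 1 \<and> x $ 1 <= r" and Y: "0 <= Y" "Y = 0 ==> l <= y $ 1 \<and> y $ 1 <= r"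
    using xy unfolding Q_def X_def Y_def by auto
   have "w1 * (u *\<^sub>R x + v *\<^sub>R y) $ 1 + w2 * (u *\<^sub>R x + v *\<^sub>R y) $ 2 = u * (X + k) + v * (Y + k)"
    unfolding X_def Y_def by (simp add: algebra_simps)
   also have "\<dots> = (u * X + v * Y) + (u + v) * k" by (simp only: algebra_simps)
   finally have e: "w1 * (u *\<^sub>R x + v *\<^sub>R y) $ 1 + w2 * (u *\<^sub>R x + v *\<^sub>R y) $ 2 = k + (u * X + v * Y)"
    using uv by simp
   have p: "0 <= u * X" "0 <= v * Y" using uv X Y by auto
   have "l <= u * x $ 1 + v * y $ 1 \<and> u * x $ 1 + v * y $ 1 <= r" if "u * X + v * Y = 0"
   proof -
    have "X = 0" "Y = 0" using that p uv' by (auto simp: add_nonneg_eq_0_iff)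
    then have "l <= x $ 1" "x $ 1 <= r" "l <= y $ 1" "y $ 1 <= r" using X Y by auto
    then show ?thesis using uv
     convex_bound_le[of "x $ 1" r "y $ 1" u v] convex_bound_le[of "- x $ 1" "- l" "- y $ 1" u v] by auto
   qed
   then show ?thesis using e p unfolding Q_def by auto
  qed
 qed
 ultimately have "newton_region c \<subseteq> Q" unfolding newton_region_def by (rule hull_minimal)
 with x have "x \<in> Q" by auto
 then show "k <= w1 * x $ 1 + w2 * x $ 2" "w1 * x $ 1 + w2 * x $ 2 = k ==> l <= x $ 1 \<and> x $ 1 <= r"
  unfolding Q_def by auto
qed

lemma newton_edgeD_real:
 assumes "newton_edge c a1 b1 a2 b2" "c a b ~= 0"
 shows "(real b1 - real b2) * a + (real a2 - real a1) * b >= (real b1 - real b2) * a1 + (real a2 - real a1) * b1"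
  and "(real b1 - real b2) * a + (real a2 - real a1) * b = (real b1 - real b2) * a1 + (real a2 - real a1) * b1
   ==> real a1 <= a \<and> a <= real a2"
proof -
 have le: "b2 <= b1" "a1 <= a2" using assms by (auto simp: newton_edge_def)
 have conv: "(real b1 - real b2) * x + (real a2 - real a1) * y = real ((b1 - b2) * x + (a2 - a1) * y)" for x y
  using le by (simp add: of_nat_diff)
 show "(real b1 - real b2) * a + (real a2 - real a1) * b >= (real b1 - real b2) * a1 + (real a2 - real a1) * b1"
  unfolding conv of_nat_le_iff using assms unfolding newton_edge_def by blast
 assume "(real b1 - real b2) * a + (real a2 - real a1) * b = (real b1 - real b2) * a1 + (real a2 - real a1) * b1"
 then have "(b1 - b2) * a + (a2 - a1) * b = (b1 - b2) * a1 + (a2 - a1) * b1" unfolding conv of_nat_eq_iff .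
 then show "real a1 <= a \<and> a <= real a2" using assms unfolding newton_edge_def by auto
qed

lemma point_on_closed_segment:
 fixes x :: "real ^ 2"
 assumes "a1 < a2" "b2 < b1"
  and "(real b1 - real b2) * x $ 1 + (real a2 - real a1) * x $ 2 = (real b1 - real b2) * a1 + (real a2 - real a1) * b1"
  and "real a1 <= x $ 1" "x $ 1 <= real a2"
 shows "x \<in> closed_segment (lattice_point a1 b1) (lattice_point a2 b2)"
proof -
 define t where "t = (x $ 1 - a1) / (real a2 - a1)"
 have d: "real a2 - real a1 > 0" using assms by auto
 have t: "0 <= t" "t <= 1" using assms d by (auto simp: t_def field_simps)
 have 1: "x $ 1 = real a1 + t * (real a2 - a1)" using d by (simp add: t_def)
 have "(real a2 - a1) * (x $ 2 - b1) = (real a2 - a1) * (t * (real b2 - b1))"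
  using assms(3) unfolding 1 by (simp add: algebra_simps)
 then have 2: "x $ 2 = real b1 + t * (real b2 - b1)" using d by simp
 have "x = (1 - t) *\<^sub>R lattice_point a1 b1 + t *\<^sub>R lattice_point a2 b2"
  unfolding vec2_eq_iff by (simp add: 1 2 algebra_simps)
 then show ?thesis using t unfolding in_segment by blast
qed

text \<open>The edge inequality makes the line a supporting hyperplane, the clause on abscissae cuts
  the face down to the segment, and two distinct endpoints give dimension one.\<close>

lemma newton_edge_face:
 assumes e: "newton_edge c a1 b1 a2 b2"
 shows "newton_region c \<inter> {x. vector [real b1 - real b2, real a2 - real a1] \<bullet> x = (real b1 - real b2) * a1 + (real a2 - real a1) * b1}
   = closed_segment (lattice_point a1 b1) (lattice_point a2 b2)" (is "?C \<inter> ?H = ?S")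
  and "closed_segment (lattice_point a1 b1) (lattice_point a2 b2) edge_of newton_region c"
proof -
 have lt: "a1 < a2" "b2 < b1" and cc: "c a1 b1 ~= 0" "c a2 b2 ~= 0" using e by (auto simp: newton_edge_def)
 have w: "0 < real b1 - real b2" "0 < real a2 - real a1" using lt by auto
 let ?k = "(real b1 - real b2) * a1 + (real a2 - real a1) * b1"
 have line: "?k <= (real b1 - real b2) * x $ 1 + (real a2 - real a1) * x $ 2"
  "(real b1 - real b2) * x $ 1 + (real a2 - real a1) * x $ 2 = ?k ==> real a1 <= x $ 1 \<and> x $ 1 <= real a2"
  if "x \<in> newton_region c" for x
  using newton_region_supporting_line[where c = c and k = ?k, OF w newton_edgeD_real(1)[OF e] newton_edgeD_real(2)[OF e] that] by auto
 show eq: "?C \<inter> ?H = ?S"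
 proof
  show "?C \<inter> ?H \<subseteq> ?S"
  proof
   fix x assume "x \<in> ?C \<inter> ?H"
   then show "x \<in> ?S" using line(2)[of x] lt by (intro point_on_closed_segment) (auto simp: inner_real2)
  qed
  have "convex (?C \<inter> ?H)" by (intro convex_Int convex_newton_region convex_hyperplane)
  moreover have "lattice_point a1 b1 \<in> ?C \<inter> ?H" "lattice_point a2 b2 \<in> ?C \<inter> ?H"
   using newton_region_lattice_point cc by (auto simp: inner_real2 algebra_simps)
  ultimately show "?S \<subseteq> ?C \<inter> ?H" by (rule closed_segment_subset[rotated 2])
 qed
 have "(?C \<inter> ?H) face_of ?C"
  using line(1) by (intro face_of_Int_supporting_hyperplane_ge convex_newton_region) (auto simp: inner_real2)
 moreover have "aff_dim ?S = 1" using lt by (simp add: segment_convex_hull aff_dim_convex_hull aff_dim_2)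
 ultimately show "?S edge_of ?C" unfolding edge_of_def eq by simp
qed

text \<open>A supporting line at the midpoint contains the whole edge. Its normal is nonnegative
  since the region absorbs the quadrant; a vanishing component would, by convenience, put the edge
  on a coordinate axis, where it could be prolonged to infinity. With both weights positive only
  finitely many abscissae of support points occur on the line, and the extreme ones give the
  endpoints.\<close>

lemma compact_newton_edge_imp:
 assumes conv: "convenient c" and E: "E edge_of newton_region c" "compact E"
 shows "\<exists>a1 b1 a2 b2. newton_edge c a1 b1 a2 b2 \<and> E = closed_segment (lattice_point a1 b1) (lattice_point a2 b2)"
proof -
 let ?C = "newton_region c"
 have face: "E face_of ?C" and dim: "aff_dim E = 1" using E by (auto simp: edge_of_def)
 have EC: "E \<subseteq> ?C" using face face_of_imp_subset by blast
 have "collinear E" using dim by (simp add: collinear_aff_dim)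
 moreover have "E ~= {}" using dim by auto
 ultimately obtain A B where AB: "E = closed_segment A B"
  using compact_convex_collinear_segment[of E] face_of_imp_convex[OF face] E(2) by blast
 have "A ~= B" using dim AB by auto
 obtain i where i: "c i 0 ~= 0" using conv by (auto simp: convenient_def)
 obtain j where j: "c 0 j ~= 0" using conv by (auto simp: convenient_def)
 have C1: "0 <= x $ 1 \<and> 0 <= x $ 2" if "x \<in> ?C" for x
 proof -
  have "newton_generators c \<subseteq> {x. 0 <= x $ 1} \<inter> {x. 0 <= x $ 2}" by auto
  moreover have "convex ({x :: real ^ 2. 0 <= x $ 1} \<inter> {x. 0 <= x $ 2})"
   by (intro convex_Int) (auto simp: convex_def)
  ultimately have "?C \<subseteq> {x. 0 <= x $ 1} \<inter> {x. 0 <= x $ 2}"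
   unfolding newton_region_def by (rule hull_minimal)
  with that show ?thesis by auto
 qed
 have "E ~= ?C"
 proof
  assume "E = ?C"
  then have "bounded ?C" using E(2) compact_imp_bounded by auto
  then obtain M where M: "\<And>x. x \<in> ?C ==> norm x <= M" by (auto simp: bounded_iff)
  have "lattice_point i 0 + vector [\<bar>M\<bar> + 1, 0] \<in> ?C" by (rule newton_region_generator[of c i 0, OF i]) auto
  from M[OF this] component_le_norm_cart[of "lattice_point i 0 + vector [\<bar>M\<bar> + 1, 0]" 1]
  show False by simp
 qed
 define x where "x = midpoint A B"
 have xE: "x \<in> E" unfolding x_def AB by simp
 have xC: "x \<in> ?C" using xE EC by blast
 have xn: "x \<notin> rel_interior ?C" using face_of_disjoint_rel_interior[OF face \<open>E ~= newton_region c\<close>] xE by blast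
 obtain w where w: "w ~= 0" "\<And>y. y \<in> ?C ==> w \<bullet> x <= w \<bullet> y"
  by (rule supporting_hyperplane_rel_boundary[OF convex_newton_region xC xn]) (rule that, assumption+)
 define k where "k = w \<bullet> x"
 have "A \<in> E" "B \<in> E" unfolding AB by auto
 then have "A \<in> ?C" "B \<in> ?C" using EC by blast+
 have "w \<bullet> A + w \<bullet> B = 2 * k" unfolding k_def x_def midpoint_def by (simp add: inner_add_right)
 then have kAB: "w \<bullet> A = k" "w \<bullet> B = k"
  using w(2)[OF \<open>A \<in> ?C\<close>, folded k_def] w(2)[OF \<open>B \<in> ?C\<close>, folded k_def] by linarith+
 have EH: "w \<bullet> y = k" if yE: "y \<in> E" for y
 proof -
  obtain t where "y = (1 - t) *\<^sub>R A + t *\<^sub>R B" using yE unfolding AB in_segment by blast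
  then have "w \<bullet> y = (1 - t) * (w \<bullet> A) + t * (w \<bullet> B)" by (simp only: inner_add_right inner_scaleR_right)
  then show ?thesis using kAB by (simp add: algebra_simps)
 qed
 have wnn: "0 <= w $ 1" "0 <= w $ 2"
 proof -
  have 1: "w \<bullet> (x + vector [1, 0]) >= w \<bullet> x" "w \<bullet> (x + vector [0, 1]) >= w \<bullet> x"
   by (rule w(2), rule newton_region_add[OF xC], simp, simp)+
  then show "0 <= w $ 1" "0 <= w $ 2" by (auto simp: inner_real2 algebra_simps)
 qed
 \<comment> \<open>If the edge contained \<open>y\<close> and \<open>y + u\<close> with
   \<open>u\<close> in the quadrant, then as a face it would contain all points
   \<open>y + n u\<close>, against compactness.\<close>
 have noray: "y + u \<notin> E" if nr: "y \<in> E" "0 <= u $ 1" "0 <= u $ 2" "u ~= 0" "\<And>z. z \<in> E ==> \<exists>s. z = y + s *\<^sub>R u" for y u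
 proof
  assume "y + u \<in> E"
  have ray: "y + real n *\<^sub>R u \<in> E" for n
  proof (cases "n <= 1")
   case True
   then show ?thesis using \<open>y \<in> E\<close> \<open>y + u \<in> E\<close> by (cases n) auto
  next
   case False
   have "y + u \<in> open_segment y (y + real n *\<^sub>R u)"
    unfolding in_segment using False nr(4) by (auto intro!: exI[of _ "1 / real n"] simp: algebra_simps)
   moreover have "y \<in> ?C" using nr(1) EC by blast
   moreover have "y + real n *\<^sub>R u \<in> ?C" using nr by (intro newton_region_add[OF \<open>y \<in> ?C\<close>]) auto
   ultimately show ?thesis using face \<open>y + u \<in> E\<close> unfolding face_of_def by blast
  qed
  obtain M where M: "\<And>x. x \<in> E ==> norm x <= M" using compact_imp_bounded[OF E(2)] unfolding bounded_iff by blast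
  obtain n where n: "real n * norm u > M + norm y" using reals_Archimedean3[of "norm u"] nr(4) by auto
  have "norm (real n *\<^sub>R u) <= norm (y + real n *\<^sub>R u) + norm y"
   using norm_triangle_ineq4[of "y + real n *\<^sub>R u" y] by simp
  then show False using M[OF ray[of n]] n by simp
 qed
 have wpos: "0 < w $ 1" "0 < w $ 2"
 proof -
  show "0 < w $ 1"
  proof (rule ccontr)
   assume "\<not> 0 < w $ 1"
   then have w1: "w $ 1 = 0" and w2: "0 < w $ 2" using wnn w(1) by (auto simp: vec2_eq_iff less_le)
   have "k <= 0" using w(2)[OF newton_region_lattice_point[of c i 0, OF i]] by (simp add: k_def inner_real2 w1)
   then have z: "y $ 2 = 0" if "y \<in> E" for y
   proof -
    have "0 <= y $ 2" "w $ 2 * y $ 2 <= 0"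
     using EH[OF that] C1[of y] that EC \<open>k <= 0\<close> by (auto simp: inner_real2 w1)
    then show ?thesis using w2 by (simp add: mult_le_0_iff)
   qed
   define P where "P = (if A $ 1 < B $ 1 then A else B)"
   define R where "R = (if A $ 1 < B $ 1 then B else A)"
   have PR: "P \<in> E" "R \<in> E" "P $ 1 < R $ 1" "P $ 2 = 0" "R $ 2 = 0"
    using \<open>A \<in> E\<close> \<open>B \<in> E\<close> \<open>A ~= B\<close> z[of A] z[of B] by (auto simp: P_def R_def vec2_eq_iff)
   have "P + (R - P) \<notin> E"
   proof (rule noray)
    fix y assume "y \<in> E"
    then have "y = P + ((y $ 1 - P $ 1) / (R $ 1 - P $ 1)) *\<^sub>R (R - P)"
     using PR z by (auto simp: vec2_eq_iff)
    then show "\<exists>s. y = P + s *\<^sub>R (R - P)" ..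
   qed (use PR in auto)
   then show False using PR by simp
  qed
  show "0 < w $ 2"
  proof (rule ccontr)
   assume "\<not> 0 < w $ 2"
   then have w2: "w $ 2 = 0" and w1: "0 < w $ 1" using wnn w(1) by (auto simp: vec2_eq_iff less_le)
   have "k <= 0" using w(2)[OF newton_region_lattice_point[of c 0 j, OF j]] by (simp add: k_def inner_real2 w2)
   then have z: "y $ 1 = 0" if "y \<in> E" for y
   proof -
    have "0 <= y $ 1" "w $ 1 * y $ 1 <= 0"
     using EH[OF that] C1[of y] that EC \<open>k <= 0\<close> by (auto simp: inner_real2 w2)
    then show ?thesis using w1 by (simp add: mult_le_0_iff)
   qed
   define P where "P = (if A $ 2 < B $ 2 then A else B)"
   define R where "R = (if A $ 2 < B $ 2 then B else A)"
   have PR: "P \<in> E" "R \<in> E" "P $ 2 < R $ 2" "P $ 1 = 0" "R $ 1 = 0"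
    using \<open>A \<in> E\<close> \<open>B \<in> E\<close> \<open>A ~= B\<close> z[of A] z[of B] by (auto simp: P_def R_def vec2_eq_iff)
   have "P + (R - P) \<notin> E"
   proof (rule noray)
    fix y assume "y \<in> E"
    then have "y = P + ((y $ 2 - P $ 2) / (R $ 2 - P $ 2)) *\<^sub>R (R - P)"
     using PR z by (auto simp: vec2_eq_iff)
    then show "\<exists>s. y = P + s *\<^sub>R (R - P)" ..
   qed (use PR in auto)
   then show False using PR by simp
  qed
 qed
 have ge: "k <= w $ 1 * a + w $ 2 * b" if "c a b ~= 0" for a b :: nat
  using w(2)[OF newton_region_lattice_point[of c a b, OF that]] by (simp add: k_def inner_real2)
 define M where "M = {a :: nat. \<exists>b. c a b ~= 0 \<and> w $ 1 * a + w $ 2 * b = k}"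
 have "finite M"
 proof (rule finite_subset)
  show "M \<subseteq> {..nat \<lceil>k / w $ 1\<rceil>}"
  proof
   fix a assume "a \<in> M"
   then obtain b :: nat where "w $ 1 * a + w $ 2 * b = k" by (auto simp: M_def)
   then have "w $ 1 * a <= k" using wpos by (smt (verit) mult_nonneg_nonneg of_nat_0_le_iff)
   then have "real a <= k / w $ 1" using wpos by (simp add: field_simps)
   then show "a \<in> {..nat \<lceil>k / w $ 1\<rceil>}" by (simp add: le_nat_iff le_ceiling_iff)
  qed
 qed auto
 have E1: "w $ 1 * y $ 1 + w $ 2 * y $ 2 = k" if "y \<in> E" for y using EH[OF that] by (simp add: inner_real2)
 have M1: "l <= y $ 1 \<and> y $ 1 <= r" if lr: "\<And>a. a \<in> M ==> l <= real a \<and> real a <= r" and yE: "y \<in> E" for l r y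
 proof -
  have h: "l <= real a \<and> real a <= r" if "c a b ~= 0" "w $ 1 * real a + w $ 2 * real b = k" for a b
   by (rule lr) (use that in \<open>auto simp: M_def\<close>)
  have "y \<in> newton_region c" using yE EC by blast
  from newton_region_supporting_line(2)[where c = c, OF wpos ge h this E1[OF yE]] show ?thesis .
 qed
 \<comment> \<open>For empty \<open>M\<close> the bounds 1 and 0 hold vacuously and would put
   \<open>A\<close> into an empty strip.\<close>
 have "M ~= {}"
  using M1[of 1 0 A] \<open>A \<in> E\<close> by auto
 define a1 a2 where "a1 = Min M" and "a2 = Max M"
 have "a1 \<in> M" "a2 \<in> M" and a12: "\<And>a. a \<in> M ==> a1 <= a \<and> a <= a2"
  using \<open>finite M\<close> \<open>M ~= {}\<close> by (auto simp: a1_def a2_def)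
 then obtain b1 b2 where b: "c a1 b1 ~= 0" "w $ 1 * a1 + w $ 2 * b1 = k" "c a2 b2 ~= 0" "w $ 1 * a2 + w $ 2 * b2 = k"
  by (auto simp: M_def)
 have "a1 < a2"
 proof (rule ccontr)
  assume "\<not> a1 < a2"
  then have "\<And>a. a \<in> M ==> real a1 <= real a \<and> real a <= real a1" using a12 by force
  from M1[OF this, of A] M1[OF this, of B] have "A $ 1 = B $ 1" using \<open>A \<in> E\<close> \<open>B \<in> E\<close> by fastforce
  moreover have "A $ 2 = B $ 2"
   using E1[OF \<open>A \<in> E\<close>] E1[OF \<open>B \<in> E\<close>, folded \<open>A $ 1 = B $ 1\<close>] wpos by auto
  ultimately show False using \<open>A ~= B\<close> by (simp add: vec2_eq_iff)
 qed
 \<comment> \<open>The normal \<open>w\<close> is proportional to (b1 - b2, a2 - a1); this turns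
   real inequalities for \<open>w\<close> into the integer ones of
   \<open>newton_edge\<close>.\<close>
 have propw: "w $ 1 * (real a2 - real a1) = w $ 2 * (real b1 - real b2)" using b by (simp add: algebra_simps)
 have "0 < w $ 2 * (real b1 - real b2)" using propw \<open>a1 < a2\<close> wpos by (metis diff_gt_0_iff_gt mult_pos_pos of_nat_less_iff)
 then have "b2 < b1" using wpos by (simp add: zero_less_mult_iff)
 have "newton_edge c a1 b1 a2 b2"
  unfolding newton_edge_def
 proof (intro conjI allI impI)
  fix a b assume cab: "c a b ~= 0"
  let ?d = "(real b1 - real b2) * (real a - a1) + (real a2 - real a1) * (real b - b1)"
  have "w $ 2 * ?d = (w $ 2 * (real b1 - real b2)) * (real a - a1) + w $ 2 * (real a2 - real a1) * (real b - b1)"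
   by (simp add: algebra_simps)
  also have "\<dots> = (real a2 - real a1) * (w $ 1 * a + w $ 2 * b - k)"
   unfolding propw[symmetric] b(2)[symmetric] by (simp add: algebra_simps)
  finally have *: "w $ 2 * ?d = (real a2 - real a1) * (w $ 1 * a + w $ 2 * b - k)" .
  have "0 <= w $ 2 * ?d" unfolding * using ge[OF cab] \<open>a1 < a2\<close> by auto
  then have d: "0 <= ?d" using wpos by (simp add: zero_le_mult_iff)
  have conv: "real ((b1 - b2) * x + (a2 - a1) * y) = (real b1 - real b2) * x + (real a2 - real a1) * y" for x y
   using \<open>a1 < a2\<close> \<open>b2 < b1\<close> by (simp add: of_nat_diff)
  have dd: "?d = real ((b1 - b2) * a + (a2 - a1) * b) - real ((b1 - b2) * a1 + (a2 - a1) * b1)"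
   unfolding conv by (simp add: algebra_simps)
  then show "(b1 - b2) * a1 + (a2 - a1) * b1 <= (b1 - b2) * a + (a2 - a1) * b" using d by linarith
  assume "(b1 - b2) * a + (a2 - a1) * b = (b1 - b2) * a1 + (a2 - a1) * b1"
  then have "?d = 0" using dd by simp
  then have "w $ 1 * a + w $ 2 * b = k" using * \<open>a1 < a2\<close> by simp
  then have "a \<in> M" using cab by (auto simp: M_def)
  then show "a1 <= a" "a <= a2" using a12 by auto
 qed (use b \<open>a1 < a2\<close> \<open>b2 < b1\<close> in auto)
 note e = this
 let ?S = "closed_segment (lattice_point a1 b1) (lattice_point a2 b2)"
 have "E \<subseteq> ?S"
 proof
  fix y assume y: "y \<in> E"
  have "w $ 2 * ((real b1 - real b2) * (y $ 1 - a1) + (real a2 - real a1) * (y $ 2 - b1))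
    = (w $ 2 * (real b1 - real b2)) * (y $ 1 - a1) + w $ 2 * (real a2 - real a1) * (y $ 2 - b1)"
   by (simp add: algebra_simps)
  also have "\<dots> = (real a2 - real a1) * (w $ 1 * y $ 1 + w $ 2 * y $ 2 - k)"
   unfolding propw[symmetric] b(2)[symmetric] by (simp add: algebra_simps)
  also have "\<dots> = 0" using E1[OF y] by simp
  finally have "(real b1 - real b2) * (y $ 1 - a1) + (real a2 - real a1) * (y $ 2 - b1) = 0"
   using wpos by simp
  then show "y \<in> ?S" using M1[of a1 a2 y] y a12 \<open>a1 < a2\<close> \<open>b2 < b1\<close>
   by (intro point_on_closed_segment) (auto simp: algebra_simps)
 qed
 have S: "?S edge_of ?C" by (rule newton_edge_face[OF e])
 then have "?S \<subseteq> ?C" by (simp add: edge_of_def face_of_imp_subset)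
 then have "E face_of ?S" using face_of_subset[OF face \<open>E \<subseteq> ?S\<close>] by auto
 then have "E = ?S" using face_of_aff_dim_lt[of ?S E] dim S by (auto simp: edge_of_def)
 with e show ?thesis by blast
qed

lemma newton_segments_eq:
 assumes "convenient c"
 shows "newton_segments c = {closed_segment (lattice_point a1 b1) (lattice_point a2 b2) | a1 b1 a2 b2. newton_edge c a1 b1 a2 b2}"
proof (intro equalityI subsetI)
 fix E assume "E \<in> newton_segments c"
 then show "E \<in> {closed_segment (lattice_point a1 b1) (lattice_point a2 b2) | a1 b1 a2 b2. newton_edge c a1 b1 a2 b2}"
  unfolding newton_segments_def using compact_newton_edge_imp[OF assms] by blast
next
 fix E assume "E \<in> {closed_segment (lattice_point a1 b1) (lattice_point a2 b2) | a1 b1 a2 b2. newton_edge c a1 b1 a2 b2}"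
 then show "E \<in> newton_segments c" unfolding newton_segments_def using newton_edge_face(2)[of c] by auto
qed

lemma endpoints_closed_segment:
 assumes "a1 < a2" "b2 < b1"
 shows "endpoints (closed_segment (lattice_point a1 b1) (lattice_point a2 b2)) = ((a1, b1), (a2, b2))"
 unfolding endpoints_def
proof (rule the_equality)
 fix e
 assume "case e of ((\<alpha>\<^sub>1, \<beta>\<^sub>1), (\<alpha>\<^sub>2, \<beta>\<^sub>2)) =>
   closed_segment (lattice_point a1 b1) (lattice_point a2 b2) = closed_segment (lattice_point \<alpha>\<^sub>1 \<beta>\<^sub>1) (lattice_point \<alpha>\<^sub>2 \<beta>\<^sub>2) \<and> \<alpha>\<^sub>1 < \<alpha>\<^sub>2 \<and> \<beta>\<^sub>2 < \<beta>\<^sub>1"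
 then obtain \<alpha>\<^sub>1 \<beta>\<^sub>1 \<alpha>\<^sub>2 \<beta>\<^sub>2 where e: "e = ((\<alpha>\<^sub>1, \<beta>\<^sub>1), (\<alpha>\<^sub>2, \<beta>\<^sub>2))"
  "closed_segment (lattice_point a1 b1) (lattice_point a2 b2) = closed_segment (lattice_point \<alpha>\<^sub>1 \<beta>\<^sub>1) (lattice_point \<alpha>\<^sub>2 \<beta>\<^sub>2)"
  "\<alpha>\<^sub>1 < \<alpha>\<^sub>2" by (cases e) auto
 then show "e = ((a1, b1), (a2, b2))" using assms by (auto simp: closed_segment_eq doubleton_eq_iff)
qed (use assms in auto)

text \<open>Over the integers the defect is measured from the left endpoint, which removes truncated
  subtraction and leaves expressions that ring normalisation can compare.\<close>

lemma newton_edge_int: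
 "newton_edge c a1 b1 a2 b2 \<longleftrightarrow> c a1 b1 ~= 0 \<and> c a2 b2 ~= 0 \<and> a1 < a2 \<and> b2 < b1 \<and>
   (\<forall>a b. c a b ~= 0 --> 0 <= (int b1 - int b2) * (int a - int a1) + (int a2 - int a1) * (int b - int b1) \<and>
    ((int b1 - int b2) * (int a - int a1) + (int a2 - int a1) * (int b - int b1) = 0 --> a1 <= a \<and> a <= a2))"
proof (cases "a1 < a2 \<and> b2 < b1")
 case True
 obtain p q where "b1 = b2 + p" "a2 = a1 + q" using True by (metis less_imp_add_positive)
 then have "(int b1 - int b2) * (int a - int a1) + (int a2 - int a1) * (int b - int b1)
   = int ((b1 - b2) * a + (a2 - a1) * b) - int ((b1 - b2) * a1 + (a2 - a1) * b1)" for a b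
  by (simp add: algebra_simps)
 note eq = this
 have "(0 <= (int b1 - int b2) * (int a - int a1) + (int a2 - int a1) * (int b - int b1))
   \<longleftrightarrow> (b1 - b2) * a1 + (a2 - a1) * b1 <= (b1 - b2) * a + (a2 - a1) * b"
  "((int b1 - int b2) * (int a - int a1) + (int a2 - int a1) * (int b - int b1) = 0)
   \<longleftrightarrow> (b1 - b2) * a + (a2 - a1) * b = (b1 - b2) * a1 + (a2 - a1) * b1" for a b
  unfolding eq by (simp_all only: diff_ge_0_iff_ge of_nat_le_iff right_minus_eq of_nat_eq_iff)
 then show ?thesis unfolding newton_edge_def by (simp only:)
qed (auto simp: newton_edge_def)

lemma newton_edge_nonneg:
 assumes "newton_edge c a1 b1 a2 b2" "c a b ~= 0"
 shows "0 <= (int b1 - int b2) * (int a - int a1) + (int a2 - int a1) * (int b - int b1)"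
 using assms unfolding newton_edge_int by blast

lemma newton_edge_zero:
 assumes "newton_edge c a1 b1 a2 b2" "c a b ~= 0"
  "(int b1 - int b2) * (int a - int a1) + (int a2 - int a1) * (int b - int b1) = 0"
 shows "a1 <= a" "a <= a2"
 using assms unfolding newton_edge_int by blast+

lemma newton_edge_basic:
 assumes "newton_edge c a1 b1 a2 b2" shows "c a1 b1 ~= 0" "c a2 b2 ~= 0" "a1 < a2" "b2 < b1"
 using assms unfolding newton_edge_def by blast+

text \<open>The mirror image turns results on first and next edges into results on last and previous
  edges.\<close>

lemma newton_edge_transpose: "newton_edge (%i j. c j i) b2 a2 b1 a1 \<longleftrightarrow> newton_edge c a1 b1 a2 b2"
proof -
 have *: "newton_edge (%i j. c j i) b2 a2 b1 a1" if "newton_edge c a1 b1 a2 b2" for c :: "nat => nat => 'a" and a1 b1 a2 b2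
  unfolding newton_edge_int
 proof (intro conjI allI impI)
  note e = newton_edge_basic[OF that]
  fix b a assume c: "c a b ~= 0"
  let ?d = "(int b1 - int b2) * (int a - int a1) + (int a2 - int a1) * (int b - int b1)"
  have d: "(int a2 - int a1) * (int b - int b2) + (int b1 - int b2) * (int a - int a2) = ?d" by (simp add: algebra_simps)
  show "0 <= (int a2 - int a1) * (int b - int b2) + (int b1 - int b2) * (int a - int a2)" unfolding d using newton_edge_nonneg[OF that c] .
  assume "(int a2 - int a1) * (int b - int b2) + (int b1 - int b2) * (int a - int a2) = 0"
  then have d0: "?d = 0" using d by simp
  then have a: "a1 <= a" "a <= a2" using newton_edge_zero[OF that c] by blast+
  have "(int b1 - int b2) * (int a - int a1) >= 0" "(int b1 - int b2) * (int a2 - int a) >= 0" using a e by auto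
  then have "(int a2 - int a1) * (int b - int b1) <= 0" "(int a2 - int a1) * (int b - int b2) >= 0"
   using d0 by (auto simp: algebra_simps)
  then show "b2 <= b" "b <= b1" using e by (auto simp: mult_le_0_iff zero_le_mult_iff)
 qed (use that in \<open>auto simp: newton_edge_def\<close>)
 show ?thesis using *[of c a1 b1 a2 b2] *[of "%i j. c j i" b2 a2 b1 a1] by blast
qed

text \<open>The edge leaving the vertex (a0, b0) downwards is found by minimising (a - a0) / (b0 -
  b) over lower support points, ties going to the largest abscissa. The weights (n, m) certify that
  (a0, b0) is a vertex: they are those of the preceding edge, or (1, 0) at the start on the
  y-axis.\<close>

lemma newton_edge_start:
 fixes n m :: int
 assumes V: "c a0 b0 ~= 0" "0 < b0" and axis: "c i 0 ~= 0"
  and nm: "0 < n" "0 <= m"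
  and ge: "\<And>a b. c a b ~= 0 ==> 0 <= n * (int a - int a0) + m * (int b - int b0)"
  and eq: "\<And>a b. c a b ~= 0 ==> n * (int a - int a0) + m * (int b - int b0) = 0 ==> b0 <= b"
 shows "\<exists>a2 b2. newton_edge c a0 b0 a2 b2"
proof -
 \<comment> \<open>The cut at abscissa \<open>i\<close> makes the minimum exist; points further to
   the right lose against (i, 0).\<close>
 define D where "D = {(a, b). c a b ~= 0 \<and> b < b0 \<and> a <= i}"
 have fin: "finite D" by (rule finite_subset[of _ "{..i} \<times> {..<b0}"]) (auto simp: D_def)
 have below: "int a0 < int a \<and> m * (int b0 - int b) < n * (int a - int a0)" if "c a b ~= 0" "b < b0" for a b
 proof -
  have 1: "n * (int a - int a0) + m * (int b - int b0) > 0"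
   using ge[OF that(1)] eq[OF that(1)] that(2) by force
  moreover have "m * (int b0 - int b) >= 0" using nm that by auto
  ultimately have "n * (int a - int a0) > 0" by (simp add: algebra_simps)
  then show ?thesis using nm 1 by (auto simp: zero_less_mult_iff algebra_simps)
 qed
 define f :: "nat \<times> nat => real" where "f = (%(a, b). (real a - real a0) / (real b0 - real b))"
 have "(i, 0) \<in> D" using V axis by (auto simp: D_def)
 then obtain P where P: "P \<in> D" "\<And>x. x \<in> D ==> f P <= f x"
  using ex_is_arg_min_if_finite[of D f] fin by (auto simp: is_arg_min_linorder)
 define M where "M = {x \<in> D. f x = f P}"
 have "P \<in> M" using P by (simp add: M_def)
 then have "M ~= {}" by blast
 moreover have "finite M" unfolding M_def using fin by simp
 ultimately obtain R where "is_arg_min (%x. - int (fst x)) (%x. x \<in> M) R"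
  using ex_is_arg_min_if_finite by blast
 then have R1: "R \<in> M \<and> (\<forall>x. x \<in> M --> - int (fst R) <= - int (fst x))"
  unfolding is_arg_min_linorder .
 have R: "R \<in> M" "\<And>x. x \<in> M ==> fst x <= fst R"
 proof -
  fix x assume "x \<in> M"
  then have "- int (fst R) <= - int (fst x)" using R1 by blast
  then show "fst x <= fst R" by simp
 qed (use R1 in blast)
 obtain a2 b2 where R2: "R = (a2, b2)" by (cases R)
 have r: "c a2 b2 ~= 0" "b2 < b0" "(a2, b2) \<in> D" using R by (auto simp: M_def D_def R2)
 have a2: "a0 < a2" "m * (int b0 - int b2) < n * (int a2 - int a0)" using below[OF r(1,2)] by auto
 have min: "(real a2 - a0) * (real b0 - b) <= (real a - a0) * (real b0 - b2) \<and>
   ((real a2 - a0) * (real b0 - b) = (real a - a0) * (real b0 - b2) --> a <= a2)" if ab: "c a b ~= 0" "b < b0" for a b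
 proof (cases "a <= i")
  case True
  then have D: "(a, b) \<in> D" using ab by (auto simp: D_def)
  have "f R <= f (a, b)" using P(2)[OF D] R by (auto simp: M_def)
  then have 1: "(real a2 - a0) * (real b0 - b) <= (real a - a0) * (real b0 - b2)"
   using r(2) ab by (simp add: f_def R2 field_simps)
  have "a <= a2" if "(real a2 - a0) * (real b0 - b) = (real a - a0) * (real b0 - b2)"
  proof -
   have "f (a, b) = f R" using that r(2) ab by (simp add: f_def R2 field_simps)
   then have "(a, b) \<in> M" using D R by (auto simp: M_def)
   from R(2)[OF this] show ?thesis by (simp add: R2)
  qed
  with 1 show ?thesis by blast
 next
  case False
  have "f R <= f (i, 0)" using P(2)[OF \<open>(i, 0) \<in> D\<close>] R by (auto simp: M_def)
  then have 1: "(real a2 - a0) * b0 <= (real i - a0) * (real b0 - b2)"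
   using r(2) V by (simp add: f_def R2 field_simps)
  have "(real a2 - a0) * (real b0 - b) <= (real a2 - a0) * b0" using a2 by (intro mult_left_mono) auto
  also note 1
  also have "(real i - a0) * (real b0 - b2) < (real a - a0) * (real b0 - b2)"
   using False r(2) by (intro mult_strict_right_mono) auto
  finally show ?thesis by simp
 qed
 have "newton_edge c a0 b0 a2 b2"
  unfolding newton_edge_int
 proof (intro conjI allI impI)
  fix a b assume ab: "c a b ~= 0"
  let ?d = "(int b0 - int b2) * (int a - int a0) + (int a2 - int a0) * (int b - int b0)"
  have "0 <= ?d \<and> (?d = 0 --> a0 <= a \<and> a <= a2)"
  proof (cases "b < b0")
   case True
   have d: "real_of_int ?d = (real a - a0) * (real b0 - b2) - (real a2 - a0) * (real b0 - b)"
    by (simp add: algebra_simps)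
   then have "0 <= real_of_int ?d" using min[OF ab True] by linarith
   then have "0 <= ?d" by (simp only: of_int_0_le_iff)
   moreover have "a <= a2" if "?d = 0"
   proof -
    have "real_of_int ?d = 0" using that by (simp only: of_int_0)
    then have "(real a2 - a0) * (real b0 - b) = (real a - a0) * (real b0 - b2)" using d by linarith
    then show ?thesis using min[OF ab True] by blast
   qed
   ultimately show ?thesis using below[OF ab True] by auto
  next
   case False
   show ?thesis
   proof (cases "a0 <= a")
    case True
    then have p: "0 <= (int b0 - int b2) * (int a - int a0)" "0 <= (int a2 - int a0) * (int b - int b0)"
     using False a2 r by auto
    have "a = a0" if "?d = 0"
    proof -
     have "(int b0 - int b2) * (int a - int a0) = 0" using that p by linarith
     then show ?thesis using r by auto
    qed
    with p a2 show ?thesis by auto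
   next
    case False': False
    \<comment> \<open>A point to the upper left is handled by comparing the slope of the certifying
      weights with the slope of the new edge.\<close>
    have g: "n * (int a0 - int a) <= m * (int b - int b0)" using ge[OF ab] by (simp add: algebra_simps)
    have p: "0 < n * (int a0 - int a)" using nm False' by auto
    have bb: "0 < int b - int b0"
    proof (rule ccontr)
     assume "\<not> 0 < int b - int b0"
     then have "m * (int b - int b0) <= 0" using nm False by (simp add: mult_le_0_iff)
     with g p show False by simp
    qed
    have "(int b0 - int b2) * (n * (int a0 - int a)) <= (int b0 - int b2) * (m * (int b - int b0))"
     using g r by (intro mult_left_mono) auto
    also have "\<dots> = (m * (int b0 - int b2)) * (int b - int b0)" by (simp add: mult_ac)
    also have "\<dots> < (n * (int a2 - int a0)) * (int b - int b0)"
     using a2 bb by (intro mult_strict_right_mono) auto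
    finally have "0 < n * ?d" by (simp add: algebra_simps)
    then have "0 < ?d" using nm by (simp add: zero_less_mult_iff)
    then show ?thesis by simp
   qed
  qed
  then show "0 <= ?d" "?d = 0 ==> a0 <= a" "?d = 0 ==> a <= a2" by auto
 qed (use V r a2 in auto)
 then show ?thesis by blast
qed

section \<open>The chain of edges between the axes\<close>

definition x_intercept :: "(nat => nat => 'k :: zero) => nat" where
 "x_intercept c = (LEAST i. c i 0 ~= 0)"
definition y_intercept :: "(nat => nat => 'k :: zero) => nat" where
 "y_intercept c = (LEAST j. c 0 j ~= 0)"

definition newton_edges :: "(nat => nat => 'k :: zero) => ((nat \<times> nat) \<times> (nat \<times> nat)) set" where
 "newton_edges c = {((a1, b1), (a2, b2)) | a1 b1 a2 b2. newton_edge c a1 b1 a2 b2}"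

lemma mem_newton_edges [simp]: "((a1, b1), (a2, b2)) \<in> newton_edges c \<longleftrightarrow> newton_edge c a1 b1 a2 b2"
 by (auto simp: newton_edges_def)

locale newton_polygon =
 fixes c :: "nat => nat => 'k :: zero"
 assumes conv: "convenient c" and c00: "c 0 0 = 0"
begin

lemma transpose: "newton_polygon (%i j. c j i)"
 using conv c00 by unfold_locales (auto simp: convenient_def)

lemma x_intercept: "c (x_intercept c) 0 ~= 0" "c i 0 ~= 0 ==> x_intercept c <= i" "0 < x_intercept c"
proof -
 obtain k where "c k 0 ~= 0" using conv unfolding convenient_def by blast
 then show 1: "c (x_intercept c) 0 ~= 0" unfolding x_intercept_def by (rule LeastI)
 show "c i 0 ~= 0 ==> x_intercept c <= i" unfolding x_intercept_def by (rule Least_le)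
 show "0 < x_intercept c"
 proof (rule ccontr)
  assume "\<not> 0 < x_intercept c"
  then have "x_intercept c = 0" by simp
  with 1 c00 show False by simp
 qed
qed

lemma y_intercept: "c 0 (y_intercept c) ~= 0" "c 0 j ~= 0 ==> y_intercept c <= j" "0 < y_intercept c"
 using newton_polygon.x_intercept[OF transpose] unfolding x_intercept_def y_intercept_def by blast+

lemma edge_bounds:
 assumes "newton_edge c a1 b1 a2 b2"
 shows "b1 <= y_intercept c" "a2 <= x_intercept c"
proof -
 note e = newton_edge_basic[OF assms]
 have "0 <= (int b1 - int b2) * (int 0 - int a1) + (int a2 - int a1) * (int (y_intercept c) - int b1)"
  by (rule newton_edge_nonneg[OF assms y_intercept(1)])
 moreover have "(int b1 - int b2) * int a1 >= 0" using e by auto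
 ultimately have "0 <= (int a2 - int a1) * (int (y_intercept c) - int b1)" by (simp add: algebra_simps)
 then show "b1 <= y_intercept c" using e by (auto simp: zero_le_mult_iff)
 have "0 <= (int b1 - int b2) * (int (x_intercept c) - int a1) + (int a2 - int a1) * (int 0 - int b1)"
  by (rule newton_edge_nonneg[OF assms x_intercept(1)])
 also have "\<dots> = (int b1 - int b2) * (int (x_intercept c) - int a2) - (int a2 - int a1) * int b2" by (simp add: algebra_simps)
 finally have "0 <= (int b1 - int b2) * (int (x_intercept c) - int a2) - (int a2 - int a1) * int b2" .
 moreover have "(int a2 - int a1) * int b2 >= 0" using e by auto
 ultimately have "0 <= (int b1 - int b2) * (int (x_intercept c) - int a2)" by linarith
 then show "a2 <= x_intercept c" using e by (auto simp: zero_le_mult_iff)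
qed

lemma finite_newton_edges: "finite (newton_edges c)"
proof (rule finite_subset)
 let ?I = "{..x_intercept c} \<times> {..y_intercept c}"
 show "newton_edges c \<subseteq> ?I \<times> ?I"
 proof
  fix e assume "e \<in> newton_edges c"
  then obtain a1 b1 a2 b2 where e: "e = ((a1, b1), (a2, b2))" "newton_edge c a1 b1 a2 b2"
   unfolding newton_edges_def by blast
  then have "a1 < a2" "b2 < b1" by (auto simp: newton_edge_def)
  with edge_bounds[OF e(2)] show "e \<in> ?I \<times> ?I" unfolding e(1) by simp
 qed
qed auto

text \<open>The weights (1, 0) certify the lowest support point on the y-axis as a vertex.\<close>

lemma first_edge: "\<exists>a2 b2. newton_edge c 0 (y_intercept c) a2 b2"
 by (rule newton_edge_start[where n = 1 and m = 0 and i = "x_intercept c"])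
   (use x_intercept y_intercept in auto)

text \<open>The weights of the current edge certify its right endpoint, because no support point on
  its line lies further down.\<close>

lemma next_edge:
 assumes e: "newton_edge c a1 b1 a2 b2" and "0 < b2"
 shows "\<exists>a3 b3. newton_edge c a2 b2 a3 b3"
proof (rule newton_edge_start[where n = "int b1 - int b2" and m = "int a2 - int a1" and i = "x_intercept c"])
 note e' = newton_edge_basic[OF e]
 show "c a2 b2 ~= 0" "0 < int b1 - int b2" "0 <= int a2 - int a1" using e' by auto
 fix a b assume ab: "c a b ~= 0"
 let ?d = "(int b1 - int b2) * (int a - int a1) + (int a2 - int a1) * (int b - int b1)"
 have d: "(int b1 - int b2) * (int a - int a2) + (int a2 - int a1) * (int b - int b2) = ?d" by (simp add: algebra_simps)
 show "0 <= (int b1 - int b2) * (int a - int a2) + (int a2 - int a1) * (int b - int b2)"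
  unfolding d by (rule newton_edge_nonneg[OF e ab])
 assume 0: "(int b1 - int b2) * (int a - int a2) + (int a2 - int a1) * (int b - int b2) = 0"
 then have "a <= a2" using newton_edge_zero[OF e ab] unfolding d by blast
 then have "(int b1 - int b2) * (int a - int a2) <= 0" using e' by (auto simp: mult_le_0_iff)
 then have "0 <= (int a2 - int a1) * (int b - int b2)" using 0 by linarith
 then show "b2 <= b" using e' by (auto simp: zero_le_mult_iff)
qed (use assms x_intercept in auto)

lemma prev_edge:
 assumes "newton_edge c a1 b1 a2 b2" and "0 < a1"
 shows "\<exists>a0 b0. newton_edge c a0 b0 a1 b1"
 using newton_polygon.next_edge[OF transpose, of b2 a2 b1 a1] assms newton_edge_transpose[of c] by blast

lemma last_edge: "\<exists>a1 b1. newton_edge c a1 b1 (x_intercept c) 0"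
 using newton_polygon.first_edge[OF transpose] newton_edge_transpose[of c]
 unfolding x_intercept_def y_intercept_def by blast

lemma edge_left_axis: "newton_edge c 0 b1 a2 b2 ==> b1 = y_intercept c"
 using edge_bounds(1)[of 0 b1 a2 b2] y_intercept(2)[of b1] by (auto simp: newton_edge_def)

lemma edge_right_axis: "newton_edge c a1 b1 a2 0 ==> a2 = x_intercept c"
 using edge_bounds(2)[of a1 b1 a2 0] x_intercept(2)[of a2] by (auto simp: newton_edge_def)

text \<open>Parallel edges support the region from the same side, so their defects at each other's
  endpoints vanish and they share a line; the clause on abscissae then identifies the
  endpoints.\<close>

lemma edge_eq_if_parallel:
 assumes "newton_edge c a1 b1 a2 b2" "newton_edge c a1' b1' a2' b2'"
  and "(int b1 - int b2) * (int a2' - int a1') = (int b1' - int b2') * (int a2 - int a1)"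
 shows "a1 = a1' \<and> b1 = b1' \<and> a2 = a2' \<and> b2 = b2'"
proof -
 have *: "a1 <= a1' \<and> a2' <= a2 \<and> (int b1 - int b2) * (int a1' - int a1) + (int a2 - int a1) * (int b1' - int b1) = 0
   \<and> (int b1 - int b2) * (int a2' - int a1) + (int a2 - int a1) * (int b2' - int b1) = 0"
  if "newton_edge c a1 b1 a2 b2" "newton_edge c a1' b1' a2' b2'"
  and par: "(int b1 - int b2) * (int a2' - int a1') = (int b1' - int b2') * (int a2 - int a1)" for a1 b1 a2 b2 a1' b1' a2' b2'
 proof -
  note e = newton_edge_basic[OF that(1)] and e' = newton_edge_basic[OF that(2)]
  let ?q = "int a2 - int a1" and ?q' = "int a2' - int a1'"
  let ?d = "%a b. (int b1 - int b2) * (int a - int a1) + (int a2 - int a1) * (int b - int b1)"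
  let ?d' = "%a b. (int b1' - int b2') * (int a - int a1') + (int a2' - int a1') * (int b - int b1')"
  have "0 <= ?d a1' b1'" "0 <= ?d a2' b2'" using newton_edge_nonneg[OF that(1)] e' by blast+
  have "?q' * ?d a1' b1' = ((int b1 - int b2) * ?q') * (int a1' - int a1) + ?q * ?q' * (int b1' - int b1)"
   by (simp add: algebra_simps)
  also have "\<dots> = - (?q * ?d' a1 b1)" unfolding par by (simp add: algebra_simps)
  finally have dd: "?q' * ?d a1' b1' = - (?q * ?d' a1 b1)" .
  have "0 <= ?d' a1 b1" by (rule newton_edge_nonneg[OF that(2) e(1)])
  then have "0 <= ?q * ?d' a1 b1" "0 < ?q'" using e e' by simp_all
  then have "?q' * ?d a1' b1' <= 0" using dd by linarith
  then have "?d a1' b1' <= 0" using \<open>0 < ?q'\<close> by (simp add: mult_le_0_iff)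
  then have 1: "?d a1' b1' = 0" using \<open>0 <= ?d a1' b1'\<close> by simp
  moreover have "?d a2' b2' = ?d a1' b1' + ((int b1 - int b2) * ?q' - (int b1' - int b2') * ?q)" by (simp add: algebra_simps)
  ultimately have 2: "?d a2' b2' = 0" using par by simp
  show ?thesis using 1 2 newton_edge_zero[OF that(1) e'(1) 1] newton_edge_zero[OF that(1) e'(2) 2] by blast
 qed
 from *[OF assms] *[OF assms(2,1) assms(3)[symmetric]] have a: "a1 = a1'" "a2 = a2'"
  and "(int a2 - int a1) * (int b1' - int b1) = 0"
  "(int b1 - int b2) * (int a2' - int a1) + (int a2 - int a1) * (int b2' - int b1) = 0" by auto
 then have "b1 = b1'" using assms by (auto simp: newton_edge_def)
 moreover have "(int a2 - int a1) * (int b2' - int b2) = 0"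
  using \<open>(int b1 - int b2) * (int a2' - int a1) + (int a2 - int a1) * (int b2' - int b1) = 0\<close> a by (simp add: algebra_simps)
 ultimately show ?thesis using a assms by (auto simp: newton_edge_def)
qed

text \<open>The defect of each edge at an endpoint of the other gives two linear inequalities for
  the offset (A, B) from the left end of the flatter edge to the right end of the steeper one.
  Eliminating \<open>A\<close> fixes the sign of \<open>B\<close>, and then the sign of
  \<open>A\<close> follows.\<close>

lemma edge_order:
 assumes "newton_edge c a1 b1 a2 b2" "newton_edge c a1' b1' a2' b2'"
  and "(int b1 - int b2) * (int a2' - int a1') > (int b1' - int b2') * (int a2 - int a1)"
 shows "b1' <= b2 \<and> a2 <= a1'"
proof -
 note e = newton_edge_basic[OF assms(1)] and e' = newton_edge_basic[OF assms(2)]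
 let ?p = "int b1 - int b2" and ?q = "int a2 - int a1" and ?p' = "int b1' - int b2'" and ?q' = "int a2' - int a1'"
 define A B where "A = int a2 - int a1'" and "B = int b2 - int b1'"
 have pos: "0 < ?p" "0 < ?q" "0 < ?p'" "0 < ?q'" using e e' by auto
 have "0 <= ?p * (int a1' - int a1) + ?q * (int b1' - int b1)" by (rule newton_edge_nonneg[OF assms(1) e'(1)])
 then have 1: "?p * A + ?q * B <= 0" unfolding A_def B_def by (simp add: algebra_simps)
 have "0 <= ?p' * (int a2 - int a1') + ?q' * (int b2 - int b1')" by (rule newton_edge_nonneg[OF assms(2) e(2)])
 then have 2: "0 <= ?p' * A + ?q' * B" unfolding A_def B_def .
 have "0 <= ?p * (?p' * A + ?q' * B) - ?p' * (?p * A + ?q * B)"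
  using mult_nonneg_nonneg[OF less_imp_le[OF pos(1)] 2] mult_nonneg_nonpos[OF less_imp_le[OF pos(3)] 1] by linarith
 also have "\<dots> = (?p * ?q' - ?p' * ?q) * B" by (simp add: algebra_simps)
 finally have B: "0 <= B" using assms(3) by (simp add: zero_le_mult_iff)
 then have "?p * A <= 0" using 1 pos mult_nonneg_nonneg[OF less_imp_le[OF pos(2)] B] by linarith
 then have "A <= 0" using pos by (simp add: mult_le_0_iff)
 with B show ?thesis unfolding A_def B_def by auto
qed

text \<open>Walking down the chain: a point not above the right ray of the current cone is strictly
  below it, which is the strict condition on the left ray of the next cone. The ordinate of the
  vertex decreases, so the walk stops.\<close>

lemma half_open_cone_exists:
 assumes "0 < x"
 shows "\<exists>a1 b1 a2 b2. newton_edge c a1 b1 a2 b2 \<and> a1 * y < b1 * x \<and> b2 * x <= a2 * y"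
proof -
 have *: "\<exists>a1 b1 a2 b2. newton_edge c a1 b1 a2 b2 \<and> a1 * y < b1 * x \<and> b2 * x <= a2 * y"
  if "newton_edge c a1 b1 a2 b2" "a1 * y < b1 * x" for a1 b1 a2 b2
  using that
 proof (induction b1 arbitrary: a1 a2 b2 rule: less_induct)
  case (less b1)
  show ?case
  proof (cases "b2 * x <= a2 * y")
   case False
   then have "0 < b2" by (cases b2) auto
   then obtain a3 b3 where "newton_edge c a2 b2 a3 b3" using next_edge less by blast
   moreover have "b2 < b1" using less by (auto simp: newton_edge_def)
   ultimately show ?thesis using less.IH[of b2 a2 a3 b3] False by auto
  qed (use less in blast)
 qed
 obtain a2 b2 where "newton_edge c 0 (y_intercept c) a2 b2" using first_edge by blast
 from *[OF this] show ?thesis using y_intercept assms by simp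
qed

lemma half_open_cone_unique:
 assumes "newton_edge c a1 b1 a2 b2" "a1 * y < b1 * x" "b2 * x <= a2 * y"
  and "newton_edge c a1' b1' a2' b2'" "a1' * y < b1' * x" "b2' * x <= a2' * y"
 shows "a1 = a1' \<and> b1 = b1' \<and> a2 = a2' \<and> b2 = b2'"
proof -
 have no: False if "a1 * y < b1 * x" "b2 * x <= a2 * y" "a1' * y < b1' * x" "b2' * x <= a2' * y" "b1' <= b2 \<and> a2 <= a1'"
  for a1 b1 a2 b2 a1' b1' a2' b2' :: nat
 proof -
  have "b1' * x <= b2 * x" "a2 * y <= a1' * y" using that by auto
  then show False using that by linarith
 qed
 consider "(int b1 - int b2) * (int a2' - int a1') = (int b1' - int b2') * (int a2 - int a1)"
  | "(int b1 - int b2) * (int a2' - int a1') > (int b1' - int b2') * (int a2 - int a1)"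
  | "(int b1' - int b2') * (int a2 - int a1) > (int b1 - int b2) * (int a2' - int a1')" by linarith
 then show ?thesis
 proof cases
  case 1
  then show ?thesis using edge_eq_if_parallel[OF assms(1,4)] by blast
 next
  case 2
  then show ?thesis using edge_order[OF assms(1,4)] no[OF assms(2,3,5,6)] by blast
 next
  case 3
  then show ?thesis using edge_order[OF assms(4,1)] no[OF assms(5,6,2,3)] by blast
 qed
qed

text \<open>Different slopes are impossible, since \<open>edge_order\<close> would place one edge
  wholly beyond the other.\<close>

lemma edge_eq_if_same_left:
 assumes "newton_edge c a1 b1 a2 b2" "newton_edge c a1 b1 a2' b2'" shows "a2 = a2' \<and> b2 = b2'"
proof -
 consider "(int b1 - int b2) * (int a2' - int a1) = (int b1 - int b2') * (int a2 - int a1)"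
  | "(int b1 - int b2) * (int a2' - int a1) > (int b1 - int b2') * (int a2 - int a1)"
  | "(int b1 - int b2') * (int a2 - int a1) > (int b1 - int b2) * (int a2' - int a1)" by linarith
 then show ?thesis
 proof cases
  case 1
  then show ?thesis using edge_eq_if_parallel[OF assms] by blast
 next
  case 2
  then show ?thesis using edge_order[OF assms] assms by (auto simp: newton_edge_def)
 next
  case 3
  then show ?thesis using edge_order[OF assms(2,1)] assms by (auto simp: newton_edge_def)
 qed
qed

lemma edge_eq_if_same_right:
 assumes "newton_edge c a1 b1 a2 b2" "newton_edge c a1' b1' a2 b2" shows "a1 = a1' \<and> b1 = b1'"
proof -
 consider "(int b1 - int b2) * (int a2 - int a1') = (int b1' - int b2) * (int a2 - int a1)"
  | "(int b1 - int b2) * (int a2 - int a1') > (int b1' - int b2) * (int a2 - int a1)"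
  | "(int b1' - int b2) * (int a2 - int a1) > (int b1 - int b2) * (int a2 - int a1')" by linarith
 then show ?thesis
 proof cases
  case 1
  then show ?thesis using edge_eq_if_parallel[OF assms] by blast
 next
  case 2
  then show ?thesis using edge_order[OF assms] assms by (auto simp: newton_edge_def)
 next
  case 3
  then show ?thesis using edge_order[OF assms(2,1)] assms by (auto simp: newton_edge_def)
 qed
qed

text \<open>Left endpoints and right endpoints run, once each, through the same set \<open>V\<close>
  of interior vertices, apart from the two points on the axes.\<close>

lemma sum_edges_telescope:
 fixes \<phi> :: "nat \<times> nat => int"
 shows "(\<Sum>(L,R)\<in>newton_edges c. \<phi> L - \<phi> R) = \<phi> (0, y_intercept c) - \<phi> (x_intercept c, 0)"
proof -
 let ?E = "newton_edges c"
 have injL: "inj_on fst ?E" unfolding inj_on_def newton_edges_def using edge_eq_if_same_left by auto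
 have injR: "inj_on snd ?E" unfolding inj_on_def newton_edges_def using edge_eq_if_same_right by auto
 define V where "V = fst ` ?E \<inter> snd ` ?E"
 have fin: "finite V" using finite_newton_edges by (auto simp: V_def)
 have L: "fst ` ?E = insert (0, y_intercept c) V" and nL: "(0, y_intercept c) \<notin> V"
 proof -
  have 0: "(0, b) \<notin> snd ` ?E" for b by (auto simp: newton_edges_def newton_edge_def)
  then show "(0, y_intercept c) \<notin> V" by (auto simp: V_def)
  obtain u v where "newton_edge c 0 (y_intercept c) u v" using first_edge by blast
  then have "((0, y_intercept c), (u, v)) \<in> ?E" by simp
  then have "(0, y_intercept c) \<in> fst ` ?E" by (metis fst_conv image_eqI)
  moreover have "v \<in> snd ` ?E" if vv: "v \<in> fst ` ?E" "v ~= (0, y_intercept c)" for v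
  proof -
   obtain a1 b1 a2 b2 where e: "v = (a1, b1)" "newton_edge c a1 b1 a2 b2" using vv by (auto simp: newton_edges_def)
   then have "0 < a1" using edge_left_axis vv(2) by (cases a1) auto
   then obtain a0 b0 where "newton_edge c a0 b0 a1 b1" using prev_edge e by blast
   then have "((a0, b0), v) \<in> ?E" using e by simp
   then show ?thesis by (metis snd_conv image_eqI)
  qed
  ultimately show "fst ` ?E = insert (0, y_intercept c) V" unfolding V_def by blast
 qed
 have R: "snd ` ?E = insert (x_intercept c, 0) V" and nR: "(x_intercept c, 0) \<notin> V"
 proof -
  have 0: "(a, 0) \<notin> fst ` ?E" for a by (auto simp: newton_edges_def newton_edge_def)
  then show "(x_intercept c, 0) \<notin> V" by (auto simp: V_def)
  obtain u v where "newton_edge c u v (x_intercept c) 0" using last_edge by blast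
  then have "((u, v), (x_intercept c, 0)) \<in> ?E" by simp
  then have "(x_intercept c, 0) \<in> snd ` ?E" by (metis snd_conv image_eqI)
  moreover have "v \<in> fst ` ?E" if vv: "v \<in> snd ` ?E" "v ~= (x_intercept c, 0)" for v
  proof -
   obtain a1 b1 a2 b2 where e: "v = (a2, b2)" "newton_edge c a1 b1 a2 b2" using vv by (auto simp: newton_edges_def)
   then have "0 < b2" using edge_right_axis vv(2) by (cases b2) auto
   then obtain a0 b0 where "newton_edge c a2 b2 a0 b0" using next_edge e by blast
   then have "(v, (a0, b0)) \<in> ?E" using e by simp
   then show ?thesis by (metis fst_conv image_eqI)
  qed
  ultimately show "snd ` ?E = insert (x_intercept c, 0) V" unfolding V_def by blast
 qed
 have "(\<Sum>(L,R)\<in>?E. \<phi> L - \<phi> R) = (\<Sum>e\<in>?E. \<phi> (fst e)) - (\<Sum>e\<in>?E. \<phi> (snd e))"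
  by (simp add: case_prod_beta sum_subtractf)
 also have "(\<Sum>e\<in>?E. \<phi> (fst e)) = sum \<phi> (fst ` ?E)" by (simp add: sum.reindex[OF injL])
 also have "(\<Sum>e\<in>?E. \<phi> (snd e)) = sum \<phi> (snd ` ?E)" by (simp add: sum.reindex[OF injR])
 finally show ?thesis using fin nL nR by (simp add: L R)
qed

text \<open>Edges above the lowest-degree point (a0, b0) are steep and count with their height,
  those below it are flat and count with their width; both are differences of one potential
  \<open>\<phi>\<close>. Among the points of lowest degree the one with smallest ordinate is taken,
  so that an edge of slope -1 belongs to the steep side.\<close>

lemma sum_edges_max:
 "(\<Sum>((a1,b1),(a2,b2))\<in>newton_edges c. int (max (b1 - b2) (a2 - a1))) + int (series_order c)
   = int (x_intercept c) + int (y_intercept c)"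
proof -
 define P where "P = (%d. \<exists>\<alpha> \<beta>. c \<alpha> \<beta> ~= 0 \<and> d = \<alpha> + \<beta>)"
 have ord: "series_order c = (LEAST d. P d)" by (simp add: series_order_def P_def)
 have "P (x_intercept c)" unfolding P_def using x_intercept(1) by (intro exI[of _ "x_intercept c"] exI[of _ 0]) simp
 then have Po: "P (series_order c)" unfolding ord by (rule LeastI)
 have le: "series_order c <= a + b" if "c a b ~= 0" for a b
  unfolding ord using that by (intro Least_le) (auto simp: P_def)
 define b0 where "b0 = (LEAST b. \<exists>a. c a b ~= 0 \<and> a + b = series_order c)"
 have "\<exists>b a. c a b ~= 0 \<and> a + b = series_order c" using Po unfolding P_def by metis
 then have "\<exists>a. c a b0 ~= 0 \<and> a + b0 = series_order c" unfolding b0_def by (rule LeastI_ex)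
 then obtain a0 where a0: "c a0 b0 ~= 0" "a0 + b0 = series_order c" by blast
 have b0: "b0 <= b" if "c a b ~= 0" "a + b = series_order c" for a b
  unfolding b0_def using that by (intro Least_le) auto
 define \<phi> :: "nat \<times> nat => int" where "\<phi> = (%(a, b). if b0 <= b then int b - int b0 else int a0 - int a)"
 have "int (max (b1 - b2) (a2 - a1)) = \<phi> (a1, b1) - \<phi> (a2, b2)" if e: "newton_edge c a1 b1 a2 b2" for a1 b1 a2 b2
 proof -
  note e' = newton_edge_basic[OF e]
  let ?p = "int b1 - int b2" and ?q = "int a2 - int a1"
  have pos: "0 < ?p" "0 < ?q" using e' by auto
  have m: "0 <= ?p * (int a0 - int a1) + ?q * (int b0 - int b1)" by (rule newton_edge_nonneg[OF e a0(1)])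
  have l1: "int a0 + int b0 <= int a1 + int b1" and l2: "int a0 + int b0 <= int a2 + int b2"
   using le[of a1 b1] le[of a2 b2] e' a0 by auto
  consider "?p > ?q" | "?p < ?q" | "?p = ?q" by linarith
  then show ?thesis
  proof cases
   case 1
   have "?q * (int a0 + int b0) <= ?q * (int a2 + int b2)" using l2 pos by (intro mult_left_mono) auto
   moreover have "?p * (int a0 - int a1) + ?q * (int b0 - int b1) = ?p * (int a0 - int a2) + ?q * (int b0 - int b2)" by (simp add: algebra_simps)
   ultimately have "0 <= (?p - ?q) * (int a0 - int a2)" using m by (simp add: algebra_simps)
   then have "a2 <= a0" using 1 by (auto simp: zero_le_mult_iff)
   then have "b0 <= b2" using l2 by linarith
   then show ?thesis using 1 pos by (auto simp: \<phi>_def max_def)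
  next
   case 2
   have "?p * (int a0 + int b0) <= ?p * (int a1 + int b1)" using l1 pos by (intro mult_left_mono) auto
   then have "0 <= (?q - ?p) * (int b0 - int b1)" using m by (simp add: algebra_simps)
   then have b: "b1 <= b0" using 2 by (auto simp: zero_le_mult_iff)
   moreover have "b1 = b0 ==> a1 = a0"
   proof -
    assume "b1 = b0"
    then have "0 <= ?p * (int a0 - int a1)" using m by simp
    then show "a1 = a0" using pos l1 \<open>b1 = b0\<close> by (auto simp: zero_le_mult_iff)
   qed
   ultimately show ?thesis using 2 pos by (auto simp: \<phi>_def max_def)
  next
   case 3
   have "?q * ((int a0 + int b0) - (int a1 + int b1)) = ?q * (int a0 - int a1) + ?q * (int b0 - int b1)"
    by (simp only: ring_distribs)
   then have "0 <= ?q * ((int a0 + int b0) - (int a1 + int b1))" using m unfolding 3 by linarith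
   then have "int a1 + int b1 <= int a0 + int b0" using pos by (simp add: zero_le_mult_iff)
   then have "a2 + b2 = series_order c" using l1 3 a0 by linarith
   then have "b0 <= b2" using b0[of a2 b2] e' by auto
   then show ?thesis using 3 pos by (auto simp: \<phi>_def max_def)
  qed
 qed
 then have "(\<Sum>((a1,b1),(a2,b2))\<in>newton_edges c. int (max (b1 - b2) (a2 - a1))) = (\<Sum>(L,R)\<in>newton_edges c. \<phi> L - \<phi> R)"
  by (intro sum.cong) (auto simp: newton_edges_def)
 also have "\<dots> = \<phi> (0, y_intercept c) - \<phi> (x_intercept c, 0)" by (rule sum_edges_telescope)
 also have "\<dots> = int (y_intercept c) + int (x_intercept c) - (int a0 + int b0)"
 proof -
  have "b0 <= y_intercept c"
  proof (rule ccontr)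
   assume "\<not> b0 <= y_intercept c"
   then have "y_intercept c + 0 < a0 + b0" by simp
   then show False using le[of 0 "y_intercept c"] y_intercept(1) a0 by simp
  qed
  \<comment> \<open>For \<open>b0 = 0\<close> the first branch of \<open>\<phi>\<close> applies at
    the right end of the chain; its value 0 has to agree with the width formula there.\<close>
  moreover have "b0 = 0 ==> x_intercept c = a0"
   using le[of "x_intercept c" 0] x_intercept(1) x_intercept(2)[of a0] a0 by auto
  ultimately show ?thesis by (auto simp: \<phi>_def)
 qed
 finally show ?thesis using a0(2) by linarith
qed

end

section \<open>Weights, cones and lattice lines of one edge\<close>

type_synonym edge = "(nat \<times> nat) \<times> (nat \<times> nat)"

definition edge_r :: "edge => nat" where
 "edge_r e = gcd (snd (fst e) - snd (snd e)) (fst (snd e) - fst (fst e))"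
definition edge_n :: "edge => nat" where "edge_n e = (snd (fst e) - snd (snd e)) div edge_r e"
definition edge_m :: "edge => nat" where "edge_m e = (fst (snd e) - fst (fst e)) div edge_r e"
definition edge_wt :: "edge => nat => nat => nat" where "edge_wt e x y = edge_n e * x + edge_m e * y"
definition edge_N :: "edge => nat" where "edge_N e = edge_wt e (fst (snd e)) (snd (snd e))"
definition edge_cone :: "edge => nat => nat => bool" where
 "edge_cone e x y \<longleftrightarrow> fst (fst e) * y <= snd (fst e) * x \<and> snd (snd e) * x <= fst (snd e) * y"

lemma le_div_iff_int:
 fixes j k a :: int
 assumes "0 < k" shows "j <= a div k \<longleftrightarrow> j * k <= a"
proof
 assume "j <= a div k"
 then have "j * k <= (a div k) * k" using assms by simp
 also have "\<dots> <= a" using assms pos_mod_sign[of k a] div_mult_mod_eq[of a k] by linarith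
 finally show "j * k <= a" .
next
 assume "j * k <= a"
 then have "(j * k) div k <= a div k" using assms by (rule zdiv_mono1)
 then show "j <= a div k" using assms by simp
qed

locale newton_edge_locale =
 fixes c :: "nat => nat => 'k :: zero" and a1 b1 a2 b2 r n m N :: nat and e :: edge
 assumes edge: "newton_edge c a1 b1 a2 b2"
  and e_def: "e = ((a1, b1), (a2, b2))"
  and r_def: "r = edge_r e" and n_def: "n = edge_n e" and m_def: "m = edge_m e" and N_def: "N = edge_N e"
begin

lemma pos: "0 < r" "0 < n" "0 < m" and b1: "b1 = b2 + r * n" and a2: "a2 = a1 + r * m" and coprime: "coprime n m"
proof -
 have lt: "a1 < a2" "b2 < b1" using newton_edge_basic[OF edge] by auto
 have r: "r = gcd (b1 - b2) (a2 - a1)" by (simp add: r_def edge_r_def e_def)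
 then show "0 < r" using lt by simp
 have n: "b1 - b2 = r * n" and m: "a2 - a1 = r * m"
  unfolding n_def m_def edge_n_def edge_m_def r_def[symmetric] by (simp_all add: e_def r)
 then show "b1 = b2 + r * n" "a2 = a1 + r * m" using lt by linarith+
 show "0 < n" "0 < m" using n m lt by (auto intro: Nat.gr0I)
 have "r * gcd n m = r" using r n m by (simp add: gcd_mult_distrib_nat)
 then show "coprime n m" using \<open>0 < r\<close> by (simp add: coprime_iff_gcd_eq_1)
qed

lemma wt: "edge_wt e x y = n * x + m * y"
 by (simp add: edge_wt_def n_def m_def)

lemma N: "N = n * a1 + m * b1" "N = n * a2 + m * b2"
proof -
 show 2: "N = n * a2 + m * b2" unfolding N_def edge_N_def wt by (simp add: e_def)
 show "N = n * a1 + m * b1" unfolding 2 using a2 b1 by (simp add: algebra_simps)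
qed

lemma N_pos: "0 < N"
 using N(2) pos a2 by simp

lemma cone: "edge_cone e x y \<longleftrightarrow> a1 * y <= b1 * x \<and> b2 * x <= a2 * y"
 by (simp add: edge_cone_def e_def)

text \<open>Both sides are the determinant of the two endpoints, twice the area of their triangle
  with the origin.\<close>

lemma r_N: "int r * int N = int b1 * int a2 - int a1 * int b2"
 unfolding N(2) using b1 a2 by (simp add: algebra_simps)

lemma newton_defect:
 "(int b1 - int b2) * (int a - int a1) + (int a2 - int a1) * (int b - int b1) = int r * (int (n * a + m * b) - int N)"
proof -
 have "int b1 - int b2 = int r * int n" "int a2 - int a1 = int r * int m" using b1 a2 by simp_all
 then show ?thesis unfolding N(1) by (simp add: algebra_simps)
qed

lemma support_ge: assumes "c a b ~= 0" shows "N <= n * a + m * b"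
proof -
 have "0 <= int r * (int (n * a + m * b) - int N)"
  using newton_edge_nonneg[OF edge assms] unfolding newton_defect .
 then have "int N <= int n * int a + int m * int b" using pos by (simp add: zero_le_mult_iff)
 then show ?thesis by (metis of_nat_add of_nat_le_iff of_nat_mult)
qed

text \<open>Coprimality of the weights makes (m, -n) a generator of the integer vectors of weight
  zero.\<close>

lemma line_param:
 fixes x y x0 y0 :: int
 assumes "int n * x + int m * y = int n * x0 + int m * y0"
 shows "\<exists>j. x = x0 + j * int m \<and> y = y0 - j * int n"
proof -
 have 1: "int n * (x - x0) = int m * (y0 - y)" using assms by (simp add: algebra_simps)
 then have "int m dvd int n * (x - x0)" by simp
 moreover have "coprime (int m) (int n)" using coprime by (simp add: coprime_commute)
 ultimately have "int m dvd x - x0" by (simp add: coprime_dvd_mult_right_iff)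
 then obtain j where j: "x - x0 = int m * j" by (auto elim: dvdE)
 then have "int m * (y0 - y) = int m * (int n * j)" using 1 by (simp add: algebra_simps)
 then have "y0 - y = int n * j" using pos by simp
 then show ?thesis using j by (intro exI[of _ j]) (simp add: algebra_simps)
qed

lemma support_eq:
 assumes "c a b ~= 0" "n * a + m * b = N"
 shows "\<exists>i\<le>r. a = a1 + i * m \<and> b + i * n = b1"
proof -
 have "int n * int a + int m * int b = int n * int a1 + int m * int b1"
  using assms(2) N(1) by (metis of_nat_add of_nat_mult)
 then obtain j where j: "int a = int a1 + j * int m" "int b = int b1 - j * int n" using line_param by blast
 have "(int b1 - int b2) * (int a - int a1) + (int a2 - int a1) * (int b - int b1) = 0"
  unfolding newton_defect using assms by simp
 from newton_edge_zero[OF edge assms(1) this] have "a1 <= a" "a <= a2" .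
 then have "int a1 <= int a" "int a <= int a1 + int r * int m" using a2
  by (metis of_nat_le_iff, metis of_nat_add of_nat_le_iff of_nat_mult)
 then have "0 <= j * int m" "j * int m <= int r * int m" unfolding j by simp_all
 then have "0 <= j" "j <= int r" using pos by (auto simp: zero_le_mult_iff)
 then obtain i where i: "j = int i" "i <= r" using nonneg_int_cases by (metis of_nat_le_iff)
 have "int a = int (a1 + i * m)" "int (b + i * n) = int b1" using j i by simp_all
 then have "a = a1 + i * m" "b + i * n = b1" by (simp_all only: of_nat_eq_iff)
 then show ?thesis using i(2) by blast
qed

text \<open>Cramer's rule: \<open>s\<close> and \<open>t\<close> are the coordinates with respect to
  the two endpoints, multiplied by the determinant \<open>r * N\<close>. The cone is where both are
  nonnegative.\<close>

lemma cone_decomp: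
 fixes x y :: int
 defines "s \<equiv> int a2 * y - int b2 * x" and "t \<equiv> int b1 * x - int a1 * y"
 shows "x * (int r * int N) = s * int a1 + t * int a2" "y * (int r * int N) = s * int b1 + t * int b2"
 unfolding r_N s_def t_def by (simp_all add: algebra_simps)

lemma cone_nonneg:
 fixes x y :: int
 assumes "0 <= int a2 * y - int b2 * x" "0 <= int b1 * x - int a1 * y"
 shows "0 <= x" "0 <= y"
proof -
 have p: "0 < int r * int N" using pos N_pos by simp
 have "0 <= x * (int r * int N)" "0 <= y * (int r * int N)"
  unfolding cone_decomp(1)[where x = x and y = y] cone_decomp(2)[where x = x and y = y] using assms by simp_all
 then show "0 <= x" "0 <= y" using p by (simp_all add: zero_le_mult_iff)
qed

lemma cone_int: "edge_cone e x y \<longleftrightarrow> 0 <= int a2 * int y - int b2 * int x \<and> 0 <= int b1 * int x - int a1 * int y"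
 unfolding cone by (metis (no_types, lifting) diff_ge_0_iff_ge of_nat_le_iff of_nat_mult)

lemma cone_add: "edge_cone e x y ==> edge_cone e x' y' ==> edge_cone e (x + x') (y + y')"
 unfolding cone_int by (simp add: algebra_simps)

text \<open>The two determinants with the endpoints are i N and (r - i) N.\<close>

lemma point_in_cone:
 assumes "i <= r" "x = a1 + i * m" "y + i * n = b1"
 shows "edge_cone e x y"
proof -
 have y: "y = b2 + (r - i) * n" using assms b1 by (simp add: diff_mult_distrib)
 have 1: "int x = int a1 + int i * int m" using assms by simp
 have 2: "int y = int b1 - int i * int n" using assms by (simp flip: of_nat_add of_nat_mult)
 have "int b1 * int x - int a1 * int y = int i * int N" unfolding 1 2 N(1) by (simp add: algebra_simps)
 moreover have "int a2 * int y - int b2 * int x = int (r - i) * int N" unfolding 1 2 N(2) using b1 a2 assms(1)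
  by (simp add: of_nat_diff algebra_simps)
 ultimately show ?thesis unfolding cone_int by simp
qed

text \<open>The cone points of weight \<open>s\<close> form an arithmetic progression with step (m,
  -n). Its first point becomes (x0, y0) and its last one gets index \<open>J\<close>. The
  equivalence ranges over all integers, so that indices outside, possibly with negative coordinates,
  are excluded as well.\<close>

lemma line_data:
 assumes "edge_cone e u v" "n * u + m * v = s"
 shows "\<exists>x0 y0 J. J * n <= y0 \<and> n * x0 + m * y0 = s \<and>
  (\<forall>j::int. (0 <= int a2 * (int y0 - j * int n) - int b2 * (int x0 + j * int m) \<and>
   0 <= int b1 * (int x0 + j * int m) - int a1 * (int y0 - j * int n)) \<longleftrightarrow> 0 <= j \<and> j <= int J)"
proof -
 define P where "P = (%j::int. 0 <= int a2 * (int v - j * int n) - int b2 * (int u + j * int m) \<and>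
   0 <= int b1 * (int u + j * int m) - int a1 * (int v - j * int n))"
 have P0: "P 0" using assms(1) unfolding P_def cone_int by simp
 define lo hi where "lo = int a1 * int v - int b1 * int u" and "hi = int a2 * int v - int b2 * int u"
 have P: "P j \<longleftrightarrow> lo <= j * int N \<and> j * int N <= hi" for j
 proof -
  have "int a2 * (int v - j * int n) - int b2 * (int u + j * int m) = hi - j * int N"
   unfolding N(2) hi_def by (simp add: algebra_simps)
  moreover have "int b1 * (int u + j * int m) - int a1 * (int v - j * int n) = j * int N - lo"
   unfolding N(1) lo_def by (simp add: algebra_simps)
  ultimately show ?thesis unfolding P_def by auto
 qed
 \<comment> \<open>\<open>jl\<close> is the quotient of \<open>lo\<close> rounded up, expressed by
   the rounding-down \<open>div\<close>.\<close>
 define jl jh where "jl = - ((- lo) div int N)" and "jh = hi div int N"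
 have Np: "0 < int N" using N_pos by simp
 have P': "P j \<longleftrightarrow> jl <= j \<and> j <= jh" for j
 proof -
  have "lo <= j * int N \<longleftrightarrow> (- j) * int N <= - lo" by auto
  also have "\<dots> \<longleftrightarrow> - j <= (- lo) div int N" using Np by (simp add: le_div_iff_int)
  finally have "lo <= j * int N \<longleftrightarrow> jl <= j" unfolding jl_def by linarith
  moreover have "j * int N <= hi \<longleftrightarrow> j <= jh" unfolding jh_def using Np by (simp add: le_div_iff_int)
  ultimately show ?thesis using P by simp
 qed
 have j: "jl <= 0" "0 <= jh" using P0 P' by auto
 define x0 y0 where "x0 = int u + jl * int m" and "y0 = int v - jl * int n"
 define J where "J = nat (jh - jl)"
 have J: "int J = jh - jl" using j by (simp add: J_def)
 have Pnn: "0 <= int u + j * int m" "0 <= int v - j * int n" if "P j" for j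
  using cone_nonneg[where x = "int u + j * int m" and y = "int v - j * int n"] that unfolding P_def by blast+
 have "P jl" "P jh" using P' j by auto
 then have nn: "0 <= x0" "0 <= y0" "0 <= int v - jh * int n"
  unfolding x0_def y0_def by (blast intro: Pnn)+
 have "int J * int n <= y0" using nn(3) unfolding y0_def J by (simp add: algebra_simps)
 then have 1: "J * n <= nat y0" using nn by (simp add: le_nat_iff)
 have "int n * x0 + int m * y0 = int s" unfolding x0_def y0_def using assms(2) by (simp add: algebra_simps flip: of_nat_mult of_nat_add)
 then have 2: "n * nat x0 + m * nat y0 = s" using nn by (metis (no_types, lifting) nat_0_le of_nat_add of_nat_eq_iff of_nat_mult)
 have 3: "(0 <= int a2 * (int (nat y0) - j * int n) - int b2 * (int (nat x0) + j * int m) \<and>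
   0 <= int b1 * (int (nat x0) + j * int m) - int a1 * (int (nat y0) - j * int n)) \<longleftrightarrow> 0 <= j \<and> j <= int J" for j
 proof -
  have "int (nat y0) - j * int n = int v - (jl + j) * int n" "int (nat x0) + j * int m = int u + (jl + j) * int m"
   using nn by (simp_all add: x0_def y0_def algebra_simps)
  then have "(0 <= int a2 * (int (nat y0) - j * int n) - int b2 * (int (nat x0) + j * int m) \<and>
   0 <= int b1 * (int (nat x0) + j * int m) - int a1 * (int (nat y0) - j * int n)) \<longleftrightarrow> P (jl + j)"
   unfolding P_def by simp
  then show ?thesis unfolding P' J by auto
 qed
 show ?thesis using 1 2 3 by blast
qed

end

section \<open>Exactness for polynomials on one edge\<close>

lemma roots_prod_dvd:
 fixes q :: "'k :: field poly"
 assumes "finite T" "\<And>t. t \<in> T ==> poly q t = 0"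
 shows "(\<Prod>t\<in>T. [:- t, 1:]) dvd q"
 using assms
proof (induction T arbitrary: q rule: finite_induct)
 case (insert t T)
 have "[:- t, 1:] dvd q" using insert(4)[of t] by (simp add: poly_eq_0_iff_dvd)
 then obtain s where s: "q = [:- t, 1:] * s" by (auto elim: dvdE)
 have "poly s u = 0" if "u \<in> T" for u
  using insert(4)[of u] that insert(2) unfolding s by auto
 then have "(\<Prod>t\<in>T. [:- t, 1:]) dvd s" by (rule insert.IH)
 then show ?case unfolding s prod.insert[OF insert(1,2)] by (rule mult_dvd_mono[OF dvd_refl])
qed auto

lemma degree_prod_linear: "finite T ==> degree (\<Prod>t\<in>T. [:- t, 1:] :: 'k :: field poly) = card T"
proof (induction T rule: finite_induct)
 case (insert t T)
 have "(\<Prod>t\<in>T. [:- t, 1:] :: 'k poly) ~= 0" using insert(1) by (simp add: prod_zero_iff)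
 then have "degree ([:- t, 1:] * (\<Prod>t\<in>T. [:- t, 1:])) = degree [:- t, 1:] + degree (\<Prod>t\<in>T. [:- t, 1:])"
  by (intro degree_mult_eq) auto
 with insert show ?case by simp
qed auto

text \<open>With as many distinct roots as its degree, \<open>p\<close> is a constant times a
  product of distinct linear factors, so divisibility can be tested at the roots.\<close>

lemma split_poly_dvd:
 fixes p q :: "'k :: field poly"
 assumes p: "p ~= 0" "card {t. poly p t = 0} = degree p" and q: "\<And>t. poly p t = 0 ==> poly q t = 0"
 shows "p dvd q"
proof -
 let ?T = "{t. poly p t = 0}"
 let ?P = "\<Prod>t\<in>?T. [:- t, 1:]"
 have fin: "finite ?T" using p(1) by (rule poly_roots_finite)
 have "?P dvd p" by (rule roots_prod_dvd[OF fin]) auto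
 then obtain s where s: "p = ?P * s" by (auto elim: dvdE)
 have P0: "?P ~= 0" using fin by (simp add: prod_zero_iff)
 have s0: "s ~= 0" using s p(1) by (metis mult_zero_right)
 have "degree p = degree ?P + degree s" using degree_mult_eq[OF P0 s0] s by metis
 then have "degree s = 0" using degree_prod_linear[OF fin] p(2) by simp
 then obtain k where "s = [:k:]" by (rule degree_eq_zeroE)
 then have "1 = s * [:1 / k:]" using s0 by (simp add: one_pCons)
 have "?P dvd q" using q by (intro roots_prod_dvd fin) auto
 moreover have "p dvd ?P"
 proof -
  have "p * [:1 / k:] = ?P * (s * [:1 / k:])" by (subst s) (rule mult.assoc)
  then have "?P = p * [:1 / k:]" unfolding \<open>1 = s * [:1 / k:]\<close>[symmetric] by simp
  then show ?thesis by (metis dvd_triv_left)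
 qed
 ultimately show ?thesis by (rule dvd_trans[rotated])
qed

text \<open>In terms of psi and t psi' the relation reads Z psi + W t psi' = 0. At a root of psi
  both t and psi' are nonzero, hence psi divides W and Z follows. The passage from (Pa, Pb) to (W,
  Z) is invertible because its determinant n a + m b is nonzero; the degree bound is read off from W
  = psi E0.\<close>

lemma koszul_poly:
 fixes \<psi> Pa Pb :: "'k :: field_char_0 poly" and a b n m :: 'k
 assumes \<psi>: "card {t. poly \<psi> t = 0} = degree \<psi>" "poly \<psi> 0 ~= 0"
  and simple: "\<And>t. poly \<psi> t = 0 ==> poly (pderiv \<psi>) t ~= 0"
  and F: "F = Polynomial.smult a \<psi> + Polynomial.smult m (pCons 0 (pderiv \<psi>))"
  and Gg: "Gg = Polynomial.smult b \<psi> - Polynomial.smult n (pCons 0 (pderiv \<psi>))"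
  and N: "n * a + m * b ~= 0"
  and eq: "Pa * F + Pb * Gg = 0"
 shows "\<exists>E. Pa = E * Gg \<and> Pb = - (E * F) \<and> (E = 0 \<or> degree E + degree \<psi> <= max (degree Pa) (degree Pb))"
proof -
 define W Z D where "W = Polynomial.smult m Pa - Polynomial.smult n Pb" and "Z = Polynomial.smult a Pa + Polynomial.smult b Pb" and "D = pCons 0 (pderiv \<psi>)"
 have \<psi>0: "\<psi> ~= 0" using \<psi>(2) by auto
 have eq': "Z * \<psi> + W * D = 0"
  using eq unfolding F Gg Z_def W_def D_def[symmetric] by (simp add: algebra_simps)
 have "poly W t = 0" if t: "poly \<psi> t = 0" for t
 proof -
  have "t ~= 0" using t \<psi>(2) by auto
  have "poly (Z * \<psi> + W * D) t = 0" unfolding eq' by simp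
  then have "poly W t * (t * poly (pderiv \<psi>) t) = 0" using t by (auto simp: D_def)
  then show ?thesis using simple[OF t] \<open>t ~= 0\<close> by simp
 qed
 then have "\<psi> dvd W" using split_poly_dvd[OF \<psi>0 \<psi>(1)] by blast
 then obtain E0 where W: "W = \<psi> * E0" by (auto elim: dvdE)
 have "\<psi> * (Z + E0 * D) = 0" using eq' unfolding W by (simp add: algebra_simps)
 then have Z: "Z = - (E0 * D)" using \<psi>0 by (simp add: eq_neg_iff_add_eq_0)
 define E where "E = Polynomial.smult (1 / (n * a + m * b)) E0"
 have "Polynomial.smult (n * a + m * b) Pa = Polynomial.smult b W + Polynomial.smult n Z"
  unfolding W_def Z_def by (simp add: algebra_simps smult_add_left smult_add_right smult_diff_right)
 also have "\<dots> = E0 * Gg" unfolding W Z Gg D_def[symmetric] by (simp add: algebra_simps)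
 finally have "Polynomial.smult (1 / (n * a + m * b)) (Polynomial.smult (n * a + m * b) Pa) = E * Gg" unfolding E_def by simp
 then have 1: "Pa = E * Gg" using N by simp
 have "Polynomial.smult (n * a + m * b) Pb = Polynomial.smult m Z - Polynomial.smult a W"
  unfolding W_def Z_def by (simp add: algebra_simps smult_add_left smult_add_right smult_diff_right)
 also have "\<dots> = - (E0 * F)" unfolding W Z F D_def[symmetric] by (simp add: algebra_simps)
 finally have "Polynomial.smult (1 / (n * a + m * b)) (Polynomial.smult (n * a + m * b) Pb) = - (E * F)" unfolding E_def by simp
 then have 2: "Pb = - (E * F)" using N by simp
 have 3: "degree E + degree \<psi> <= max (degree Pa) (degree Pb)" if "E ~= 0"
 proof -
  have "E0 ~= 0" using that by (auto simp: E_def)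
  then have "degree W = degree \<psi> + degree E0" unfolding W using \<psi>0 by (simp add: degree_mult_eq)
  moreover have "degree E = degree E0" using N by (simp add: E_def)
  moreover have "degree W <= max (degree Pa) (degree Pb)"
   unfolding W_def by (rule order_trans[OF degree_diff_le_max]) (meson degree_smult_le max.mono)
  ultimately show ?thesis by simp
 qed
 show ?thesis using 1 2 3 by blast
qed

lemma coeff_mult_top:
 fixes p q :: "'k :: comm_semiring_0 poly"
 assumes "\<And>l. i < l ==> Polynomial.coeff p l = 0" "\<And>l. j < l ==> Polynomial.coeff q l = 0"
 shows "Polynomial.coeff (p * q) (i + j) = Polynomial.coeff p i * Polynomial.coeff q j"
proof -
 have "Polynomial.coeff (p * q) (i + j) = (\<Sum>l\<le>i + j. if l = i then Polynomial.coeff p i * Polynomial.coeff q j else 0)"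
  unfolding coeff_mult
 proof (intro sum.cong refl)
  fix l assume "l \<in> {..i + j}"
  then show "Polynomial.coeff p l * Polynomial.coeff q (i + j - l) = (if l = i then Polynomial.coeff p i * Polynomial.coeff q j else 0)"
   using assms(1)[of l] assms(2)[of "i + j - l"] by (cases "l = i"; cases "i < l") auto
 qed
 then show ?thesis by simp
qed

section \<open>The weight filtration\<close>

context newton_polygon
begin

text \<open>A common multiple of all edge degrees: scaled by the integers \<open>W e\<close>, all
  edges lie at the same level.\<close>

definition L :: nat where "L = (\<Prod>e\<in>newton_edges c. edge_N e)"
definition W :: "edge => nat" where "W e = L div edge_N e"
text \<open>The Newton filtration: a concave piecewise linear function, linear on the cone of each
  edge and equal to \<open>L\<close> along the Newton polygon.\<close>

definition H :: "nat => nat => nat" where "H x y = Min ((%e. W e * edge_wt e x y) ` newton_edges c)"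

lemma edge_locale:
 assumes "e \<in> newton_edges c"
 obtains a1 b1 a2 b2 where "newton_edge_locale c a1 b1 a2 b2 (edge_r e) (edge_n e) (edge_m e) (edge_N e) e"
 using assms unfolding newton_edges_def newton_edge_locale_def by blast

lemma edge_N_pos: "e \<in> newton_edges c ==> 0 < edge_N e"
 by (erule edge_locale) (rule newton_edge_locale.N_pos)

lemma edge_nm_pos: "e \<in> newton_edges c ==> 0 < edge_n e \<and> 0 < edge_m e"
 by (erule edge_locale) (blast dest: newton_edge_locale.pos)

lemma edges_nonempty: "newton_edges c ~= {}"
 using first_edge by (metis empty_iff mem_newton_edges)

lemma W_N: "e \<in> newton_edges c ==> W e * edge_N e = L"
 unfolding W_def L_def by (simp add: dvd_prodI finite_newton_edges)

lemma L_pos: "0 < L"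
 unfolding L_def using edge_N_pos by (simp add: prod_pos)

lemma W_pos: "e \<in> newton_edges c ==> 0 < W e"
 using W_N L_pos by (metis mult_is_0 neq0_conv)

lemma H_le: "e \<in> newton_edges c ==> H x y <= W e * edge_wt e x y"
 unfolding H_def using finite_newton_edges by simp

lemma H_geI: "(\<And>e. e \<in> newton_edges c ==> d <= W e * edge_wt e x y) ==> d <= H x y"
 unfolding H_def using finite_newton_edges edges_nonempty by simp

lemma edge_wt_add: "edge_wt e (x + x') (y + y') = edge_wt e x y + edge_wt e x' y'"
 by (simp add: edge_wt_def algebra_simps)

lemma H_add: "H x y + H x' y' <= H (x + x') (y + y')"
 by (rule H_geI) (metis H_le add_mono distrib_left edge_wt_add)

lemma H_support: "c x y ~= 0 ==> L <= H x y"
proof (rule H_geI)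
 fix e assume c: "c x y ~= 0" and e: "e \<in> newton_edges c"
 from e obtain a1 b1 a2 b2 where "newton_edge_locale c a1 b1 a2 b2 (edge_r e) (edge_n e) (edge_m e) (edge_N e) e"
  by (rule edge_locale)
 from newton_edge_locale.support_ge[OF this c] have "edge_N e <= edge_wt e x y" by (simp add: edge_wt_def)
 then show "L <= W e * edge_wt e x y" unfolding W_N[OF e, symmetric] by (rule mult_le_mono2)
qed

lemma H_ge_degree: "x + y <= H x y"
proof (rule H_geI)
 fix e assume e: "e \<in> newton_edges c"
 have "x + y <= edge_wt e x y" unfolding edge_wt_def using edge_nm_pos[OF e] by (intro add_mono) auto
 also have "\<dots> <= W e * edge_wt e x y" using W_pos[OF e] by simp
 finally show "x + y <= W e * edge_wt e x y" .
qed

lemma finite_H_less: "finite {(x, y). H x y < D}"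
proof (rule finite_subset)
 show "{(x, y). H x y < D} \<subseteq> {..D} \<times> {..D}"
 proof clarify
  fix x y assume "H x y < D"
  with H_ge_degree[of x y] show "x \<in> {..D} \<and> y \<in> {..D}" by simp
 qed
qed simp

lemma cone_exists: "\<exists>e\<in>newton_edges c. edge_cone e x y"
proof (cases "x = 0")
 case True
 obtain a2 b2 where "newton_edge c 0 (y_intercept c) a2 b2" using first_edge by blast
 then show ?thesis using True by (intro bexI[of _ "((0, y_intercept c), (a2, b2))"]) (auto simp: edge_cone_def)
next
 case False
 then obtain a1 b1 a2 b2 where "newton_edge c a1 b1 a2 b2" "a1 * y < b1 * x" "b2 * x <= a2 * y"
  using half_open_cone_exists[of x y] by blast
 then show ?thesis by (intro bexI[of _ "((a1, b1), (a2, b2))"]) (auto simp: edge_cone_def)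
qed

text \<open>In the coordinates given by the endpoints of \<open>e\<close>, both endpoints have
  scaled weight exactly \<open>L\<close> for \<open>e\<close> and, being support points, at least
  \<open>L\<close> for any other edge. Nonnegative coordinates carry the comparison over to the
  point.\<close>

lemma H_cone:
 assumes e: "e \<in> newton_edges c" and cone: "edge_cone e x y"
 shows "H x y = W e * edge_wt e x y"
proof (rule antisym[OF H_le[OF e]], rule H_geI)
 fix k assume k: "k \<in> newton_edges c"
 from e obtain a1 b1 a2 b2 where "newton_edge_locale c a1 b1 a2 b2 (edge_r e) (edge_n e) (edge_m e) (edge_N e) e"
  by (rule edge_locale)
 then interpret e: newton_edge_locale c a1 b1 a2 b2 "edge_r e" "edge_n e" "edge_m e" "edge_N e" e .
 from k obtain a1' b1' a2' b2' where "newton_edge_locale c a1' b1' a2' b2' (edge_r k) (edge_n k) (edge_m k) (edge_N k) k"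
  by (rule edge_locale)
 then interpret k: newton_edge_locale c a1' b1' a2' b2' "edge_r k" "edge_n k" "edge_m k" "edge_N k" k .
 define s t where "s = int a2 * int y - int b2 * int x" and "t = int b1 * int x - int a1 * int y"
 have st: "0 <= s" "0 <= t" using cone unfolding e.cone_int s_def t_def by auto
 have D: "int x * (int (edge_r e) * int (edge_N e)) = s * int a1 + t * int a2"
   "int y * (int (edge_r e) * int (edge_N e)) = s * int b1 + t * int b2"
  unfolding s_def t_def by (rule e.cone_decomp)+
 let ?D = "int (edge_r e) * int (edge_N e)"
 have wt: "int (edge_wt l x y) * ?D = s * int (edge_wt l a1 b1) + t * int (edge_wt l a2 b2)" for l
 proof -
  have "int (edge_wt l x y) * ?D = int (edge_n l) * (int x * ?D) + int (edge_m l) * (int y * ?D)"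
   by (simp add: edge_wt_def algebra_simps)
  also have "\<dots> = s * int (edge_wt l a1 b1) + t * int (edge_wt l a2 b2)"
   unfolding D by (simp add: edge_wt_def algebra_simps)
  finally show ?thesis .
 qed
 have ce: "c a1 b1 ~= 0" "c a2 b2 ~= 0" using newton_edge_basic[OF e.edge] by auto
 have "edge_N k <= edge_wt k a1 b1" "edge_N k <= edge_wt k a2 b2"
  unfolding k.wt by (rule k.support_ge[OF ce(1)], rule k.support_ge[OF ce(2)])
 then have kk: "L <= W k * edge_wt k a1 b1" "L <= W k * edge_wt k a2 b2"
  unfolding W_N[OF k, symmetric] by (simp_all only: mult_le_mono2)
 have ee: "edge_wt e a1 b1 = edge_N e" "edge_wt e a2 b2 = edge_N e"
  unfolding e.wt using e.N by auto
 have "int (W e * edge_wt e x y) * ?D = int (W e) * (int (edge_wt e x y) * ?D)" by (simp add: mult_ac)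
 also have "\<dots> = s * int (W e * edge_N e) + t * int (W e * edge_N e)"
  unfolding wt ee by (simp add: algebra_simps)
 also have "\<dots> <= s * int (W k * edge_wt k a1 b1) + t * int (W k * edge_wt k a2 b2)"
  unfolding W_N[OF e] using st kk by (intro add_mono mult_left_mono) (simp_all only: of_nat_le_iff)
 also have "\<dots> = int (W k) * (int (edge_wt k x y) * ?D)" unfolding wt by (simp add: algebra_simps)
 also have "\<dots> = int (W k * edge_wt k x y) * ?D" by (simp add: mult_ac)
 finally have le: "int (W e * edge_wt e x y) * ?D <= int (W k * edge_wt k x y) * ?D" .
 have "0 < ?D" using e.pos e.N_pos by simp
 then have "int (W e * edge_wt e x y) <= int (W k * edge_wt k x y)" using le by (simp only: mult_le_cancel_right_pos)
 then show "W e * edge_wt e x y <= W k * edge_wt k x y" by (simp only: of_nat_le_iff)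
qed

text \<open>Expand the point in the cone of some edge \<open>k\<close> that contains it. Equality of
  the weights forces every endpoint of \<open>k\<close> with nonzero coordinate to have level
  \<open>L\<close> for \<open>e\<close>; as a support point it then lies on \<open>e\<close>, and
  the cone of \<open>e\<close> is convex.\<close>

lemma cone_if_H:
 assumes e: "e \<in> newton_edges c" and H: "H x y = W e * edge_wt e x y"
 shows "edge_cone e x y"
proof -
 obtain k where k: "k \<in> newton_edges c" "edge_cone k x y" using cone_exists by blast
 from e obtain a1 b1 a2 b2 where "newton_edge_locale c a1 b1 a2 b2 (edge_r e) (edge_n e) (edge_m e) (edge_N e) e"
  by (rule edge_locale)
 then interpret e: newton_edge_locale c a1 b1 a2 b2 "edge_r e" "edge_n e" "edge_m e" "edge_N e" e .
 from k(1) obtain a1' b1' a2' b2' where "newton_edge_locale c a1' b1' a2' b2' (edge_r k) (edge_n k) (edge_m k) (edge_N k) k"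
  by (rule edge_locale)
 then interpret k: newton_edge_locale c a1' b1' a2' b2' "edge_r k" "edge_n k" "edge_m k" "edge_N k" k .
 define s t where "s = int a2' * int y - int b2' * int x" and "t = int b1' * int x - int a1' * int y"
 have st: "0 <= s" "0 <= t" using k(2) unfolding k.cone_int s_def t_def by auto
 let ?D = "int (edge_r k) * int (edge_N k)"
 have D: "int x * ?D = s * int a1' + t * int a2'" "int y * ?D = s * int b1' + t * int b2'"
  unfolding s_def t_def by (rule k.cone_decomp)+
 have Dpos: "0 < ?D" using k.pos k.N_pos by simp
 have wt: "int (edge_wt l x y) * ?D = s * int (edge_wt l a1' b1') + t * int (edge_wt l a2' b2')" for l
 proof -
  have "int (edge_wt l x y) * ?D = int (edge_n l) * (int x * ?D) + int (edge_m l) * (int y * ?D)"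
   by (simp add: edge_wt_def algebra_simps)
  also have "\<dots> = s * int (edge_wt l a1' b1') + t * int (edge_wt l a2' b2')"
   unfolding D by (simp add: edge_wt_def algebra_simps)
  finally show ?thesis .
 qed
 have ck: "c a1' b1' ~= 0" "c a2' b2' ~= 0" using newton_edge_basic[OF k.edge] by auto
 have "edge_wt k a1' b1' = edge_N k" "edge_wt k a2' b2' = edge_N k"
  unfolding k.wt using k.N by auto
 then have "int (W k) * (int (edge_wt k x y) * ?D) = s * int (W k * edge_N k) + t * int (W k * edge_N k)"
  unfolding wt by (simp add: algebra_simps)
 then have 1: "int (W k) * (int (edge_wt k x y) * ?D) = s * int L + t * int L" unfolding W_N[OF k(1)] .
 have 2: "int (W e) * (int (edge_wt e x y) * ?D) = s * int (W e * edge_wt e a1' b1') + t * int (W e * edge_wt e a2' b2')"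
  unfolding wt by (simp add: algebra_simps)
 have "int (W e) * (int (edge_wt e x y) * ?D) = int (W e * edge_wt e x y) * ?D"
   "int (W k) * (int (edge_wt k x y) * ?D) = int (W k * edge_wt k x y) * ?D" by (simp_all add: mult_ac)
 moreover have "W e * edge_wt e x y = W k * edge_wt k x y" using H H_cone[OF k] by simp
 ultimately have 3: "s * int (W e * edge_wt e a1' b1') + t * int (W e * edge_wt e a2' b2') = s * int L + t * int L"
  using 1 2 by metis
 have g: "edge_N e <= edge_wt e a1' b1'" "edge_N e <= edge_wt e a2' b2'"
  unfolding e.wt by (rule e.support_ge[OF ck(1)], rule e.support_ge[OF ck(2)])
 then have "L <= W e * edge_wt e a1' b1'" "L <= W e * edge_wt e a2' b2'"
  unfolding W_N[OF e, symmetric] by (simp_all only: mult_le_mono2)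
 then have "0 <= s * (int (W e * edge_wt e a1' b1') - int L)" "0 <= t * (int (W e * edge_wt e a2' b2') - int L)"
  using st by (simp_all only: zero_le_mult_iff diff_ge_0_iff_ge of_nat_le_iff) auto
 moreover have "s * (int (W e * edge_wt e a1' b1') - int L) + t * (int (W e * edge_wt e a2' b2') - int L) = 0"
  using 3 by (simp add: algebra_simps)
 ultimately have z: "s * (int (W e * edge_wt e a1' b1') - int L) = 0" "t * (int (W e * edge_wt e a2' b2') - int L) = 0"
  by linarith+
 have on: "edge_cone e u v" if "W e * edge_wt e u v = L" "c u v ~= 0" for u v
 proof -
  have "edge_wt e u v = edge_N e" using that(1) W_N[OF e] W_pos[OF e] by (metis mult_left_cancel neq0_conv)
  then have "edge_n e * u + edge_m e * v = edge_N e" unfolding e.wt .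
  from e.support_eq[OF that(2) this] show ?thesis using e.point_in_cone by blast
 qed
 have c1: "s = 0 \<or> edge_cone e a1' b1'" and c2: "t = 0 \<or> edge_cone e a2' b2'"
  using z on ck by (simp_all only: mult_eq_0_iff right_minus_eq of_nat_eq_iff) blast+
 have s1: "0 <= s * (int a2 * int b1' - int b2 * int a1')" "0 <= s * (int b1 * int a1' - int a1 * int b1')"
  using c1 st unfolding e.cone_int by auto
 have t1: "0 <= t * (int a2 * int b2' - int b2 * int a2')" "0 <= t * (int b1 * int a2' - int a1 * int b2')"
  using c2 st unfolding e.cone_int by auto
 have "(int a2 * int y - int b2 * int x) * ?D = int a2 * (int y * ?D) - int b2 * (int x * ?D)" by (simp add: algebra_simps)
 also have "\<dots> = s * (int a2 * int b1' - int b2 * int a1') + t * (int a2 * int b2' - int b2 * int a2')"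
  unfolding D by (simp add: algebra_simps)
 finally have "0 <= (int a2 * int y - int b2 * int x) * ?D" using s1 t1 by linarith
 then have 4: "0 <= int a2 * int y - int b2 * int x" using Dpos by (simp only: zero_le_mult_iff) linarith
 have "(int b1 * int x - int a1 * int y) * ?D = int b1 * (int x * ?D) - int a1 * (int y * ?D)" by (simp add: algebra_simps)
 also have "\<dots> = s * (int b1 * int a1' - int a1 * int b1') + t * (int b1 * int a2' - int a1 * int b2')"
  unfolding D by (simp add: algebra_simps)
 finally have "0 <= (int b1 * int x - int a1 * int y) * ?D" using s1 t1 by linarith
 then have 5: "0 <= int b1 * int x - int a1 * int y" using Dpos by (simp only: zero_le_mult_iff) linarith
 show ?thesis unfolding e.cone_int using 4 5 by blast
qed

end

section \<open>Substitution of power series and analytic expansions\<close>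

text \<open>Extension by zero to negative exponents frees convolutions along a weight line from side
  conditions on signs.\<close>

definition ext_coeff :: "'k::zero fps fps => int => int => 'k" where
 "ext_coeff p x y = (if 0 <= x \<and> 0 <= y then cf p (nat x) (nat y) else 0)"

text \<open>The form phi of the edge with Y set to 1; its variable stands for the ratio x^m /
  y^n.\<close>

definition edge_poly :: "(nat => nat => 'k :: comm_ring_1) => edge => 'k poly" where
 "edge_poly c e = (\<Sum>i\<le>edge_r e. Polynomial.monom (c (fst (fst e) + i * edge_m e) (snd (fst e) - i * edge_n e)) i)"

text \<open>Composition with two series meant to have no constant term: the monomial with exponents
  \<alpha> and \<beta> then has order at least \<alpha> + \<beta>, so the cut-off loses
  nothing.\<close>

definition subst2 :: "(nat => nat => 'k) => 'k::comm_ring_1 fps => 'k fps => 'k fps" where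
 "subst2 c X Y = Abs_fps (%k. \<Sum>(\<alpha>,\<beta>)\<in>{(\<alpha>,\<beta>). \<alpha> + \<beta> <= k}. c \<alpha> \<beta> * fps_nth (X ^ \<alpha> * Y ^ \<beta>) k)"

lemma finite_degree_le: "finite {(\<alpha>::nat, \<beta>::nat). \<alpha> + \<beta> <= k}"
 by (rule finite_subset[of _ "{..k} \<times> {..k}"]) auto

lemma fps_dvd_nth_zero:
 fixes X :: "'k::comm_ring_1 fps"
 assumes "fps_nth X 0 = 0" "fps_nth Y 0 = 0" "k < \<alpha> + \<beta>"
 shows "fps_nth (X ^ \<alpha> * Y ^ \<beta>) k = 0"
proof -
 obtain X' where X: "X = fps_X * X'"
  using assms(1) by (intro that[of "fps_shift 1 X"]) (auto simp: fps_eq_iff fps_X_mult_nth)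
 obtain Y' where Y: "Y = fps_X * Y'"
  using assms(2) by (intro that[of "fps_shift 1 Y"]) (auto simp: fps_eq_iff fps_X_mult_nth)
 have "X ^ \<alpha> * Y ^ \<beta> = fps_X ^ (\<alpha> + \<beta>) * (X' ^ \<alpha> * Y' ^ \<beta>)"
  unfolding X Y by (simp add: power_mult_distrib power_add mult_ac)
 then show ?thesis using assms(3) by (simp add: fps_X_power_mult_nth)
qed

lemma subst2_nth:
 assumes "fps_nth X 0 = 0" "fps_nth Y 0 = 0" "finite S" "{(\<alpha>, \<beta>). \<alpha> + \<beta> <= k} \<subseteq> S"
 shows "fps_nth (subst2 c X Y) k = (\<Sum>(\<alpha>,\<beta>)\<in>S. c \<alpha> \<beta> * fps_nth (X ^ \<alpha> * Y ^ \<beta>) k)"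
proof -
 have "(\<Sum>(\<alpha>,\<beta>)\<in>S. c \<alpha> \<beta> * fps_nth (X ^ \<alpha> * Y ^ \<beta>) k) = (\<Sum>(\<alpha>,\<beta>)\<in>{(\<alpha>,\<beta>). \<alpha> + \<beta> <= k}. c \<alpha> \<beta> * fps_nth (X ^ \<alpha> * Y ^ \<beta>) k)"
 proof (rule sum.mono_neutral_right[OF assms(3,4)], intro ballI)
  fix v assume v: "v \<in> S - {(\<alpha>, \<beta>). \<alpha> + \<beta> <= k}"
  obtain \<alpha> \<beta> where "v = (\<alpha>, \<beta>)" by (cases v)
  with v show "(case v of (\<alpha>, \<beta>) => c \<alpha> \<beta> * fps_nth (X ^ \<alpha> * Y ^ \<beta>) k) = 0"
   by (simp add: fps_dvd_nth_zero[OF assms(1,2)])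
 qed
 then show ?thesis by (simp add: subst2_def)
qed

text \<open>Unordered summability at the single point (\<rho>, \<rho>) already bounds all terms;
  half of that radius turns the bound into a product of geometric series.\<close>

lemma has_power_series_imp_convergent:
 fixes c :: "nat => nat => 'k :: {real_normed_field, euclidean_space}"
 assumes "has_power_series_at_0 G c"
 shows "convergent_series (series_of c)"
proof -
 obtain d where d: "d > 0" "\<And>z. dist z (0, 0) < d ==> ((%(\<alpha>, \<beta>). c \<alpha> \<beta> * fst z ^ \<alpha> * snd z ^ \<beta>) has_sum G z) UNIV"
  using assms unfolding has_power_series_at_0_def eventually_nhds_metric by blast
 define \<rho> where "\<rho> = d / 4"
 define z :: "'k \<times> 'k" where "z = (of_real \<rho>, of_real \<rho>)"
 define h where "h = (%(\<alpha>, \<beta>). c \<alpha> \<beta> * fst z ^ \<alpha> * snd z ^ \<beta>)"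
 have "dist z (0, 0) <= dist (fst z) 0 + dist (snd z) 0"
  unfolding z_def dist_Pair_Pair fst_conv snd_conv by (rule sqrt_sum_squares_le_sum) auto
 also have "\<dots> < d" using d(1) by (simp add: z_def \<rho>_def)
 finally have "(h has_sum G z) UNIV" unfolding h_def by (rule d(2))
 then have "eventually (%S. dist (sum h S) (G z) < 1) (finite_subsets_at_top UNIV)"
  unfolding has_sum_def by (rule tendstoD) simp
 then obtain F0 where F0: "finite F0" "\<And>S. finite S ==> F0 \<subseteq> S ==> dist (sum h S) (G z) < 1"
  unfolding eventually_finite_subsets_at_top by auto
 \<comment> \<open>A term outside \<open>F0\<close> is the difference of two partial sums within
   distance 1 of the limit, hence at most 2 in norm.\<close>
 define B where "B = 2 + (\<Sum>x\<in>F0. norm (h x))"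
 have B: "norm (h x) <= B" for x
 proof (cases "x \<in> F0")
  case True
  then have "norm (h x) <= (\<Sum>x\<in>F0. norm (h x))" using F0(1) by (intro member_le_sum) auto
  then show ?thesis by (simp add: B_def)
 next
  case False
  have "h x = sum h (insert x F0) - sum h F0" using False F0(1) by simp
  also have "norm \<dots> <= dist (sum h (insert x F0)) (G z) + dist (sum h F0) (G z)"
   unfolding dist_norm by (metis norm_triangle_ineq4 diff_diff_eq2 diff_add_cancel diff_add_eq_diff_diff_swap diff_diff_add add_diff_cancel_right)
  also have "\<dots> <= 2"
  proof -
   have "dist (sum h (insert x F0)) (G z) < 1" "dist (sum h F0) (G z) < 1" using F0(1) by (blast intro: F0(2))+
   then show ?thesis by linarith
  qed
  also have "\<dots> <= B" by (simp add: B_def sum_nonneg)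
  finally show ?thesis .
 qed
 have B0: "0 <= B" using B[of "(0,0)"] norm_ge_zero order_trans by blast
 have \<rho>: "\<rho> > 0" using d(1) by (simp add: \<rho>_def)
 have cb: "norm (c a b) * \<rho> ^ (a + b) <= B" for a b
  using B[of "(a, b)"] \<rho> by (simp add: h_def z_def norm_mult norm_power power_add mult.assoc)
 have "nrm (\<rho> / 2) K (series_of c) <= B * (2 * 2)" for K
 proof -
  have "nrm (\<rho> / 2) K (series_of c) <= (\<Sum>(a, b)\<in>{..K}\<times>{..K}. B * ((1 / 2) ^ a * (1 / 2) ^ b))"
   unfolding nrm_eq
  proof (intro sum_mono, clarify)
   fix a b
   have "norm (cf (series_of c) a b) * (\<rho> / 2) ^ (a + b) = (norm (c a b) * \<rho> ^ (a + b)) * ((1 / 2) ^ a * (1 / 2) ^ b)"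
    by (simp add: series_of_def power_add power_divide)
   also have "\<dots> <= B * ((1 / 2) ^ a * (1 / 2) ^ b)" by (intro mult_right_mono cb) auto
   finally show "norm (cf (series_of c) a b) * (\<rho> / 2) ^ (a + b) <= B * ((1 / 2) ^ a * (1 / 2) ^ b)" .
  qed
  also have "\<dots> = B * ((\<Sum>a\<le>K. (1 / 2) ^ a) * (\<Sum>b\<le>K. (1 / 2) ^ b))"
  proof -
   have "(\<Sum>a\<le>K. (1 / 2 :: real) ^ a) * (\<Sum>b\<le>K. (1 / 2) ^ b) = (\<Sum>(a, b)\<in>{..K}\<times>{..K}. (1 / 2) ^ a * (1 / 2) ^ b)"
    by (simp only: sum_product sum.cartesian_product)
   then show ?thesis by (simp only:) (simp add: sum_distrib_left case_prod_beta)
  qed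
  also have "\<dots> <= B * (2 * 2)"
  proof -
   have "(\<Sum>a\<le>K. (1 / 2 :: real) ^ a) <= 2"
    using sum_le_suminf[of "%a. (1 / 2 :: real) ^ a" "{..K}"] suminf_geometric[of "1 / 2 :: real"] by (simp add: summable_geometric)
   then show ?thesis using B0 by (intro mult_left_mono mult_mono) (auto intro!: sum_nonneg)
  qed
  finally show ?thesis .
 qed
 then show ?thesis using \<rho> by (intro convergent_seriesI[of "\<rho> / 2"]) auto
qed

lemma fps_small_norm:
 fixes X :: "'k :: {real_normed_field, banach} fps"
 assumes "fps_conv_radius X > 0" "fps_nth X 0 = 0" "\<rho> > 0"
 shows "\<exists>t>0. ereal t < fps_conv_radius X \<and> (\<forall>t' K. 0 <= t' --> t' <= t --> fps_nrm t' K X <= \<rho>)"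
proof -
 obtain s where s: "0 < s" "ereal s < fps_conv_radius X"
  using assms(1) by (metis ereal_dense2 ereal_less(2) less_ereal.simps(1))
 have "summable (%n. norm (fps_nth X n * of_real s ^ n))" using s by (intro norm_summable_fps) auto
 then have sm: "summable (%n. norm (fps_nth X n) * s ^ n)" using s by (simp add: norm_mult norm_power)
 define B where "B = (\<Sum>n. norm (fps_nth X n) * s ^ n) + 1"
 have B: "fps_nrm s K X <= B" for K
  unfolding fps_nrm_def B_def using sum_le_suminf[OF sm, of "{..K}"] s by (simp add: add_increasing2)
 have B1: "B > 0" unfolding B_def using suminf_nonneg[OF sm] s by (simp add: add_nonneg_pos)
 define \<theta> where "\<theta> = min 1 (\<rho> / B)"
 have \<theta>: "0 < \<theta>" "\<theta> <= 1" "\<theta> * B <= \<rho>" using B1 assms(3) by (auto simp: \<theta>_def min_def field_simps)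
 have "fps_nrm t' K X <= \<rho>" if t': "0 <= t'" "t' <= \<theta> * s" for t' K
 proof -
  have "fps_nrm t' K X <= \<theta> * fps_nrm s K X"
   unfolding fps_nrm_def sum_distrib_left
  proof (intro sum_mono)
   fix k
   show "norm (fps_nth X k) * t' ^ k <= \<theta> * (norm (fps_nth X k) * s ^ k)"
   proof (cases k)
    case (Suc l)
    have "t' ^ k <= (\<theta> * s) ^ k" using t' by (intro power_mono) auto
    also have "\<dots> = \<theta> ^ k * s ^ k" by (rule power_mult_distrib)
    also have "\<dots> <= \<theta> * s ^ k"
    proof -
     have "\<theta> ^ k <= \<theta> ^ 1" unfolding Suc using \<theta> by (intro power_decreasing) auto
     then show ?thesis using s by (intro mult_right_mono) auto
    qed
    finally have "norm (fps_nth X k) * t' ^ k <= norm (fps_nth X k) * (\<theta> * s ^ k)" by (intro mult_left_mono) auto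
    then show ?thesis by (simp only: mult_ac)
   qed (simp add: assms(2))
  qed
  also have "\<dots> <= \<theta> * B" using B \<theta> by (intro mult_left_mono) auto
  finally show ?thesis using \<theta> by linarith
 qed
 moreover have "ereal (\<theta> * s) < fps_conv_radius X"
 proof -
  have "\<theta> * s <= s" using \<theta> s by (simp add: mult_le_cancel_right1)
  then show ?thesis using s(2) by (metis ereal_less_eq(3) le_less_trans)
 qed
 ultimately show ?thesis using \<theta> s by (intro exI[of _ "\<theta> * s"]) auto
qed

lemma eval_fps_norm_le:
 fixes X :: "'k :: {real_normed_field, banach} fps"
 assumes "ereal (norm u) < fps_conv_radius X" "\<And>K. fps_nrm (norm u) K X <= \<rho>"
 shows "norm (eval_fps X u) <= \<rho>"
proof -
 have sm: "summable (%n. norm (fps_nth X n * u ^ n))" using assms(1) by (rule norm_summable_fps)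
 have "norm (eval_fps X u) <= (\<Sum>n. norm (fps_nth X n * u ^ n))"
  unfolding eval_fps_def by (rule summable_norm[OF sm])
 also have "\<dots> <= \<rho>"
 proof (rule suminf_le_const[OF sm])
  fix n
  have "(\<Sum>i<n. norm (fps_nth X i * u ^ i)) <= fps_nrm (norm u) n X"
   unfolding fps_nrm_def by (rule order_trans[OF _ sum_mono2[of "{..n}" "{..<n}"]]) (auto simp: norm_mult norm_power)
  also have "\<dots> <= \<rho>" by (rule assms(2))
  finally show "(\<Sum>i<n. norm (fps_nth X i * u ^ i)) <= \<rho>" .
 qed
 finally show ?thesis .
qed

text \<open>The family over exponents and degree is absolutely summable by the majorant norms.
  Summing over the degree first gives G at the curve point, summing over the exponents first gives
  the coefficients of the composite.\<close>

lemma has_fps_expansion_subst2: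
 fixes G :: "'k :: {real_normed_field, euclidean_space} \<times> 'k => 'k"
 assumes G: "has_power_series_at_0 G c"
  and X: "fps_conv_radius X > 0" "fps_nth X 0 = 0" and Y: "fps_conv_radius Y > 0" "fps_nth Y 0 = 0"
 shows "(%\<epsilon>. G (curve_at (X, Y) \<epsilon>)) has_fps_expansion subst2 c X Y"
proof (rule has_fps_expansionI)
 obtain d where d: "d > 0" "\<And>z. dist z (0, 0) < d ==> ((%(\<alpha>, \<beta>). c \<alpha> \<beta> * fst z ^ \<alpha> * snd z ^ \<beta>) has_sum G z) UNIV"
  using G unfolding has_power_series_at_0_def eventually_nhds_metric by blast
 obtain \<rho>0 B where \<rho>0: "\<rho>0 > 0" "\<And>K. nrm \<rho>0 K (series_of c) <= B"
  using has_power_series_imp_convergent[OF G] unfolding convergent_series_iff by blast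
 define \<rho> where "\<rho> = min \<rho>0 (d / 3)"
 have \<rho>: "\<rho> > 0" "\<rho> + \<rho> < d" "\<And>K. nrm \<rho> K (series_of c) <= B"
  using \<rho>0 d order_trans[OF nrm_mono_radius[of \<rho> \<rho>0] \<rho>0(2)] by (auto simp: \<rho>_def)
 obtain tx where tx: "tx > 0" "ereal tx < fps_conv_radius X" "\<And>t' K. 0 <= t' ==> t' <= tx ==> fps_nrm t' K X <= \<rho>"
  using fps_small_norm[OF X \<rho>(1)] by blast
 obtain ty where ty: "ty > 0" "ereal ty < fps_conv_radius Y" "\<And>t' K. 0 <= t' ==> t' <= ty ==> fps_nrm t' K Y <= \<rho>"
  using fps_small_norm[OF Y \<rho>(1)] by blast
 define t where "t = min tx ty"
 have "(%k. fps_nth (subst2 c X Y) k * u ^ k) sums G (curve_at (X, Y) u)" if u: "norm u < t" for u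
 proof -
  have ut: "norm u <= tx" "norm u <= ty" using u by (auto simp: t_def)
  have ur: "ereal (norm u) < fps_conv_radius X" "ereal (norm u) < fps_conv_radius Y"
   using ut tx(2) ty(2) by (meson ereal_less_eq(3) le_less_trans)+
  define x y where "x = eval_fps X u" and "y = eval_fps Y u"
  have xy: "norm x <= \<rho>" "norm y <= \<rho>"
   unfolding x_def y_def using ur ut tx(3) ty(3) by (auto intro!: eval_fps_norm_le)
  define a where "a = (%((\<alpha>, \<beta>), k). c \<alpha> \<beta> * fps_nth (X ^ \<alpha> * Y ^ \<beta>) k * u ^ k)"
  have pow: "fps_nrm (norm u) K (X ^ \<alpha> * Y ^ \<beta>) <= \<rho> ^ (\<alpha> + \<beta>)" for K \<alpha> \<beta>
  proof -
   have "fps_nrm (norm u) K (X ^ \<alpha> * Y ^ \<beta>) <= fps_nrm (norm u) K (X ^ \<alpha>) * fps_nrm (norm u) K (Y ^ \<beta>)"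
    by (rule fps_nrm_mult) simp
   also have "\<dots> <= fps_nrm (norm u) K X ^ \<alpha> * fps_nrm (norm u) K Y ^ \<beta>"
    by (intro mult_mono fps_nrm_power fps_nrm_nonneg zero_le_power) auto
   also have "\<dots> <= \<rho> ^ \<alpha> * \<rho> ^ \<beta>"
    using \<rho>(1) by (intro mult_mono power_mono tx(3) ty(3) fps_nrm_nonneg ut zero_le_power) auto
   finally show ?thesis by (simp add: power_add)
  qed
  have "(%v. norm (a v)) summable_on UNIV"
  proof (intro nonneg_bdd_above_summable_on bdd_aboveI)
   fix s assume "s \<in> sum (%v. norm (a v)) ` {F. F \<subseteq> UNIV \<and> finite F}"
   then obtain F where F: "finite F" "s = (\<Sum>v\<in>F. norm (a v))" by auto
   define K where "K = Max (insert 0 ((fst \<circ> fst) ` F \<union> (snd \<circ> fst) ` F \<union> snd ` F))"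
   have K: "F \<subseteq> ({..K} \<times> {..K}) \<times> {..K}"
   proof
    fix v assume "v \<in> F"
    then have "fst (fst v) <= K" "snd (fst v) <= K" "snd v <= K" unfolding K_def using F(1) by (auto intro!: Max_ge)
    then show "v \<in> ({..K} \<times> {..K}) \<times> {..K}" by (cases v) auto
   qed
   have "s <= (\<Sum>v\<in>({..K} \<times> {..K}) \<times> {..K}. norm (a v))" unfolding F(2) using K by (intro sum_mono2) auto
   also have "\<dots> = (\<Sum>(\<alpha>, \<beta>)\<in>{..K} \<times> {..K}. norm (c \<alpha> \<beta>) * fps_nrm (norm u) K (X ^ \<alpha> * Y ^ \<beta>))"
    unfolding sum.cartesian_product' fps_nrm_def by (intro sum.cong refl) (auto simp: a_def norm_mult norm_power sum_distrib_left mult.assoc)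
   also have "\<dots> <= nrm \<rho> K (series_of c)"
    unfolding nrm_eq by (intro sum_mono) (auto simp: series_of_def intro!: mult_left_mono pow)
   also have "\<dots> <= B" by (rule \<rho>(3))
   finally show "s <= B" .
  qed auto
  then have "a summable_on UNIV" by (rule abs_summable_summable)
  then obtain S where "(a has_sum S) UNIV" by (auto simp: summable_on_def)
  then have S: "(a has_sum S) (UNIV \<times> UNIV)" by simp
  have inner: "((%k. a ((\<alpha>, \<beta>), k)) has_sum c \<alpha> \<beta> * x ^ \<alpha> * y ^ \<beta>) UNIV" for \<alpha> \<beta>
  proof (rule norm_summable_imp_has_sum)
   have r: "fps_conv_radius (X ^ \<alpha>) > norm u" "fps_conv_radius (Y ^ \<beta>) > norm u"
    using ur fps_conv_radius_power[of X \<alpha>] fps_conv_radius_power[of Y \<beta>] by (auto intro: less_le_trans)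
   then have r2: "ereal (norm u) < fps_conv_radius (X ^ \<alpha> * Y ^ \<beta>)"
    using fps_conv_radius_mult[of "X ^ \<alpha>" "Y ^ \<beta>"] by (auto intro: less_le_trans[OF _ fps_conv_radius_mult])
   have e: "eval_fps (X ^ \<alpha> * Y ^ \<beta>) u = x ^ \<alpha> * y ^ \<beta>"
    using r ur by (simp add: eval_fps_mult eval_fps_power x_def y_def)
   have "(%k. fps_nth (X ^ \<alpha> * Y ^ \<beta>) k * u ^ k) sums (x ^ \<alpha> * y ^ \<beta>)"
    unfolding e[symmetric] by (rule sums_eval_fps[OF r2])
   from sums_mult[OF this, of "c \<alpha> \<beta>"] show "(%k. a ((\<alpha>, \<beta>), k)) sums (c \<alpha> \<beta> * x ^ \<alpha> * y ^ \<beta>)"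
    by (simp add: a_def mult.assoc)
   have "summable (%k. norm (fps_nth (X ^ \<alpha> * Y ^ \<beta>) k * u ^ k))" by (rule norm_summable_fps[OF r2])
   from summable_mult[OF this, of "norm (c \<alpha> \<beta>)"] show "summable (%k. norm (a ((\<alpha>, \<beta>), k)))"
    by (simp add: a_def norm_mult mult.assoc)
  qed
  have "((%(\<alpha>, \<beta>). c \<alpha> \<beta> * x ^ \<alpha> * y ^ \<beta>) has_sum S) UNIV"
   by (rule has_sum_SigmaD[OF S]) (use inner in auto)
  moreover have "dist (x, y) (0, 0) < d"
  proof -
   have "dist (x, y) (0, 0) <= dist x 0 + dist y 0"
    unfolding dist_Pair_Pair by (rule sqrt_sum_squares_le_sum) auto
   then show ?thesis using xy \<rho>(2) by simp
  qed
  from d(2)[OF this] have "((%(\<alpha>, \<beta>). c \<alpha> \<beta> * x ^ \<alpha> * y ^ \<beta>) has_sum G (x, y)) UNIV" by simp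
  ultimately have SG: "S = G (x, y)" by (rule has_sum_unique)
  have S': "((%(k, v). a (v, k)) has_sum S) (UNIV \<times> UNIV)" using S unfolding has_sum_swap[of a] .
  have "((%k. fps_nth (subst2 c X Y) k * u ^ k) has_sum S) UNIV"
  proof (rule has_sum_SigmaD[OF S'])
   fix k
   have "((%v. a (v, k)) has_sum (\<Sum>v\<in>{(\<alpha>, \<beta>). \<alpha> + \<beta> <= k}. a (v, k))) {(\<alpha>, \<beta>). \<alpha> + \<beta> <= k}"
    by (rule has_sum_finite[OF finite_degree_le])
   then have "((%v. a (v, k)) has_sum (\<Sum>v\<in>{(\<alpha>, \<beta>). \<alpha> + \<beta> <= k}. a (v, k))) UNIV"
    by (subst has_sum_cong_neutral[where g = "%v. a (v, k)" and T = "{(\<alpha>, \<beta>). \<alpha> + \<beta> <= k}"])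
      (auto simp: a_def fps_dvd_nth_zero X Y)
   moreover have "(\<Sum>v\<in>{(\<alpha>, \<beta>). \<alpha> + \<beta> <= k}. a (v, k)) = fps_nth (subst2 c X Y) k * u ^ k"
    unfolding subst2_def fps_nth_Abs_fps sum_distrib_right by (intro sum.cong refl) (auto simp: a_def)
   ultimately show "((%v. (%(k, v). a (v, k)) (k, v)) has_sum fps_nth (subst2 c X Y) k * u ^ k) UNIV" by simp
  qed
  then have "(%k. fps_nth (subst2 c X Y) k * u ^ k) sums S" by (rule has_sum_imp_sums)
  then show ?thesis unfolding SG x_def y_def curve_at_def by simp
 qed
 moreover have "t > 0" using tx ty by (simp add: t_def)
 ultimately show "\<forall>\<^sub>F u in nhds 0. (%n. fps_nth (subst2 c X Y) n * u ^ n) sums G (curve_at (X, Y) u)"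
  unfolding eventually_nhds_metric by (intro exI[of _ t]) auto
qed

lemma has_power_series_swap:
 assumes "has_power_series_at_0 G c"
 shows "has_power_series_at_0 (%z. G (snd z, fst z)) (%\<alpha> \<beta>. c \<beta> \<alpha>)"
proof -
 obtain d where d: "d > 0" "\<And>z. dist z (0, 0) < d ==> ((%(\<alpha>, \<beta>). c \<alpha> \<beta> * fst z ^ \<alpha> * snd z ^ \<beta>) has_sum G z) UNIV"
  using assms unfolding has_power_series_at_0_def eventually_nhds_metric by blast
 have "((%(\<alpha>, \<beta>). c \<beta> \<alpha> * fst z ^ \<alpha> * snd z ^ \<beta>) has_sum G (snd z, fst z)) UNIV" if "dist z (0, 0) < d" for z
 proof -
  have "dist (snd z, fst z) (0, 0) < d" using that by (cases z) (simp add: dist_Pair_Pair add.commute)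
  from d(2)[OF this] have "((%(\<alpha>, \<beta>). c \<alpha> \<beta> * snd z ^ \<alpha> * fst z ^ \<beta>) has_sum G (snd z, fst z)) (UNIV \<times> UNIV)" by simp
  then have "((%(x, y). (%(\<alpha>, \<beta>). c \<alpha> \<beta> * snd z ^ \<alpha> * fst z ^ \<beta>) (y, x)) has_sum G (snd z, fst z)) (UNIV \<times> UNIV)"
   by (rule has_sum_swap[THEN iffD1])
  then show ?thesis by (simp add: mult_ac)
 qed
 then show ?thesis unfolding has_power_series_at_0_def eventually_nhds_metric using d(1) by blast
qed

text \<open>For fixed y the function is a power series in x alone, with coefficients
  \<open>A\<close>, and is differentiated termwise; the formal derivative, as a double sum, is then
  summed row by row to the same value.\<close>

lemma has_power_series_partial_x:
 fixes G :: "'k :: {real_normed_field, euclidean_space} \<times> 'k => 'k"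
 assumes G: "has_power_series_at_0 G c"
 shows "has_power_series_at_0 (partial_x G) (%\<alpha> \<beta>. of_nat (Suc \<alpha>) * c (Suc \<alpha>) \<beta>)"
proof -
 obtain d where d: "d > 0" "\<And>z. dist z (0, 0) < d ==> ((%(\<alpha>, \<beta>). c \<alpha> \<beta> * fst z ^ \<alpha> * snd z ^ \<beta>) has_sum G z) UNIV"
  using G unfolding has_power_series_at_0_def eventually_nhds_metric by blast
 have cs: "convergent_series (series_of c)" by (rule has_power_series_imp_convergent[OF G])
 obtain \<rho>0 where \<rho>0: "\<rho>0 > 0" "(%(\<alpha>, \<beta>). norm (c \<alpha> \<beta>) * \<rho>0 ^ (\<alpha> + \<beta>)) summable_on UNIV"
  using cs unfolding convergent_series_def by (auto simp: series_of_def)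
 obtain \<rho>1 where \<rho>1: "\<rho>1 > 0" "(%(\<alpha>, \<beta>). norm (of_nat (Suc \<alpha>) * c (Suc \<alpha>) \<beta>) * \<rho>1 ^ (\<alpha> + \<beta>)) summable_on UNIV"
  using convergent_series_deriv(1)[OF cs] unfolding convergent_series_def cf_dx by (auto simp: series_of_def)
 define \<rho> where "\<rho> = Min {\<rho>0, \<rho>1, d / 3}"
 have \<rho>: "\<rho> > 0" "\<rho> <= \<rho>0" "\<rho> <= \<rho>1" "\<rho> + \<rho> < d" using \<rho>0(1) \<rho>1(1) d(1) by (auto simp: \<rho>_def)
 have dom: "(%(\<alpha>, \<beta>). e \<alpha> \<beta> * x ^ \<alpha> * y ^ \<beta>) summable_on UNIV"
  if "(%(\<alpha>, \<beta>). norm (e \<alpha> \<beta>) * \<rho>' ^ (\<alpha> + \<beta>)) summable_on UNIV" "norm x <= \<rho>'" "norm y <= \<rho>'"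
  for e :: "nat => nat => 'k" and x y \<rho>'
 proof (rule abs_summable_summable, rule summable_on_comparison_test[OF that(1)])
  show "norm ((%(\<alpha>, \<beta>). e \<alpha> \<beta> * x ^ \<alpha> * y ^ \<beta>) v) <= (%(\<alpha>, \<beta>). norm (e \<alpha> \<beta>) * \<rho>' ^ (\<alpha> + \<beta>)) v" for v
  proof (cases v)
   case (Pair \<alpha> \<beta>)
   have "norm x ^ \<alpha> * norm y ^ \<beta> <= \<rho>' ^ \<alpha> * \<rho>' ^ \<beta>"
   proof -
    have "0 <= \<rho>'" using that(2) norm_ge_zero[of x] by linarith
    then show ?thesis using that(2,3) by (intro mult_mono power_mono zero_le_power) auto
   qed
   then show ?thesis unfolding Pair by (simp add: norm_mult norm_power power_add mult.assoc mult_left_mono)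
  qed
 qed auto
 have main: "((%(\<alpha>, \<beta>). (of_nat (Suc \<alpha>) * c (Suc \<alpha>) \<beta>) * fst z ^ \<alpha> * snd z ^ \<beta>) has_sum partial_x G z) UNIV" if z: "dist z (0, 0) < \<rho>" for z
 proof -
  obtain x y where zxy: "z = (x, y)" by (cases z)
  have "norm x <= dist z (0, 0)" "norm y <= dist z (0, 0)"
   unfolding zxy dist_Pair_Pair by (simp_all add: real_le_rsqrt)
  then have xy: "norm x < \<rho>" "norm y < \<rho>" using z by auto
  have dist: "dist (x', y) (0, 0) < d" if "norm x' < \<rho>" for x'
  proof -
   have "dist (x', y) (0, 0) <= dist x' 0 + dist y 0" unfolding dist_Pair_Pair by (rule sqrt_sum_squares_le_sum) auto
   then show ?thesis using that xy \<rho>(4) by simp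
  qed
  define A where "A = (%\<alpha>. infsum (%\<beta>. c \<alpha> \<beta> * y ^ \<beta>) UNIV)"
  have A: "((%\<beta>. c \<alpha> \<beta> * y ^ \<beta>) has_sum A \<alpha>) UNIV" for \<alpha>
  proof -
   \<comment> \<open>A nonzero abscissa, so that \<open>x1 ^ \<alpha>\<close> can be divided out of
     a row of the double sum.\<close>
   define x1 :: 'k where "x1 = of_real \<rho>"
   have "norm x1 = \<rho>" unfolding x1_def using \<rho>(1) by simp
   then have "(%(\<alpha>, \<beta>). c \<alpha> \<beta> * x1 ^ \<alpha> * y ^ \<beta>) summable_on UNIV \<times> UNIV" using dom[OF \<rho>0(2), of x1 y] xy \<rho>(2) by simp
   then have "(%(\<alpha>, \<beta>). c \<alpha> \<beta> * x1 ^ \<alpha> * y ^ \<beta>) summable_on range (Pair \<alpha>)" by (rule summable_on_subset_banach) auto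
   then have "((%(\<alpha>, \<beta>). c \<alpha> \<beta> * x1 ^ \<alpha> * y ^ \<beta>) \<circ> Pair \<alpha>) summable_on UNIV"
    by (subst (asm) summable_on_reindex) (auto simp: inj_on_def)
   then have "(%\<beta>. x1 ^ \<alpha> * (c \<alpha> \<beta> * y ^ \<beta>)) summable_on UNIV" by (simp add: o_def mult_ac)
   then have "(%\<beta>. inverse (x1 ^ \<alpha>) * (x1 ^ \<alpha> * (c \<alpha> \<beta> * y ^ \<beta>))) summable_on UNIV" by (rule summable_on_cmult_right)
   moreover have "x1 ~= 0" using \<open>norm x1 = \<rho>\<close> \<rho>(1) by auto
   ultimately have "(%\<beta>. c \<alpha> \<beta> * y ^ \<beta>) summable_on UNIV" by (simp add: mult.assoc[symmetric])
   then show ?thesis unfolding A_def by (rule has_sum_infsum)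
  qed
  have GA: "(%\<alpha>. A \<alpha> * x' ^ \<alpha>) sums G (x', y)" if x': "norm x' < \<rho>" for x'
  proof -
   from d(2)[OF dist[OF x']] have "((%(\<alpha>, \<beta>). c \<alpha> \<beta> * x' ^ \<alpha> * y ^ \<beta>) has_sum G (x', y)) (UNIV \<times> UNIV)" by simp
   then have "((%\<alpha>. A \<alpha> * x' ^ \<alpha>) has_sum G (x', y)) UNIV"
   proof (rule has_sum_SigmaD)
    fix \<alpha>
    from has_sum_cmult_right[OF A[of \<alpha>], of "x' ^ \<alpha>"]
    show "((%\<beta>. (%(\<alpha>, \<beta>). c \<alpha> \<beta> * x' ^ \<alpha> * y ^ \<beta>) (\<alpha>, \<beta>)) has_sum A \<alpha> * x' ^ \<alpha>) UNIV" by (simp add: mult_ac)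
   qed
   then show ?thesis by (rule has_sum_imp_sums)
  qed
  have "((%x'. \<Sum>n. A n * x' ^ n) has_field_derivative (\<Sum>n. diffs A n * x ^ n)) (at x)"
  proof (rule has_field_derivative_powser)
   define x1 :: 'k where "x1 = of_real ((norm x + \<rho>) / 2)"
   have n1: "norm x1 = (norm x + \<rho>) / 2" unfolding x1_def norm_of_real using \<rho>(1) by simp
   then have "norm x1 < \<rho>" "norm x < norm x1" using xy by auto
   then have "ereal (norm x1) <= conv_radius A" using GA[of x1] by (intro conv_radius_geI) (auto simp: sums_iff)
   then show "ereal (norm x) < conv_radius A" using \<open>norm x < norm x1\<close> by (meson ereal_less_le less_ereal.simps(1) less_le_trans)
  qed
  then have "((%x'. G (x', y)) has_field_derivative (\<Sum>n. diffs A n * x ^ n)) (at x)"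
  proof (rule has_field_derivative_transform_within_open)
   show "open (ball 0 \<rho> :: 'k set)" "x \<in> ball 0 \<rho>" using xy by auto
   show "(\<Sum>n. A n * x' ^ n) = G (x', y)" if "x' \<in> ball 0 \<rho>" for x'
    using GA[of x'] that by (simp add: sums_iff)
  qed
  then have P: "partial_x G z = (\<Sum>n. diffs A n * x ^ n)" unfolding partial_x_def zxy by (simp add: DERIV_imp_deriv)
  obtain S where S: "((%(\<alpha>, \<beta>). (of_nat (Suc \<alpha>) * c (Suc \<alpha>) \<beta>) * x ^ \<alpha> * y ^ \<beta>) has_sum S) UNIV"
   using dom[OF \<rho>1(2), of x y] xy \<rho>(3) unfolding summable_on_def by auto
  then have "((%(\<alpha>, \<beta>). (of_nat (Suc \<alpha>) * c (Suc \<alpha>) \<beta>) * x ^ \<alpha> * y ^ \<beta>) has_sum S) (UNIV \<times> UNIV)" by simp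
  then have "((%\<alpha>. diffs A \<alpha> * x ^ \<alpha>) has_sum S) UNIV"
  proof (rule has_sum_SigmaD)
   fix \<alpha>
   from has_sum_cmult_right[OF A[of "Suc \<alpha>"], of "of_nat (Suc \<alpha>) * x ^ \<alpha>"]
   show "((%\<beta>. (%(\<alpha>, \<beta>). (of_nat (Suc \<alpha>) * c (Suc \<alpha>) \<beta>) * x ^ \<alpha> * y ^ \<beta>) (\<alpha>, \<beta>)) has_sum diffs A \<alpha> * x ^ \<alpha>) UNIV"
    by (simp add: diffs_def mult_ac del: of_nat_Suc)
  qed
  then have "S = (\<Sum>n. diffs A n * x ^ n)" using has_sum_imp_sums sums_unique by blast
  then show ?thesis using S P zxy by simp
 qed
 then show ?thesis unfolding has_power_series_at_0_def eventually_nhds_metric using \<rho>(1) by blast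
qed

lemma has_power_series_partial_y:
 fixes G :: "'k :: {real_normed_field, euclidean_space} \<times> 'k => 'k"
 assumes G: "has_power_series_at_0 G c"
 shows "has_power_series_at_0 (partial_y G) (%\<alpha> \<beta>. of_nat (Suc \<beta>) * c \<alpha> (Suc \<beta>))"
proof -
 have "has_power_series_at_0 (%z. partial_x (%z. G (snd z, fst z)) (snd z, fst z)) (%\<alpha> \<beta>. of_nat (Suc \<beta>) * c \<alpha> (Suc \<beta>))"
  using has_power_series_swap[OF has_power_series_partial_x[OF has_power_series_swap[OF G]]] by simp
 moreover have "(%z. partial_x (%z. G (snd z, fst z)) (snd z, fst z)) = partial_y G"
  by (rule ext) (simp add: partial_x_def partial_y_def)
 ultimately show ?thesis by simp
qed

section \<open>The weighted implicit function theorem\<close>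

lemma fps_power_nth_0: "fps_nth (X ^ n) 0 = fps_nth (X :: 'k::comm_ring_1 fps) 0 ^ n"
 by (induction n) auto

lemma fps_power_agree:
 fixes U U' :: "'k::comm_ring_1 fps"
 assumes "\<And>l. l <= k ==> fps_nth U l = fps_nth U' l" "l <= k"
 shows "fps_nth (U ^ j) l = fps_nth (U' ^ j) l"
 using assms(2)
proof (induction j arbitrary: l)
 case (Suc j)
 then show ?case by (auto simp: fps_mult_nth assms(1) intro!: sum.cong)
qed simp

text \<open>A factor of the first variable shifts degrees up by at least one, and pure powers U^j
  occur only for j >= 2, where the missing constant term of U keeps every factor below degree
  \<open>k\<close>. So degree \<open>k\<close> of the composite depends only on lower coefficients
  of U.\<close>

lemma subst2_fixpoint_agree:
 fixes U U' :: "'k::comm_ring_1 fps"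
 assumes e: "e 0 0 = 0" "e 0 (Suc 0) = 0" and U: "fps_nth U 0 = 0" "fps_nth U' 0 = 0"
  and agree: "\<And>l. l < k ==> fps_nth U l = fps_nth U' l"
 shows "fps_nth (subst2 e fps_X U) k = fps_nth (subst2 e fps_X U') k"
 unfolding subst2_def fps_nth_Abs_fps
proof (intro sum.cong refl, clarify)
 fix i j :: nat assume "i + j <= k"
 show "e i j * fps_nth (fps_X ^ i * U ^ j) k = e i j * fps_nth (fps_X ^ i * U' ^ j) k"
 proof (cases "i = 0")
  case False
  have "fps_nth (U ^ j) (k - i) = fps_nth (U' ^ j) (k - i)" if "i <= k"
   by (rule fps_power_agree[of "k - i"]) (use agree False that in auto)
  then show ?thesis by (simp add: fps_X_power_mult_nth)
 next
  case True
  show ?thesis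
  proof (cases "j < 2")
   case True
   then have "j = 0 \<or> j = Suc 0" by linarith
   then show ?thesis using \<open>i = 0\<close> e by auto
  next
   case False
   define j' where "j' = j - 2"
   have j': "j = Suc (Suc j')" using False by (simp add: j'_def)
   have "fps_nth (U * U ^ Suc j') k = fps_nth (U' * U' ^ Suc j') k"
    unfolding fps_mult_nth
   proof (intro sum.cong refl)
    fix l assume l: "l \<in> {0..k}"
    show "fps_nth U l * fps_nth (U ^ Suc j') (k - l) = fps_nth U' l * fps_nth (U' ^ Suc j') (k - l)"
    proof (cases "l = 0 \<or> l = k")
     case True
     then show ?thesis using U by (auto simp: fps_power_nth_0)
    next
     case False
     have "fps_nth (U ^ Suc j') (k - l) = fps_nth (U' ^ Suc j') (k - l)"
      by (rule fps_power_agree[of "k - l"]) (use agree False l in auto)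
     moreover have "fps_nth U l = fps_nth U' l" using agree False l by auto
     ultimately show ?thesis by (simp only:)
    qed
   qed
   then show ?thesis unfolding \<open>i = 0\<close> j' by simp
  qed
 qed
qed

lemma subst2_nth_0: "fps_nth (subst2 e X Y) 0 = e 0 (0::nat)"
proof -
 have "{(\<alpha>, \<beta>). \<alpha> + \<beta> <= (0::nat)} = {(0, 0)}" by auto
 then show ?thesis by (simp add: subst2_def)
qed

lemma subst2_fixpoint_unique:
 fixes U U' :: "'k::comm_ring_1 fps"
 assumes e: "e 0 0 = 0" "e 0 (Suc 0) = 0" and U: "subst2 e fps_X U = U" "subst2 e fps_X U' = U'"
  "fps_nth U 0 = 0" "fps_nth U' 0 = 0"
 shows "U = U'"
proof (rule fps_ext)
 fix k show "fps_nth U k = fps_nth U' k"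
 proof (induction k rule: less_induct)
  case (less k)
  have "fps_nth (subst2 e fps_X U) k = fps_nth (subst2 e fps_X U') k"
   by (rule subst2_fixpoint_agree[where e = e and U = U and U' = U', OF e U(3,4)]) (rule less)
  then show ?case unfolding U(1,2) .
 qed
qed

lemma fps_nrm_const_mult: "fps_nrm \<rho> K (fps_const k * F) = norm k * fps_nrm \<rho> K F"
 unfolding fps_nrm_def by (simp add: norm_mult sum_distrib_left mult.assoc)

text \<open>Iteration from 0 stabilises one more coefficient in each step, which yields the formal
  solution; it converges because the iteration preserves a ball in the truncated majorant
  norm.\<close>

lemma subst2_fixpoint_exists:
 fixes e :: "nat => nat => 'k :: {real_normed_field, euclidean_space}"
 assumes e: "e 0 0 = 0" "e 0 (Suc 0) = 0" and conv: "convergent_series (series_of e)"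
 shows "\<exists>U. subst2 e fps_X U = U \<and> fps_nth U 0 = 0 \<and> fps_conv_radius U > 0"
proof -
 define V where "V s = ((subst2 e fps_X) ^^ s) 0" for s
 have V0: "V 0 = 0" and VS: "V (Suc s) = subst2 e fps_X (V s)" for s by (simp_all add: V_def)
 have Vz: "fps_nth (V s) 0 = 0" for s by (cases s) (simp_all add: V0 VS subst2_nth_0 e)
 have agree: "fps_nth (V s) l = fps_nth (V (Suc s)) l" if "l < s" for s l
  using that
 proof (induction s arbitrary: l)
  case (Suc s)
  have "fps_nth (subst2 e fps_X (V s)) l = fps_nth (subst2 e fps_X (V (Suc s))) l"
   by (rule subst2_fixpoint_agree[where e = e and U = "V s" and U' = "V (Suc s)", OF e Vz Vz]) (use Suc in auto)
  then show ?case by (simp only: VS)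
 qed simp
 have agree': "fps_nth (V (s + i)) l = fps_nth (V s) l" if "l < s" for s i l
  using that by (induction i) (auto simp: agree[symmetric])
 define U where "U = Abs_fps (%l. fps_nth (V (Suc l)) l)"
 have UV: "fps_nth U l = fps_nth (V s) l" if "l < s" for l s
  using agree'[of l "Suc l" "s - Suc l"] that by (simp add: U_def)
 have U0: "fps_nth U 0 = 0" by (simp add: U_def Vz)
 have fixp: "subst2 e fps_X U = U"
 proof (rule fps_ext)
  fix k
  have "fps_nth (subst2 e fps_X U) k = fps_nth (subst2 e fps_X (V k)) k"
   by (rule subst2_fixpoint_agree[where e = e and U = U and U' = "V k", OF e U0 Vz]) (rule UV)
  then show "fps_nth (subst2 e fps_X U) k = fps_nth U k" unfolding VS[symmetric] by (simp add: U_def)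
 qed
 obtain \<rho> B where \<rho>: "\<rho> > 0" "\<And>K. nrm \<rho> K (series_of e) <= B" using conv unfolding convergent_series_iff by blast
 have B0: "0 <= B" using \<rho>(2)[of 0] nrm_nonneg[of \<rho> 0 "series_of e"] \<rho>(1) by linarith
 \<comment> \<open>Terms of order at least 2 in the second variable contribute at most (\<delta> /
   \<rho>)^2 B, terms containing the first variable at most (t / \<rho>) B. The choices of \<delta>
   and t bound each share by \<delta> / 2.\<close>
 define \<delta> where "\<delta> = min \<rho> (\<rho>\<^sup>2 / (2 * (B + 1)))"
 define t where "t = min \<rho> (\<rho> * \<delta> / (2 * (B + 1)))"
 have \<delta>: "0 < \<delta>" "\<delta> <= \<rho>" using \<rho>(1) B0 by (auto simp: \<delta>_def)
 have t: "0 < t" "t <= \<rho>" using \<rho>(1) \<delta> B0 by (auto simp: t_def)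
 have small: "((\<delta> / \<rho>)\<^sup>2 + t / \<rho>) * B <= \<delta>"
 proof -
  have "\<delta> * (2 * (B + 1)) <= \<rho>\<^sup>2"
  proof -
   have "\<delta> <= \<rho>\<^sup>2 / (2 * (B + 1))" unfolding \<delta>_def by (rule min.cobounded2)
   moreover have "0 < 2 * (B + 1)" using B0 by simp
   ultimately show ?thesis by (simp only: pos_le_divide_eq)
  qed
  then have "\<delta> * (\<delta> * (2 * (B + 1))) <= \<delta> * \<rho>\<^sup>2" using \<delta> by (intro mult_left_mono) auto
  then have "\<delta>\<^sup>2 * (B + 1) <= (\<delta> / 2) * \<rho>\<^sup>2" by (simp add: power2_eq_square algebra_simps)
  then have 1: "(\<delta> / \<rho>)\<^sup>2 * (B + 1) <= \<delta> / 2" using \<rho>(1)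
   by (simp only: power_divide times_divide_eq_left pos_divide_le_eq zero_less_power)
  have "t * (2 * (B + 1)) <= \<rho> * \<delta>"
  proof -
   have "t <= \<rho> * \<delta> / (2 * (B + 1))" unfolding t_def by (rule min.cobounded2)
   moreover have "0 < 2 * (B + 1)" using B0 by simp
   ultimately show ?thesis by (simp only: pos_le_divide_eq)
  qed
  then have "t * (B + 1) <= (\<delta> / 2) * \<rho>" by (simp add: algebra_simps)
  then have 2: "(t / \<rho>) * (B + 1) <= \<delta> / 2" using \<rho>(1)
   by (simp only: times_divide_eq_left pos_divide_le_eq)
  have "((\<delta> / \<rho>)\<^sup>2 + t / \<rho>) * B <= ((\<delta> / \<rho>)\<^sup>2 + t / \<rho>) * (B + 1)"
   using t \<rho>(1) by (intro mult_left_mono) auto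
  also have "\<dots> <= \<delta>" using 1 2 unfolding distrib_right by linarith
  finally show ?thesis .
 qed
 have termb: "norm (e i j) * (t ^ i * \<delta> ^ j) <= ((\<delta> / \<rho>)\<^sup>2 + t / \<rho>) * (norm (e i j) * \<rho> ^ (i + j))" for i j
 proof (cases "i = 0 \<and> j < 2")
  case True
  then have "j = 0 \<or> j = Suc 0" by linarith
  then show ?thesis using True e by auto
 next
  case False
  have "t ^ i * \<delta> ^ j <= ((\<delta> / \<rho>)\<^sup>2 + t / \<rho>) * \<rho> ^ (i + j)"
  proof (cases i)
   case 0
   then have j: "2 <= j" using False by simp
   have "(\<delta> / \<rho>) ^ j <= (\<delta> / \<rho>)\<^sup>2" using \<delta> \<rho>(1) j by (intro power_decreasing) auto
   then have "(\<delta> / \<rho>) ^ j * \<rho> ^ j <= (\<delta> / \<rho>)\<^sup>2 * \<rho> ^ j" using \<rho>(1) by (intro mult_right_mono) auto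
   also have "\<dots> <= ((\<delta> / \<rho>)\<^sup>2 + t / \<rho>) * \<rho> ^ j" using \<rho>(1) t by (intro mult_right_mono) auto
   finally show ?thesis using 0 \<rho>(1) by (simp add: power_divide)
  next
   case (Suc i')
   have "t ^ i' * \<delta> ^ j <= \<rho> ^ i' * \<rho> ^ j" using t \<delta> by (intro mult_mono power_mono) auto
   then have "t * (t ^ i' * \<delta> ^ j) <= t * (\<rho> ^ i' * \<rho> ^ j)" using t by (intro mult_left_mono) auto
   also have "\<dots> = t / \<rho> * \<rho> ^ (i + j)" using \<rho>(1) unfolding Suc by (simp add: power_add)
   also have "\<dots> <= ((\<delta> / \<rho>)\<^sup>2 + t / \<rho>) * \<rho> ^ (i + j)" using \<rho>(1) by (intro mult_right_mono) auto
   finally show ?thesis unfolding Suc by (simp add: mult.assoc)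
  qed
  then have "norm (e i j) * (t ^ i * \<delta> ^ j) <= norm (e i j) * (((\<delta> / \<rho>)\<^sup>2 + t / \<rho>) * \<rho> ^ (i + j))"
   by (intro mult_left_mono) auto
  then show ?thesis by (simp only: mult_ac)
 qed
 have X: "fps_nrm t K (fps_X :: 'k fps) <= t" for K
 proof -
  have "fps_nrm t K (fps_X :: 'k fps) = (\<Sum>k\<le>K. if k = 1 then t else 0)" unfolding fps_nrm_def by (intro sum.cong) auto
  then show ?thesis using t by (auto simp: sum.delta)
 qed
 have step: "fps_nrm t K (subst2 e fps_X W) <= \<delta>" if W: "fps_nth W 0 = 0" "fps_nrm t K W <= \<delta>" for W K
 proof -
  let ?S = "{..K} \<times> {..K}"
  have "fps_nrm t K (subst2 e fps_X W) = fps_nrm t K (\<Sum>v\<in>?S. fps_const (e (fst v) (snd v)) * (fps_X ^ fst v * W ^ snd v))"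
   unfolding fps_nrm_def
  proof (intro sum.cong refl)
   fix k assume "k \<in> {..K}"
   then have "fps_nth (subst2 e fps_X W) k = (\<Sum>(i, j)\<in>?S. e i j * fps_nth (fps_X ^ i * W ^ j) k)"
    by (intro subst2_nth) (auto simp: W)
   then show "norm (fps_nth (subst2 e fps_X W) k) * t ^ k
     = norm (fps_nth (\<Sum>v\<in>?S. fps_const (e (fst v) (snd v)) * (fps_X ^ fst v * W ^ snd v)) k) * t ^ k"
    by (simp add: fps_sum_nth case_prod_beta)
  qed
  also have "\<dots> <= (\<Sum>v\<in>?S. fps_nrm t K (fps_const (e (fst v) (snd v)) * (fps_X ^ fst v * W ^ snd v)))"
   using t by (intro fps_nrm_sum) auto
  also have "\<dots> <= (\<Sum>v\<in>?S. norm (e (fst v) (snd v)) * (t ^ fst v * \<delta> ^ snd v))"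
  proof (intro sum_mono)
   fix v
   have "fps_nrm t K (fps_X ^ fst v * W ^ snd v) <= fps_nrm t K (fps_X ^ fst v :: 'k fps) * fps_nrm t K (W ^ snd v)"
    using t by (intro fps_nrm_mult) auto
   also have "\<dots> <= fps_nrm t K (fps_X :: 'k fps) ^ fst v * fps_nrm t K W ^ snd v"
    using t by (intro mult_mono fps_nrm_power fps_nrm_nonneg zero_le_power) auto
   also have "\<dots> <= t ^ fst v * \<delta> ^ snd v"
    using t by (intro mult_mono power_mono X W(2) fps_nrm_nonneg zero_le_power) auto
   finally show "fps_nrm t K (fps_const (e (fst v) (snd v)) * (fps_X ^ fst v * W ^ snd v)) <= norm (e (fst v) (snd v)) * (t ^ fst v * \<delta> ^ snd v)"
    unfolding fps_nrm_const_mult by (intro mult_left_mono) auto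
  qed
  also have "\<dots> <= (\<Sum>v\<in>?S. ((\<delta> / \<rho>)\<^sup>2 + t / \<rho>) * (norm (e (fst v) (snd v)) * \<rho> ^ (fst v + snd v)))"
   by (intro sum_mono termb)
  also have "\<dots> = ((\<delta> / \<rho>)\<^sup>2 + t / \<rho>) * nrm \<rho> K (series_of e)"
   unfolding nrm_eq by (simp add: sum_distrib_left case_prod_beta series_of_def)
  also have "\<dots> <= ((\<delta> / \<rho>)\<^sup>2 + t / \<rho>) * B" using t \<rho> by (intro mult_left_mono) auto
  also have "\<dots> <= \<delta>" by (rule small)
  finally show ?thesis .
 qed
 have bound: "fps_nrm t K (V s) <= \<delta>" for K s
 proof (induction s)
  case 0
  then show ?case unfolding V0 using \<delta> by (simp add: fps_nrm_def)
 next
  case (Suc s)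
  then show ?case unfolding VS by (intro step Vz)
 qed
 have boundU: "fps_nrm t K U <= \<delta>" for K
 proof -
  have "fps_nrm t K U = fps_nrm t K (V (Suc K))" unfolding fps_nrm_def by (intro sum.cong refl) (simp add: UV[of _ "Suc K"] less_Suc_eq_le)
  then show ?thesis using bound by simp
 qed
 have "summable (%k. norm (fps_nth U k) * t ^ k)"
 proof (rule summableI_nonneg_bounded)
  show "0 <= norm (fps_nth U k) * t ^ k" for k using t by simp
  show "(\<Sum>k<K. norm (fps_nth U k) * t ^ k) <= \<delta>" for K

  proof -
   have "(\<Sum>k<K. norm (fps_nth U k) * t ^ k) <= (\<Sum>k\<le>K. norm (fps_nth U k) * t ^ k)"
    using t by (intro sum_mono2) auto
   also have "\<dots> <= \<delta>" using boundU[of K] unfolding fps_nrm_def .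
   finally show ?thesis .
  qed
 qed
 then have "summable (%k. norm (fps_nth U k * of_real t ^ k))" using t by (simp add: norm_mult norm_power)
 then have "summable (%k. fps_nth U k * of_real t ^ k)" by (rule summable_norm_cancel)
 then have "ereal (norm (of_real t :: 'k)) <= fps_conv_radius U" unfolding fps_conv_radius_def by (rule conv_radius_geI)
 moreover have "0 < ereal (norm (of_real t :: 'k))" using t by simp
 ultimately have "0 < fps_conv_radius U" by (simp only: less_le_trans)
 then show ?thesis using fixp U0 by blast
qed

lemma fps_weighted_power:
 "(fps_X ^ n * V) ^ \<alpha> * (fps_X ^ m * W) ^ \<beta> = fps_X ^ (n * \<alpha> + m * \<beta>) * (V ^ \<alpha> * (W :: 'k::comm_ring_1 fps) ^ \<beta>)"
proof -
 have "(fps_X ^ n * V) ^ \<alpha> = fps_X ^ (n * \<alpha>) * V ^ \<alpha>" "(fps_X ^ m * W) ^ \<beta> = fps_X ^ (m * \<beta>) * W ^ \<beta>"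
  by (simp_all add: power_mult_distrib power_mult)
 then show ?thesis by (simp only: power_add mult_ac)
qed

lemma finite_weight_le: "0 < n ==> 0 < m ==> finite {(\<alpha>::nat, \<beta>::nat). n * \<alpha> + m * \<beta> <= k}"
proof (rule finite_subset)
 assume "0 < n" "0 < m"
 have "\<alpha> <= k \<and> \<beta> <= k" if "n * \<alpha> + m * \<beta> <= k" for \<alpha> \<beta>
 proof -
  have "\<alpha> <= n * \<alpha>" "\<beta> <= m * \<beta>" using \<open>0 < n\<close> \<open>0 < m\<close> by auto
  then show ?thesis using that by linarith
 qed
 then show "{(\<alpha>, \<beta>). n * \<alpha> + m * \<beta> <= k} \<subseteq> {..k} \<times> {..k}"
  unfolding subset_iff split_paired_All mem_Collect_eq case_prod_conv mem_Sigma_iff atMost_iff by blast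
qed simp

lemma finite_weight_eq: "0 < n ==> 0 < m ==> finite {(\<alpha>::nat, \<beta>::nat). n * \<alpha> + m * \<beta> = k}"
 by (rule finite_subset[OF _ finite_weight_le[of n m k]]) (simp_all add: subset_iff)

text \<open>Each monomial carries the parameter to the power of its weight n \<alpha> + m \<beta>;
  the contributions are grouped by this weight.\<close>

lemma subst2_weighted_nth:
 fixes V W :: "'k::comm_ring_1 fps"
 assumes nm: "0 < n" "0 < m" and c: "\<And>\<alpha> \<beta>. c \<alpha> \<beta> ~= 0 ==> N <= n * \<alpha> + m * \<beta>"
 shows "fps_nth (subst2 c (fps_X ^ n * V) (fps_X ^ m * W)) k
  = (\<Sum>l\<in>{N..k}. \<Sum>(\<alpha>,\<beta>)\<in>{(\<alpha>,\<beta>). n * \<alpha> + m * \<beta> = l}. c \<alpha> \<beta> * fps_nth (V ^ \<alpha> * W ^ \<beta>) (k - l))"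
proof -
 let ?P = "%l. {(\<alpha>::nat, \<beta>::nat). n * \<alpha> + m * \<beta> = l}"
 have "fps_nth (subst2 c (fps_X ^ n * V) (fps_X ^ m * W)) k = (\<Sum>(\<alpha>,\<beta>)\<in>{(\<alpha>,\<beta>). \<alpha> + \<beta> <= k}.
   c \<alpha> \<beta> * (if k < n * \<alpha> + m * \<beta> then 0 else fps_nth (V ^ \<alpha> * W ^ \<beta>) (k - (n * \<alpha> + m * \<beta>))))"
  unfolding subst2_def fps_nth_Abs_fps fps_weighted_power fps_X_power_mult_nth ..
 also have "\<dots> = (\<Sum>(\<alpha>,\<beta>)\<in>(\<Union>l\<in>{N..k}. ?P l). c \<alpha> \<beta> * fps_nth (V ^ \<alpha> * W ^ \<beta>) (k - (n * \<alpha> + m * \<beta>)))"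
 proof (rule sum.mono_neutral_cong)
  have le: "\<alpha> + \<beta> <= n * \<alpha> + m * \<beta>" for \<alpha> \<beta> using nm by (intro add_mono) auto
  show "finite {(\<alpha>::nat, \<beta>::nat). \<alpha> + \<beta> <= k}" by (rule finite_degree_le)
  show "finite (\<Union>l\<in>{N..k}. ?P l)" using finite_weight_eq[OF nm] by blast
  fix v :: "nat \<times> nat"
  obtain \<alpha> \<beta> where v: "v = (\<alpha>, \<beta>)" by (cases v)
  { assume "v \<in> (\<Union>l\<in>{N..k}. ?P l) - {(\<alpha>, \<beta>). \<alpha> + \<beta> <= k}"
   then show "(case v of (\<alpha>, \<beta>) => c \<alpha> \<beta> * fps_nth (V ^ \<alpha> * W ^ \<beta>) (k - (n * \<alpha> + m * \<beta>))) = 0"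
    using le[of \<alpha> \<beta>] unfolding v by auto }
  { assume "v \<in> {(\<alpha>, \<beta>). \<alpha> + \<beta> <= k} - (\<Union>l\<in>{N..k}. ?P l)"
   then show "(case v of (\<alpha>, \<beta>) => c \<alpha> \<beta> * (if k < n * \<alpha> + m * \<beta> then 0 else fps_nth (V ^ \<alpha> * W ^ \<beta>) (k - (n * \<alpha> + m * \<beta>)))) = 0"
    using c[of \<alpha> \<beta>] unfolding v by fastforce }
  { assume "v \<in> {(\<alpha>, \<beta>). \<alpha> + \<beta> <= k} \<inter> (\<Union>l\<in>{N..k}. ?P l)"
   then show "(case v of (\<alpha>, \<beta>) => c \<alpha> \<beta> * (if k < n * \<alpha> + m * \<beta> then 0 else fps_nth (V ^ \<alpha> * W ^ \<beta>) (k - (n * \<alpha> + m * \<beta>))))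
     = (case v of (\<alpha>, \<beta>) => c \<alpha> \<beta> * fps_nth (V ^ \<alpha> * W ^ \<beta>) (k - (n * \<alpha> + m * \<beta>)))"
    unfolding v by auto }
 qed
 also have "\<dots> = (\<Sum>l\<in>{N..k}. \<Sum>(\<alpha>,\<beta>)\<in>?P l. c \<alpha> \<beta> * fps_nth (V ^ \<alpha> * W ^ \<beta>) (k - (n * \<alpha> + m * \<beta>)))"
  using finite_weight_eq[OF nm] by (intro sum.UNION_disjoint) auto
 also have "\<dots> = (\<Sum>l\<in>{N..k}. \<Sum>(\<alpha>,\<beta>)\<in>?P l. c \<alpha> \<beta> * fps_nth (V ^ \<alpha> * W ^ \<beta>) (k - l))"
  by (intro sum.cong refl) auto
 finally show ?thesis .
qed

lemma subst2_lead:
 fixes V W :: "'k::comm_ring_1 fps"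
 assumes nm: "0 < n" "0 < m" and c: "\<And>\<alpha> \<beta>. c \<alpha> \<beta> ~= 0 ==> N <= n * \<alpha> + m * \<beta>"
 shows "k < N ==> fps_nth (subst2 c (fps_X ^ n * V) (fps_X ^ m * W)) k = 0"
  and "fps_nth (subst2 c (fps_X ^ n * V) (fps_X ^ m * W)) N
   = (\<Sum>(\<alpha>,\<beta>)\<in>{(\<alpha>,\<beta>). n * \<alpha> + m * \<beta> = N}. c \<alpha> \<beta> * fps_nth V 0 ^ \<alpha> * fps_nth W 0 ^ \<beta>)"
 using subst2_weighted_nth[OF assms, where V = V and W = W and k = k]
  subst2_weighted_nth[OF assms, where V = V and W = W and k = N]
 by (simp_all add: fps_power_nth_0 mult.assoc)

text \<open>The range ends at \<open>s\<close> instead of \<alpha>: powers U^j with j > s vanish in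
  degree \<open>s\<close>, and binomials with j > \<alpha> are 0. A range independent of \<alpha>
  permits the later exchange of sums.\<close>

lemma fps_const_add_power_nth:
 fixes U :: "'k::comm_ring_1 fps"
 assumes "fps_nth U 0 = 0"
 shows "fps_nth ((fps_const v + U) ^ \<alpha>) s = (\<Sum>j\<le>s. of_nat (\<alpha> choose j) * v ^ (\<alpha> - j) * fps_nth (U ^ j) s)"
proof -
 have "(fps_const v + U) ^ \<alpha> = (U + fps_const v) ^ \<alpha>" by (simp only: add.commute)
 also have "\<dots> = (\<Sum>j\<le>\<alpha>. of_nat (\<alpha> choose j) * U ^ j * fps_const v ^ (\<alpha> - j))" by (rule binomial_ring)
 finally have "fps_nth ((fps_const v + U) ^ \<alpha>) s = (\<Sum>j\<le>\<alpha>. fps_nth (of_nat (\<alpha> choose j) * U ^ j * fps_const v ^ (\<alpha> - j)) s)"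
  by (simp only: fps_sum_nth)
 also have "\<dots> = (\<Sum>j\<le>\<alpha>. of_nat (\<alpha> choose j) * v ^ (\<alpha> - j) * fps_nth (U ^ j) s)"
  by (intro sum.cong refl) (simp add: fps_const_power fps_of_nat[symmetric] del: fps_of_nat)
 also have "\<dots> = (\<Sum>j\<le>s. of_nat (\<alpha> choose j) * v ^ (\<alpha> - j) * fps_nth (U ^ j) s)"
 proof (rule sum.mono_neutral_cong)
  fix j assume "j \<in> {..\<alpha>} - {..s}"
  then have "fps_nth (U ^ j) s = 0" using startsby_zero_power_prefix[OF assms] by simp
  then show "of_nat (\<alpha> choose j) * v ^ (\<alpha> - j) * fps_nth (U ^ j) s = 0" by simp
 qed (simp_all add: binomial_eq_0)
 finally show ?thesis .
qed

lemma binomial_partial_sum_le: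
 fixes a b :: real
 assumes "0 <= a" "0 <= b"
 shows "(\<Sum>j\<le>K. of_nat (\<alpha> choose j) * a ^ (\<alpha> - j) * b ^ j) <= (a + b) ^ \<alpha>"
proof -
 have "(\<Sum>j\<le>K. of_nat (\<alpha> choose j) * a ^ (\<alpha> - j) * b ^ j) <= (\<Sum>j\<le>max K \<alpha>. of_nat (\<alpha> choose j) * a ^ (\<alpha> - j) * b ^ j)"
  using assms by (intro sum_mono2) auto
 also have "\<dots> = (\<Sum>j\<le>\<alpha>. of_nat (\<alpha> choose j) * a ^ (\<alpha> - j) * b ^ j)"
  by (rule sum.mono_neutral_right) auto
 also have "\<dots> = (b + a) ^ \<alpha>" unfolding binomial_ring by (intro sum.cong refl) (simp add: mult_ac)
 finally show ?thesis by (simp add: add.commute)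
qed

text \<open>The coefficient of e^i u^j in e^(-N) G(e^n (v + u), e^m w): \<open>i\<close> is the
  excess of the weight over N, and the binomial term expands (v + u)^\<alpha>.\<close>

definition weighted_coeff :: "nat => nat => nat => (nat => nat => 'k::comm_ring_1) => 'k => 'k => nat => nat => 'k" where
 "weighted_coeff n m N c v w i j = (\<Sum>(\<alpha>,\<beta>)\<in>{(\<alpha>,\<beta>). n * \<alpha> + m * \<beta> = N + i}.
   c \<alpha> \<beta> * w ^ \<beta> * (of_nat (\<alpha> choose j) * v ^ (\<alpha> - j)))"

lemma subst2_weighted_coeff:
 fixes U :: "'k::comm_ring_1 fps"
 assumes nm: "0 < n" "0 < m" and c: "\<And>\<alpha> \<beta>. c \<alpha> \<beta> ~= 0 ==> N <= n * \<alpha> + m * \<beta>" and U: "fps_nth U 0 = 0"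
 shows "fps_nth (subst2 c (fps_X ^ n * (fps_const v + U)) (fps_X ^ m * fps_const w)) (N + k)
  = fps_nth (subst2 (weighted_coeff n m N c v w) fps_X U) k"
proof -
 let ?P = "%l. {(\<alpha>::nat, \<beta>::nat). n * \<alpha> + m * \<beta> = l}"
 let ?d = "weighted_coeff n m N c v w"
 have nthc: "fps_nth ((fps_const v + U) ^ \<alpha> * fps_const w ^ \<beta>) s
   = w ^ \<beta> * (\<Sum>j\<le>s. of_nat (\<alpha> choose j) * v ^ (\<alpha> - j) * fps_nth (U ^ j) s)" for \<alpha> \<beta> s
  by (simp add: fps_const_power fps_const_add_power_nth[OF U] mult.commute)
 have "fps_nth (subst2 c (fps_X ^ n * (fps_const v + U)) (fps_X ^ m * fps_const w)) (N + k)
   = (\<Sum>l\<in>{N..N+k}. \<Sum>(\<alpha>,\<beta>)\<in>?P l. c \<alpha> \<beta> * fps_nth ((fps_const v + U) ^ \<alpha> * fps_const w ^ \<beta>) (N + k - l))"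
  by (rule subst2_weighted_nth[OF nm c])
 also have "\<dots> = (\<Sum>i\<le>k. \<Sum>(\<alpha>,\<beta>)\<in>?P (N + i). c \<alpha> \<beta> * fps_nth ((fps_const v + U) ^ \<alpha> * fps_const w ^ \<beta>) (k - i))"
  by (rule sum.reindex_bij_witness[of _ "%i. N + i" "%l. l - N"]) (auto simp: add.commute)
 also have "\<dots> = (\<Sum>i\<le>k. \<Sum>j\<le>k-i. ?d i j * fps_nth (U ^ j) (k - i))"
 proof (intro sum.cong refl)
  fix i
  have "(\<Sum>(\<alpha>,\<beta>)\<in>?P (N + i). c \<alpha> \<beta> * fps_nth ((fps_const v + U) ^ \<alpha> * fps_const w ^ \<beta>) (k - i))
    = (\<Sum>x\<in>?P (N + i). \<Sum>j\<le>k-i. c (fst x) (snd x) * w ^ snd x * (of_nat (fst x choose j) * v ^ (fst x - j)) * fps_nth (U ^ j) (k - i))"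
   unfolding nthc by (intro sum.cong refl) (auto simp: sum_distrib_left mult.assoc case_prod_beta)
  also have "\<dots> = (\<Sum>j\<le>k-i. \<Sum>x\<in>?P (N + i). c (fst x) (snd x) * w ^ snd x * (of_nat (fst x choose j) * v ^ (fst x - j)) * fps_nth (U ^ j) (k - i))"
   by (rule sum.swap)
  also have "\<dots> = (\<Sum>j\<le>k-i. ?d i j * fps_nth (U ^ j) (k - i))"
   unfolding weighted_coeff_def sum_distrib_right by (simp add: case_prod_beta)
  finally show "(\<Sum>(\<alpha>,\<beta>)\<in>?P (N + i). c \<alpha> \<beta> * fps_nth ((fps_const v + U) ^ \<alpha> * fps_const w ^ \<beta>) (k - i))
    = (\<Sum>j\<le>k-i. ?d i j * fps_nth (U ^ j) (k - i))" .
 qed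
 also have "\<dots> = (\<Sum>(i,j)\<in>(SIGMA i:{..k}. {..k-i}). ?d i j * fps_nth (U ^ j) (k - i))"
  by (rule sum.Sigma) auto
 also have "(SIGMA i:{..k}. {..k-i}) = {(i, j). i + j <= k}" by auto
 also have "(\<Sum>(i,j)\<in>{(i, j). i + j <= k}. ?d i j * fps_nth (U ^ j) (k - i)) = fps_nth (subst2 ?d fps_X U) k"
  unfolding subst2_def fps_nth_Abs_fps fps_X_power_mult_nth by (intro sum.cong refl) auto
 finally show ?thesis .
qed

text \<open>Used with \<open>k\<close> minus the inverse of the linear coefficient, it turns a zero
  problem into a fixed point problem without linear term.\<close>

lemma subst2_add_linear:
 fixes U :: "'k::comm_ring_1 fps"
 assumes U: "fps_nth U 0 = 0"
 shows "subst2 (%i j. (if i = 0 \<and> j = Suc 0 then 1 else 0) + k * d i j) fps_X U = U + fps_const k * subst2 d fps_X U"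
proof (rule fps_ext)
 fix l
 let ?S = "{..Suc l} \<times> {..Suc l}"
 have S: "{(\<alpha>, \<beta>). \<alpha> + \<beta> <= l} \<subseteq> ?S" by auto
 have "fps_nth (subst2 (%i j. (if i = 0 \<and> j = Suc 0 then 1 else 0) + k * d i j) fps_X U) l
   = (\<Sum>(i,j)\<in>?S. ((if i = 0 \<and> j = Suc 0 then 1 else 0) + k * d i j) * fps_nth (fps_X ^ i * U ^ j) l)"
  by (rule subst2_nth) (use S U in auto)
 also have "\<dots> = (\<Sum>x\<in>?S. (if x = (0, Suc 0) then fps_nth U l else 0)) + k * (\<Sum>(i,j)\<in>?S. d i j * fps_nth (fps_X ^ i * U ^ j) l)"
  unfolding sum_distrib_left sum.distrib[symmetric]
 proof (intro sum.cong refl)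
  fix x :: "nat \<times> nat"
  obtain i j where x: "x = (i, j)" by (cases x)
  show "(case x of (i, j) => ((if i = 0 \<and> j = Suc 0 then 1 else 0) + k * d i j) * fps_nth (fps_X ^ i * U ^ j) l)
    = (if x = (0, Suc 0) then fps_nth U l else 0) + k * (case x of (i, j) => d i j * fps_nth (fps_X ^ i * U ^ j) l)"
   by (cases "i = 0 \<and> j = Suc 0") (auto simp: x algebra_simps)
 qed
 also have "(\<Sum>x\<in>?S. (if x = (0, Suc 0) then fps_nth U l else 0)) = fps_nth U l" by (simp add: sum.delta)
 also have "(\<Sum>(i,j)\<in>?S. d i j * fps_nth (fps_X ^ i * U ^ j) l) = fps_nth (subst2 d fps_X U) l"
  by (rule subst2_nth[symmetric]) (use S U in auto)
 finally show "fps_nth (subst2 (%i j. (if i = 0 \<and> j = Suc 0 then 1 else 0) + k * d i j) fps_X U) l = fps_nth (U + fps_const k * subst2 d fps_X U) l"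
  by simp
qed

text \<open>For weight N + i the degree \<alpha> + \<beta> is at most N + i, so
  \<open>\<theta> ^ i\<close> is at most
  \<open>\<theta> ^ (\<alpha> + \<beta>) / \<theta> ^ N\<close>. The binomial sum is at most (norm v
  + \<theta>)^\<alpha>, and \<theta> is small enough for the norms of v and w to be absorbed into
  \<rho>.\<close>

lemma weighted_coeff_bound:
 fixes c :: "nat => nat => 'k :: {real_normed_field, euclidean_space}"
 assumes nm: "0 < n" "0 < m" and conv: "convergent_series (series_of c)"
 shows "\<exists>\<theta>>0. \<exists>B. \<forall>K. (\<Sum>(i,j)\<in>{..K}\<times>{..K}. norm (weighted_coeff n m N c v w i j) * \<theta> ^ (i + j)) <= B"
proof -
 let ?P = "%l. {(\<alpha>::nat, \<beta>::nat). n * \<alpha> + m * \<beta> = l}"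
 obtain \<rho> B where \<rho>: "\<rho> > 0" "\<And>K. nrm \<rho> K (series_of c) <= B" using conv unfolding convergent_series_iff by blast
 define \<theta> where "\<theta> = min 1 (\<rho> / (norm v + norm w + 1))"
 have den: "0 < norm v + norm w + 1" by (smt (verit) norm_ge_zero)
 have \<theta>: "0 < \<theta>" "\<theta> <= 1" using \<rho> den by (auto simp: \<theta>_def)
 have "\<theta> <= \<rho> / (norm v + norm w + 1)" unfolding \<theta>_def by (rule min.cobounded2)
 then have th: "\<theta> * (norm v + norm w + 1) <= \<rho>" using den by (simp only: pos_le_divide_eq)
 have thv: "\<theta> * (norm v + \<theta>) <= \<rho>"
 proof -
  have "\<theta> * (norm v + \<theta>) <= \<theta> * (norm v + norm w + 1)" using \<theta> norm_ge_zero[of w] by (intro mult_left_mono) linarith+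
  then show ?thesis using th by linarith
 qed
 have thw: "\<theta> * norm w <= \<rho>"
 proof -
  have "\<theta> * norm w <= \<theta> * (norm v + norm w + 1)" using \<theta> by (intro mult_left_mono) auto
  then show ?thesis using th by linarith
 qed
 have single: "norm (c \<alpha> \<beta>) * norm w ^ \<beta> * (\<Sum>j\<le>K. of_nat (\<alpha> choose j) * norm v ^ (\<alpha> - j) * \<theta> ^ j) * \<theta> ^ i
   <= (norm (c \<alpha> \<beta>) * \<rho> ^ (\<alpha> + \<beta>)) / \<theta> ^ N" if ab: "n * \<alpha> + m * \<beta> = N + i" for \<alpha> \<beta> i K
 proof -
  have "\<alpha> <= n * \<alpha>" "\<beta> <= m * \<beta>" using nm by auto
  then have "\<theta> ^ (N + i) <= \<theta> ^ (\<alpha> + \<beta>)" using \<theta> ab by (intro power_decreasing) linarith+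
  then have p: "\<theta> ^ i <= \<theta> ^ (\<alpha> + \<beta>) / \<theta> ^ N" using \<theta> by (simp add: pos_le_divide_eq power_add mult.commute)
  have "norm w ^ \<beta> * (\<Sum>j\<le>K. of_nat (\<alpha> choose j) * norm v ^ (\<alpha> - j) * \<theta> ^ j) * \<theta> ^ i
    <= norm w ^ \<beta> * (norm v + \<theta>) ^ \<alpha> * (\<theta> ^ (\<alpha> + \<beta>) / \<theta> ^ N)"
   using \<theta> by (intro mult_mono p binomial_partial_sum_le mult_left_mono mult_nonneg_nonneg) auto
  also have "\<dots> = ((\<theta> * norm w) ^ \<beta> * (\<theta> * (norm v + \<theta>)) ^ \<alpha>) / \<theta> ^ N"
   by (simp add: power_mult_distrib power_add)
  also have "\<dots> <= (\<rho> ^ \<beta> * \<rho> ^ \<alpha>) / \<theta> ^ N"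
   using \<theta> \<rho> by (intro divide_right_mono mult_mono power_mono thv thw) auto
  also have "\<dots> = \<rho> ^ (\<alpha> + \<beta>) / \<theta> ^ N" by (simp add: power_add)
  finally have "norm (c \<alpha> \<beta>) * (norm w ^ \<beta> * (\<Sum>j\<le>K. of_nat (\<alpha> choose j) * norm v ^ (\<alpha> - j) * \<theta> ^ j) * \<theta> ^ i)
   <= norm (c \<alpha> \<beta>) * (\<rho> ^ (\<alpha> + \<beta>) / \<theta> ^ N)" by (intro mult_left_mono) auto
  then show ?thesis by (simp only: mult.assoc times_divide_eq_right)
 qed
 have row: "(\<Sum>j\<le>K. norm (weighted_coeff n m N c v w i j) * \<theta> ^ (i + j)) <= (\<Sum>x\<in>?P (N + i). norm (c (fst x) (snd x)) * \<rho> ^ (fst x + snd x)) / \<theta> ^ N" for i K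
 proof -
  have "(\<Sum>j\<le>K. norm (weighted_coeff n m N c v w i j) * \<theta> ^ (i + j))
    <= (\<Sum>j\<le>K. (\<Sum>x\<in>?P (N + i). norm (c (fst x) (snd x)) * norm w ^ snd x * (of_nat (fst x choose j) * norm v ^ (fst x - j))) * \<theta> ^ (i + j))"
   using \<theta> unfolding weighted_coeff_def
   by (intro sum_mono mult_right_mono order_trans[OF norm_sum]) (auto simp: norm_mult norm_power case_prod_beta)
  also have "\<dots> = (\<Sum>x\<in>?P (N + i). \<Sum>j\<le>K. norm (c (fst x) (snd x)) * norm w ^ snd x * (of_nat (fst x choose j) * norm v ^ (fst x - j)) * \<theta> ^ (i + j))"
   unfolding sum_distrib_right by (rule sum.swap)
  also have "\<dots> = (\<Sum>x\<in>?P (N + i). norm (c (fst x) (snd x)) * norm w ^ snd x * (\<Sum>j\<le>K. of_nat (fst x choose j) * norm v ^ (fst x - j) * \<theta> ^ j) * \<theta> ^ i)"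
   unfolding sum_distrib_left sum_distrib_right power_add by (simp only: mult_ac)
  also have "\<dots> <= (\<Sum>x\<in>?P (N + i). (norm (c (fst x) (snd x)) * \<rho> ^ (fst x + snd x)) / \<theta> ^ N)"
   by (intro sum_mono single) auto
  finally show ?thesis by (simp only: sum_divide_distrib)
 qed
 have "(\<Sum>(i,j)\<in>{..K}\<times>{..K}. norm (weighted_coeff n m N c v w i j) * \<theta> ^ (i + j)) <= B / \<theta> ^ N" for K
 proof -
  have "(\<Sum>(i,j)\<in>{..K}\<times>{..K}. norm (weighted_coeff n m N c v w i j) * \<theta> ^ (i + j))
    = (\<Sum>i\<le>K. \<Sum>j\<le>K. norm (weighted_coeff n m N c v w i j) * \<theta> ^ (i + j))"
   by (rule sum.cartesian_product[symmetric])
  also have "\<dots> <= (\<Sum>i\<le>K. (\<Sum>x\<in>?P (N + i). norm (c (fst x) (snd x)) * \<rho> ^ (fst x + snd x)) / \<theta> ^ N)"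
   by (intro sum_mono row)
  also have "\<dots> = (\<Sum>i\<le>K. \<Sum>x\<in>?P (N + i). norm (c (fst x) (snd x)) * \<rho> ^ (fst x + snd x)) / \<theta> ^ N"
   by (simp only: sum_divide_distrib)
  also have "(\<Sum>i\<le>K. \<Sum>x\<in>?P (N + i). norm (c (fst x) (snd x)) * \<rho> ^ (fst x + snd x))
   = (\<Sum>x\<in>(\<Union>i\<le>K. ?P (N + i)). norm (c (fst x) (snd x)) * \<rho> ^ (fst x + snd x))"
   using finite_weight_eq[OF nm] by (intro sum.UNION_disjoint[symmetric]) auto
  also have "\<dots> <= (\<Sum>x\<in>{..N+K}\<times>{..N+K}. norm (c (fst x) (snd x)) * \<rho> ^ (fst x + snd x))"
  proof (rule sum_mono2)
   show "(\<Union>i\<le>K. ?P (N + i)) \<subseteq> {..N+K}\<times>{..N+K}"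
   proof
    fix x assume "x \<in> (\<Union>i\<le>K. ?P (N + i))"
    then obtain i \<alpha> \<beta> where 1: "x = (\<alpha>, \<beta>)" "i <= K" "n * \<alpha> + m * \<beta> = N + i" by blast
    have le: "\<alpha> <= n * \<alpha>" "\<beta> <= m * \<beta>" using nm by auto
    have "\<alpha> <= N + K" using le 1(2,3) by linarith
    moreover have "\<beta> <= N + K" using le 1(2,3) by linarith
    ultimately show "x \<in> {..N+K}\<times>{..N+K}" unfolding 1(1) by simp
   qed
  qed (use \<rho> in auto)
  also have "\<dots> = nrm \<rho> (N + K) (series_of c)" unfolding nrm_eq by (simp add: case_prod_beta series_of_def)
  also have "\<dots> <= B" by (rule \<rho>(2))
  finally show ?thesis using \<theta> by (simp add: divide_right_mono)
 qed
 then show ?thesis using \<theta> by blast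
qed

lemma weighted_implicit:
 fixes c :: "nat => nat => 'k :: {real_normed_field, euclidean_space}"
 assumes nm: "0 < n" "0 < m" and c: "\<And>\<alpha> \<beta>. c \<alpha> \<beta> ~= 0 ==> N <= n * \<alpha> + m * \<beta>"
  and root: "(\<Sum>(\<alpha>,\<beta>)\<in>{(\<alpha>,\<beta>). n * \<alpha> + m * \<beta> = N}. c \<alpha> \<beta> * v ^ \<alpha> * w ^ \<beta>) = 0"
  and simple: "(\<Sum>(\<alpha>,\<beta>)\<in>{(\<alpha>,\<beta>). n * \<alpha> + m * \<beta> = N}. of_nat \<alpha> * c \<alpha> \<beta> * v ^ (\<alpha> - 1) * w ^ \<beta>) ~= 0"
 defines "Z \<equiv> %U. subst2 c (fps_X ^ n * (fps_const v + U)) (fps_X ^ m * fps_const w)"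
 shows "fps_nth U 0 = 0 ==> fps_nth U' 0 = 0 ==> Z U = 0 ==> Z U' = 0 ==> U = U'"
  and "convergent_series (series_of c) ==> \<exists>U. fps_nth U 0 = 0 \<and> fps_conv_radius U > 0 \<and> Z U = 0"
proof -
 define d where "d = weighted_coeff n m N c v w"
 \<comment> \<open>A Newton step with frozen derivative: u minus the equation divided by its
   coefficient of u, which is nonzero by simplicity of the root. Thus \<open>e\<close> has neither a
   constant term nor a pure linear term in u.\<close>
 define e where "e = (%i j. (if i = 0 \<and> j = Suc 0 then 1 else 0) + (- inverse (d 0 (Suc 0))) * d i j)"
 have d00: "d 0 0 = 0" unfolding d_def weighted_coeff_def using root by (simp add: mult_ac case_prod_beta)
 have d01: "d 0 (Suc 0) ~= 0" unfolding d_def weighted_coeff_def using simple by (simp add: mult_ac case_prod_beta)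
 have e0: "e 0 0 = 0" "e 0 (Suc 0) = 0" unfolding e_def using d00 d01 by simp_all
 have fix_iff: "subst2 e fps_X U = U \<longleftrightarrow> Z U = 0" if U: "fps_nth U 0 = 0" for U
 proof -
  have "Z U = 0 \<longleftrightarrow> subst2 d fps_X U = 0"
  proof
   assume Z: "Z U = 0"
   show "subst2 d fps_X U = 0"
    by (rule fps_ext) (simp add: d_def subst2_weighted_coeff[OF nm c U, symmetric] Z[unfolded Z_def])
  next
   assume Z: "subst2 d fps_X U = 0"
   show "Z U = 0"
   proof (rule fps_ext)
    fix k show "fps_nth (Z U) k = fps_nth 0 k"
    proof (cases "k < N")
     case True
     then show ?thesis unfolding Z_def using subst2_lead(1)[OF nm c] by simp
    next
     case False
     then have "k = N + (k - N)" by simp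
     then show ?thesis unfolding Z_def
      using subst2_weighted_coeff[OF nm c U, where v = v and w = w and k = "k - N"] Z[unfolded d_def] by simp
    qed
   qed
  qed
  moreover have "subst2 e fps_X U = U + fps_const (- inverse (d 0 (Suc 0))) * subst2 d fps_X U"
   unfolding e_def by (rule subst2_add_linear[OF U])
  ultimately show ?thesis using d01 by simp
 qed
 { assume "fps_nth U 0 = 0" "fps_nth U' 0 = 0" "Z U = 0" "Z U' = 0"
  with subst2_fixpoint_unique[where e = e, OF e0] fix_iff show "U = U'" by blast }
 assume conv: "convergent_series (series_of c)"
 obtain \<theta> B where \<theta>: "\<theta> > 0" "\<And>K. (\<Sum>(i,j)\<in>{..K}\<times>{..K}. norm (d i j) * \<theta> ^ (i + j)) <= B"
  unfolding d_def using weighted_coeff_bound[OF nm conv] by blast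
 have "nrm \<theta> K (series_of e) <= inverse (norm (d 0 (Suc 0))) * B" for K
 proof -
  have "norm (e i j) <= inverse (norm (d 0 (Suc 0))) * norm (d i j)" for i j
   using d01 by (auto simp: e_def norm_mult norm_inverse)
  then have "nrm \<theta> K (series_of e) <= (\<Sum>x\<in>{..K}\<times>{..K}. inverse (norm (d 0 (Suc 0))) * norm (d (fst x) (snd x)) * \<theta> ^ (fst x + snd x))"
   unfolding nrm_eq series_of_def case_prod_beta fps_nth_Abs_fps using \<theta> by (intro sum_mono mult_right_mono) auto
  also have "\<dots> = inverse (norm (d 0 (Suc 0))) * (\<Sum>(i,j)\<in>{..K}\<times>{..K}. norm (d i j) * \<theta> ^ (i + j))"
   by (simp add: sum_distrib_left mult.assoc case_prod_beta)
  also have "\<dots> <= inverse (norm (d 0 (Suc 0))) * B" by (intro mult_left_mono \<theta>(2)) auto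
  finally show ?thesis .
 qed
 then have "convergent_series (series_of e)" unfolding convergent_series_iff using \<theta>(1) by blast
 from subst2_fixpoint_exists[where e = e, OF e0 this] fix_iff
 show "\<exists>U. fps_nth U 0 = 0 \<and> fps_conv_radius U > 0 \<and> Z U = 0" by blast
qed

section \<open>Leading forms and regularity of curves\<close>

lemma has_fps_expansion_subdegree:
 fixes F :: "'k :: {real_normed_field, euclidean_space} fps"
 assumes f: "f has_fps_expansion F" and d: "d <= subdegree F"
 shows "\<exists>h. (h \<longlongrightarrow> fps_nth F d) (at 0) \<and> (\<forall>\<^sub>F \<epsilon> in at 0. f \<epsilon> = \<epsilon> ^ d * h \<epsilon>)"
proof (intro exI conjI)
 let ?H = "fps_shift d F"
 have R: "fps_conv_radius F > 0" and ev: "\<forall>\<^sub>F z in nhds 0. eval_fps F z = f z"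
  using f unfolding has_fps_expansion_def by auto
 have "isCont (eval_fps ?H) 0" by (rule continuous_eval_fps) (use R in \<open>simp add: zero_ereal_def\<close>)
 then show "(eval_fps ?H \<longlongrightarrow> fps_nth F d) (at 0)" unfolding isCont_def by (simp add: eval_fps_at_0)
 have "\<forall>\<^sub>F z in nhds (0::'k). z \<in> eball 0 (fps_conv_radius F)"
  by (rule eventually_nhds_in_open) (use R in \<open>simp_all add: zero_ereal_def\<close>)
 then have "\<forall>\<^sub>F z in nhds 0. z ~= 0 --> f z = z ^ d * eval_fps ?H z"
  using ev by eventually_elim (auto simp: eval_fps_shift[OF d] in_eball_iff)
 then show "\<forall>\<^sub>F \<epsilon> in at 0. f \<epsilon> = \<epsilon> ^ d * eval_fps ?H \<epsilon>" unfolding eventually_at_filter by simp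
qed

text \<open>If a coefficient below \<open>k\<close> survived, division by the lowest power present
  would leave a function with nonzero limit that is bounded by a positive power of the
  parameter.\<close>

lemma bigo_fps_expansion_iff:
 fixes F :: "'k :: {real_normed_field, euclidean_space} fps"
 assumes f: "f has_fps_expansion F"
 shows "f \<in> O[at 0](%\<epsilon>. \<epsilon> ^ k) \<longleftrightarrow> (\<forall>j<k. fps_nth F j = 0)"
proof
 assume "\<forall>j<k. fps_nth F j = 0"
 show "f \<in> O[at 0](%\<epsilon>. \<epsilon> ^ k)"
 proof (cases "F = 0")
  case True
  then have "\<forall>\<^sub>F z in nhds 0. f z = 0" using f unfolding has_fps_expansion_def by (auto elim: eventually_mono)
  then have "\<forall>\<^sub>F z in at 0. f z = 0" unfolding eventually_at_filter by eventually_elim simp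
  then have "f \<in> O[at 0](%\<epsilon>. \<epsilon> ^ k) \<longleftrightarrow> (%_. 0) \<in> O[at 0](%\<epsilon>::'k. \<epsilon> ^ k)" by (rule landau_o.big.in_cong)
  then show ?thesis by simp
 next
  case False
  then have "k <= subdegree F" using \<open>\<forall>j<k. fps_nth F j = 0\<close> subdegree_geI by blast
  from has_fps_expansion_subdegree[OF f this] obtain h where
   h: "(h \<longlongrightarrow> fps_nth F k) (at 0)" "\<forall>\<^sub>F \<epsilon> in at 0. f \<epsilon> = \<epsilon> ^ k * h \<epsilon>" by blast
  have "h \<in> O[at 0](%_. 1)" by (rule bigoI_tendsto[where c = "fps_nth F k"]) (use h(1) in auto)
  then have "(%\<epsilon>. \<epsilon> ^ k * h \<epsilon>) \<in> O[at 0](%\<epsilon>. \<epsilon> ^ k * 1)" by (intro landau_o.big.mult) auto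
  moreover have "f \<in> O[at 0](%\<epsilon>. \<epsilon> ^ k) \<longleftrightarrow> (%\<epsilon>. \<epsilon> ^ k * h \<epsilon>) \<in> O[at 0](%\<epsilon>. \<epsilon> ^ k)" using h(2) by (rule landau_o.big.in_cong)
  ultimately show ?thesis by simp
 qed
next
 assume O: "f \<in> O[at 0](%\<epsilon>. \<epsilon> ^ k)"
 show "\<forall>j<k. fps_nth F j = 0"
 proof (rule ccontr)
  assume "\<not> (\<forall>j<k. fps_nth F j = 0)"
  then obtain j where j: "j < k" "fps_nth F j ~= 0" by blast
  define d where "d = subdegree F"
  have dk: "d < k" using j subdegree_leI[of F j] by (simp add: d_def)
  have "F ~= 0" using j by auto
  then have Fd: "fps_nth F d ~= 0" unfolding d_def by (rule nth_subdegree_nonzero)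
  obtain h where h: "(h \<longlongrightarrow> fps_nth F d) (at 0)" "\<forall>\<^sub>F \<epsilon> in at 0. f \<epsilon> = \<epsilon> ^ d * h \<epsilon>"
   using has_fps_expansion_subdegree[OF f, of d] d_def by blast
  obtain C where C: "\<forall>\<^sub>F \<epsilon> in at 0. norm (f \<epsilon>) <= C * norm (\<epsilon> ^ k)" using O by (elim landau_o.bigE)
  have "\<forall>\<^sub>F \<epsilon>::'k in at 0. \<epsilon> ~= 0" by (simp add: eventually_at_filter)
  with C h(2) have "\<forall>\<^sub>F \<epsilon> in at 0. norm (h \<epsilon>) <= C * norm \<epsilon> ^ (k - d)"
  proof eventually_elim
   case (elim \<epsilon>)
   have "norm \<epsilon> ^ k = norm \<epsilon> ^ d * norm \<epsilon> ^ (k - d)" using dk by (simp add: power_add[symmetric])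
   then have "norm \<epsilon> ^ d * norm (h \<epsilon>) <= norm \<epsilon> ^ d * (C * norm \<epsilon> ^ (k - d))"
    using elim by (simp add: norm_mult norm_power mult_ac)
   then show ?case using elim by simp
  qed
  moreover have "((%\<epsilon>::'k. C * norm \<epsilon> ^ (k - d)) \<longlongrightarrow> C * norm (0::'k) ^ (k - d)) (at 0)" by (intro tendsto_intros)
  ultimately have "norm (fps_nth F d) <= C * norm (0::'k) ^ (k - d)"
   using tendsto_norm[OF h(1)] by (intro tendsto_le[of "at (0::'k)"]) auto
  then show False using Fd dk by (simp add: power_0_left)
 qed
qed

lemma has_fps_expansion_zero_imp:
 fixes F :: "'k :: {real_normed_field, euclidean_space} fps"
 assumes "f has_fps_expansion F" "\<forall>\<^sub>F \<epsilon> in nhds 0. f \<epsilon> = 0"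
 shows "F = 0"
proof (rule fps_ext)
 fix k
 have "\<forall>\<^sub>F \<epsilon> in at 0. f \<epsilon> = 0" using assms(2) unfolding eventually_at_filter by eventually_elim simp
 then have "f \<in> O[at 0](%\<epsilon>. \<epsilon> ^ Suc k) \<longleftrightarrow> (%_. 0) \<in> O[at 0](%\<epsilon>::'k. \<epsilon> ^ Suc k)" by (rule landau_o.big.in_cong)
 then show "fps_nth F k = fps_nth 0 k" using bigo_fps_expansion_iff[OF assms(1), of "Suc k"] by simp
qed

lemma solution_curve_iff:
 fixes G :: "'k :: {real_normed_field, euclidean_space} \<times> 'k => 'k"
 assumes G: "has_power_series_at_0 G c"
 shows "solution_curve G z \<longleftrightarrow> fps_conv_radius (fst z) > 0 \<and> fps_conv_radius (snd z) > 0 \<and>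
   fps_nth (fst z) 0 = 0 \<and> fps_nth (snd z) 0 = 0 \<and> subst2 c (fst z) (snd z) = 0"
proof -
 have "(\<forall>\<^sub>F \<epsilon> in nhds 0. G (curve_at z \<epsilon>) = 0) \<longleftrightarrow> subst2 c (fst z) (snd z) = 0"
  if z: "fps_conv_radius (fst z) > 0" "fps_nth (fst z) 0 = 0" "fps_conv_radius (snd z) > 0" "fps_nth (snd z) 0 = 0"
 proof -
  have e: "(%\<epsilon>. G (curve_at z \<epsilon>)) has_fps_expansion subst2 c (fst z) (snd z)"
   using has_fps_expansion_subst2[OF G z] by simp
  show ?thesis
  proof
   assume "subst2 c (fst z) (snd z) = 0"
   then show "\<forall>\<^sub>F \<epsilon> in nhds 0. G (curve_at z \<epsilon>) = 0"
    using e unfolding has_fps_expansion_def by (auto elim: eventually_mono)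
  qed (rule has_fps_expansion_zero_imp[OF e])
 qed
 then show ?thesis unfolding solution_curve_def by auto
qed

text \<open>The coefficient form of \<open>leading_form\<close>. One component is an exact monomial,
  which fixes the parametrisation; this is what makes the curve unique for given v and w.\<close>

definition weighted_curve :: "nat => nat => 'k::comm_ring_1 => 'k => 'k fps \<times> 'k fps => bool" where
 "weighted_curve n m v w z \<longleftrightarrow> (\<exists>U. fps_nth U 0 = 0 \<and>
   z = (if n >= m then (fps_X ^ n * (fps_const v + U), fps_X ^ m * fps_const w)
    else (fps_X ^ n * fps_const v, fps_X ^ m * (fps_const w + U))))"

lemma weighted_curveE:
 assumes "weighted_curve n m v w z"
 obtains V W where "z = (fps_X ^ n * V, fps_X ^ m * W)" "fps_nth V 0 = v" "fps_nth W 0 = w"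
proof -
 obtain U where U: "fps_nth U 0 = 0" "z = (if n >= m then (fps_X ^ n * (fps_const v + U), fps_X ^ m * fps_const w)
    else (fps_X ^ n * fps_const v, fps_X ^ m * (fps_const w + U)))"
  using assms unfolding weighted_curve_def by blast
 show thesis
 proof (cases "n >= m")
  case True
  then show ?thesis using U by (intro that[of "fps_const v + U" "fps_const w"]) auto
 next
  case False
  then show ?thesis using U by (intro that[of "fps_const v" "fps_const w + U"]) auto
 qed
qed

lemma fps_X_power_mult_cases:
 fixes F :: "'k::comm_ring_1 fps"
 shows "(\<forall>j<Suc n. fps_nth (F - fps_X ^ n * fps_const v) j = 0) \<longleftrightarrow> (\<exists>U. fps_nth U 0 = 0 \<and> F = fps_X ^ n * (fps_const v + U))"
proof
 assume *: "\<forall>j<Suc n. fps_nth (F - fps_X ^ n * fps_const v) j = 0"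
 have "F = fps_X ^ n * (fps_const v + (fps_shift n F - fps_const v))"
 proof (rule fps_ext)
  fix k show "fps_nth F k = fps_nth (fps_X ^ n * (fps_const v + (fps_shift n F - fps_const v))) k"
   using *[rule_format, of k] by (cases "k < n") (auto simp: fps_X_power_mult_nth)
 qed
 moreover have "fps_nth (fps_shift n F - fps_const v) 0 = 0"
  using *[rule_format, of n] by (simp add: fps_X_power_mult_nth)
 ultimately show "\<exists>U. fps_nth U 0 = 0 \<and> F = fps_X ^ n * (fps_const v + U)" by blast
next
 assume "\<exists>U. fps_nth U 0 = 0 \<and> F = fps_X ^ n * (fps_const v + U)"
 then show "\<forall>j<Suc n. fps_nth (F - fps_X ^ n * fps_const v) j = 0"
  by (auto simp: fps_X_power_mult_nth less_Suc_eq)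
qed

lemma monomial_expansion:
 "(%\<epsilon>. \<epsilon> ^ n * v) has_fps_expansion (fps_X ^ n * fps_const (v :: 'k :: {real_normed_field, euclidean_space}))"
 by (intro fps_expansion_intros)

lemma eventually_monomial_iff:
 fixes F :: "'k :: {real_normed_field, euclidean_space} fps"
 assumes "fps_conv_radius F > 0"
 shows "(\<forall>\<^sub>F \<epsilon> in nhds 0. eval_fps F \<epsilon> = \<epsilon> ^ n * v) \<longleftrightarrow> F = fps_X ^ n * fps_const v"
proof
 assume ev: "\<forall>\<^sub>F \<epsilon> in nhds 0. eval_fps F \<epsilon> = \<epsilon> ^ n * v"
 have "(%\<epsilon>. eval_fps F \<epsilon> - \<epsilon> ^ n * v) has_fps_expansion (F - fps_X ^ n * fps_const v)"
  by (intro has_fps_expansion_diff eval_fps_has_fps_expansion monomial_expansion assms)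
 moreover have "\<forall>\<^sub>F \<epsilon> in nhds 0. eval_fps F \<epsilon> - \<epsilon> ^ n * v = 0" using ev by eventually_elim simp
 ultimately have "F - fps_X ^ n * fps_const v = 0" by (rule has_fps_expansion_zero_imp)
 then show "F = fps_X ^ n * fps_const v" by simp
next
 assume "F = fps_X ^ n * fps_const v"
 then show "\<forall>\<^sub>F \<epsilon> in nhds 0. eval_fps F \<epsilon> = \<epsilon> ^ n * v"
  using monomial_expansion[of n v] unfolding has_fps_expansion_def by auto
qed

lemma leading_form_iff:
 fixes z :: "'k :: {real_normed_field, euclidean_space} fps \<times> 'k fps"
 assumes z: "fps_conv_radius (fst z) > 0" "fps_conv_radius (snd z) > 0"
 shows "leading_form E v w z \<longleftrightarrow> weighted_curve (seg_n E) (seg_m E) v w z"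
proof -
 have O: "(%\<epsilon>. eval_fps F \<epsilon> - \<epsilon> ^ n * u) \<in> O[at 0](%\<epsilon>. \<epsilon> ^ (n + 1)) \<longleftrightarrow> (\<exists>U. fps_nth U 0 = 0 \<and> F = fps_X ^ n * (fps_const u + U))"
  if F: "fps_conv_radius F > 0" for F :: "'k fps" and n u
 proof -
  have "(%\<epsilon>. eval_fps F \<epsilon> - \<epsilon> ^ n * u) has_fps_expansion (F - fps_X ^ n * fps_const u)"
   by (intro has_fps_expansion_diff eval_fps_has_fps_expansion monomial_expansion F)
  from bigo_fps_expansion_iff[OF this, of "n + 1"] show ?thesis unfolding Suc_eq_plus1[symmetric] fps_X_power_mult_cases .
 qed
 obtain x y where xy: "z = (x, y)" by (cases z)
 show ?thesis
  using z unfolding leading_form_def weighted_curve_def Let_def xy fst_conv snd_conv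
  by (simp add: O[simplified] eventually_monomial_iff) blast
qed

lemma subst2_swap: "subst2 (%\<alpha> \<beta>. c \<beta> \<alpha>) Y X = subst2 c X Y"
 unfolding subst2_def
proof (intro arg_cong[of _ _ Abs_fps] ext)
 fix k
 show "(\<Sum>(\<alpha>, \<beta>)\<in>{(\<alpha>, \<beta>). \<alpha> + \<beta> <= k}. c \<beta> \<alpha> * fps_nth (Y ^ \<alpha> * X ^ \<beta>) k)
   = (\<Sum>(\<alpha>, \<beta>)\<in>{(\<alpha>, \<beta>). \<alpha> + \<beta> <= k}. c \<alpha> \<beta> * fps_nth (X ^ \<alpha> * Y ^ \<beta>) k)"
  by (rule sum.reindex_bij_witness[of _ prod.swap prod.swap]) (auto simp: mult.commute)
qed

text \<open>The quasi-homogeneous part of weight N; with an extra factor \<alpha> or \<beta> in the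
  coefficients it becomes the Euler derivative v d/dv or w d/dw of that part.\<close>

definition edge_form :: "nat => nat => nat => (nat => nat => 'k::comm_ring_1) => 'k => 'k => 'k" where
 "edge_form n m N c v w = (\<Sum>(\<alpha>,\<beta>)\<in>{(\<alpha>,\<beta>). n * \<alpha> + m * \<beta> = N}. c \<alpha> \<beta> * v ^ \<alpha> * w ^ \<beta>)"

lemma edge_form_swap: "edge_form m n N (%\<alpha> \<beta>. c \<beta> \<alpha>) w v = edge_form n m N c v w"
 unfolding edge_form_def
 by (rule sum.reindex_bij_witness[of _ prod.swap prod.swap]) (auto simp: mult_ac)

lemma edge_form_deriv:
 "v * (\<Sum>(\<alpha>,\<beta>)\<in>{(\<alpha>,\<beta>). n * \<alpha> + m * \<beta> = N}. of_nat \<alpha> * c \<alpha> \<beta> * v ^ (\<alpha> - 1) * w ^ \<beta>)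
   = edge_form n m N (%\<alpha> \<beta>. of_nat \<alpha> * c \<alpha> \<beta>) v w"
 unfolding edge_form_def sum_distrib_left
proof (intro sum.cong refl, clarify)
 fix \<alpha> \<beta>
 show "v * (of_nat \<alpha> * c \<alpha> \<beta> * v ^ (\<alpha> - 1) * w ^ \<beta>) = of_nat \<alpha> * c \<alpha> \<beta> * v ^ \<alpha> * w ^ \<beta>"
  by (cases \<alpha>) (auto simp: mult_ac)
qed

text \<open>The factor \<open>v\<close> restores the exponent lost by differentiation; terms with
  exponent 0 are missing on the left and vanish on the right.\<close>

lemma edge_form_partial:
 assumes "n <= N" "0 < n" "0 < m"
 shows "v * edge_form n m (N - n) (%\<alpha> \<beta>. of_nat (Suc \<alpha>) * c (Suc \<alpha>) \<beta>) v w = edge_form n m N (%\<alpha> \<beta>. of_nat \<alpha> * c \<alpha> \<beta>) v w"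
proof -
 have "v * edge_form n m (N - n) (%\<alpha> \<beta>. of_nat (Suc \<alpha>) * c (Suc \<alpha>) \<beta>) v w
   = (\<Sum>(\<alpha>,\<beta>)\<in>{(\<alpha>,\<beta>). n * \<alpha> + m * \<beta> = N - n}. of_nat (Suc \<alpha>) * c (Suc \<alpha>) \<beta> * v ^ Suc \<alpha> * w ^ \<beta>)"
  unfolding edge_form_def sum_distrib_left by (intro sum.cong refl) (auto simp: mult_ac)
 also have "\<dots> = (\<Sum>(\<alpha>,\<beta>)\<in>{(\<alpha>,\<beta>). n * \<alpha> + m * \<beta> = N \<and> \<alpha> ~= 0}. of_nat \<alpha> * c \<alpha> \<beta> * v ^ \<alpha> * w ^ \<beta>)"
 proof (rule sum.reindex_bij_witness[of _ "%(\<alpha>, \<beta>). (\<alpha> - 1, \<beta>)" "%(\<alpha>, \<beta>). (Suc \<alpha>, \<beta>)"])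
  fix x assume "x \<in> {(\<alpha>,\<beta>). n * \<alpha> + m * \<beta> = N \<and> \<alpha> ~= 0}"
  then obtain k \<beta> where "x = (Suc k, \<beta>)" "n * Suc k + m * \<beta> = N" by (cases x, cases "fst x") auto
  then show "(case x of (\<alpha>, \<beta>) => (\<alpha> - 1, \<beta>)) \<in> {(\<alpha>,\<beta>). n * \<alpha> + m * \<beta> = N - n}" by auto
 qed (use assms in auto)
 also have "\<dots> = edge_form n m N (%\<alpha> \<beta>. of_nat \<alpha> * c \<alpha> \<beta>) v w"
  unfolding edge_form_def
 proof (rule sum.mono_neutral_left)
  show "finite {(\<alpha>, \<beta>). n * \<alpha> + m * \<beta> = N}" using finite_weight_eq assms(2,3) by blast
 qed (auto intro!: Nat.gr0I)
 finally show ?thesis .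
qed

text \<open>The coefficients of G_x at N - n and of G_y at N - m, multiplied by v and w, are the two
  Euler derivatives assumed nonzero. Hence both orders are exact and the smaller one is the minimal
  degree.\<close>

lemma weighted_curve_regularity:
 fixes G :: "'k :: {real_normed_field, euclidean_space} \<times> 'k => 'k"
 assumes G: "has_power_series_at_0 G c"
  and nm: "0 < n" "0 < m" "n <= N" "m <= N" and c: "\<And>\<alpha> \<beta>. c \<alpha> \<beta> ~= 0 ==> N <= n * \<alpha> + m * \<beta>"
  and smooth: "edge_form n m N (%\<alpha> \<beta>. of_nat \<alpha> * c \<alpha> \<beta>) v w ~= 0" "edge_form n m N (%\<alpha> \<beta>. of_nat \<beta> * c \<alpha> \<beta>) v w ~= 0"
  and z: "weighted_curve n m v w z" "fps_conv_radius (fst z) > 0" "fps_conv_radius (snd z) > 0"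
 shows "has_minimal_regularity_degree G z (N - max n m)"
proof -
 obtain V W where VW: "z = (fps_X ^ n * V, fps_X ^ m * W)" "fps_nth V 0 = v" "fps_nth W 0 = w"
  using z(1) by (rule weighted_curveE)
 have z0: "fps_nth (fst z) 0 = 0" "fps_nth (snd z) 0 = 0" using nm by (simp_all add: VW)
 define cx where "cx = (%\<alpha> \<beta>. of_nat (Suc \<alpha>) * c (Suc \<alpha>) \<beta>)"
 define cy where "cy = (%\<alpha> \<beta>. of_nat (Suc \<beta>) * c \<alpha> (Suc \<beta>))"
 define P where "P = subst2 cx (fst z) (snd z)"
 define Q where "Q = subst2 cy (fst z) (snd z)"
 have P: "(%\<epsilon>. partial_x G (curve_at z \<epsilon>)) has_fps_expansion P"
  using has_fps_expansion_subst2[OF has_power_series_partial_x[OF G] z(2) z0(1) z(3) z0(2)] by (simp add: P_def cx_def)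
 have Q: "(%\<epsilon>. partial_y G (curve_at z \<epsilon>)) has_fps_expansion Q"
  using has_fps_expansion_subst2[OF has_power_series_partial_y[OF G] z(2) z0(1) z(3) z0(2)] by (simp add: Q_def cy_def)
 have cx: "N - n <= n * \<alpha> + m * \<beta>" if "cx \<alpha> \<beta> ~= 0" for \<alpha> \<beta>
  using c[of "Suc \<alpha>" \<beta>] that by (auto simp: cx_def)
 have cy: "N - m <= n * \<alpha> + m * \<beta>" if "cy \<alpha> \<beta> ~= 0" for \<alpha> \<beta>
  using c[of \<alpha> "Suc \<beta>"] that by (auto simp: cy_def)
 have P0: "fps_nth P k = 0" if "k < N - n" for k
  unfolding P_def VW fst_conv snd_conv by (rule subst2_lead(1)[OF nm(1,2) cx that])
 have Q0: "fps_nth Q k = 0" if "k < N - m" for k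
  unfolding Q_def VW fst_conv snd_conv by (rule subst2_lead(1)[OF nm(1,2) cy that])
 have "fps_nth P (N - n) = edge_form n m (N - n) cx v w"
  using subst2_lead(2)[where c = cx, OF nm(1,2) cx, where V = V and W = W] unfolding P_def VW(1) fst_conv snd_conv VW(2,3) edge_form_def by simp
 then have Pn: "fps_nth P (N - n) ~= 0"
  using smooth(1) edge_form_partial[OF nm(3,1,2), where v = v and c = c and w = w] unfolding cx_def by auto
 have "fps_nth Q (N - m) = edge_form n m (N - m) cy v w"
  using subst2_lead(2)[where c = cy, OF nm(1,2) cy, where V = V and W = W] unfolding Q_def VW(1) fst_conv snd_conv VW(2,3) edge_form_def by simp
 also have "\<dots> = edge_form m n (N - m) (%\<alpha> \<beta>. cy \<beta> \<alpha>) w v" by (rule edge_form_swap[symmetric])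
 finally have Qm: "fps_nth Q (N - m) ~= 0"
  using smooth(2) edge_form_partial[OF nm(4,2,1), where v = w and c = "%\<alpha> \<beta>. c \<beta> \<alpha>" and w = v]
   edge_form_swap[where m = m and n = n and N = N and c = "%\<alpha> \<beta>. of_nat \<beta> * c \<alpha> \<beta>" and w = w and v = v]
  unfolding cy_def by auto
 have fct: "fact (2 * k) / fact k ~= (0::'k)" for k by simp
 show ?thesis unfolding has_minimal_regularity_degree_def regularity_op_def
 proof (rule exI[of _ P], rule exI[of _ Q], intro conjI P Q allI impI)
  show "(fact (2 * j) / fact j * fps_nth P j, fact (2 * j) / fact j * fps_nth Q j) = (0, 0)" if "j < N - max n m" for j
  proof -
   have "fps_nth P j = 0" by (rule P0) (use that in linarith)
   moreover have "fps_nth Q j = 0" by (rule Q0) (use that in linarith)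
   ultimately show ?thesis by simp
  qed
  have "fps_nth P (N - max n m) ~= 0 \<or> fps_nth Q (N - max n m) ~= 0"
   using Pn Qm by (cases "n >= m") (auto simp: max_def)
  then show "(fact (2 * (N - max n m)) / fact (N - max n m) * fps_nth P (N - max n m),
    fact (2 * (N - max n m)) / fact (N - max n m) * fps_nth Q (N - max n m)) ~= (0, 0)"
   using fct by simp
 qed
qed

lemma fps_weighted_linear:
 fixes F :: "'k::comm_ring_1 fps"
 shows "(fps_X ^ n * F) oo (fps_const s * fps_X) = fps_X ^ n * (fps_const (s ^ n) * (F oo (fps_const s * fps_X)))"
proof (rule fps_ext)
 fix k
 show "fps_nth ((fps_X ^ n * F) oo (fps_const s * fps_X)) k = fps_nth (fps_X ^ n * (fps_const (s ^ n) * (F oo (fps_const s * fps_X)))) k"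
 proof (cases "k < n")
  case False
  then have "s ^ k = s ^ n * s ^ (k - n)" by (simp add: power_add[symmetric])
  with False show ?thesis by (simp only: fps_compose_linear fps_nth_Abs_fps fps_X_power_mult_nth fps_mult_left_const_nth) (simp add: mult.assoc)
 qed (simp only: fps_compose_linear fps_nth_Abs_fps fps_X_power_mult_nth, simp)
qed

lemma subst2_compose_linear:
 fixes X Y :: "'k::field fps"
 shows "subst2 c (X oo (fps_const s * fps_X)) (Y oo (fps_const s * fps_X)) = subst2 c X Y oo (fps_const s * fps_X)"
proof (rule fps_ext)
 fix k
 have L0: "fps_nth (fps_const s * fps_X) 0 = 0" by simp
 have "(X oo (fps_const s * fps_X)) ^ \<alpha> * (Y oo (fps_const s * fps_X)) ^ \<beta> = (X ^ \<alpha> * Y ^ \<beta>) oo (fps_const s * fps_X)" for \<alpha> \<beta>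
  by (simp only: fps_compose_mult_distrib[OF L0] fps_compose_power[OF L0])
 then show "fps_nth (subst2 c (X oo (fps_const s * fps_X)) (Y oo (fps_const s * fps_X))) k = fps_nth (subst2 c X Y oo (fps_const s * fps_X)) k"
  by (simp only: subst2_def fps_nth_Abs_fps fps_compose_linear) (simp add: sum_distrib_left case_prod_beta mult_ac)
qed

lemma weighted_curve_rescale:
 fixes v w s :: "'k::field"
 assumes "weighted_curve n m v w z"
 shows "weighted_curve n m (s ^ n * v) (s ^ m * w) (fst z oo (fps_const s * fps_X), snd z oo (fps_const s * fps_X))"
proof -
 let ?L = "fps_const s * fps_X :: 'k fps"
 obtain U where U: "fps_nth U 0 = 0" "z = (if n >= m then (fps_X ^ n * (fps_const v + U), fps_X ^ m * fps_const w)
    else (fps_X ^ n * fps_const v, fps_X ^ m * (fps_const w + U)))"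
  using assms unfolding weighted_curve_def by blast
 show ?thesis unfolding weighted_curve_def
  by (rule exI[of _ "fps_const (if n >= m then s ^ n else s ^ m) * (U oo ?L)"])
   (auto simp: U fps_weighted_linear fps_compose_add_distrib distrib_left)
qed

text \<open>For n >= m the equation is solved for the first component; otherwise the same implicit
  solution is applied to the transposed coefficients.\<close>

lemma edge_form_zero_curve:
 fixes c :: "nat => nat => 'k :: {real_normed_field, euclidean_space}"
 assumes nm: "0 < n" "0 < m" and c: "\<And>\<alpha> \<beta>. c \<alpha> \<beta> ~= 0 ==> N <= n * \<alpha> + m * \<beta>"
  and root: "edge_form n m N c v w = 0"
  and smooth: "edge_form n m N (%\<alpha> \<beta>. of_nat \<alpha> * c \<alpha> \<beta>) v w ~= 0" "edge_form n m N (%\<alpha> \<beta>. of_nat \<beta> * c \<alpha> \<beta>) v w ~= 0"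
 shows "weighted_curve n m v w z ==> weighted_curve n m v w z' ==> subst2 c (fst z) (snd z) = 0 ==> subst2 c (fst z') (snd z') = 0 ==> z = z'"
  and "convergent_series (series_of c) ==> \<exists>z. weighted_curve n m v w z \<and> fps_conv_radius (fst z) > 0 \<and> fps_conv_radius (snd z) > 0 \<and> subst2 c (fst z) (snd z) = 0"
proof -
 have sv: "(\<Sum>(\<alpha>,\<beta>)\<in>{(\<alpha>,\<beta>). n * \<alpha> + m * \<beta> = N}. of_nat \<alpha> * c \<alpha> \<beta> * v ^ (\<alpha> - 1) * w ^ \<beta>) ~= 0"
  using smooth(1) edge_form_deriv[where v = v and n = n and m = m and N = N and c = c and w = w] by auto
 note I = weighted_implicit[OF nm c root[unfolded edge_form_def] sv]
 define c' where "c' = (%\<alpha> \<beta>. c \<beta> \<alpha>)"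
 have c': "N <= m * \<alpha> + n * \<beta>" if "c' \<alpha> \<beta> ~= 0" for \<alpha> \<beta> using c[of \<beta> \<alpha>] that by (simp add: c'_def add.commute)
 have root': "edge_form m n N c' w v = 0" using root edge_form_swap[where m = m and n = n and N = N and c = c and w = w and v = v] by (simp add: c'_def)
 have "edge_form m n N (%\<alpha> \<beta>. of_nat \<alpha> * c' \<alpha> \<beta>) w v ~= 0"
  using smooth(2) edge_form_swap[where m = m and n = n and N = N and c = "%\<alpha> \<beta>. of_nat \<beta> * c \<alpha> \<beta>" and w = w and v = v] by (simp add: c'_def)
 then have sw: "(\<Sum>(\<alpha>,\<beta>)\<in>{(\<alpha>,\<beta>). m * \<alpha> + n * \<beta> = N}. of_nat \<alpha> * c' \<alpha> \<beta> * w ^ (\<alpha> - 1) * v ^ \<beta>) ~= 0"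
  using edge_form_deriv[where v = w and n = m and m = n and N = N and c = c' and w = v] by auto
 note I' = weighted_implicit[OF nm(2,1) c' root'[unfolded edge_form_def] sw]
 have sub: "subst2 c' Y X = subst2 c X Y" for X Y unfolding c'_def by (rule subst2_swap)
 have radius: "fps_conv_radius (fps_X ^ k * F) > 0" if "fps_conv_radius F > 0" for k and F :: "'k fps"
  using fps_conv_radius_mult[of "fps_X ^ k" F] that by (simp add: less_le_trans)
 have radius_add: "fps_conv_radius (fps_const u + F) > 0" if "fps_conv_radius F > 0" for u and F :: "'k fps"
  using fps_conv_radius_add[of "fps_const u" F] that by (simp add: less_le_trans)
 { assume z: "weighted_curve n m v w z" "weighted_curve n m v w z'" "subst2 c (fst z) (snd z) = 0" "subst2 c (fst z') (snd z') = 0"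
  obtain U where U: "fps_nth U 0 = 0" "z = (if n >= m then (fps_X ^ n * (fps_const v + U), fps_X ^ m * fps_const w)
    else (fps_X ^ n * fps_const v, fps_X ^ m * (fps_const w + U)))"
   using z(1) unfolding weighted_curve_def by blast
  obtain U' where U': "fps_nth U' 0 = 0" "z' = (if n >= m then (fps_X ^ n * (fps_const v + U'), fps_X ^ m * fps_const w)
    else (fps_X ^ n * fps_const v, fps_X ^ m * (fps_const w + U')))"
   using z(2) unfolding weighted_curve_def by blast
  have "U = U'"
  proof (cases "n >= m")
   case True
   show ?thesis by (rule I(1)) (use z(3,4) U U' True in simp_all)
  next
   case False
   show ?thesis by (rule I'(1)) (use z(3,4) U U' False in \<open>simp_all add: sub\<close>)
  qed
  then show "z = z'" using U U' by simp }
 assume conv: "convergent_series (series_of c)"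
 show "\<exists>z. weighted_curve n m v w z \<and> fps_conv_radius (fst z) > 0 \<and> fps_conv_radius (snd z) > 0 \<and> subst2 c (fst z) (snd z) = 0"
 proof (cases "n >= m")
  case True
  obtain U where U: "fps_nth U 0 = 0" "fps_conv_radius U > 0" "subst2 c (fps_X ^ n * (fps_const v + U)) (fps_X ^ m * fps_const w) = 0"
   using I(2)[OF _ conv] by blast
  show ?thesis
   by (rule exI[of _ "(fps_X ^ n * (fps_const v + U), fps_X ^ m * fps_const w)"])
    (use U True in \<open>auto simp: weighted_curve_def intro!: radius radius_add\<close>)
 next
  case False
  have "convergent_series (series_of c')"
  proof -
   obtain \<rho> where \<rho>: "\<rho> > 0" "(%(\<alpha>, \<beta>). norm (c \<alpha> \<beta>) * \<rho> ^ (\<alpha> + \<beta>)) summable_on UNIV \<times> UNIV"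
    using conv unfolding convergent_series_def series_of_def by auto
   have "(%(\<alpha>, \<beta>). norm (c \<beta> \<alpha>) * \<rho> ^ (\<beta> + \<alpha>)) summable_on UNIV \<times> UNIV" using iffD1[OF summable_on_swap \<rho>(2)] by simp
   then show ?thesis unfolding convergent_series_def series_of_def c'_def
    by (intro exI[of _ \<rho>]) (simp add: \<rho> add.commute)
  qed
  from I'(2)[OF _ this] obtain U where U: "fps_nth U 0 = 0" "fps_conv_radius U > 0" "subst2 c' (fps_X ^ m * (fps_const w + U)) (fps_X ^ n * fps_const v) = 0"
   by blast
  show ?thesis
   by (rule exI[of _ "(fps_X ^ n * fps_const v, fps_X ^ m * (fps_const w + U))"])
    (use U False in \<open>auto simp: weighted_curve_def sub intro!: radius radius_add\<close>)
 qed
qed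

section \<open>Orbits and their invariants\<close>

lemma same_orbitD:
 assumes "(z, w) \<in> same_orbit" "\<delta> > 0"
 shows "\<exists>\<delta>'>0. curve_at z ` ball 0 \<delta>' \<subseteq> curve_at w ` ball 0 \<delta> \<and> curve_at w ` ball 0 \<delta>' \<subseteq> curve_at z ` ball 0 \<delta>"
proof -
 have "\<forall>\<delta>>0. \<exists>\<delta>'>0. curve_at z ` ball 0 \<delta>' \<subseteq> curve_at w ` ball 0 \<delta> \<and> curve_at w ` ball 0 \<delta>' \<subseteq> curve_at z ` ball 0 \<delta>"
  using assms(1) unfolding same_orbit_def by simp
 then show ?thesis using assms(2) by (elim allE impE)
qed

lemma same_orbitI:
 assumes "\<And>\<delta>. \<delta> > 0 ==> \<exists>\<delta>'>0. curve_at z ` ball 0 \<delta>' \<subseteq> curve_at w ` ball 0 \<delta> \<and> curve_at w ` ball 0 \<delta>' \<subseteq> curve_at z ` ball 0 \<delta>"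
 shows "(z, w) \<in> same_orbit"
 using assms unfolding same_orbit_def by simp

lemma equiv_same_orbit: "equiv UNIV (same_orbit :: ('k :: {real_normed_field, euclidean_space} fps \<times> 'k fps) rel)"
proof (rule equivI)
 show "refl (same_orbit :: ('k fps \<times> 'k fps) rel)" by (rule refl_onI) (auto intro!: same_orbitI)
 show "sym (same_orbit :: ('k fps \<times> 'k fps) rel)"
 proof (rule symI)
  fix z w :: "'k fps \<times> 'k fps" assume zw: "(z, w) \<in> same_orbit"
  show "(w, z) \<in> same_orbit"
  proof (rule same_orbitI)
   fix \<delta> :: real assume "\<delta> > 0"
   obtain \<delta>' where "\<delta>' > 0" "curve_at z ` ball 0 \<delta>' \<subseteq> curve_at w ` ball 0 \<delta>" "curve_at w ` ball 0 \<delta>' \<subseteq> curve_at z ` ball 0 \<delta>"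
    using same_orbitD[OF zw \<open>\<delta> > 0\<close>] by (elim exE conjE) (rule that; assumption)
   then show "\<exists>\<delta>'>0. curve_at w ` ball 0 \<delta>' \<subseteq> curve_at z ` ball 0 \<delta> \<and> curve_at z ` ball 0 \<delta>' \<subseteq> curve_at w ` ball 0 \<delta>"
    by (intro exI[of _ \<delta>'] conjI)
  qed
 qed
 show "trans (same_orbit :: ('k fps \<times> 'k fps) rel)"
 proof (rule transI)
  fix z w u :: "'k fps \<times> 'k fps" assume zw: "(z, w) \<in> same_orbit" and wu: "(w, u) \<in> same_orbit"
  show "(z, u) \<in> same_orbit"
  proof (rule same_orbitI)
   fix \<delta> :: real assume d: "\<delta> > 0"
   obtain \<delta>1 where 1: "\<delta>1 > 0" "curve_at w ` ball 0 \<delta>1 \<subseteq> curve_at u ` ball 0 \<delta>" using same_orbitD[OF wu d] by (elim exE conjE) (rule that; assumption)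
   obtain \<delta>2 where 2: "\<delta>2 > 0" "curve_at z ` ball 0 \<delta>2 \<subseteq> curve_at w ` ball 0 \<delta>1" using same_orbitD[OF zw 1(1)] by (elim exE conjE) (rule that; assumption)
   obtain \<delta>3 where 3: "\<delta>3 > 0" "curve_at w ` ball 0 \<delta>3 \<subseteq> curve_at z ` ball 0 \<delta>" using same_orbitD[OF zw d] by (elim exE conjE) (rule that; assumption)
   obtain \<delta>4 where 4: "\<delta>4 > 0" "curve_at u ` ball 0 \<delta>4 \<subseteq> curve_at w ` ball 0 \<delta>3" using same_orbitD[OF wu 3(1)] by (elim exE conjE) (rule that; assumption)
   have min_pos: "min \<delta>2 \<delta>4 > 0" using 2(1) 4(1) by simp
   have b: "ball (0::'k) (min \<delta>2 \<delta>4) \<subseteq> ball 0 \<delta>2" "ball (0::'k) (min \<delta>2 \<delta>4) \<subseteq> ball 0 \<delta>4" by auto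
   have "curve_at z ` ball 0 (min \<delta>2 \<delta>4) \<subseteq> curve_at u ` ball 0 \<delta>"
    by (rule order_trans[OF image_mono[OF b(1)] order_trans[OF 2(2) 1(2)]])
   moreover have "curve_at u ` ball 0 (min \<delta>2 \<delta>4) \<subseteq> curve_at z ` ball 0 \<delta>"
    by (rule order_trans[OF image_mono[OF b(2)] order_trans[OF 4(2) 3(2)]])
   ultimately show "\<exists>\<delta>'>0. curve_at z ` ball 0 \<delta>' \<subseteq> curve_at u ` ball 0 \<delta> \<and> curve_at u ` ball 0 \<delta>' \<subseteq> curve_at z ` ball 0 \<delta>"
    using min_pos by (intro exI[of _ "min \<delta>2 \<delta>4"] conjI)
  qed
 qed
qed simp

lemma card_quotient_family:
 assumes r: "equiv UNIV r" and ne: "\<And>i. i \<in> I ==> C i ~= {}"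
  and rel: "\<And>i j x y. i \<in> I ==> j \<in> I ==> x \<in> C i ==> y \<in> C j ==> (x, y) \<in> r \<longleftrightarrow> i = j"
 shows "card ((\<Union>i\<in>I. C i) // r) = card I"
proof -
 define f where "f i = r `` {SOME x. x \<in> C i}" for i
 have some: "(SOME x. x \<in> C i) \<in> C i" if "i \<in> I" for i using ne[OF that] by (simp add: some_in_eq)
 have f: "r `` {x} = f i" if "i \<in> I" "x \<in> C i" for i x
  unfolding f_def using equiv_class_eq[OF r] rel[OF that(1) that(1) that(2) some[OF that(1)]] by blast
 have "inj_on f I"
 proof (rule inj_onI)
  fix i j assume ij: "i \<in> I" "j \<in> I" "f i = f j"
  then have "((SOME x. x \<in> C i), (SOME x. x \<in> C j)) \<in> r" unfolding f_def using eq_equiv_class[OF _ r] by blast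
  then show "i = j" using rel[OF ij(1,2) some[OF ij(1)] some[OF ij(2)]] by blast
 qed
 moreover have "f ` I = (\<Union>i\<in>I. C i) // r"
 proof (intro equalityI subsetI)
  fix K assume "K \<in> f ` I"
  then obtain i where "i \<in> I" "K = f i" by blast
  then show "K \<in> (\<Union>i\<in>I. C i) // r" unfolding f_def using some by (blast intro: quotientI)
 next
  fix K assume "K \<in> (\<Union>i\<in>I. C i) // r"
  then obtain i x where "i \<in> I" "x \<in> C i" "K = r `` {x}" by (auto elim: quotientE)
  then show "K \<in> f ` I" using f by blast
 qed
 ultimately show ?thesis using card_image by fastforce
qed

lemma curve_at_compose_linear:
 "curve_at (X oo (fps_const s * fps_X), Y oo (fps_const s * fps_X)) \<epsilon> = curve_at (X, Y) (s * \<epsilon>)"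
 by (simp only: curve_at_def eval_fps_def fps_compose_linear fps_nth_Abs_fps fst_conv snd_conv)
  (simp add: power_mult_distrib mult_ac)

lemma same_orbit_rescale:
 fixes s :: "'k :: {real_normed_field, euclidean_space}"
 assumes "s ~= 0"
 shows "(z, (fst z oo (fps_const s * fps_X), snd z oo (fps_const s * fps_X))) \<in> same_orbit" (is "(z, ?w) \<in> _")
proof (rule same_orbitI)
 fix \<delta> :: real assume d: "\<delta> > 0"
 have w: "curve_at ?w \<epsilon> = curve_at z (s * \<epsilon>)" for \<epsilon> using curve_at_compose_linear[of "fst z" s "snd z"] by simp
 define \<delta>' where "\<delta>' = min (\<delta> * norm s) (\<delta> / norm s)"
 have s: "norm s > 0" using assms by simp
 have 1: "curve_at z ` ball 0 \<delta>' \<subseteq> curve_at ?w ` ball 0 \<delta>"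
 proof (rule image_subsetI)
  fix \<epsilon> :: 'k assume "\<epsilon> \<in> ball 0 \<delta>'"
  then have "norm \<epsilon> < \<delta> * norm s" by (simp add: \<delta>'_def)
  then have "norm (\<epsilon> / s) < \<delta>" using s by (simp add: norm_divide pos_divide_less_eq)
  moreover have "curve_at z \<epsilon> = curve_at ?w (\<epsilon> / s)" using assms by (simp add: w)
  ultimately show "curve_at z \<epsilon> \<in> curve_at ?w ` ball 0 \<delta>" by (intro image_eqI) auto
 qed
 have 2: "curve_at ?w ` ball 0 \<delta>' \<subseteq> curve_at z ` ball 0 \<delta>"
 proof (rule image_subsetI)
  fix \<epsilon> :: 'k assume "\<epsilon> \<in> ball 0 \<delta>'"
  then have "norm \<epsilon> < \<delta> / norm s" by (simp add: \<delta>'_def)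
  then have "norm (s * \<epsilon>) < \<delta>" using s by (simp add: norm_mult pos_less_divide_eq mult.commute)
  then show "curve_at ?w \<epsilon> \<in> curve_at z ` ball 0 \<delta>" unfolding w by (intro image_eqI[OF refl]) simp
 qed
 have "\<delta>' > 0" using s d by (simp add: \<delta>'_def)
 then show "\<exists>\<delta>'>0. curve_at z ` ball 0 \<delta>' \<subseteq> curve_at ?w ` ball 0 \<delta> \<and> curve_at ?w ` ball 0 \<delta>' \<subseteq> curve_at z ` ball 0 \<delta>"
  using 1 2 by (intro exI[of _ \<delta>'] conjI)
qed

text \<open>A point of z near the origin is a point of w at some small parameter, which is nonzero
  because z has left the origin. So what holds on the punctured curve w passes to z.\<close>

lemma same_orbit_eventually:
 assumes zw: "(z, w) \<in> same_orbit" and z: "\<forall>\<^sub>F \<epsilon> in at 0. curve_at z \<epsilon> ~= (0, 0)" and w: "curve_at w 0 = (0, 0)"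
  and Q: "\<forall>\<^sub>F \<epsilon> in at 0. Q (curve_at w \<epsilon>)"
 shows "\<forall>\<^sub>F \<epsilon> in at 0. Q (curve_at z \<epsilon>)"
proof -
 obtain \<delta> where \<delta>: "\<delta> > 0" "\<And>\<epsilon>. \<epsilon> ~= 0 ==> dist \<epsilon> 0 < \<delta> ==> Q (curve_at w \<epsilon>)"
  using Q unfolding eventually_at by blast
 obtain \<delta>' where \<delta>': "\<delta>' > 0" "curve_at z ` ball 0 \<delta>' \<subseteq> curve_at w ` ball 0 \<delta>" using same_orbitD[OF zw \<delta>(1)] by (elim exE conjE) (rule that; assumption)
 have "\<forall>\<^sub>F \<epsilon> in at 0. \<epsilon> \<in> ball 0 \<delta>'" using \<delta>'(1) unfolding eventually_at by (intro exI[of _ \<delta>']) (auto simp: dist_commute)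
 with z show ?thesis
 proof eventually_elim
  case (elim \<epsilon>)
  obtain \<eta> where \<eta>: "\<eta> \<in> ball 0 \<delta>" "curve_at z \<epsilon> = curve_at w \<eta>"
   using subsetD[OF \<delta>'(2) imageI[OF elim(2)]] by (elim imageE) (rule that; assumption)
  then have "\<eta> ~= 0" using elim(1) w by auto
  then show ?case using \<delta>(2)[of \<eta>] \<eta> by (simp add: dist_commute)
 qed
qed

lemma same_orbit_tendsto_unique:
 fixes q :: "'k :: {real_normed_field, euclidean_space} \<times> 'k => 'k"
 assumes zw: "(z, w) \<in> same_orbit" and z: "\<forall>\<^sub>F \<epsilon> in at 0. curve_at z \<epsilon> ~= (0, 0)" and w: "curve_at w 0 = (0, 0)"
  and lim: "((%\<epsilon>. q (curve_at z \<epsilon>)) \<longlongrightarrow> l) (at 0)" "((%\<epsilon>. q (curve_at w \<epsilon>)) \<longlongrightarrow> l') (at 0)"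
 shows "l = l'"
proof -
 have "((%\<epsilon>. q (curve_at z \<epsilon>)) \<longlongrightarrow> l') (at 0)"
 proof (rule topological_tendstoI)
  fix S assume "open S" "l' \<in> S"
  from topological_tendstoD[OF lim(2) this] have "\<forall>\<^sub>F \<epsilon> in at 0. (%x. q x \<in> S) (curve_at w \<epsilon>)" .
  from same_orbit_eventually[OF zw z w this] show "\<forall>\<^sub>F \<epsilon> in at 0. q (curve_at z \<epsilon>) \<in> S" .
 qed
 then show ?thesis using tendsto_unique[OF _ lim(1)] by simp
qed

lemma weighted_expansion:
 fixes V :: "'k :: {real_normed_field, euclidean_space} fps"
 assumes "fps_conv_radius (fps_X ^ n * V) > 0"
 shows "\<exists>h. (h \<longlongrightarrow> fps_nth V 0) (at 0) \<and> (\<forall>\<^sub>F \<epsilon> in at 0. eval_fps (fps_X ^ n * V) \<epsilon> = \<epsilon> ^ n * h \<epsilon>)"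
proof (cases "V = 0")
 case True
 then show ?thesis by (intro exI[of _ "%_. 0"]) simp
next
 case False
 have "fps_nth (fps_X ^ n * V) n = fps_nth V 0" by (simp add: fps_X_power_mult_nth)
 moreover have "n <= subdegree (fps_X ^ n * V)" using False by simp
 ultimately show ?thesis using has_fps_expansion_subdegree[OF eval_fps_has_fps_expansion[OF assms], of n] by simp
qed

text \<open>Up to factors tending to the constant terms of V and W, the ratio behaves like the power
  n' m - m' n of the parameter.\<close>

lemma monomial_ratio_tendsto:
 fixes z :: "'k :: {real_normed_field, euclidean_space} fps \<times> 'k fps"
 assumes z: "z = (fps_X ^ n' * V, fps_X ^ m' * W)" "fps_conv_radius (fst z) > 0" "fps_conv_radius (snd z) > 0"
  and ne: "fps_nth W 0 ~= 0" and le: "m' * n <= n' * m"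
 shows "((%\<epsilon>. (%(x, y). x ^ m / y ^ n) (curve_at z \<epsilon>)) \<longlongrightarrow> (if m' * n = n' * m then fps_nth V 0 ^ m / fps_nth W 0 ^ n else 0)) (at 0)"
proof -
 obtain h where h: "(h \<longlongrightarrow> fps_nth V 0) (at 0)" "\<forall>\<^sub>F \<epsilon> in at 0. eval_fps (fst z) \<epsilon> = \<epsilon> ^ n' * h \<epsilon>"
  using weighted_expansion[of n' V] z by auto
 obtain g where g: "(g \<longlongrightarrow> fps_nth W 0) (at 0)" "\<forall>\<^sub>F \<epsilon> in at 0. eval_fps (snd z) \<epsilon> = \<epsilon> ^ m' * g \<epsilon>"
  using weighted_expansion[of m' W] z by auto
 define d where "d = n' * m - m' * n"
 have A: "((%\<epsilon>. \<epsilon> ^ d * (h \<epsilon> ^ m / g \<epsilon> ^ n)) \<longlongrightarrow> 0 ^ d * (fps_nth V 0 ^ m / fps_nth W 0 ^ n)) (at 0)"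
  using ne by (intro tendsto_intros h(1) g(1)) simp
 have B: "(0::'k) ^ d * (fps_nth V 0 ^ m / fps_nth W 0 ^ n) = (if m' * n = n' * m then fps_nth V 0 ^ m / fps_nth W 0 ^ n else 0)"
  using le by (auto simp: d_def power_0_left)
 have "\<forall>\<^sub>F \<epsilon>::'k in at 0. \<epsilon> ~= 0" by (simp add: eventually_at_filter)
 then have C: "\<forall>\<^sub>F \<epsilon> in at 0. \<epsilon> ^ d * (h \<epsilon> ^ m / g \<epsilon> ^ n) = (%(x, y). x ^ m / y ^ n) (curve_at z \<epsilon>)"
  using h(2) g(2)
 proof eventually_elim
  case (elim \<epsilon>)
  have "n' * m = m' * n + d" using le by (simp add: d_def)
  then have "(\<epsilon> ^ n') ^ m = (\<epsilon> ^ m') ^ n * \<epsilon> ^ d" by (simp only: power_mult[symmetric] power_add)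
  then show ?case using elim by (simp add: curve_at_def power_mult_distrib)
 qed
 show ?thesis by (rule Lim_transform_eventually[OF A[unfolded B] C])
qed

lemma curve_at_eventually_nonzero:
 fixes z :: "'k :: {real_normed_field, euclidean_space} fps \<times> 'k fps"
 assumes z: "z = (fps_X ^ n * V, Y)" "fps_conv_radius (fst z) > 0" and ne: "fps_nth V 0 ~= 0"
 shows "\<forall>\<^sub>F \<epsilon> in at 0. curve_at z \<epsilon> ~= (0, 0)"
proof -
 obtain h where h: "(h \<longlongrightarrow> fps_nth V 0) (at 0)" "\<forall>\<^sub>F \<epsilon> in at 0. eval_fps (fst z) \<epsilon> = \<epsilon> ^ n * h \<epsilon>"
  using weighted_expansion[of n V] z by auto
 have "\<forall>\<^sub>F \<epsilon> in at 0. h \<epsilon> ~= 0" using tendsto_imp_eventually_ne[OF h(1) ne] .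
 moreover have "\<forall>\<^sub>F \<epsilon>::'k in at 0. \<epsilon> ~= 0" by (simp add: eventually_at_filter)
 ultimately show ?thesis using h(2) by eventually_elim (simp add: curve_at_def)
qed

text \<open>With the exponents of the first curve, x^m / y^n has a finite nonzero limit on that
  curve. On the second curve this ratio or its inverse tends to 0 unless the weights are
  proportional, and limits along a curve depend only on its orbit.\<close>

lemma same_orbit_weighted_curves:
 fixes z z' :: "'k :: {real_normed_field, euclidean_space} fps \<times> 'k fps"
 assumes z: "weighted_curve n m v w z" "fps_conv_radius (fst z) > 0" "fps_conv_radius (snd z) > 0" "v ~= 0" "w ~= 0"
  and z': "weighted_curve n' m' v' w' z'" "fps_conv_radius (fst z') > 0" "fps_conv_radius (snd z') > 0" "v' ~= 0" "w' ~= 0"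
  and nm: "0 < n" "0 < m" "0 < n'" "0 < m'"
  and orb: "(z, z') \<in> same_orbit"
 shows "m' * n = n' * m" and "v ^ m / w ^ n = v' ^ m / w' ^ n"
proof -
 obtain V W where VW: "z = (fps_X ^ n * V, fps_X ^ m * W)" "fps_nth V 0 = v" "fps_nth W 0 = w"
  using z(1) by (rule weighted_curveE)
 obtain V' W' where VW': "z' = (fps_X ^ n' * V', fps_X ^ m' * W')" "fps_nth V' 0 = v'" "fps_nth W' 0 = w'"
  using z'(1) by (rule weighted_curveE)
 have nz: "\<forall>\<^sub>F \<epsilon> in at 0. curve_at z \<epsilon> ~= (0, 0)" by (rule curve_at_eventually_nonzero[OF VW(1) z(2)]) (simp add: VW z)
 have z0: "curve_at z' 0 = (0, 0)" using nm by (simp add: curve_at_def VW' eval_fps_at_0)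
 have lim: "((%\<epsilon>. (%(x, y). x ^ m / y ^ n) (curve_at z \<epsilon>)) \<longlongrightarrow> v ^ m / w ^ n) (at 0)"
  using monomial_ratio_tendsto[OF VW(1) z(2,3), of n m] z(5) by (simp add: VW mult.commute)
 show eq: "m' * n = n' * m"
 proof (rule ccontr)
  assume ne: "m' * n ~= n' * m"
  show False
  proof (cases "m' * n <= n' * m")
   case True
   have "((%\<epsilon>. (%(x, y). x ^ m / y ^ n) (curve_at z' \<epsilon>)) \<longlongrightarrow> 0) (at 0)"
    using monomial_ratio_tendsto[OF VW'(1) z'(2,3) _ True] ne z'(5) by (simp add: VW')
   from same_orbit_tendsto_unique[OF orb nz z0 lim this] show False using z(4,5) by simp
  next
   case False
   define u where "u = (snd z, fst z)"
   define u' where "u' = (snd z', fst z')"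
   have swap: "(%(x, y). x ^ n / y ^ m) (curve_at (snd y, fst y) \<epsilon>) = (%(x, y). y ^ n / x ^ m) (curve_at y \<epsilon>)" for y :: "'k fps \<times> 'k fps" and \<epsilon>
    by (simp add: curve_at_def)
   have "((%\<epsilon>. (%(x, y). x ^ n / y ^ m) (curve_at u \<epsilon>)) \<longlongrightarrow> w ^ n / v ^ m) (at 0)"
    using monomial_ratio_tendsto[of u m W n V m n] z(2,3,4) by (simp add: u_def VW mult.commute)
   then have 1: "((%\<epsilon>. (%(x, y). y ^ n / x ^ m) (curve_at z \<epsilon>)) \<longlongrightarrow> w ^ n / v ^ m) (at 0)" unfolding u_def swap .
   have "((%\<epsilon>. (%(x, y). x ^ n / y ^ m) (curve_at u' \<epsilon>)) \<longlongrightarrow> 0) (at 0)"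
    using monomial_ratio_tendsto[of u' m' W' n' V' m n] z'(2,3,4) False by (simp add: u'_def VW')
   then have 2: "((%\<epsilon>. (%(x, y). y ^ n / x ^ m) (curve_at z' \<epsilon>)) \<longlongrightarrow> 0) (at 0)" unfolding u'_def swap .
   from same_orbit_tendsto_unique[OF orb nz z0 1 2] show False using z(4,5) by simp
  qed
 qed
 have "((%\<epsilon>. (%(x, y). x ^ m / y ^ n) (curve_at z' \<epsilon>)) \<longlongrightarrow> v' ^ m / w' ^ n) (at 0)"
  using monomial_ratio_tendsto[OF VW'(1) z'(2,3), of n m] z'(5) eq by (simp add: VW')
 from same_orbit_tendsto_unique[OF orb nz z0 lim this] show "v ^ m / w ^ n = v' ^ m / w' ^ n" .
qed

section \<open>Linear factors and roots of the edge polynomial\<close>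

text \<open>Homogenisation; the degree \<open>d\<close> is a separate argument since it may exceed
  the degree of \<open>p\<close>, as in \<open>homog_linear_mult\<close>.\<close>

definition homog :: "nat => 'k::field poly => 'k poly poly" where
 "homog d p = (\<Sum>i\<le>d. Polynomial.monom (Polynomial.monom (Polynomial.coeff p i) i) (d - i))"

lemma coeff_homog:
 "Polynomial.coeff (Polynomial.coeff (homog d p) j) i = (if i + j = d then Polynomial.coeff p i else 0)"
proof -
 have "Polynomial.coeff (Polynomial.coeff (homog d p) j) i
   = (\<Sum>l\<le>d. Polynomial.coeff (Polynomial.coeff (Polynomial.monom (Polynomial.monom (Polynomial.coeff p l) l) (d - l)) j) i)"
  unfolding homog_def Polynomial.coeff_sum ..
 also have "\<dots> = (\<Sum>l\<le>d. if l = i then (if i + j = d then Polynomial.coeff p i else 0) else 0)"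
  by (intro sum.cong refl) auto
 also have "\<dots> = (if i + j = d then Polynomial.coeff p i else 0)" by (simp add: sum.delta)
 finally show ?thesis .
qed

lemma linear_form_eq: "linear_form a b = [:[:0, a:], [:b:]:]"
 unfolding linear_form_def by (simp add: monom_0 monom_Suc monom_altdef)

lemma homog_linear_mult:
 assumes "Polynomial.degree q <= d"
 shows "homog (Suc d) ([:b, a:] * q) = linear_form a b * homog d q"
proof (intro poly_eqI)
 fix j i
 have top: "Polynomial.coeff q (Suc d) = 0" using assms by (intro coeff_eq_0) simp
 have L: "linear_form a b * homog d q = Polynomial.smult [:0, a:] (homog d q) + pCons 0 (Polynomial.smult [:b:] (homog d q))"
  unfolding linear_form_eq by simp
 have "Polynomial.coeff (Polynomial.coeff (linear_form a b * homog d q) j) i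
   = a * (case i of 0 => 0 | Suc i' => Polynomial.coeff (Polynomial.coeff (homog d q) j) i')
    + b * (case j of 0 => 0 | Suc j' => Polynomial.coeff (Polynomial.coeff (homog d q) j') i)"
  unfolding L by (cases i; cases j) (simp_all add: coeff_pCons)
 also have "\<dots> = (if i + j = Suc d then Polynomial.coeff ([:b, a:] * q) i else 0)"
  using top by (cases i; cases j) (auto simp: coeff_homog coeff_pCons)
 finally show "Polynomial.coeff (Polynomial.coeff (homog (Suc d) ([:b, a:] * q)) j) i = Polynomial.coeff (Polynomial.coeff (linear_form a b * homog d q) j) i"
  unfolding coeff_homog ..
qed

lemma poly_homog_1: "poly (homog d p) 1 = (\<Sum>i\<le>d. Polynomial.monom (Polynomial.coeff p i) i)"
 unfolding homog_def by (simp add: poly_sum poly_monom)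

lemma degree_linear_mult:
 fixes p :: "'k::field poly"
 assumes "a ~= 0" "p ~= 0" shows "Polynomial.degree ([:b, a:] * p) = Suc (Polynomial.degree p)"
proof -
 have "Polynomial.degree ([:b, a:] * p) = Polynomial.degree [:b, a:] + Polynomial.degree p"
  by (rule degree_mult_eq) (use assms in auto)
 then show ?thesis using assms by (simp del: mult_pCons_left)
qed

text \<open>Setting Y = 1 recovers \<open>p\<close>. At a double root the square of
  \<open>[:b, a:]\<close> would divide \<open>p\<close>, and homogenising again would make the
  square of the linear form a divisor.\<close>

lemma simple_linear_factor_homog:
 fixes p :: "'k::field_char_0 poly"
 assumes d: "Polynomial.degree p = d" "0 < d" and a: "a ~= 0" and s: "simple_linear_factor a b (homog d p)"
 shows "poly p (- b / a) = 0" and "poly (pderiv p) (- b / a) ~= 0"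
proof -
 have p1: "poly (homog d p) 1 = p"
  unfolding poly_homog_1 using poly_as_sum_of_monoms'[of p d] d by simp
 obtain h where h: "homog d p = linear_form a b * h" using s unfolding simple_linear_factor_def dvd_def by blast
 have "p = [:b, a:] * poly h 1"
  using arg_cong[OF h, of "%x. poly x 1"] unfolding p1 linear_form_eq by simp
 then obtain q where q: "p = [:b, a:] * q" by blast
 show 0: "poly p (- b / a) = 0" unfolding q using a by simp
 have p0: "p ~= 0" using d by auto
 show "poly (pderiv p) (- b / a) ~= 0"
 proof
  assume "poly (pderiv p) (- b / a) = 0"
  then have "poly q (- b / a) = 0" unfolding q pderiv_mult using a by (simp add: pderiv_pCons)
  then have "[:b / a, 1:] dvd q" by (simp add: poly_eq_0_iff_dvd)
  then obtain q' where "q = [:b / a, 1:] * q'" by (auto simp: dvd_def)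
  then have "q = [:b, a:] * Polynomial.smult (1 / a) q'" using a by (simp add: smult_add_right)
  then obtain u where u: "q = [:b, a:] * u" by blast
  have u0: "u ~= 0" using p0 unfolding q u by auto
  have "Polynomial.degree ([:b, a:] * u) = Suc (Polynomial.degree u)"
   by (rule degree_linear_mult[OF a u0])
  moreover have "Polynomial.degree ([:b, a:] * ([:b, a:] * u)) = Suc (Polynomial.degree ([:b, a:] * u))"
   by (rule degree_linear_mult[OF a]) (use u0 a in \<open>simp del: mult_pCons_left\<close>)
  ultimately have "d = Suc (Suc (Polynomial.degree u))" using d unfolding q u by simp
  then have "homog d p = linear_form a b * homog (Suc (Polynomial.degree u)) ([:b, a:] * u)"
   unfolding q u by (simp only:) (rule homog_linear_mult, use \<open>Polynomial.degree ([:b, a:] * u) = Suc (Polynomial.degree u)\<close> in simp)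
  also have "\<dots> = linear_form a b * (linear_form a b * homog (Polynomial.degree u) u)"
   by (subst homog_linear_mult[OF order_refl]) simp
  finally have "linear_form a b ^ 2 dvd homog d p" by (simp add: power2_eq_square mult.assoc[symmetric] dvdI)
  then show False using s unfolding simple_linear_factor_def by blast
 qed
qed

text \<open>A constant factor (a = 0) adds neither a root nor a degree. Any other factor adds a root
  that the rest does not share, since a shared root would be a zero of the derivative.\<close>

lemma card_roots_prod_linear:
 fixes L :: "('k::field_char_0 \<times> 'k) list"
 assumes "p = prod_list (map (%(a, b). [:b, a:]) L)" "p ~= 0" "\<And>t. poly p t = 0 ==> poly (pderiv p) t ~= 0"
 shows "card {t. poly p t = 0} = Polynomial.degree p"
 using assms
proof (induction L arbitrary: p)
 case Nil
 then show ?case by simp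
next
 case (Cons x L)
 obtain a b where x: "x = (a, b)" by (cases x)
 define q where "q = prod_list (map (%(a, b). [:b, a:]) L)"
 have p: "p = [:b, a:] * q" using Cons.prems(1) by (simp add: x q_def)
 have q0: "q ~= 0" and ab: "[:b, a:] ~= 0" using Cons.prems(2) unfolding p by auto
 have dp: "poly (pderiv p) t = a * poly q t + (a * t + b) * poly (pderiv q) t" for t
  unfolding p pderiv_mult by (simp add: pderiv_pCons algebra_simps)
 have pt: "poly p t = (a * t + b) * poly q t" for t unfolding p by (simp add: algebra_simps)
 have IH: "card {t. poly q t = 0} = Polynomial.degree q"
 proof (rule Cons.IH[OF q_def q0])
  fix t assume "poly q t = 0"
  then show "poly (pderiv q) t ~= 0" using Cons.prems(3)[of t] unfolding dp pt by auto
 qed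
 show ?case
 proof (cases "a = 0")
  case True
  then have "b ~= 0" using ab by auto
  then show ?thesis using IH True unfolding p by simp
 next
  case False
  have nq: "poly q (- b / a) ~= 0"
   using Cons.prems(3)[of "- b / a"] False unfolding dp pt by auto
  have "a * t + b = 0 \<longleftrightarrow> t = - b / a" for t
   unfolding nonzero_eq_divide_eq[OF False] eq_neg_iff_add_eq_0 by (simp only: mult.commute)
  then have "{t. poly p t = 0} = insert (- b / a) {t. poly q t = 0}" unfolding pt mult_eq_0_iff by blast
  then have "card {t. poly p t = 0} = Suc (card {t. poly q t = 0})"
   using nq poly_roots_finite[OF q0] by simp
  also have "\<dots> = Polynomial.degree p" unfolding IH p by (rule degree_linear_mult[OF False q0, symmetric])
  finally show ?thesis .
 qed
qed

text \<open>A root of \<open>p\<close> is a root of one of the given factors; simplicity of that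
  factor makes the root simple, and a product of linear factors with only simple roots has as many
  of them as its degree.\<close>

lemma splits_simply_homog:
 fixes p :: "'k::field_char_0 poly"
 assumes d: "Polynomial.degree p = d" "0 < d" and p0: "poly p 0 ~= 0" and s: "splits_simply (homog d p)"
 shows "poly p t = 0 ==> \<exists>a b. a ~= 0 \<and> b ~= 0 \<and> t = - b / a \<and> simple_linear_factor a b (homog d p)"
  and "poly p t = 0 ==> poly (pderiv p) t ~= 0"
  and "card {t. poly p t = 0} = d"
proof -
 have p1: "poly (homog d p) 1 = p"
  unfolding poly_homog_1 using poly_as_sum_of_monoms'[of p d] d by simp
 obtain L where L: "homog d p = prod_list (map (%(a, b). linear_form a b) L)"
  "\<And>a b. (a, b) \<in> set L ==> simple_linear_factor a b (homog d p)"
  using s unfolding splits_simply_def by blast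
 have "poly (prod_list (map (%(a, b). linear_form a b) L)) 1 = prod_list (map (%(a, b). [:b, a:]) L)" for L :: "('k \<times> 'k) list"
  by (induction L) (auto simp: linear_form_eq)
 then have pL: "p = prod_list (map (%(a, b). [:b, a:]) L)" using p1 L(1) by simp
 have root: "\<exists>a b. a ~= 0 \<and> b ~= 0 \<and> t = - b / a \<and> simple_linear_factor a b (homog d p)" if t: "poly p t = 0" for t
 proof -
  have "\<exists>x\<in>set L. poly ((%(a, b). [:b, a:]) x) t = 0" if "poly (prod_list (map (%(a, b). [:b, a:]) L)) t = 0" for L :: "('k \<times> 'k) list"
   using that by (induction L) auto
  then obtain a b where ab: "(a, b) \<in> set L" "b + t * a = 0" using t unfolding pL by fastforce
  \<comment> \<open>If \<open>a\<close> vanished, so would \<open>b\<close>, and the zero form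
    cannot divide a nonzero polynomial.\<close>
  have "a ~= 0"
  proof
   assume "a = 0"
   then have "b = 0" using ab by simp
   then have "linear_form a b = 0" using \<open>a = 0\<close> by (simp add: linear_form_eq)
   then have "homog d p = 0" using L(2)[OF ab(1)] by (simp add: simple_linear_factor_def)
   then show False using p1 d by auto
  qed
  moreover from this have tb: "t = - b / a" using ab(2) by (simp add: field_simps add_eq_0_iff)
  moreover have "b ~= 0" using p0 t tb by auto
  ultimately show ?thesis using L(2)[OF ab(1)] by blast
 qed
 show "\<exists>a b. a ~= 0 \<and> b ~= 0 \<and> t = - b / a \<and> simple_linear_factor a b (homog d p)" if "poly p t = 0" using root[OF that] .
 have dt: "poly (pderiv p) t ~= 0" if "poly p t = 0" for t
  using root[OF that] simple_linear_factor_homog(2)[OF d] by blast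
 show "poly (pderiv p) t ~= 0" if "poly p t = 0" using dt[OF that] .
 have "p ~= 0" using p0 by auto
 from card_roots_prod_linear[OF pL this dt] show "card {t. poly p t = 0} = d" using d by simp
qed

text \<open>With x m + y n = 1 the witnesses are the integer powers v = t^x and w = t^(-y), so no
  roots have to exist in the field.\<close>

lemma coprime_power_solution:
 fixes t :: "'k::field"
 assumes "t ~= 0" and "coprime n m"
 shows "\<exists>v w. v ~= 0 \<and> w ~= 0 \<and> v ^ m = t * w ^ n"
proof -
 have "coprime (int m) (int n)" using assms(2) by (simp add: coprime_commute)
 then obtain x y where xy: "x * int m + y * int n = 1" using coprime_iff_gcd_eq_1 bezout_int[of "int m" "int n"] by metis
 have "(t powi x) ^ m = t powi (x * int m)" by (simp add: power_int_mult)
 also have "x * int m = 1 + (- y) * int n" using xy by simp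
 also have "t powi \<dots> = t powi 1 * t powi ((- y) * int n)" by (rule power_int_add) (simp add: assms(1))
 also have "t powi ((- y) * int n) = (t powi (- y)) ^ n" unfolding power_int_mult by (rule power_int_of_nat)
 finally have "(t powi x) ^ m = t * (t powi (- y)) ^ n" by (simp only: power_int_1_right)
 moreover have "t powi x ~= 0" "t powi (- y) ~= 0" using assms(1) by simp_all
 ultimately show ?thesis by blast
qed

text \<open>With y m + x n = 1 the witness is s = A^x B^y; the relation A^m = B^n collapses its
  powers to A and B.\<close>

lemma coprime_power_scale:
 fixes A B :: "'k::field"
 assumes A: "A ~= 0" and B: "B ~= 0" and "A ^ m = B ^ n" and "coprime n m"
 shows "\<exists>s. s ~= 0 \<and> A = s ^ n \<and> B = s ^ m"
proof -
 have "coprime (int m) (int n)" using assms(4) by (simp add: coprime_commute)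
 then obtain y x where xy: "y * int m + x * int n = 1" using coprime_iff_gcd_eq_1 bezout_int[of "int m" "int n"] by metis
 define s where "s = A powi x * B powi y"
 have AB: "A powi (int m * k) = B powi (int n * k)" for k
  using assms(3) by (simp add: power_int_mult)
 have "s ^ n = A powi (x * int n) * B powi (int n * y)"
  by (simp add: s_def power_mult_distrib power_int_mult mult.commute[of "int n"])
 also have "\<dots> = A powi (x * int n + int m * y)" unfolding AB[symmetric] using A by (simp add: power_int_add)
 also have "x * int n + int m * y = 1" using xy by (simp add: mult.commute)
 finally have 1: "s ^ n = A" by simp
 have "s ^ m = A powi (int m * x) * B powi (y * int m)"
  by (simp add: s_def power_mult_distrib power_int_mult mult.commute[of "int m"])
 also have "\<dots> = B powi (int n * x + y * int m)" unfolding AB using B by (simp add: power_int_add)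
 also have "int n * x + y * int m = 1" using xy by (simp add: mult.commute)
 finally have 2: "s ^ m = B" by simp
 have "s ~= 0" using A B by (simp add: s_def)
 then show ?thesis using 1 2 by blast
qed

lemma newton_edge_poly:
 fixes c :: "nat => nat => 'k::field"
 assumes "newton_edge_locale c a1 b1 a2 b2 r n m N e"
 shows "Polynomial.coeff (edge_poly c e) i = (if i <= r then c (a1 + i * m) (b1 - i * n) else 0)"
  and "Polynomial.degree (edge_poly c e) = r" and "poly (edge_poly c e) 0 ~= 0"
proof -
 interpret newton_edge_locale c a1 b1 a2 b2 r n m N e by fact
 have co: "Polynomial.coeff (edge_poly c e) i = (if i <= r then c (a1 + i * m) (b1 - i * n) else 0)" for i
  unfolding edge_poly_def Polynomial.coeff_sum e_def m_def n_def r_def by (simp add: sum.delta)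
 then show "Polynomial.coeff (edge_poly c e) i = (if i <= r then c (a1 + i * m) (b1 - i * n) else 0)" .
 show "poly (edge_poly c e) 0 ~= 0" using newton_edge_basic[OF edge] by (simp add: poly_0_coeff_0 co)
 show "Polynomial.degree (edge_poly c e) = r"
 proof (rule antisym)
  show "Polynomial.degree (edge_poly c e) <= r" by (rule degree_le) (simp add: co)
  show "r <= Polynomial.degree (edge_poly c e)"
   using newton_edge_basic(2)[OF edge] a2 b1 by (intro le_degree) (simp add: co)
 qed
qed

lemma newton_edge_form:
 fixes c h :: "nat => nat => 'k::field"
 assumes "newton_edge_locale c a1 b1 a2 b2 r n m N e"
  and h: "\<And>\<alpha> \<beta>. c \<alpha> \<beta> = 0 ==> h \<alpha> \<beta> = 0" and w: "w ~= 0"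
 shows "edge_form n m N h v w = v ^ a1 * w ^ b1 * (\<Sum>i\<le>r. h (a1 + i * m) (b1 - i * n) * (v ^ m / w ^ n) ^ i)"
proof -
 interpret newton_edge_locale c a1 b1 a2 b2 r n m N e by fact
 have bn: "i * n <= b1" if "i <= r" for i using that b1 by (simp add: trans_le_add2)
 let ?g = "%i. (a1 + i * m, b1 - i * n)"
 have inj: "inj_on ?g {..r}" using pos by (auto intro!: inj_onI)
 have sub: "?g ` {..r} \<subseteq> {(\<alpha>, \<beta>). n * \<alpha> + m * \<beta> = N}"
 proof (rule image_subsetI)
  fix i assume "i \<in> {..r}"
  then obtain k where k: "b1 = i * n + k" using bn[of i] le_iff_add[of "i * n" b1] by auto
  have "n * (a1 + i * m) + m * (b1 - i * n) = N" unfolding N(1) k by (simp add: algebra_simps)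
  then show "?g i \<in> {(\<alpha>, \<beta>). n * \<alpha> + m * \<beta> = N}" by simp
 qed
 have "edge_form n m N h v w = (\<Sum>(\<alpha>,\<beta>)\<in>?g ` {..r}. h \<alpha> \<beta> * v ^ \<alpha> * w ^ \<beta>)"
  unfolding edge_form_def
 proof (rule sum.mono_neutral_right[OF finite_weight_eq[OF pos(2,3)] sub], rule ballI)
  fix x assume x: "x \<in> {(\<alpha>, \<beta>). n * \<alpha> + m * \<beta> = N} - ?g ` {..r}"
  obtain \<alpha> \<beta> where ab: "x = (\<alpha>, \<beta>)" by (cases x)
  have "n * \<alpha> + m * \<beta> = N" and out: "(\<alpha>, \<beta>) \<notin> ?g ` {..r}" using x unfolding ab by simp_all
  have "c \<alpha> \<beta> = 0"
  proof (rule ccontr)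
   assume "c \<alpha> \<beta> ~= 0"
   from support_eq[OF this \<open>n * \<alpha> + m * \<beta> = N\<close>] obtain i where i: "i <= r" "\<alpha> = a1 + i * m" "\<beta> + i * n = b1" by blast
   then have "\<beta> = b1 - i * n" by simp
   then show False using out i by blast
  qed
  then show "(case x of (\<alpha>, \<beta>) => h \<alpha> \<beta> * v ^ \<alpha> * w ^ \<beta>) = 0" using h unfolding ab by simp
 qed
 also have "\<dots> = (\<Sum>i\<le>r. h (a1 + i * m) (b1 - i * n) * v ^ (a1 + i * m) * w ^ (b1 - i * n))"
  by (simp add: sum.reindex[OF inj])
 also have "\<dots> = v ^ a1 * w ^ b1 * (\<Sum>i\<le>r. h (a1 + i * m) (b1 - i * n) * (v ^ m / w ^ n) ^ i)"
  unfolding sum_distrib_left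
 proof (intro sum.cong refl)
  fix i assume "i \<in> {..r}"
  then have "w ^ b1 = w ^ (b1 - i * n) * (w ^ n) ^ i" using bn[of i] by (simp add: power_mult[symmetric] power_add[symmetric] mult.commute)
  moreover have "v ^ (a1 + i * m) = v ^ a1 * (v ^ m) ^ i" by (simp add: power_add power_mult[symmetric] mult.commute)
  ultimately show "h (a1 + i * m) (b1 - i * n) * v ^ (a1 + i * m) * w ^ (b1 - i * n) = v ^ a1 * w ^ b1 * (h (a1 + i * m) (b1 - i * n) * (v ^ m / w ^ n) ^ i)"
   using w by (simp add: power_divide)
 qed
 finally show ?thesis .
qed

text \<open>The exponents a1 + i m turn the sum into a1 psi(t) + m t psi'(t), the exponents b1 - i n
  into b1 psi(t) - n t psi'(t). With psi(t) = 0 only the nonzero term t psi'(t) remains.\<close>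

lemma newton_edge_form_root:
 fixes c :: "nat => nat => 'k::field_char_0"
 assumes L: "newton_edge_locale c a1 b1 a2 b2 r n m N e" and v: "v ~= 0" and w: "w ~= 0"
  and root: "poly (edge_poly c e) (v ^ m / w ^ n) = 0" and simple: "poly (pderiv (edge_poly c e)) (v ^ m / w ^ n) ~= 0"
 shows "edge_form n m N c v w = 0" and "edge_form n m N (%\<alpha> \<beta>. of_nat \<alpha> * c \<alpha> \<beta>) v w ~= 0"
  and "edge_form n m N (%\<alpha> \<beta>. of_nat \<beta> * c \<alpha> \<beta>) v w ~= 0"
proof -
 interpret newton_edge_locale c a1 b1 a2 b2 r n m N e by fact
 let ?t = "v ^ m / w ^ n"
 let ?c = "%i. c (a1 + i * m) (b1 - i * n)"
 note co = newton_edge_poly(1)[OF L] and deg = newton_edge_poly(2)[OF L]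
 have t: "?t ~= 0" using v w by simp
 have p: "(\<Sum>i\<le>r. ?c i * ?t ^ i) = 0"
  using root unfolding poly_altdef deg by (simp add: co)
 have dp: "(\<Sum>i\<le>r. of_nat i * ?c i * ?t ^ i) = ?t * poly (pderiv (edge_poly c e)) ?t"
 proof -
  have alt: "poly q x = (\<Sum>i\<le>k. Polynomial.coeff q i * x ^ i)" if "Polynomial.degree q <= k" for q :: "'k poly" and x k
   using arg_cong[OF poly_as_sum_of_monoms'[OF that], of "%p. poly p x"] by (simp add: poly_sum poly_monom)
  have "Polynomial.degree (pCons 0 (pderiv (edge_poly c e))) <= r"
   using degree_pderiv[of "edge_poly c e"] pos(1) deg by (auto simp: degree_pCons_eq_if)
  moreover have "Polynomial.coeff (pCons 0 (pderiv (edge_poly c e))) i = of_nat i * Polynomial.coeff (edge_poly c e) i" for i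
   by (cases i) (simp_all add: coeff_pderiv)
  ultimately have "poly (pCons 0 (pderiv (edge_poly c e))) ?t = (\<Sum>i\<le>r. of_nat i * Polynomial.coeff (edge_poly c e) i * ?t ^ i)"
   using alt[of "pCons 0 (pderiv (edge_poly c e))" r ?t] by (simp only:)
  also have "\<dots> = (\<Sum>i\<le>r. of_nat i * ?c i * ?t ^ i)" by (intro sum.cong refl) (simp add: co)
  finally show ?thesis by simp
 qed
 have q: "(\<Sum>i\<le>r. of_nat i * ?c i * ?t ^ i) ~= 0" unfolding dp using t simple by simp
 show "edge_form n m N c v w = 0" unfolding newton_edge_form[OF L _ w, of c v, simplified] p by simp
 have "(\<Sum>i\<le>r. of_nat (a1 + i * m) * ?c i * ?t ^ i) = of_nat a1 * (\<Sum>i\<le>r. ?c i * ?t ^ i) + of_nat m * (\<Sum>i\<le>r. of_nat i * ?c i * ?t ^ i)"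
  unfolding sum_distrib_left sum.distrib[symmetric] by (intro sum.cong refl) (simp add: algebra_simps)
 then have "(\<Sum>i\<le>r. of_nat (a1 + i * m) * ?c i * ?t ^ i) ~= 0" using p q pos by simp
 then show "edge_form n m N (%\<alpha> \<beta>. of_nat \<alpha> * c \<alpha> \<beta>) v w ~= 0"
  using v w by (subst newton_edge_form[OF L _ w]) auto
 have "(\<Sum>i\<le>r. of_nat (b1 - i * n) * ?c i * ?t ^ i) = of_nat b1 * (\<Sum>i\<le>r. ?c i * ?t ^ i) - of_nat n * (\<Sum>i\<le>r. of_nat i * ?c i * ?t ^ i)"
  unfolding sum_distrib_left sum_subtractf[symmetric]
 proof (intro sum.cong refl)
  fix i assume "i \<in> {..r}"
  then have "i * n <= b1" using b1 by (simp add: trans_le_add2)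
  then show "of_nat (b1 - i * n) * ?c i * ?t ^ i = of_nat b1 * (?c i * ?t ^ i) - of_nat n * (of_nat i * ?c i * ?t ^ i)"
   by (simp add: of_nat_diff algebra_simps)
 qed
 then have "(\<Sum>i\<le>r. of_nat (b1 - i * n) * ?c i * ?t ^ i) ~= 0" using p q pos by simp
 then show "edge_form n m N (%\<alpha> \<beta>. of_nat \<beta> * c \<alpha> \<beta>) v w ~= 0"
  using v w by (subst newton_edge_form[OF L _ w]) auto
qed

section \<open>Koszul exactness on cones and across vertices\<close>

context newton_polygon
begin

definition hge :: "nat => 'b::zero fps fps => bool" where
 "hge d p \<longleftrightarrow> (\<forall>x y. H x y < d --> cf p x y = 0)"

lemma hgeD: "hge d p ==> cf p x y ~= 0 ==> d <= H x y"
 unfolding hge_def by (meson not_le)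

end

text \<open>The two assumptions together say that every edge polynomial is, up to a constant, a
  product of distinct linear factors over \<open>'k\<close>.\<close>

locale newton_split = newton_polygon c
 for c :: "nat => nat => 'k :: {real_normed_field, euclidean_space}" +
 assumes card_roots: "e \<in> newton_edges c ==> card {t. poly (edge_poly c e) t = 0} = edge_r e"
  and simple_roots: "e \<in> newton_edges c ==> poly (edge_poly c e) t = 0 ==> poly (pderiv (edge_poly c e)) t ~= 0"
begin

definition f :: "'k fps fps" where "f = Abs_fps (%a. Abs_fps (%b. of_nat a * c a b))"
definition g :: "'k fps fps" where "g = Abs_fps (%a. Abs_fps (%b. of_nat b * c a b))"

lemma cf_f: "cf f a b = of_nat a * c a b" and cf_g: "cf g a b = of_nat b * c a b"
 by (simp_all add: f_def g_def)

end

locale newton_split_edge = newton_split c + newton_edge_locale c a1 b1 a2 b2 r n m N e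
 for c :: "nat => nat => 'k :: {real_normed_field, euclidean_space}" and a1 b1 a2 b2 r n m N e
begin

lemma e_in: "e \<in> newton_edges c" using edge e_def by simp

text \<open>In the cone of \<open>e\<close> levels are weights of \<open>e\<close>, and d + L is the
  lowest level of the product. Hence in each contributing pair of exponents the one from
  \<open>q\<close> has minimal weight for \<open>e\<close>, that is, it lies on the edge.\<close>

lemma conv_level:
 fixes p q :: "'k fps fps"
 assumes p: "hge d p" and q: "\<And>x y. cf q x y ~= 0 ==> c x y ~= 0"
  and cone: "edge_cone e x y" and H: "H x y = d + L"
 shows "cf (p * q) x y = (\<Sum>i\<le>r. ext_coeff p (int x - int (a1 + i * m)) (int y - int (b1 - i * n)) * cf q (a1 + i * m) (b1 - i * n))"
proof -
 define G where "G = (%(i, j). ext_coeff p (int x - int i) (int y - int j) * cf q i j)"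
 define w where "w = (%i. (a1 + i * m, b1 - i * n))"
 have "cf (p * q) x y = cf (q * p) x y" by (simp add: mult.commute)
 also have "\<dots> = (\<Sum>i\<le>x. \<Sum>j\<le>y. G (i, j))"
  unfolding cf_mult
 proof (intro sum.cong refl)
  fix i j assume ij: "i \<in> {..x}" "j \<in> {..y}"
  have "ext_coeff p (int x - int i) (int y - int j) = cf p (x - i) (y - j)"
   using ij by (simp add: ext_coeff_def nat_diff_distrib)
  then show "cf q i j * cf p (x - i) (y - j) = G (i, j)" unfolding G_def by (simp add: mult.commute)
 qed
 also have "\<dots> = sum G ({..x} \<times> {..y})" by (simp add: sum.cartesian_product)
 also have "\<dots> = sum G (w ` {..r})"
 proof (rule sum.mono_neutral_cong)
  show "G u = 0" if "u \<in> w ` {..r} - {..x} \<times> {..y}" for u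
   using that by (cases u) (auto simp: G_def ext_coeff_def)
  show "G u = 0" if u: "u \<in> {..x} \<times> {..y} - w ` {..r}" for u
  proof (rule ccontr)
   assume "G u ~= 0"
   obtain i j where ij: "u = (i, j)" "i <= x" "j <= y" using u by (cases u) auto
   have e': "ext_coeff p (int x - int i) (int y - int j) = cf p (x - i) (y - j)"
    using ij by (simp add: ext_coeff_def nat_diff_distrib)
   have nz: "cf p (x - i) (y - j) ~= 0" "cf q i j ~= 0" using \<open>G u ~= 0\<close> ij e' by (auto simp: G_def)
   have c: "c i j ~= 0" using q nz by blast
   have "d <= H (x - i) (y - j)" using hgeD[OF p nz(1)] .
   then have 1: "d <= W e * edge_wt e (x - i) (y - j)" using H_le[OF e_in, of "x - i" "y - j"] by linarith
   have 2: "L <= W e * edge_wt e i j" using H_support[OF c] H_le[OF e_in, of i j] by linarith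
   have "d + L = W e * edge_wt e ((x - i) + i) ((y - j) + j)" using H_cone[OF e_in cone] H ij by simp
   also have "\<dots> = W e * edge_wt e (x - i) (y - j) + W e * edge_wt e i j"
    unfolding edge_wt_add by (simp add: distrib_left)
   finally have "W e * edge_wt e i j = L" using 1 2 by linarith
   then have "W e * edge_wt e i j = W e * N" using W_N[OF e_in] by (simp add: N_def)
   then have "n * i + m * j = N" using W_pos[OF e_in] unfolding wt by simp
   from support_eq[OF c this] obtain l where "l <= r" "i = a1 + l * m" "j + l * n = b1" by blast
   then have "u \<in> w ` {..r}" unfolding ij w_def by (intro image_eqI[of _ _ l]) auto
   then show False using u by blast
  qed
 qed auto
 also have "\<dots> = (\<Sum>i\<le>r. G (w i))"
 proof -
  have "inj_on w {..r}" using pos by (auto simp: inj_on_def w_def)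
  then show ?thesis by (simp add: sum.reindex)
 qed
 finally show ?thesis unfolding G_def w_def by simp
qed

end

text \<open>One weight line in the cone of \<open>e\<close>, with data as produced by
  \<open>line_data\<close>. Its lattice points are indexed by 0 to \<open>J\<close>, and a series
  restricted to them becomes a polynomial in the index.\<close>

locale newton_split_line = newton_split_edge c a1 b1 a2 b2 r n m N e
 for c :: "nat => nat => 'k :: {real_normed_field, euclidean_space}" and a1 b1 a2 b2 r n m N e +
 fixes x0 y0 J s d :: nat
 assumes J: "J * n <= y0" and s: "n * x0 + m * y0 = s" and d: "W e * s = d"
  and line: "\<And>j::int. (0 <= int a2 * (int y0 - j * int n) - int b2 * (int x0 + j * int m) \<and>
   0 <= int b1 * (int x0 + j * int m) - int a1 * (int y0 - j * int n)) \<longleftrightarrow> 0 <= j \<and> j <= int J"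
begin

lemma line_point:
 assumes "0 <= int x0 + j * int m" "0 <= int y0 - j * int n"
 shows "edge_wt e (nat (int x0 + j * int m)) (nat (int y0 - j * int n)) = s"
  and "edge_cone e (nat (int x0 + j * int m)) (nat (int y0 - j * int n)) \<longleftrightarrow> 0 <= j \<and> j <= int J"
proof -
 have i: "int (nat (int x0 + j * int m)) = int x0 + j * int m" "int (nat (int y0 - j * int n)) = int y0 - j * int n"
  by (rule nat_0_le[OF assms(1)], rule nat_0_le[OF assms(2)])
 have "int (n * nat (int x0 + j * int m) + m * nat (int y0 - j * int n)) = int n * (int x0 + j * int m) + int m * (int y0 - j * int n)"
  unfolding of_nat_add of_nat_mult i ..
 also have "\<dots> = int (n * x0 + m * y0)" by (simp add: algebra_simps)
 finally have "int (n * nat (int x0 + j * int m) + m * nat (int y0 - j * int n)) = int (n * x0 + m * y0)" .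
 then show "edge_wt e (nat (int x0 + j * int m)) (nat (int y0 - j * int n)) = s"
  unfolding wt s by (simp only: of_nat_eq_iff)
 show "edge_cone e (nat (int x0 + j * int m)) (nat (int y0 - j * int n)) \<longleftrightarrow> 0 <= j \<and> j <= int J"
  unfolding cone_int i by (rule line)
qed

lemma line_H:
 assumes "0 <= int x0 + j * int m" "0 <= int y0 - j * int n"
 shows "H (nat (int x0 + j * int m)) (nat (int y0 - j * int n)) <= d"
  and "d <= H (nat (int x0 + j * int m)) (nat (int y0 - j * int n)) \<longleftrightarrow> 0 <= j \<and> j <= int J"
proof -
 let ?x = "nat (int x0 + j * int m)" and ?y = "nat (int y0 - j * int n)"
 have wd: "W e * edge_wt e ?x ?y = d" unfolding line_point(1)[OF assms] by (rule d)
 show le: "H ?x ?y <= d" using H_le[OF e_in, of ?x ?y] unfolding wd .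
 show "d <= H ?x ?y \<longleftrightarrow> 0 <= j \<and> j <= int J"
  unfolding line_point(2)[OF assms, symmetric]
 proof
  assume "d <= H ?x ?y"
  then have "H ?x ?y = W e * edge_wt e ?x ?y" using wd le by linarith
  then show "edge_cone e ?x ?y" by (rule cone_if_H[OF e_in])
 next
  assume "edge_cone e ?x ?y"
  from H_cone[OF e_in this] show "d <= H ?x ?y" using wd by linarith
 qed
qed

lemma ext_coeff_line:
 assumes "hge d p" "ext_coeff p (int x0 + j * int m) (int y0 - j * int n) ~= 0"
 shows "0 <= j \<and> j <= int J"
proof -
 have nn: "0 <= int x0 + j * int m" "0 <= int y0 - j * int n"
  and "cf p (nat (int x0 + j * int m)) (nat (int y0 - j * int n)) ~= 0"
  using assms(2) by (auto simp: ext_coeff_def split: if_splits)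
 then show ?thesis using hgeD[OF assms(1)] line_H(2)[OF nn] by blast
qed

definition lp :: "'k fps fps => 'k poly" where
 "lp p = (\<Sum>j\<le>J. Polynomial.monom (ext_coeff p (int x0 + int j * int m) (int y0 - int j * int n)) j)"

definition ep :: "'k fps fps => 'k poly" where
 "ep q = (\<Sum>i\<le>r. Polynomial.monom (cf q (a1 + i * m) (b1 - i * n)) i)"

lemma coeff_sum_monom: "Polynomial.coeff (\<Sum>j\<le>K. Polynomial.monom (h j) j) l = (if l <= K then h l else 0)"
 by (simp add: Polynomial.coeff_sum Polynomial.coeff_monom)

lemma coeff_lp:
 assumes "hge d p"
 shows "Polynomial.coeff (lp p) l = ext_coeff p (int x0 + int l * int m) (int y0 - int l * int n)"
proof (cases "l <= J")
 case False
 then have "ext_coeff p (int x0 + int l * int m) (int y0 - int l * int n) = 0"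
  using ext_coeff_line[OF assms, of "int l"] by auto
 then show ?thesis unfolding lp_def coeff_sum_monom using False by simp
qed (simp add: lp_def coeff_sum_monom)

lemma coeff_lp_eq: "l <= J ==> Polynomial.coeff (lp p) l = cf p (x0 + l * m) (y0 - l * n)"
proof -
 assume "l <= J"
 then have "l * n <= J * n" by simp
 then have "l * n <= y0" using J by linarith
 then have "0 <= int y0 - int l * int n" "nat (int y0 - int l * int n) = y0 - l * n"
  by (simp_all add: nat_diff_distrib flip: of_nat_mult)
 then show ?thesis using \<open>l <= J\<close> unfolding lp_def coeff_sum_monom ext_coeff_def by (simp flip: of_nat_mult of_nat_add)
qed

lemma lp_zero: "J < l ==> Polynomial.coeff (lp p) l = 0"
 unfolding lp_def coeff_sum_monom by simp

lemma ep_zero: "r < l ==> Polynomial.coeff (ep q) l = 0"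
 unfolding ep_def coeff_sum_monom by simp

lemma on_line: "j <= J ==> j * n <= y0 \<and> edge_cone e (x0 + j * m) (y0 - j * n) \<and> H (x0 + j * m) (y0 - j * n) = d"
proof -
 assume j: "j <= J"
 then have "j * n <= J * n" by simp
 then have le: "j * n <= y0" using J by linarith
 then have nn: "0 <= int x0 + int j * int m" "0 <= int y0 - int j * int n"
  by (simp_all flip: of_nat_mult of_nat_add)
 have eq: "nat (int x0 + int j * int m) = x0 + j * m" "nat (int y0 - int j * int n) = y0 - j * n"
  using le by (simp_all add: nat_diff_distrib flip: of_nat_mult of_nat_add)
 show ?thesis using line_point(2)[OF nn] line_H[OF nn] j le unfolding eq by auto
qed

lemma on_line_conv:
 assumes "edge_cone e x y" "H x y = d"
 shows "\<exists>j\<le>J. x = x0 + j * m \<and> y = y0 - j * n \<and> j * n <= y0"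
proof -
 have "W e * edge_wt e x y = W e * s" using H_cone[OF e_in assms(1)] assms(2) d by linarith
 then have "n * x + m * y = n * x0 + m * y0" using W_pos[OF e_in] s unfolding wt by simp
 then have "int n * int x + int m * int y = int n * int x0 + int m * int y0" by (metis of_nat_add of_nat_mult)
 then obtain j where j: "int x = int x0 + j * int m" "int y = int y0 - j * int n" using line_param by blast
 have "0 <= j \<and> j <= int J" using line[of j] assms(1) unfolding cone_int j by blast
 then obtain l where l: "j = int l" "l <= J" by (metis nonneg_int_cases of_nat_le_iff)
 have "int x = int (x0 + l * m)" "int (y + l * n) = int y0" using j l by simp_all
 then have "x = x0 + l * m" "y + l * n = y0" by (simp_all only: of_nat_eq_iff)
 then show ?thesis using l by (intro exI[of _ l]) auto
qed

lemma edge_point: "i <= r ==> i * n <= b1 \<and> edge_cone e (a1 + i * m) (b1 - i * n) \<and> H (a1 + i * m) (b1 - i * n) = L"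
proof -
 assume i: "i <= r"
 then have "i * n <= r * n" by simp
 then have le: "i * n <= b1" using b1 by linarith
 then have cone: "edge_cone e (a1 + i * m) (b1 - i * n)" using i by (intro point_in_cone[of i]) auto
 have "n * (a1 + i * m) + m * (b1 - i * n) = N"
  unfolding N(1) using le by (simp add: algebra_simps diff_mult_distrib2 le_diff_conv2)
 then have "edge_wt e (a1 + i * m) (b1 - i * n) = edge_N e" unfolding wt N_def .
 then show ?thesis using le cone H_cone[OF e_in cone] W_N[OF e_in] by simp
qed

lemma H_cone_add:
 assumes "edge_cone e x y" "edge_cone e x' y'"
 shows "H (x + x') (y + y') = H x y + H x' y'"
 unfolding H_cone[OF e_in assms(1)] H_cone[OF e_in assms(2)] H_cone[OF e_in cone_add[OF assms]] edge_wt_add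
 by (simp add: distrib_left)

text \<open>Indices add: a point of the line plus a point of the edge lies on the parallel line at
  level d + L, so the lowest part of the product is a product of polynomials.\<close>

lemma line_conv:
 assumes p: "hge d p" and q: "\<And>x y. cf q x y ~= 0 ==> c x y ~= 0" and l: "l <= J + r"
 shows "l * n <= y0 + b1" "H (x0 + l * m + a1) (y0 + b1 - l * n) = d + L"
  "cf (p * q) (x0 + l * m + a1) (y0 + b1 - l * n) = Polynomial.coeff (lp p * ep q) l"
proof -
 \<comment> \<open>Some splitting of \<open>l\<close> into an index of the line and one of the edge
   is enough to place the point in the cone.\<close>
 define j i where "j = min l J" and "i = l - min l J"
 have ji: "l = j + i" "j <= J" "i <= r" using l by (auto simp: j_def i_def)
 note P = on_line[OF ji(2)] and Q = edge_point[OF ji(3)]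
 show le: "l * n <= y0 + b1" using P Q unfolding ji(1) by (simp add: add_mult_distrib)
 have eq: "x0 + l * m + a1 = (x0 + j * m) + (a1 + i * m)" "y0 + b1 - l * n = (y0 - j * n) + (b1 - i * n)"
  using P Q unfolding ji(1) by (simp_all add: add_mult_distrib)
 have cone: "edge_cone e (x0 + l * m + a1) (y0 + b1 - l * n)" unfolding eq using P Q by (blast intro: cone_add)
 show H: "H (x0 + l * m + a1) (y0 + b1 - l * n) = d + L" unfolding eq using H_cone_add P Q by metis
 have "cf (p * q) (x0 + l * m + a1) (y0 + b1 - l * n)
   = (\<Sum>i\<le>r. ext_coeff p (int (x0 + l * m + a1) - int (a1 + i * m)) (int (y0 + b1 - l * n) - int (b1 - i * n)) * cf q (a1 + i * m) (b1 - i * n))"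
  by (rule conv_level[OF p q cone H])
 also have "\<dots> = (\<Sum>i\<le>r. ext_coeff p (int x0 + (int l - int i) * int m) (int y0 - (int l - int i) * int n) * Polynomial.coeff (ep q) i)"
 proof (intro sum.cong refl)
  fix i assume i: "i \<in> {..r}"
  then have "i * n <= b1" using edge_point by auto
  then have "int (y0 + b1 - l * n) - int (b1 - i * n) = int y0 - (int l - int i) * int n"
   using le by (simp add: of_nat_diff algebra_simps)
  moreover have "int (x0 + l * m + a1) - int (a1 + i * m) = int x0 + (int l - int i) * int m" by (simp add: algebra_simps)
  moreover have "Polynomial.coeff (ep q) i = cf q (a1 + i * m) (b1 - i * n)" using i unfolding ep_def coeff_sum_monom by simp
  ultimately show "ext_coeff p (int (x0 + l * m + a1) - int (a1 + i * m)) (int (y0 + b1 - l * n) - int (b1 - i * n)) * cf q (a1 + i * m) (b1 - i * n)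
    = ext_coeff p (int x0 + (int l - int i) * int m) (int y0 - (int l - int i) * int n) * Polynomial.coeff (ep q) i" by simp
 qed
 also have "\<dots> = (\<Sum>i\<le>l. Polynomial.coeff (ep q) i * Polynomial.coeff (lp p) (l - i))"
 proof (rule sum.mono_neutral_cong)
  show "Polynomial.coeff (ep q) i * Polynomial.coeff (lp p) (l - i) = 0" if "i \<in> {..l} - {..r}" for i
   using that ep_zero[of i q] by auto
  show "ext_coeff p (int x0 + (int l - int i) * int m) (int y0 - (int l - int i) * int n) * Polynomial.coeff (ep q) i = 0"
   if "i \<in> {..r} - {..l}" for i
   using that ext_coeff_line[OF p, of "int l - int i"] by auto
  show "ext_coeff p (int x0 + (int l - int i) * int m) (int y0 - (int l - int i) * int n) * Polynomial.coeff (ep q) i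
    = Polynomial.coeff (ep q) i * Polynomial.coeff (lp p) (l - i)" if "i \<in> {..r} \<inter> {..l}" for i
   using that unfolding coeff_lp[OF p] by (simp add: of_nat_diff mult.commute)
 qed auto
 also have "\<dots> = Polynomial.coeff (lp p * ep q) l" unfolding mult.commute[of "lp p"] coeff_mult ..
 finally show "cf (p * q) (x0 + l * m + a1) (y0 + b1 - l * n) = Polynomial.coeff (lp p * ep q) l" .
qed

lemma coeff_edge_poly: "Polynomial.coeff (edge_poly c e) i = (if i <= r then c (a1 + i * m) (b1 - i * n) else 0)"
 unfolding edge_poly_def coeff_sum_monom e_def m_def n_def r_def by simp

lemma degree_edge_poly: "Polynomial.degree (edge_poly c e) = r"
proof (rule antisym)
 show "Polynomial.degree (edge_poly c e) <= r" by (rule degree_le) (simp add: coeff_edge_poly)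
 have "Polynomial.coeff (edge_poly c e) r = c a2 b2" unfolding coeff_edge_poly using a2 b1 by simp
 also have "\<dots> ~= 0" using newton_edge_basic[OF edge] by simp
 finally show "r <= Polynomial.degree (edge_poly c e)" by (rule le_degree)
qed

lemma edge_poly_0: "poly (edge_poly c e) 0 ~= 0"
 using newton_edge_basic[OF edge] by (simp add: poly_0_coeff_0 coeff_edge_poly)

lemma coeff_pCons_pderiv: "Polynomial.coeff (pCons 0 (pderiv p)) i = of_nat i * Polynomial.coeff p i"
 by (cases i) (auto simp: coeff_pderiv simp del: of_nat_Suc)

lemma ep_f: "ep f = Polynomial.smult (of_nat a1) (edge_poly c e) + Polynomial.smult (of_nat m) (pCons 0 (pderiv (edge_poly c e)))"
proof (rule poly_eqI)
 fix i
 show "Polynomial.coeff (ep f) i = Polynomial.coeff (Polynomial.smult (of_nat a1) (edge_poly c e) + Polynomial.smult (of_nat m) (pCons 0 (pderiv (edge_poly c e)))) i"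
  unfolding ep_def coeff_sum_monom Polynomial.coeff_add Polynomial.coeff_smult coeff_pCons_pderiv
  by (simp add: coeff_edge_poly cf_f algebra_simps)
qed

lemma ep_g: "ep g = Polynomial.smult (of_nat b1) (edge_poly c e) - Polynomial.smult (of_nat n) (pCons 0 (pderiv (edge_poly c e)))"
proof (rule poly_eqI)
 fix i
 have *: "(of_nat (b1 - i * n) :: 'k) = of_nat b1 - of_nat i * of_nat n" if "i <= r"
  using edge_point[OF that] by (simp add: of_nat_diff)
 show "Polynomial.coeff (ep g) i = Polynomial.coeff (Polynomial.smult (of_nat b1) (edge_poly c e) - Polynomial.smult (of_nat n) (pCons 0 (pderiv (edge_poly c e)))) i"
  unfolding ep_def coeff_sum_monom Polynomial.coeff_diff Polynomial.coeff_smult coeff_pCons_pderiv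
  by (cases "i <= r") (simp_all add: coeff_edge_poly cf_g * left_diff_distrib mult_ac)
qed

lemma f_supp: "cf f x y ~= 0 ==> c x y ~= 0" and g_supp: "cf g x y ~= 0 ==> c x y ~= 0"
 by (auto simp: cf_f cf_g)

lemma lp_ep_zero: "J + r < l ==> Polynomial.coeff (lp p * ep q) l = 0"
proof -
 assume l: "J + r < l"
 have z: "Polynomial.coeff (lp p) i * Polynomial.coeff (ep q) (l - i) = 0" for i
  using lp_zero[of i p] ep_zero[of "l - i" q] l by (cases "J < i") auto
 show ?thesis unfolding coeff_mult by (intro sum.neutral ballI z)
qed

lemma koszul_line:
 assumes p: "hge d p" and q: "hge d q"
  and z: "\<And>x y. H x y = d + L ==> cf (p * f + q * g) x y = 0"
 shows "\<exists>E. lp p = E * ep g \<and> lp q = - (E * ep f) \<and> (E = 0 \<or> Polynomial.degree E + r <= J)"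
proof -
 have "lp p * ep f + lp q * ep g = 0"
 proof (rule poly_eqI)
  fix l
  show "Polynomial.coeff (lp p * ep f + lp q * ep g) l = Polynomial.coeff 0 l"
  proof (cases "l <= J + r")
   case True
   have "cf (p * f) (x0 + l * m + a1) (y0 + b1 - l * n) + cf (q * g) (x0 + l * m + a1) (y0 + b1 - l * n) = 0"
    using z[OF line_conv(2)[OF p f_supp True]] by simp
   then show ?thesis using line_conv(3)[OF p f_supp True] line_conv(3)[OF q g_supp True] by simp
  qed (simp add: lp_ep_zero)
 qed
 moreover have "(of_nat n :: 'k) * of_nat a1 + of_nat m * of_nat b1 ~= 0"
 proof -
  have "(of_nat n :: 'k) * of_nat a1 + of_nat m * of_nat b1 = of_nat N" unfolding N(1) by simp
  then show ?thesis using N_pos by simp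
 qed
 moreover have "card {t. poly (edge_poly c e) t = 0} = Polynomial.degree (edge_poly c e)"
  unfolding degree_edge_poly card_roots[OF e_in] r_def ..
 ultimately obtain E where E: "lp p = E * ep g" "lp q = - (E * ep f)"
  "E = 0 \<or> Polynomial.degree E + Polynomial.degree (edge_poly c e) <= max (Polynomial.degree (lp p)) (Polynomial.degree (lp q))"
  using koszul_poly[OF _ edge_poly_0 simple_roots[OF e_in] ep_f ep_g] by blast
 have "Polynomial.degree (lp p) <= J" "Polynomial.degree (lp q) <= J"
  by (rule degree_le, simp add: lp_zero)+
 then show ?thesis using E unfolding degree_edge_poly by (intro exI[of _ E]) auto
qed

text \<open>The polynomial \<open>ep f\<close> is nonzero, its top coefficient being a2 times the
  coefficient of G at the right endpoint, with a2 > a1 >= 0.\<close>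

lemma koszul_line_inj:
 assumes p: "hge d p" and z: "\<And>x y. H x y = d + L ==> cf (p * f) x y = 0"
 shows "lp p = 0"
proof -
 have "lp p * ep f = 0"
 proof (rule poly_eqI)
  fix l
  show "Polynomial.coeff (lp p * ep f) l = Polynomial.coeff 0 l"
  proof (cases "l <= J + r")
   case True
   then show ?thesis using z[OF line_conv(2)[OF p f_supp True]] line_conv(3)[OF p f_supp True] by simp
  qed (simp add: lp_ep_zero)
 qed
 moreover have "Polynomial.coeff (ep f) r ~= 0"
 proof -
  have "a1 + r * m = a2" "b1 - r * n = b2" using a2 b1 by simp_all
  then have "Polynomial.coeff (ep f) r = of_nat a2 * c a2 b2" unfolding ep_def coeff_sum_monom cf_f by simp
  then show ?thesis using newton_edge_basic[OF edge] by simp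
 qed
 then have "ep f ~= 0" by auto
 ultimately show ?thesis by simp
qed

end

context newton_split_edge
begin

lemma edge_points: "edge_cone e a1 b1" "edge_cone e a2 b2" "H a1 b1 = L" "H a2 b2 = L"
proof -
 show c1: "edge_cone e a1 b1" using b1 by (intro point_in_cone[of 0]) auto
 show c2: "edge_cone e a2 b2" using a2 b1 by (intro point_in_cone[of r]) auto
 have "edge_wt e a1 b1 = edge_N e" "edge_wt e a2 b2 = edge_N e" unfolding wt using N N_def by auto
 then show "H a1 b1 = L" "H a2 b2 = L"
  using H_cone[OF e_in c1] H_cone[OF e_in c2] W_N[OF e_in] by auto
qed

lemma H_cone_add:
 assumes "edge_cone e x y" "edge_cone e x' y'"
 shows "H (x + x') (y + y') = H x y + H x' y'"
 unfolding H_cone[OF e_in assms(1)] H_cone[OF e_in assms(2)] H_cone[OF e_in cone_add[OF assms]] edge_wt_add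
 by (simp add: distrib_left)

text \<open>The multiplier E of \<open>koszul_line\<close> has degree at most J - r, so its
  coefficients sit at cone points of level d - L; \<epsilon> records them. Quantifying over
  \<open>h\<close> allows the values to be taken from one global series later. The last two clauses
  compare lowest and highest coefficients, which sit on the two boundary rays of the cone, and
  prepare the gluing.\<close>

lemma local_koszul:
 fixes p q :: "'k fps fps"
 assumes p: "hge d p" and q: "hge d q"
  and z: "\<And>x y. H x y = d + L ==> cf (p * f + q * g) x y = 0"
 shows "\<exists>\<epsilon>. (\<forall>h. (\<forall>x y. cf h x y ~= 0 --> H x y + L = d) -->
    (\<forall>x y. edge_cone e x y \<and> H x y + L = d --> cf h x y = \<epsilon> x y) -->
    (\<forall>x y. edge_cone e x y \<and> H x y = d --> cf (h * g) x y = cf p x y \<and> cf (h * f) x y = - cf q x y))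
   \<and> (\<forall>x y. H x y + L = d \<and> edge_cone e x y \<and> a1 * y = b1 * x --> \<epsilon> x y * cf f a1 b1 = - cf q (x + a1) (y + b1))
   \<and> (\<forall>x y. H x y + L = d \<and> edge_cone e x y \<and> a2 * y = b2 * x --> \<epsilon> x y * cf f a2 b2 = - cf q (x + a2) (y + b2))"
  (is "\<exists>\<epsilon>. ?A \<epsilon> \<and> ?BL \<epsilon> \<and> ?BR \<epsilon>")
proof (cases "\<exists>u v. edge_cone e u v \<and> H u v = d")
 case False
 \<comment> \<open>Adding the left endpoint would produce a cone point of level d.\<close>
 have "\<not> (edge_cone e x y \<and> H x y + L = d)" for x y
  using False H_cone_add[of x y a1 b1] cone_add[of x y a1 b1] edge_points by metis
 then have "?A (%x y. 0) \<and> ?BL (%x y. 0) \<and> ?BR (%x y. 0)" using False by blast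
 then show ?thesis by (rule exI[of _ "%x y. 0"])
next
 case True
 then obtain u v where uv: "edge_cone e u v" "H u v = d" by blast
 define s where "s = n * u + m * v"
 have d: "W e * s = d" using H_cone[OF e_in uv(1)] uv(2) unfolding wt s_def by simp
 obtain x0 y0 J where data: "J * n <= y0" "n * x0 + m * y0 = s"
  "\<And>j::int. (0 <= int a2 * (int y0 - j * int n) - int b2 * (int x0 + j * int m) \<and>
   0 <= int b1 * (int x0 + j * int m) - int a1 * (int y0 - j * int n)) \<longleftrightarrow> 0 <= j \<and> j <= int J"
  using line_data[OF uv(1) s_def[symmetric]] by blast
 interpret newton_split_line c a1 b1 a2 b2 r n m N e x0 y0 J s d
  by unfold_locales (use data d in blast)+
 obtain E where E: "lp p = E * ep g" "lp q = - (E * ep f)" "E = 0 \<or> Polynomial.degree E + r <= J"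
  using koszul_line[OF p q z] by blast
 have E0: "Polynomial.coeff E l = 0" if "J < l + r" for l
  using E(3) that by (auto intro: coeff_eq_0)
 \<comment> \<open>A point gets the index that its translate by the left endpoint has on the line;
   the abscissa alone determines it.\<close>
 define \<epsilon> where "\<epsilon> x (y::nat) = Polynomial.coeff E (nat ((int x + int a1 - int x0) div int m))" for x y
 have \<epsilon>: "\<epsilon> x y = Polynomial.coeff E (nat j)" if "int x + int a1 = int x0 + j * int m" for x y j
 proof -
  have "(int x + int a1 - int x0) div int m = j" using that pos by simp
  then show ?thesis unfolding \<epsilon>_def by simp
 qed
 have wt_shift: "H x y + L = d \<longleftrightarrow> H x y = W e * edge_wt e x y"
  if "int x + int a1 = int x0 + j * int m" "int y + int b1 = int y0 - j * int n" for x y j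
 proof -
  have "int (n * (x + a1) + m * (y + b1)) = int n * (int x + int a1) + int m * (int y + int b1)" by simp
  also have "\<dots> = int (n * x0 + m * y0)" unfolding that by (simp add: algebra_simps)
  finally have "n * (x + a1) + m * (y + b1) = s" unfolding of_nat_eq_iff data(2) .
  then have "edge_wt e x y + N = s" unfolding wt N(1) by (simp add: algebra_simps)
  then have "W e * (edge_wt e x y + N) = d" using d by simp
  moreover have "W e * N = L" unfolding N_def by (rule W_N[OF e_in])
  ultimately have "W e * edge_wt e x y + L = d" by (simp add: distrib_left)
  then show ?thesis by auto
 qed
 have in_range: "0 <= j \<and> j <= int J"
  if xy: "int x + int a1 = int x0 + j * int m" "int y + int b1 = int y0 - j * int n" and cone: "edge_cone e x y" for x y j
 proof -
  have "edge_cone e (x + a1) (y + b1)" by (intro cone_add cone edge_points)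
  then show ?thesis unfolding cone_int line[of j, symmetric] xy(1)[symmetric] xy(2)[symmetric] by simp
 qed
 \<comment> \<open>A nonzero coefficient has index between 0 and J - r. The left ray is controlled
   at index j and the right ray at index j + r, because passing from one endpoint to the other
   shifts the index by r.\<close>
 have nonzero: "0 <= int x0 + j * int m - int a1 \<and> 0 <= int y0 - j * int n - int b1 \<and>
   edge_cone e (nat (int x0 + j * int m - int a1)) (nat (int y0 - j * int n - int b1))"
  if j: "0 <= j" "Polynomial.coeff E (nat j) ~= 0" for j
 proof -
  have "\<not> J < nat j + r" using j E0 by blast
  then have jr: "0 <= j + int r \<and> j + int r <= int J" "0 <= j \<and> j <= int J" using j(1) by linarith+
  let ?X = "int x0 + j * int m - int a1" and ?Y = "int y0 - j * int n - int b1"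
  have "int a2 * ?Y - int b2 * ?X = int a2 * (int y0 - (j + int r) * int n) - int b2 * (int x0 + (j + int r) * int m)"
   unfolding b1 a2 by (simp add: algebra_simps)
  then have 1: "0 <= int a2 * ?Y - int b2 * ?X" using line[of "j + int r"] jr(1) by simp
  have "int b1 * ?X - int a1 * ?Y = int b1 * (int x0 + j * int m) - int a1 * (int y0 - j * int n)"
   by (simp add: algebra_simps)
  then have 2: "0 <= int b1 * ?X - int a1 * ?Y" using line[of j] jr(2) by simp
  have nn: "0 <= ?X" "0 <= ?Y" using cone_nonneg[where x = ?X and y = ?Y] 1 2 by blast+
  have "edge_cone e (nat ?X) (nat ?Y)" unfolding cone_int nat_0_le[OF nn(1)] nat_0_le[OF nn(2)] using 1 2 by blast
  with nn show ?thesis by blast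
 qed
 have A: "?A \<epsilon>"
 proof (intro allI impI)
  fix h :: "'k fps fps" and x y
  assume h1: "\<forall>x y. cf h x y ~= 0 --> H x y + L = d"
   and h2: "\<forall>x y. edge_cone e x y \<and> H x y + L = d --> cf h x y = \<epsilon> x y"
   and xy: "edge_cone e x y \<and> H x y = d"
  \<comment> \<open>Along the translated line \<open>h\<close> has exactly the coefficients of E,
    and zero at negative indices; this makes the convolution a polynomial product.\<close>
  have K: "ext_coeff h (int x0 + j * int m - int a1) (int y0 - j * int n - int b1) = (if 0 <= j then Polynomial.coeff E (nat j) else 0)" (is "?l = ?r") for j
  proof -
   let ?X = "int x0 + j * int m - int a1" and ?Y = "int y0 - j * int n - int b1"
   have c1: "?l = ?r" if "?r ~= 0"
   proof -
    have j: "0 <= j" "Polynomial.coeff E (nat j) ~= 0" using that by (auto split: if_splits)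
    note nz = nonzero[OF j]
    then have i: "int (nat ?X) + int a1 = int x0 + j * int m" "int (nat ?Y) + int b1 = int y0 - j * int n" by simp_all
    have "H (nat ?X) (nat ?Y) + L = d" unfolding wt_shift[OF i] using H_cone[OF e_in] nz by blast
    then have "cf h (nat ?X) (nat ?Y) = Polynomial.coeff E (nat j)" using h2 nz \<epsilon>[OF i(1)] by simp
    then show ?thesis using nz j unfolding ext_coeff_def by simp
   qed
   moreover have "?l = ?r" if "?l ~= 0"
   proof -
    have nn: "0 <= ?X" "0 <= ?Y" and nz: "cf h (nat ?X) (nat ?Y) ~= 0" and l: "?l = cf h (nat ?X) (nat ?Y)"
     using that by (auto simp: ext_coeff_def split: if_splits)
    then have i: "int (nat ?X) + int a1 = int x0 + j * int m" "int (nat ?Y) + int b1 = int y0 - j * int n" by simp_all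
    have H: "H (nat ?X) (nat ?Y) + L = d" using h1 nz by blast
    then have cone: "edge_cone e (nat ?X) (nat ?Y)" unfolding wt_shift[OF i] by (rule cone_if_H[OF e_in])
    have "0 <= j" using in_range[OF i cone] by blast
    then show ?thesis using l h2 cone H \<epsilon>[OF i(1)] by simp
   qed
   ultimately show ?thesis by metis
  qed
  obtain l where l: "l <= J" "x = x0 + l * m" "y = y0 - l * n" "l * n <= y0"
   using on_line_conv xy by blast
  have conv: "cf (h * w) x y = Polynomial.coeff (E * ep w) l" if w: "\<And>x y. cf w x y ~= 0 ==> c x y ~= 0" for w :: "'k fps fps"
  proof (cases "L <= d")
   case True
   have "hge (d - L) h" unfolding hge_def using h1 by (metis add_diff_cancel_right' less_irrefl)
   then have "cf (h * w) x y = (\<Sum>i\<le>r. ext_coeff h (int x - int (a1 + i * m)) (int y - int (b1 - i * n)) * cf w (a1 + i * m) (b1 - i * n))"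
    using w xy True by (intro conv_level[where d = "d - L"]) auto
   also have "\<dots> = (\<Sum>i\<le>r. (if int i <= int l then Polynomial.coeff E (nat (int l - int i)) else 0) * Polynomial.coeff (ep w) i)"
   proof (intro sum.cong refl)
    fix i assume i: "i \<in> {..r}"
    then have "i * n <= b1" using edge_point by auto
    then have ya: "int y - int (b1 - i * n) = int y0 - (int l - int i) * int n - int b1"
     using l by (simp add: of_nat_diff algebra_simps)
    have xa: "int x - int (a1 + i * m) = int x0 + (int l - int i) * int m - int a1" using l by (simp add: algebra_simps)
    have za: "cf w (a1 + i * m) (b1 - i * n) = Polynomial.coeff (ep w) i" using i unfolding ep_def coeff_sum_monom by simp
    show "ext_coeff h (int x - int (a1 + i * m)) (int y - int (b1 - i * n)) * cf w (a1 + i * m) (b1 - i * n)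
      = (if int i <= int l then Polynomial.coeff E (nat (int l - int i)) else 0) * Polynomial.coeff (ep w) i"
     unfolding xa ya za K[of "int l - int i"] by simp
   qed
   also have "\<dots> = (\<Sum>i\<le>l. Polynomial.coeff (ep w) i * Polynomial.coeff E (l - i))"
   proof (rule sum.mono_neutral_cong)
    show "Polynomial.coeff (ep w) i * Polynomial.coeff E (l - i) = 0" if "i \<in> {..l} - {..r}" for i
     using that ep_zero[of i w] by auto
    show "(if int i <= int l then Polynomial.coeff E (nat (int l - int i)) else 0) * Polynomial.coeff (ep w) i
      = Polynomial.coeff (ep w) i * Polynomial.coeff E (l - i)" if "i \<in> {..r} \<inter> {..l}" for i
     using that by (simp add: nat_diff_distrib mult.commute)
   qed auto
   also have "\<dots> = Polynomial.coeff (E * ep w) l" unfolding mult.commute[of E] coeff_mult ..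
   finally show ?thesis .
  next
   case False
   \<comment> \<open>For d < L there is no point of level d - L: \<open>h\<close> vanishes by its
     support, and E because each nonzero coefficient would produce such a point.\<close>
   have "cf h x y = 0" for x y using h1 False by (metis le_add2)
   then have "h = 0" by (intro cf_eqI) simp
   have "E = 0"
   proof (rule poly_eqI)
    fix i
    show "Polynomial.coeff E i = Polynomial.coeff 0 i"
    proof (rule ccontr)
     assume "Polynomial.coeff E i ~= Polynomial.coeff 0 i"
     then have nz: "Polynomial.coeff E (nat (int i)) ~= 0" by simp
     let ?X = "int x0 + int i * int m - int a1" and ?Y = "int y0 - int i * int n - int b1"
     note nn = nonzero[OF _ nz]
     then have i: "int (nat ?X) + int a1 = int x0 + int i * int m" "int (nat ?Y) + int b1 = int y0 - int i * int n" by simp_all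
     have "H (nat ?X) (nat ?Y) + L = d" unfolding wt_shift[OF i] using H_cone[OF e_in] nn by simp
     then show False using False by simp
    qed
   qed
   with \<open>h = 0\<close> show ?thesis by simp
  qed
  have "cf (h * g) x y = Polynomial.coeff (lp p) l" unfolding E(1) by (rule conv[OF g_supp])
  moreover have "cf (h * f) x y = - Polynomial.coeff (lp q) l" unfolding E(2) using conv[OF f_supp] by simp
  ultimately show "cf (h * g) x y = cf p x y \<and> cf (h * f) x y = - cf q x y"
   unfolding coeff_lp_eq[OF l(1)] l(2,3) by simp
 qed
 have ex_j: "\<exists>j. int x + int a1 = int x0 + j * int m \<and> int y + int b1 = int y0 - j * int n \<and> 0 <= j \<and> j <= int J"
  if "H x y + L = d" "edge_cone e x y" for x y
 proof -
  have "edge_cone e (x + a1) (y + b1)" "H (x + a1) (y + b1) = d"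
   using that H_cone_add[OF that(2) edge_points(1)] edge_points by (auto intro: cone_add)
  from on_line_conv[OF this] obtain j where j: "j <= J" "x + a1 = x0 + j * m" "y + b1 = y0 - j * n" "j * n <= y0" by blast
  have "int (x + a1) = int x0 + int j * int m" unfolding j(2) by simp
  moreover have "int (y + b1) = int y0 - int j * int n" unfolding j(3) using j(4) by (simp add: of_nat_diff)
  ultimately show ?thesis using j(1) by (intro exI[of _ "int j"]) simp
 qed
 have BL: "?BL \<epsilon>"
 proof (intro allI impI)
  fix x y assume xy: "H x y + L = d \<and> edge_cone e x y \<and> a1 * y = b1 * x"
  then obtain j where j: "int x + int a1 = int x0 + j * int m" "int y + int b1 = int y0 - j * int n" "0 <= j" "j <= int J"
   using ex_j by blast
  \<comment> \<open>Otherwise index j - 1 would still belong to the line, although the determinant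
    with the left endpoint equals -N there.\<close>
  have "j = 0"
  proof (rule ccontr)
   assume "j ~= 0"
   then have "0 <= int b1 * (int x0 + (j - 1) * int m) - int a1 * (int y0 - (j - 1) * int n)" using line[of "j - 1"] j by simp
   also have "\<dots> = int b1 * (int x0 + j * int m) - int a1 * (int y0 - j * int n) - int N"
    unfolding N(1) by (simp add: algebra_simps)
   also have "\<dots> = int b1 * int x - int a1 * int y - int N" unfolding j(1,2)[symmetric] by (simp add: algebra_simps)
   also have "\<dots> < 0" using xy N_pos by (simp flip: of_nat_mult)
   finally show False by simp
  qed
  then have 0: "x + a1 = x0" "y + b1 = y0" using j by simp_all
  have "\<epsilon> x y * cf f a1 b1 = Polynomial.coeff E 0 * Polynomial.coeff (ep f) 0"
   using \<epsilon>[OF j(1)] \<open>j = 0\<close> unfolding ep_def coeff_sum_monom by simp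
  also have "\<dots> = - Polynomial.coeff (lp q) 0" unfolding E(2) by (simp add: coeff_mult)
  also have "\<dots> = - cf q (x + a1) (y + b1)" using coeff_lp_eq[of 0 q] 0 by simp
  finally show "\<epsilon> x y * cf f a1 b1 = - cf q (x + a1) (y + b1)" .
 qed
 have BR: "?BR \<epsilon>"
 proof (intro allI impI)
  fix x y assume xy: "H x y + L = d \<and> edge_cone e x y \<and> a2 * y = b2 * x"
  then obtain j where j: "int x + int a1 = int x0 + j * int m" "int y + int b1 = int y0 - j * int n" "0 <= j" "j <= int J"
   using ex_j by blast
  have 2: "int x + int a2 = int x0 + (j + int r) * int m" "int y + int b2 = int y0 - (j + int r) * int n"
   using j(1,2) a2 b1 by (simp_all add: algebra_simps)
  have "edge_cone e (x + a2) (y + b2)" using xy edge_points by (blast intro: cone_add)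
  then have le: "j + int r <= int J" using line[of "j + int r"] unfolding cone_int 2[symmetric] by simp
  \<comment> \<open>The mirror argument: index j + r + 1 would still belong to the line, although
    the determinant with the right endpoint equals -N there.\<close>
  have "j + int r = int J"
  proof (rule ccontr)
   assume "j + int r ~= int J"
   then have "0 <= int a2 * (int y0 - (j + int r + 1) * int n) - int b2 * (int x0 + (j + int r + 1) * int m)"
    using line[of "j + int r + 1"] j le by simp
   also have "\<dots> = int a2 * (int y0 - (j + int r) * int n) - int b2 * (int x0 + (j + int r) * int m) - int N"
    unfolding N(2) by (simp add: algebra_simps)
   also have "\<dots> = int a2 * int y - int b2 * int x - int N" unfolding 2[symmetric] by (simp add: algebra_simps)
   also have "\<dots> < 0" using xy N_pos by (simp flip: of_nat_mult)
   finally show False by simp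
  qed
  define i where "i = nat j"
  have i: "j = int i" "i + r = J" using j(3) \<open>j + int r = int J\<close> by (auto simp: i_def)
  have "int (x + a2) = int (x0 + J * m)" "int (y + b2) + int (J * n) = int y0" using 2 \<open>j + int r = int J\<close> by simp_all
  then have 0: "x + a2 = x0 + J * m" "y + b2 = y0 - J * n" by linarith+
  have e2: "a1 + r * m = a2" "b1 - r * n = b2" using a2 b1 by simp_all
  have "\<epsilon> x y * cf f a2 b2 = Polynomial.coeff E i * Polynomial.coeff (ep f) r"
   using \<epsilon>[OF j(1)] e2 unfolding ep_def coeff_sum_monom i_def by simp
  also have "\<dots> = Polynomial.coeff (E * ep f) (i + r)"
   by (rule coeff_mult_top[symmetric]) (use E0 i ep_zero in auto)
  also have "\<dots> = - Polynomial.coeff (lp q) J" unfolding E(2) i(2) by simp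
  also have "\<dots> = - cf q (x + a2) (y + b2)" using coeff_lp_eq[of J q] 0 by simp
  finally show "\<epsilon> x y * cf f a2 b2 = - cf q (x + a2) (y + b2)" .
 qed
 from A BL BR show ?thesis by blast
qed

lemma local_inj:
 fixes p :: "'k fps fps"
 assumes p: "hge d p" and z: "\<And>x y. H x y = d + L ==> cf (p * f) x y = 0"
  and uv: "edge_cone e u v" "H u v = d"
 shows "cf p u v = 0"
proof -
 define s where "s = n * u + m * v"
 have d: "W e * s = d" using H_cone[OF e_in uv(1)] uv(2) unfolding wt s_def by simp
 obtain x0 y0 J where data: "J * n <= y0" "n * x0 + m * y0 = s"
  "\<And>j::int. (0 <= int a2 * (int y0 - j * int n) - int b2 * (int x0 + j * int m) \<and>
   0 <= int b1 * (int x0 + j * int m) - int a1 * (int y0 - j * int n)) \<longleftrightarrow> 0 <= j \<and> j <= int J"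
  using line_data[OF uv(1) s_def[symmetric]] by blast
 interpret newton_split_line c a1 b1 a2 b2 r n m N e x0 y0 J s d
  by unfold_locales (use data d in blast)+
 obtain l where l: "l <= J" "u = x0 + l * m" "v = y0 - l * n" using on_line_conv[OF uv] by blast
 show ?thesis using koszul_line_inj[OF p z] coeff_lp_eq[OF l(1), of p] unfolding l(2,3) by simp
qed

end

context newton_polygon
begin

lemma hge_add: "hge d (p :: 'b::comm_ring_1 fps fps) ==> hge d q ==> hge d (p + q)"
 and hge_diff: "hge d (p :: 'b::comm_ring_1 fps fps) ==> hge d q ==> hge d (p - q)"
 and hge_uminus: "hge d (p :: 'b::comm_ring_1 fps fps) ==> hge d (- p)"
 and hge_mono: "hge d' p' ==> d <= d' ==> hge d p'"
 and hge_zero: "hge d (0 :: 'b fps fps)"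
 and hge_0: "hge 0 p'"
 by (auto simp: hge_def)

lemma hge_mult:
 fixes p q :: "'b::comm_ring_1 fps fps"
 assumes "hge d p" "hge d' q" shows "hge (d + d') (p * q)"
 unfolding hge_def
proof (intro allI impI)
 fix x y assume H: "H x y < d + d'"
 show "cf (p * q) x y = 0"
  unfolding cf_mult
 proof (intro sum.neutral ballI)
  fix i j assume ij: "i \<in> {..x}" "j \<in> {..y}"
  then have "H i j + H (x - i) (y - j) <= H x y" using H_add[of i j "x - i" "y - j"] by simp
  then have "H i j < d \<or> H (x - i) (y - j) < d'" using H by linarith
  then show "cf p i j * cf q (x - i) (y - j) = 0" using assms unfolding hge_def by auto
 qed
qed

end

context newton_split
begin

lemma hge_f: "hge L f" and hge_g: "hge L g"
 unfolding hge_def using H_support by (auto simp: cf_f cf_g not_le[symmetric])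

lemma split_edge_locale:
 assumes "e \<in> newton_edges c"
 obtains a1 b1 a2 b2 where "newton_split_edge c a1 b1 a2 b2 (edge_r e) (edge_n e) (edge_m e) (edge_N e) e"
proof -
 obtain a1 b1 a2 b2 where "newton_edge_locale c a1 b1 a2 b2 (edge_r e) (edge_n e) (edge_m e) (edge_N e) e"
  using edge_locale[OF assms] by blast
 then interpret newton_edge_locale c a1 b1 a2 b2 "edge_r e" "edge_n e" "edge_m e" "edge_N e" e .
 have "newton_split_edge c a1 b1 a2 b2 (edge_r e) (edge_n e) (edge_m e) (edge_N e) e" by unfold_locales
 then show ?thesis by (rule that)
qed

text \<open>The conclusion of \<open>local_koszul\<close> with both endpoints treated alike, so that
  neighbouring edges can be compared at a shared vertex.\<close>

definition local_solution :: "'k fps fps => 'k fps fps => nat => (nat => nat => 'k) => edge => bool" where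
 "local_solution p q d \<epsilon> e \<longleftrightarrow>
   (\<forall>h. (\<forall>x y. cf h x y ~= 0 --> H x y + L = d) -->
    (\<forall>x y. edge_cone e x y \<and> H x y + L = d --> cf h x y = \<epsilon> x y) -->
    (\<forall>x y. edge_cone e x y \<and> H x y = d --> cf (h * g) x y = cf p x y \<and> cf (h * f) x y = - cf q x y))
   \<and> (\<forall>V\<in>{fst e, snd e}. \<forall>x y. H x y + L = d \<and> edge_cone e x y \<and> fst V * y = snd V * x -->
      \<epsilon> x y * cf f (fst V) (snd V) = - cf q (x + fst V) (y + snd V))"

lemma local_solution_exists:
 assumes "e \<in> newton_edges c" "hge d p" "hge d q" "\<And>x y. H x y = d + L ==> cf (p * f + q * g) x y = 0"
 shows "\<exists>\<epsilon>. local_solution p q d \<epsilon> e"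
proof -
 obtain a1 b1 a2 b2 where "newton_split_edge c a1 b1 a2 b2 (edge_r e) (edge_n e) (edge_m e) (edge_N e) e"
  using split_edge_locale[OF assms(1)] by blast
 then interpret newton_split_edge c a1 b1 a2 b2 "edge_r e" "edge_n e" "edge_m e" "edge_N e" e .
 have V: "{fst e, snd e} = {(a1, b1), (a2, b2)}" by (simp add: e_def)
 show ?thesis using local_koszul[OF assms(2-4)] unfolding local_solution_def V by auto
qed

text \<open>On the ray of \<open>V\<close> both values solve the same scalar equation, whose
  coefficient is \<open>fst V\<close> times the coefficient of G at \<open>V\<close>. Off the y-axis
  it is nonzero.\<close>

lemma glue_vertex:
 assumes e: "e \<in> newton_edges c" "local_solution p q d \<epsilon> e" and e': "e' \<in> newton_edges c" "local_solution p q d \<epsilon>' e'"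
  and V: "V \<in> {fst e, snd e}" "V \<in> {fst e', snd e'}" "0 < fst V"
  and xy: "H x y + L = d" "edge_cone e x y" "edge_cone e' x y" "fst V * y = snd V * x"
 shows "\<epsilon> x y = \<epsilon>' x y"
proof -
 have "\<epsilon> x y * cf f (fst V) (snd V) = - cf q (x + fst V) (y + snd V)"
  using e(2) V(1) xy unfolding local_solution_def by blast
 moreover have "\<epsilon>' x y * cf f (fst V) (snd V) = - cf q (x + fst V) (y + snd V)"
  using e'(2) V(2) xy unfolding local_solution_def by blast
 moreover have "c (fst V) (snd V) ~= 0" using e(1) V(1) by (auto simp: newton_edges_def newton_edge_def)
 then have "cf f (fst V) (snd V) ~= 0" using V(3) by (simp add: cf_f)
 ultimately show ?thesis by (metis mult_right_cancel)
qed

text \<open>Away from the origin, cones of different edges meet only in the ray of a common vertex.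
  At the origin all cones meet, and the values are compared through the chain of neighbouring edges
  back to the first one.\<close>

lemma glue:
 assumes loc: "\<And>e. e \<in> newton_edges c ==> local_solution p q d (\<epsilon> e) e"
  and e: "e \<in> newton_edges c" and e': "e' \<in> newton_edges c"
  and xy: "H x y + L = d" "edge_cone e x y" "edge_cone e' x y"
 shows "\<epsilon> e x y = \<epsilon> e' x y"
proof (cases "x = 0 \<and> y = 0")
 case True
 obtain u0 v0 where e0: "newton_edge c 0 (y_intercept c) u0 v0" using first_edge by blast
 have *: "\<epsilon> ((a1, b1), (a2, b2)) x y = \<epsilon> ((0, y_intercept c), (u0, v0)) x y"
  if "newton_edge c a1 b1 a2 b2" for a1 b1 a2 b2
  using that
 proof (induction a1 arbitrary: b1 a2 b2 rule: less_induct)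
  case (less a1)
  show ?case
  proof (cases "a1 = 0")
   case True
   then have "b1 = y_intercept c" using edge_left_axis less by blast
   then show ?thesis using edge_eq_if_same_left[of 0 b1 a2 b2 u0 v0] less(2) e0 True by simp
  next
   case False
   then obtain a0 b0 where p: "newton_edge c a0 b0 a1 b1" using prev_edge[OF less(2)] by blast
   have "\<epsilon> ((a0, b0), (a1, b1)) x y = \<epsilon> ((a1, b1), (a2, b2)) x y"
    using p less(2) False xy(1) True
    by (intro glue_vertex[OF _ loc _ loc, where V = "(a1, b1)"]) (auto simp: edge_cone_def)
   moreover have "a0 < a1" using p by (simp add: newton_edge_def)
   ultimately show ?thesis using less.IH[OF _ p] by simp
  qed
 qed
 show ?thesis using * e e' unfolding newton_edges_def by auto
next
 case False
 obtain a1 b1 a2 b2 a1' b1' a2' b2' where ee: "e = ((a1, b1), (a2, b2))" "newton_edge c a1 b1 a2 b2"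
  "e' = ((a1', b1'), (a2', b2'))" "newton_edge c a1' b1' a2' b2'" using e e' unfolding newton_edges_def by blast
 have key: "\<epsilon> ((a1, b1), (a2, b2)) x y = \<epsilon> ((a1', b1'), (a2', b2')) x y"
  if e: "newton_edge c a1 b1 a2 b2" and e': "newton_edge c a1' b1' a2' b2'" and o: "b1' <= b2" "a2 <= a1'"
   and cone: "edge_cone ((a1, b1), (a2, b2)) x y" "edge_cone ((a1', b1'), (a2', b2')) x y"
  for a1 b1 a2 b2 a1' b1' a2' b2'
 proof -
  have lt: "a1 < a2" "b2' < b1'" using e e' by (auto simp: newton_edge_def)
  have 1: "b2 * x <= a2 * y" "a1' * y <= b1' * x" using cone by (auto simp: edge_cone_def)
  have 2: "a2 * y <= a1' * y" "b1' * x <= b2 * x" using o by auto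
  have eq: "a2 * y = b2 * x" "a2 * y = a1' * y" "b1' * x = b2 * x" using 1 2 by linarith+
  have "y ~= 0"
  proof
   assume "y = 0"
   with False have "x ~= 0" by simp
   with eq \<open>y = 0\<close> have "b1' = 0" by simp
   with lt show False by simp
  qed
  moreover have "x ~= 0"
  proof
   assume "x = 0"
   with eq \<open>y ~= 0\<close> have "a2 = 0" by simp
   with lt show False by simp
  qed
  ultimately have "a2 = a1'" "b1' = b2" using eq(2,3) by (metis mult_right_cancel)+
  then show ?thesis using e e' lt cone xy(1) eq
   by (intro glue_vertex[OF _ loc _ loc, where V = "(a2, b2)"]) auto
 qed
 consider "(int b1 - int b2) * (int a2' - int a1') = (int b1' - int b2') * (int a2 - int a1)"
  | "(int b1 - int b2) * (int a2' - int a1') > (int b1' - int b2') * (int a2 - int a1)"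
  | "(int b1' - int b2') * (int a2 - int a1) > (int b1 - int b2) * (int a2' - int a1')" by linarith
 then show ?thesis
 proof cases
  case 1
  then show ?thesis using edge_eq_if_parallel[OF ee(2,4)] unfolding ee by simp
 next
  case 2
  then show ?thesis using edge_order[OF ee(2,4)] key[OF ee(2,4)] xy unfolding ee by simp
 next
  case 3
  then show ?thesis using edge_order[OF ee(4,2)] key[OF ee(4,2)] xy unfolding ee by simp
 qed
qed

text \<open>Since the edgewise solutions agree on overlaps, choosing for each point an edge
  \<open>k x y\<close> whose cone contains it gives a global multiplier \<open>h\<close>. It has
  finite support and removes the part of level exactly d.\<close>

lemma koszul_step:
 assumes p: "hge d p" and q: "hge d q" and z: "hge (d + L + 1) (p * f + q * g)"
 shows "\<exists>h. convergent_series h \<and> hge (d + 1) (p - h * g) \<and> hge (d + 1) (q + h * f)"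
proof -
 have z': "cf (p * f + q * g) x y = 0" if "H x y = d + L" for x y
  using z that unfolding hge_def by auto
 obtain \<epsilon> where loc: "\<And>e. e \<in> newton_edges c ==> local_solution p q d (\<epsilon> e) e"
  using local_solution_exists[OF _ p q z'] by metis
 obtain k where k: "\<And>x y. k x y \<in> newton_edges c \<and> edge_cone (k x y) x y"
  using cone_exists by metis
 define h where "h = Abs_fps (%x. Abs_fps (%y. if H x y + L = d then \<epsilon> (k x y) x y else 0))"
 have h: "cf h x y = (if H x y + L = d then \<epsilon> (k x y) x y else 0)" for x y by (simp add: h_def)
 have h1: "\<forall>x y. cf h x y ~= 0 --> H x y + L = d" using h by auto
 \<comment> \<open>Here the choice made by \<open>k\<close> becomes immaterial: any edge whose cone
   contains the point gives the same value.\<close>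
 have h2: "\<forall>x y. edge_cone e x y \<and> H x y + L = d --> cf h x y = \<epsilon> e x y" if "e \<in> newton_edges c" for e
  using glue[OF loc, of "k _ _" e] k that h by auto
 have "convergent_series h"
 proof (rule convergent_series_finite_support, rule finite_subset)
  show "{(a, b). cf h a b ~= 0} \<subseteq> {(x, y). H x y < d + 1}" using h1 by (auto, fastforce)
 qed (rule finite_H_less)
 moreover have lead: "cf (h * g) x y = cf p x y \<and> cf (h * f) x y = - cf q x y" if "H x y = d" for x y
  using loc[of "k x y"] k[of x y] h1 h2[of "k x y"] that unfolding local_solution_def by blast
 moreover have low: "hge d (h * w)" if w: "hge L w" for w
 proof (cases "L <= d")
  case True
  have "hge (d - L) h" unfolding hge_def using h1 by (metis add_diff_cancel_right' less_irrefl)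
  from hge_mult[OF this w] True show ?thesis by simp
 next
  case False
  have "cf h x y = 0" for x y using h1 False by (metis le_add2)
  then have "h = 0" by (intro cf_eqI) simp
  then show ?thesis by (simp add: hge_zero)
 qed
 have "cf (p - h * g) x y = 0 \<and> cf (q + h * f) x y = 0" if "H x y < d + 1" for x y
 proof (cases "H x y = d")
  case True
  then show ?thesis using lead[OF True] by simp
 next
  case False
  then have "H x y < d" using that by simp
  then show ?thesis using p q low[OF hge_g] low[OF hge_f] unfolding hge_def by simp
 qed
 then show ?thesis using \<open>convergent_series h\<close> unfolding hge_def by blast
qed

text \<open>A finite level takes finitely many steps, so \<open>h\<close> stays in the convergent
  ring without passing to a limit.\<close>

lemma koszul_exact:
 assumes "hge (D + L) (p * f + q * g)"
 shows "\<exists>h. convergent_series h \<and> hge D (p - h * g) \<and> hge D (q + h * f)"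
proof -
 have "\<exists>h. convergent_series h \<and> hge d (p - h * g) \<and> hge d (q + h * f)" if "d <= D" for d
  using that
 proof (induction d)
  case 0
  then show ?case using convergent_series_0 by (intro exI[of _ 0]) (simp add: hge_0)
 next
  case (Suc d)
  then obtain h where h: "convergent_series h" "hge d (p - h * g)" "hge d (q + h * f)" by auto
  have "(p - h * g) * f + (q + h * f) * g = p * f + q * g" by (simp add: algebra_simps)
  then have "hge (d + L + 1) ((p - h * g) * f + (q + h * f) * g)"
   using hge_mono[OF assms, of "d + L + 1"] Suc by simp
  from koszul_step[OF h(2,3) this] obtain h' where h': "convergent_series h'"
   "hge (d + 1) (p - h * g - h' * g)" "hge (d + 1) (q + h * f + h' * f)" by blast
  then show ?case using convergent_series_add[OF h(1) h'(1)]
   by (intro exI[of _ "h + h'"]) (simp add: algebra_simps)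
 qed
 then show ?thesis by blast
qed

text \<open>Level by level as for exactness, now with \<open>local_inj\<close> on a cone containing
  the given point.\<close>

lemma hge_f_inj:
 assumes "hge (d + L) (h * f)" shows "hge d h"
proof -
 have "hge i h" if "i <= d" for i
  using that
 proof (induction i)
  case (Suc i)
  then have hi: "hge i h" by simp
  have z: "cf (h * f) x y = 0" if "H x y = i + L" for x y
   using assms that Suc.prems unfolding hge_def by auto
  have "cf h x y = 0" if xy: "H x y = i" for x y
  proof -
   obtain e where e: "e \<in> newton_edges c" "edge_cone e x y" using cone_exists by blast
   obtain a1 b1 a2 b2 where "newton_split_edge c a1 b1 a2 b2 (edge_r e) (edge_n e) (edge_m e) (edge_N e) e"
    using split_edge_locale[OF e(1)] by blast
   then interpret newton_split_edge c a1 b1 a2 b2 "edge_r e" "edge_n e" "edge_m e" "edge_N e" e .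
   show ?thesis by (rule local_inj[OF hi z e(2) xy])
  qed
  then show ?case using hi unfolding hge_def by (metis less_Suc_eq)
 qed (rule hge_0)
 then show ?thesis by blast
qed

end

section \<open>Lattice point counts\<close>

lemma div_add_mult_nat: "0 < k ==> (a + b * k) div k = a div k + (b :: nat)"
 by simp

context newton_edge_locale
begin

text \<open>The left ray is excluded and the right ray included, so that the cones of all edges tile
  the points with x > 0.\<close>

definition half_open_line :: "nat => (nat \<times> nat) set" where
 "half_open_line s = {(x, y). n * x + m * y = s \<and> a1 * y < b1 * x \<and> b2 * x <= a2 * y}"

text \<open>Bezout coefficients parametrise the integer points of weight \<open>s\<close>, and the
  cone cuts out the interval from B s / N, excluded, to A s / N, included. Raising \<open>s\<close>
  by N moves the ends by B and A, and A - B = r.\<close>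

lemma card_half_open_line_add: "card (half_open_line (s + N)) = card (half_open_line s) + r"
 and finite_half_open_line: "finite (half_open_line s)"
proof -
 have "gcd (int n) (int m) = 1" using coprime by simp
 then obtain \<gamma> \<delta> where bez: "\<gamma> * int n + \<delta> * int m = 1" by (metis bezout_int)
 define A B where "A = int a2 * \<delta> - int b2 * \<gamma>" and "B = int a1 * \<delta> - int b1 * \<gamma>"
 have AB: "A - B = int r"
 proof -
  have "A - B = int r * (\<gamma> * int n + \<delta> * int m)" unfolding A_def B_def a2 b1 by (simp add: algebra_simps)
  then show ?thesis using bez by simp
 qed
 have N': "0 < int N" using N_pos by simp
 define P where "P = (%s j. (\<gamma> * int s + j * int m, \<delta> * int s - j * int n))"
 define I where "I = (%s. {(B * int s) div int N <.. (A * int s) div int N})"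
 have cond: "(0 < int b1 * fst (P s j) - int a1 * snd (P s j) \<and> 0 <= int a2 * snd (P s j) - int b2 * fst (P s j)) \<longleftrightarrow> j \<in> I s" for s j
 proof -
  have 1: "int b1 * fst (P s j) - int a1 * snd (P s j) = j * int N - B * int s"
   unfolding P_def B_def N(1) by (simp add: algebra_simps)
  have 2: "int a2 * snd (P s j) - int b2 * fst (P s j) = A * int s - j * int N"
   unfolding P_def A_def N(2) by (simp add: algebra_simps)
  have "0 < j * int N - B * int s \<longleftrightarrow> \<not> j <= (B * int s) div int N"
   using le_div_iff_int[OF N', of j "B * int s"] by auto
  moreover have "0 <= A * int s - j * int N \<longleftrightarrow> j <= (A * int s) div int N"
   using le_div_iff_int[OF N', of j "A * int s"] by auto
  ultimately show ?thesis unfolding 1 2 I_def by auto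
 qed
 have img: "(%(x, y). (int x, int y)) ` half_open_line s = P s ` I s" for s
 proof (intro equalityI subsetI)
  fix u assume "u \<in> (%(x, y). (int x, int y)) ` half_open_line s"
  then obtain x y where u: "u = (int x, int y)" and xy: "n * x + m * y = s" "a1 * y < b1 * x" "b2 * x <= a2 * y"
   by (auto simp: half_open_line_def)
  have "int n * int x + int m * int y = int s" using xy(1) by (metis of_nat_add of_nat_mult)
  also have "\<dots> = int n * (\<gamma> * int s) + int m * (\<delta> * int s)"
  proof -
   have "int n * (\<gamma> * int s) + int m * (\<delta> * int s) = (\<gamma> * int n + \<delta> * int m) * int s" by (simp add: algebra_simps)
   then show ?thesis using bez by simp
  qed
  finally obtain j where j: "int x = \<gamma> * int s + j * int m" "int y = \<delta> * int s - j * int n" using line_param by blast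
  have uP: "u = P s j" unfolding u P_def j ..
  have "int a1 * int y < int b1 * int x" "int b2 * int x <= int a2 * int y"
   using xy(2,3) by (metis of_nat_less_iff of_nat_mult, metis of_nat_le_iff of_nat_mult)
  then have "j \<in> I s" unfolding cond[symmetric] uP[symmetric] u by simp
  then show "u \<in> P s ` I s" using uP by blast
 next
  fix u assume "u \<in> P s ` I s"
  then obtain j where j: "u = P s j" "j \<in> I s" by blast
  obtain x y where u: "u = (x, y)" by (cases u)
  have c: "0 < int b1 * x - int a1 * y" "0 <= int a2 * y - int b2 * x"
   using j(2) unfolding cond[symmetric] j(1)[symmetric] u by auto
  have nn: "0 <= x" "0 <= y" using cone_nonneg[where x = x and y = y] c by auto
  have xyj: "x = \<gamma> * int s + j * int m" "y = \<delta> * int s - j * int n" using j(1) unfolding u P_def by simp_all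
  have "int n * x + int m * y = (\<gamma> * int n + \<delta> * int m) * int s"
   unfolding xyj by (simp add: algebra_simps)
  then have "int n * x + int m * y = int s" using bez by simp
  moreover obtain x' y' where n': "x = int x'" "y = int y'" using nn nonneg_int_cases by metis
  ultimately have "n * x' + m * y' = s" by (metis of_nat_add of_nat_eq_iff of_nat_mult)
  moreover have "a1 * y' < b1 * x'" "b2 * x' <= a2 * y'"
   using c unfolding n' by (simp_all flip: of_nat_mult)
  ultimately have "(x', y') \<in> half_open_line s" unfolding half_open_line_def by blast
  then show "u \<in> (%(x, y). (int x, int y)) ` half_open_line s" unfolding u n' by force
 qed
 have inj: "inj_on (%(x, y). (int x, int y)) X" for X by (auto simp: inj_on_def)
 have injP: "inj_on (P s) X" for s X using pos by (auto simp: inj_on_def P_def)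
 have fin: "finite (half_open_line s)" for s
  using img[of s] inj finite_imageD by (metis finite_greaterThanAtMost_int finite_imageI I_def)
 then show "finite (half_open_line s)" .
 have card: "card (half_open_line s) = nat ((A * int s) div int N - (B * int s) div int N)" for s
  using card_image[OF inj, of "half_open_line s"] card_image[OF injP, of s "I s"] img[of s] unfolding I_def by simp
 have ge: "(B * int s) div int N <= (A * int s) div int N" for s
  using AB N' by (intro zdiv_mono1 mult_right_mono) auto
 have add: "(C * int (s + N)) div int N = (C * int s) div int N + C" for C s
 proof -
  have "C * int (s + N) = C * int s + C * int N" by (simp add: algebra_simps)
  then show ?thesis using N' by simp
 qed
 show "card (half_open_line (s + N)) = card (half_open_line s) + r"
  unfolding card add using ge[of s] AB by linarith
qed

definition half_open_count :: "nat => nat" where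
 "half_open_count k = (\<Sum>s<k. card (half_open_line s))"

text \<open>When a block of N consecutive weights is raised by N, each of its N lines gains r
  points.\<close>

lemma half_open_count_second_difference:
 "int (half_open_count (k + 2 * N)) - 2 * int (half_open_count (k + N)) + int (half_open_count k) = int (r * N)"
proof -
 have d: "half_open_count (k + N) = half_open_count k + (\<Sum>s<N. card (half_open_line (k + s)))" for k
 proof -
  have "(\<Sum>s<k + N. card (half_open_line s)) = (\<Sum>s<k. card (half_open_line s)) + (\<Sum>s\<in>{k..<k + N}. card (half_open_line s))"
   by (simp add: lessThan_atLeast0 sum.atLeastLessThan_concat)
  also have "(\<Sum>s\<in>{k..<k + N}. card (half_open_line s)) = (\<Sum>s<N. card (half_open_line (k + s)))"
   using sum.shift_bounds_nat_ivl[of "%s. card (half_open_line s)" 0 k N] by (simp add: lessThan_atLeast0 add.commute)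
  finally show ?thesis unfolding half_open_count_def .
 qed
 have "(\<Sum>s<N. card (half_open_line (k + N + s))) = (\<Sum>s<N. card (half_open_line (k + s)) + r)"
 proof (intro sum.cong refl)
  fix s
  have "k + N + s = (k + s) + N" by simp
  then show "card (half_open_line (k + N + s)) = card (half_open_line (k + s)) + r" using card_half_open_line_add by metis
 qed
 also have "\<dots> = (\<Sum>s<N. card (half_open_line (k + s))) + N * r" by (simp add: sum.distrib)
 finally have 1: "(\<Sum>s<N. card (half_open_line (k + N + s))) = (\<Sum>s<N. card (half_open_line (k + s))) + N * r" .
 have "k + 2 * N = (k + N) + N" by simp
 then have h2: "half_open_count (k + 2 * N) = half_open_count (k + N) + ((\<Sum>s<N. card (half_open_line (k + s))) + N * r)"
  unfolding 1[symmetric] using d[of "k + N"] by (simp only:)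
 show ?thesis unfolding h2 d[of k] by (simp add: mult.commute)
qed

end

context newton_polygon
begin

definition half_open_cone :: "edge => nat => (nat \<times> nat) set" where
 "half_open_cone e D = {(x, y). fst (fst e) * y < snd (fst e) * x \<and> snd (snd e) * x <= fst (snd e) * y \<and> H x y < D}"

lemma half_open_cone_second_difference:
 assumes e: "e \<in> newton_edges c"
 shows "int (card (half_open_cone e (D + 2 * L))) - 2 * int (card (half_open_cone e (D + L))) + int (card (half_open_cone e D))
   = int (edge_r e * edge_N e)"
proof -
 obtain a1 b1 a2 b2 where "newton_edge_locale c a1 b1 a2 b2 (edge_r e) (edge_n e) (edge_m e) (edge_N e) e"
  using edge_locale[OF e] by blast
 then interpret newton_edge_locale c a1 b1 a2 b2 "edge_r e" "edge_n e" "edge_m e" "edge_N e" e .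
 \<comment> \<open>The argument is D / W e rounded up, the number of weights s with W e s < D. As L
   is W e times the degree of the edge, raising D by L raises it by exactly that degree.\<close>
 have "card (half_open_cone e D) = half_open_count ((D + W e - 1) div W e)" for D
 proof -
  have Wp: "0 < W e" by (rule W_pos[OF e])
  have lt: "W e * s < D \<longleftrightarrow> s < (D + W e - 1) div W e" for s
  proof -
   have "s < (D + W e - 1) div W e \<longleftrightarrow> Suc s <= (D + W e - 1) div W e" by auto
   also have "\<dots> \<longleftrightarrow> Suc s * W e <= D + W e - 1" using Wp by (simp add: less_eq_div_iff_mult_less_eq)
   also have "\<dots> \<longleftrightarrow> W e * s < D" using Wp by (auto simp: mult.commute)
   finally show ?thesis by simp
  qed
  have "half_open_cone e D = (\<Union>s\<in>{..<(D + W e - 1) div W e}. half_open_line s)"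
  proof (intro equalityI subsetI)
   fix u assume u: "u \<in> half_open_cone e D"
   obtain x y where xy: "u = (x, y)" by (cases u)
   have h: "a1 * y < b1 * x" "b2 * x <= a2 * y" "H x y < D" using u unfolding xy half_open_cone_def e_def by auto
   then have "edge_cone e x y" unfolding cone by simp
   then have "W e * edge_wt e x y < D" using H_cone[OF e] h(3) by simp
   then have "edge_n e * x + edge_m e * y < (D + W e - 1) div W e" unfolding lt wt .
   then show "u \<in> (\<Union>s\<in>{..<(D + W e - 1) div W e}. half_open_line s)" using h unfolding xy half_open_line_def by auto
  next
   fix u assume "u \<in> (\<Union>s\<in>{..<(D + W e - 1) div W e}. half_open_line s)"
   then obtain s x y where s: "s < (D + W e - 1) div W e" and u: "u = (x, y)"
    "edge_n e * x + edge_m e * y = s" "a1 * y < b1 * x" "b2 * x <= a2 * y" by (auto simp: half_open_line_def)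
   then have "edge_cone e x y" unfolding cone by simp
   then have "H x y = W e * s" using H_cone[OF e] u(2) unfolding wt by simp
   then show "u \<in> half_open_cone e D" using s u lt unfolding half_open_cone_def e_def by auto
  qed
  moreover have "card (\<Union>s\<in>{..<(D + W e - 1) div W e}. half_open_line s) = half_open_count ((D + W e - 1) div W e)"
   unfolding half_open_count_def by (rule card_UN_disjoint) (auto simp: finite_half_open_line, auto simp: half_open_line_def)
  ultimately show ?thesis by simp
 qed
 note card = this
 have Wp: "0 < W e" by (rule W_pos[OF e])
 have shift: "(D + i * L + W e - 1) div W e = (D + W e - 1) div W e + i * edge_N e" for i
 proof -
  have "D + i * L + W e - 1 = (D + W e - 1) + i * edge_N e * W e"
  proof -
   have "i * L = i * edge_N e * W e" unfolding W_N[OF e, symmetric] by (simp only: mult_ac)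
   then show ?thesis using Wp by linarith
  qed
  then show ?thesis using div_add_mult_nat[OF Wp] by (simp only:)
 qed
 show ?thesis unfolding card using half_open_count_second_difference[of "(D + W e - 1) div W e"]
   shift[of 1] shift[of 2] by simp
qed

definition H_count :: "nat => nat" where "H_count D = card {(x, y). H x y < D}"

text \<open>The half-open cones miss exactly the points with x = 0. There the level is a multiple k
  y with L = k times the y-intercept, so this count grows by a constant for every step L and drops
  out of the second difference.\<close>

lemma H_count_second_difference:
 "int (H_count (D + 2 * L)) - 2 * int (H_count (D + L)) + int (H_count D) = (\<Sum>e\<in>newton_edges c. int (edge_r e * edge_N e))"
proof -
 define Ax where "Ax = (%D. {(x, y). x = 0 \<and> H x y < D})"
 have "H_count D = card (Ax D) + (\<Sum>e\<in>newton_edges c. card (half_open_cone e D))" for D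
 proof -
  have fin: "finite (half_open_cone e D)" "finite (Ax D)" for e
   by (rule finite_subset[OF _ finite_H_less[of D]], auto simp: half_open_cone_def Ax_def)+
  have eq: "{(x, y). H x y < D} = Ax D \<union> (\<Union>e\<in>newton_edges c. half_open_cone e D)"
  proof (intro equalityI subsetI)
   fix u assume u: "u \<in> {(x, y). H x y < D}"
   obtain x y where xy: "u = (x, y)" by (cases u)
   show "u \<in> Ax D \<union> (\<Union>e\<in>newton_edges c. half_open_cone e D)"
   proof (cases "x = 0")
    case True
    then show ?thesis using u unfolding xy Ax_def by simp
   next
    case False
    then obtain a1 b1 a2 b2 where "newton_edge c a1 b1 a2 b2" "a1 * y < b1 * x" "b2 * x <= a2 * y"
     using half_open_cone_exists[of x y] by blast
    then have "((a1, b1), (a2, b2)) \<in> newton_edges c" "u \<in> half_open_cone ((a1, b1), (a2, b2)) D"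
     using u unfolding xy half_open_cone_def by auto
    then show ?thesis by blast
   qed
  qed (auto simp: Ax_def half_open_cone_def)
  have "Ax D \<inter> (\<Union>e\<in>newton_edges c. half_open_cone e D) = {}" by (auto simp: Ax_def half_open_cone_def)
  then have "H_count D = card (Ax D) + card (\<Union>e\<in>newton_edges c. half_open_cone e D)"
   unfolding H_count_def eq using fin finite_newton_edges by (intro card_Un_disjoint) auto
  also have "card (\<Union>e\<in>newton_edges c. half_open_cone e D) = (\<Sum>e\<in>newton_edges c. card (half_open_cone e D))"
  proof (rule card_UN_disjoint[OF finite_newton_edges])
   show "\<forall>i\<in>newton_edges c. finite (half_open_cone i D)" using fin by blast
   show "\<forall>i\<in>newton_edges c. \<forall>j\<in>newton_edges c. i ~= j --> half_open_cone i D \<inter> half_open_cone j D = {}"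
   proof (intro ballI impI equals0I)
    fix i j u assume ij: "i \<in> newton_edges c" "j \<in> newton_edges c" "i ~= j" and u: "u \<in> half_open_cone i D \<inter> half_open_cone j D"
    obtain x y where xy: "u = (x, y)" by (cases u)
    obtain a1 b1 a2 b2 a1' b1' a2' b2' where e: "i = ((a1, b1), (a2, b2))" "newton_edge c a1 b1 a2 b2"
      "j = ((a1', b1'), (a2', b2'))" "newton_edge c a1' b1' a2' b2'" using ij(1,2) unfolding newton_edges_def by blast
    have "a1 * y < b1 * x" "b2 * x <= a2 * y" "a1' * y < b1' * x" "b2' * x <= a2' * y"
     using u unfolding xy e half_open_cone_def by auto
    from half_open_cone_unique[OF e(2) this(1,2) e(4) this(3,4)] show False using ij(3) e by simp
   qed
  qed
  finally show ?thesis .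
 qed
 note cnt = this
 have ax: "int (card (Ax (D + 2 * L))) - 2 * int (card (Ax (D + L))) + int (card (Ax D)) = 0"
 proof -
  obtain a2 b2 where e0: "newton_edge c 0 (y_intercept c) a2 b2" using first_edge by blast
  define e where "e = ((0 :: nat, y_intercept c), (a2, b2))"
  have e: "e \<in> newton_edges c" unfolding e_def using e0 by simp
  define k where "k = W e * edge_m e"
  have kp: "0 < k" unfolding k_def using W_pos[OF e] edge_nm_pos[OF e] by simp
  have H0: "H 0 y = k * y" for y
  proof -
   have "edge_cone e 0 y" unfolding edge_cone_def e_def by simp
   from H_cone[OF e this] show ?thesis unfolding k_def edge_wt_def by simp
  qed
  have "H 0 (y_intercept c) = L"
  proof -
   obtain p1 q1 p2 q2 where "newton_edge_locale c p1 q1 p2 q2 (edge_r e) (edge_n e) (edge_m e) (edge_N e) e"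
    using edge_locale[OF e] by blast
   then interpret ee: newton_edge_locale c p1 q1 p2 q2 "edge_r e" "edge_n e" "edge_m e" "edge_N e" e .
   have "p1 = 0" "q1 = y_intercept c" using ee.e_def e_def by auto
   then have "edge_wt e 0 (y_intercept c) = edge_N e" using ee.N(1) ee.wt by simp
   moreover have "edge_cone e 0 (y_intercept c)" unfolding edge_cone_def e_def by simp
   ultimately show ?thesis using H_cone[OF e] W_N[OF e] by simp
  qed
  then have Lk: "L = y_intercept c * k" using H0 by (simp add: mult.commute)
  have "card (Ax D) = (D + k - 1) div k" for D
  proof -
   have lt: "k * s < D \<longleftrightarrow> s < (D + k - 1) div k" for s
   proof -
    have "s < (D + k - 1) div k \<longleftrightarrow> Suc s <= (D + k - 1) div k" by auto
    also have "\<dots> \<longleftrightarrow> Suc s * k <= D + k - 1" using kp by (simp add: less_eq_div_iff_mult_less_eq)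
    also have "\<dots> \<longleftrightarrow> k * s < D" using kp by (auto simp: mult.commute)
    finally show ?thesis by simp
   qed
   have "Ax D = {0} \<times> {..<(D + k - 1) div k}"
    unfolding Ax_def using H0 lt by auto
   then show ?thesis by (simp add: card_cartesian_product)
  qed
  note cax = this
  have shift: "(D + i * L + k - 1) div k = (D + k - 1) div k + i * y_intercept c" for i
  proof -
   have "D + i * L + k - 1 = (D + k - 1) + i * y_intercept c * k"
   proof -
    have "i * L = i * y_intercept c * k" unfolding Lk by (simp only: mult_ac)
    then show ?thesis using kp by linarith
   qed
   then show ?thesis using div_add_mult_nat[OF kp] by (simp only:)
  qed
  show ?thesis unfolding cax using shift[of 1] shift[of 2] by simp
 qed
 have "(\<Sum>e\<in>newton_edges c. int (edge_r e * edge_N e)) =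
   (\<Sum>e\<in>newton_edges c. int (card (half_open_cone e (D + 2 * L))) - 2 * int (card (half_open_cone e (D + L))) + int (card (half_open_cone e D)))"
  using half_open_cone_second_difference by (intro sum.cong) auto
 also have "\<dots> = (\<Sum>e\<in>newton_edges c. int (card (half_open_cone e (D + 2 * L)))) - 2 * (\<Sum>e\<in>newton_edges c. int (card (half_open_cone e (D + L))))
   + (\<Sum>e\<in>newton_edges c. int (card (half_open_cone e D)))"
  by (simp add: sum.distrib sum_subtractf sum_distrib_left)
 finally show ?thesis unfolding cnt using ax by simp
qed

end

section \<open>Codimension of the ideal (f, g)\<close>

lemma (in scalar_space) rel_dim_0D: "rel_dim U W 0 ==> W = U"
 by (erule rel_dim.cases) auto

lemma (in scalar_space_pair) linearI:
 assumes "\<And>x y. T (x + y) = T x + T y" "\<And>k x. T (s1 k x) = s2 k (T x)"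
 shows "Vector_Spaces.linear s1 s2 T"
 by unfold_locales (use assms in auto)

definition fscale :: "'k::field => 'k fps fps => 'k fps fps" where
 "fscale k p = fps_const (fps_const k) * p"

definition fscale2 :: "'k::field => 'k fps fps \<times> 'k fps fps => 'k fps fps \<times> 'k fps fps" where
 "fscale2 k z = (fscale k (fst z), fscale k (snd z))"

lemma cf_fscale [simp]: "cf (fscale k p) a b = k * cf p a b"
 by (simp add: fscale_def)

lemma fscale_mult: "fscale k p * q = fscale k (p * q)" "p * fscale k q = fscale k (p * q)"
 by (simp_all add: fscale_def mult_ac)

interpretation fs: scalar_space fscale
 by unfold_locales (auto intro!: cf_eqI simp: algebra_simps)

interpretation fs2: scalar_space fscale2
 by unfold_locales (auto simp: fscale2_def fs.scale_right_distrib fs.scale_left_distrib)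

interpretation fs11: scalar_space_pair fscale fscale ..
interpretation fs12: scalar_space_pair fscale fscale2 ..
interpretation fs21: scalar_space_pair fscale2 fscale ..
interpretation fs22: scalar_space_pair fscale2 fscale2 ..

abbreviation CS :: "'k :: {real_normed_field, euclidean_space} fps fps set" where
 "CS \<equiv> {p. convergent_series p}"

lemma convergent_series_fscale: "convergent_series p ==> convergent_series (fscale k p)"
 unfolding fscale_def by (intro convergent_series_mult convergent_series_const)

text \<open>The monomials with exponents in \<Omega> span a complement; they are adjoined one at a
  time.\<close>

lemma rel_dim_coefficients:
 assumes "finite \<Omega>"
 shows "fs.rel_dim {p \<in> CS. \<forall>x y. (x, y) \<in> \<Omega> --> cf p x y = (0 :: 'k :: {real_normed_field, euclidean_space})} CS (card \<Omega>)"
 using assms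
proof (induction \<Omega> rule: finite_induct)
 case empty
 have "fs.subspace (CS :: 'k fps fps set)"
  by (intro fs.subspaceI) (auto simp: convergent_series_0 convergent_series_add convergent_series_fscale)
 then show ?case by (simp add: fs.rel_dim_0)
next
 case (insert u \<Omega>)
 obtain a b where u: "u = (a, b)" by (cases u)
 let ?V = "{p \<in> CS. \<forall>x y. (x, y) \<in> \<Omega> --> cf p x y = (0 :: 'k)}" and ?U = "{p \<in> CS. \<forall>x y. (x, y) \<in> insert u \<Omega> --> cf p x y = (0 :: 'k)}"
 have sub: "fs.subspace ?U"
  by (intro fs.subspaceI) (auto simp: convergent_series_0 convergent_series_add convergent_series_fscale)
 have m: "cf (mon a b :: 'k fps fps) x y = 0" if "(x, y) \<in> \<Omega>" for x y
  using that insert(2) u by (auto simp: cf_mon)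
 have notin: "mon a b \<notin> ?U"
 proof
  assume "mon a b \<in> ?U"
  then have "cf (mon a b :: 'k fps fps) a b = 0" using u by blast
  then show False by (simp add: cf_mon)
 qed
 have eq: "fs.line_sum ?U (mon a b) = ?V"
 proof (intro equalityI subsetI)
  fix p assume "p \<in> fs.line_sum ?U (mon a b)"
  then obtain q k where "p = q + fscale k (mon a b)" "q \<in> ?U" unfolding fs.line_sum_def by blast
  then have pq: "p = q + fscale k (mon a b)" "convergent_series q" "\<And>x y. (x, y) \<in> \<Omega> ==> cf q x y = 0" by blast+
  show "p \<in> ?V"
  proof (intro CollectI conjI allI impI)
   show "convergent_series p" unfolding pq(1)
    using pq(2) by (blast intro: convergent_series_add convergent_series_fscale convergent_series_mon)
   fix x y assume "(x, y) \<in> \<Omega>"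
   then show "cf p x y = 0" unfolding pq(1) using m pq(3) by simp
  qed
 next
  fix p assume p: "p \<in> ?V"
  have "p - fscale (cf p a b) (mon a b) \<in> ?U"
  proof (intro CollectI conjI allI impI)
   show "convergent_series (p - fscale (cf p a b) (mon a b))"
    using p by (blast intro: convergent_series_diff convergent_series_fscale convergent_series_mon)
   fix x y assume xy: "(x, y) \<in> insert u \<Omega>"
   show "cf (p - fscale (cf p a b) (mon a b)) x y = 0"
   proof (cases "(x, y) = (a, b)")
    case True
    then show ?thesis by (simp add: cf_mon)
   next
    case False
    then have "(x, y) \<in> \<Omega>" using xy u by blast
    then have "cf p x y = 0" "cf (mon a b :: 'k fps fps) x y = 0" using p m by blast+
    then show ?thesis by simp
   qed
  qed
  then show "p \<in> fs.line_sum ?U (mon a b)" unfolding fs.line_sum_iff by blast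
 qed
 have "fs.rel_dim ?U ?V (Suc 0)" using fs.rel_dim_Suc[OF fs.rel_dim_0[OF sub] notin] unfolding eq .
 from fs.rel_dim_trans[OF insert.IH this] show ?case using insert(1,2) by simp
qed

locale newton_milnor = newton_split c
 for c :: "nat => nat => 'k :: {real_normed_field, euclidean_space}" +
 assumes conv_c: "convergent_series (series_of c)"
begin

definition Gx :: "'k fps fps" where "Gx = series_dx (series_of c)"
definition Gy :: "'k fps fps" where "Gy = series_dy (series_of c)"

lemma cf_Gx: "cf Gx i j = of_nat (Suc i) * c (Suc i) j" and cf_Gy: "cf Gy i j = of_nat (Suc j) * c i (Suc j)"
 unfolding Gx_def Gy_def cf_dx cf_dy by (simp_all add: series_of_def)

lemma conv_Gx: "convergent_series Gx" and conv_Gy: "convergent_series Gy"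
 unfolding Gx_def Gy_def by (intro convergent_series_deriv conv_c)+

lemma f_eq: "f = mon 1 0 * Gx"
proof (rule cf_eqI)
 fix a b show "cf f a b = cf (mon 1 0 * Gx) a b" unfolding cf_mon_mult cf_f cf_Gx by (cases a) auto
qed

lemma g_eq: "g = mon 0 1 * Gy"
proof (rule cf_eqI)
 fix a b show "cf g a b = cf (mon 0 1 * Gy) a b" unfolding cf_mon_mult cf_g cf_Gy by (cases b) auto
qed

lemma conv_f: "convergent_series f" and conv_g: "convergent_series g"
 unfolding f_eq g_eq by (intro convergent_series_mult convergent_series_mon conv_Gx conv_Gy)+

definition F :: "nat => 'k fps fps set" where "F D = {p \<in> CS. hge D p}"

definition I0 :: "'k fps fps set" where "I0 = {p * f + q * g | p q. convergent_series p \<and> convergent_series q}"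

lemma subspace_F: "fs.subspace (F D)"
 unfolding F_def by (intro fs.subspaceI) (auto simp: convergent_series_0 convergent_series_add convergent_series_fscale hge_add hge_zero, auto simp: hge_def)

lemma rel_dim_F: "fs.rel_dim (F D) CS (H_count D)"
proof -
 have "F D = {p \<in> CS. \<forall>x y. (x, y) \<in> {(x, y). H x y < D} --> cf p x y = 0}" unfolding F_def hge_def by auto
 then show ?thesis using rel_dim_coefficients[OF finite_H_less[of D]] unfolding H_count_def by simp
qed

lemma conv_ideal_I0: "conv_ideal I0"
 unfolding conv_ideal_def
proof (intro conjI ballI allI impI)
 show "I0 \<subseteq> CS" unfolding I0_def by (auto intro!: convergent_series_add convergent_series_mult conv_f conv_g)
 show "0 \<in> I0" unfolding I0_def using convergent_series_0 by (intro CollectI exI[of _ 0]) simp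
next
 fix x y assume "x \<in> I0" "y \<in> I0"
 then obtain p q p' q' where "x = p * f + q * g" "y = p' * f + q' * g"
  "convergent_series p" "convergent_series q" "convergent_series p'" "convergent_series q'" unfolding I0_def by blast
 then have "x + y = (p + p') * f + (q + q') * g" "convergent_series (p + p')" "convergent_series (q + q')"
  by (auto simp: algebra_simps convergent_series_add)
 then show "x + y \<in> I0" unfolding I0_def by blast
next
 fix x r :: "'k fps fps" assume "x \<in> I0" "convergent_series r"
 then obtain p q where "x = p * f + q * g" "convergent_series p" "convergent_series q" unfolding I0_def by blast
 then have "r * x = (r * p) * f + (r * q) * g" "convergent_series (r * p)" "convergent_series (r * q)"
  using \<open>convergent_series r\<close> by (auto simp: algebra_simps convergent_series_mult)
 then show "r * x \<in> I0" unfolding I0_def by blast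
qed

definition T :: "'k fps fps \<times> 'k fps fps => 'k fps fps" where "T z = fst z * f + snd z * g"

lemma linear_T: "Vector_Spaces.linear fscale2 fscale T"
 by (rule fs21.linearI) (simp_all add: T_def fscale2_def algebra_simps fscale_mult fs.scale_right_distrib)

lemma rel_dim_prod:
 assumes "fs.rel_dim U (CS :: 'k fps fps set) n"
 shows "fs2.rel_dim (U \<times> U) (CS \<times> CS) (n + n)"
proof -
 have sub: "fs.subspace U" "fs.subspace (CS :: 'k fps fps set)" "U \<subseteq> CS" using fs.rel_dim_subspace[OF assms] by auto
 have subp: "fs2.subspace (X \<times> Y)" if "fs.subspace X" "fs.subspace Y" for X Y
  using that by (intro fs2.subspaceI) (auto simp: fscale2_def zero_prod_def fs.subspace_0 fs.subspace_add fs.subspace_scale)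
 have 1: "fs2.rel_dim (U \<times> U) {z + (p, 0) | z p. z \<in> U \<times> U \<and> p \<in> CS} n"
 proof (rule fs12.rel_dim_image[OF _ subp[OF sub(1,1)] assms])
  show "Vector_Spaces.linear fscale fscale2 (%p. (p, 0))" by (rule fs12.linearI) (auto simp: fscale2_def)
 qed (use sub fs.subspace_0 in auto)
 have "{z + (p, 0 :: 'k fps fps) | z p. z \<in> U \<times> U \<and> p \<in> CS} = CS \<times> U"
 proof (intro equalityI subsetI)
  fix w :: "'k fps fps \<times> 'k fps fps" assume "w \<in> {z + (p, 0) | z p. z \<in> U \<times> U \<and> p \<in> CS}"
  then show "w \<in> CS \<times> U" using sub(3) by (auto intro!: convergent_series_add)
 next
  fix w :: "'k fps fps \<times> 'k fps fps" assume "w \<in> CS \<times> U"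
  then have "w = (0, snd w) + (fst w, 0)" "(0, snd w) \<in> U \<times> U" "fst w \<in> CS" using fs.subspace_0[OF sub(1)] by auto
  then show "w \<in> {z + (p, 0) | z p. z \<in> U \<times> U \<and> p \<in> CS}" by blast
 qed
 with 1 have 1: "fs2.rel_dim (U \<times> U) (CS \<times> U) n" by simp
 have 2: "fs2.rel_dim (CS \<times> U) {z + (0, p) | z p. z \<in> CS \<times> U \<and> p \<in> CS} n"
 proof (rule fs12.rel_dim_image[OF _ subp[OF sub(2,1)] assms])
  show "Vector_Spaces.linear fscale fscale2 (%p. (0, p))" by (rule fs12.linearI) (auto simp: fscale2_def)
 qed (use sub convergent_series_0 in auto)
 have "{z + (0 :: 'k fps fps, p) | z p. z \<in> CS \<times> U \<and> p \<in> CS} = CS \<times> CS"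
 proof (intro equalityI subsetI)
  fix w :: "'k fps fps \<times> 'k fps fps" assume "w \<in> {z + (0, p) | z p. z \<in> CS \<times> U \<and> p \<in> CS}"
  then show "w \<in> CS \<times> CS" using sub(3) by (auto intro!: convergent_series_add)
 next
  fix w :: "'k fps fps \<times> 'k fps fps" assume "w \<in> CS \<times> (CS :: 'k fps fps set)"
  then have "w = (fst w, 0) + (0, snd w)" "(fst w, 0) \<in> CS \<times> U" "snd w \<in> CS" using fs.subspace_0[OF sub(1)] by auto
  then show "w \<in> {z + (0, p) | z p. z \<in> CS \<times> U \<and> p \<in> CS}" by blast
 qed
 with 2 have "fs2.rel_dim (CS \<times> U) (CS \<times> CS) n" by simp
 from fs2.rel_dim_trans[OF this 1] show ?thesis .
qed

definition M :: nat where "M = (\<Sum>e\<in>newton_edges c. edge_r e * edge_N e)"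

text \<open>Let \<open>K\<close> be the kernel of (p, q) -> p f + q g modulo level D + 2 L.
  Exactness shows that it consists of the pairs at level D + L and the multiples (h g, - h f).
  Counting between these pairs, \<open>K\<close>, all pairs, and the image leaves the second
  difference of \<open>H_count\<close>, which is \<open>M\<close>.\<close>

lemma rel_dim_F_I0: "fs.rel_dim {z + w | z w. z \<in> F (D + 2 * L) \<and> w \<in> I0} CS M"
proof -
 define K where "K = {z \<in> CS \<times> CS. T z \<in> F (D + 2 * L)}"
 let ?U = "F (D + L) \<times> F (D + L)"
 have U: "fs2.rel_dim ?U (CS \<times> CS) (H_count (D + L) + H_count (D + L))" by (rule rel_dim_prod[OF rel_dim_F])
 have subU: "fs2.subspace ?U" using fs2.rel_dim_subspace[OF U] by simp
 define S where "S h = (h * g, - (h * f))" for h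
 have linS: "Vector_Spaces.linear fscale fscale2 S"
  by (rule fs12.linearI) (auto simp: S_def fscale2_def algebra_simps fscale_mult)
 \<comment> \<open>The forward direction needs \<open>hge_f_inj\<close>: the level of h f determines
   that of h.\<close>
 have S: "S h \<in> ?U \<longleftrightarrow> h \<in> F D" if h: "h \<in> CS" for h
 proof
  assume "S h \<in> ?U"
  then have "hge (D + L) (h * f)" unfolding S_def F_def using hge_uminus[of "D + L" "- (h * f)"] by simp
  then show "h \<in> F D" using hge_f_inj h unfolding F_def by blast
 next
  assume "h \<in> F D"
  then have "hge (D + L) (h * g)" "hge (D + L) (h * f)" unfolding F_def by (auto intro: hge_mult hge_f hge_g)
  then show "S h \<in> ?U" unfolding S_def F_def using h
   by (auto intro!: convergent_series_mult convergent_series_uminus conv_f conv_g hge_uminus)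
 qed
 have "fs2.rel_dim ?U {z + S h | z h. z \<in> ?U \<and> h \<in> CS} (H_count D)"
  by (rule fs12.rel_dim_image[OF linS subU rel_dim_F]) (rule S)
 also have "{z + S h | z h. z \<in> ?U \<and> h \<in> CS} = K"
 proof (intro equalityI subsetI)
  fix w assume "w \<in> {z + S h | z h. z \<in> ?U \<and> h \<in> CS}"
  then obtain p q h where w: "w = (p, q) + S h" "p \<in> F (D + L)" "q \<in> F (D + L)" "h \<in> CS" by blast
  have Tw: "T w = p * f + q * g" unfolding T_def w(1) S_def by (simp add: algebra_simps)
  have "hge (D + L + L) (p * f + q * g)" using w(2,3) unfolding F_def by (intro hge_add hge_mult hge_f hge_g) auto
  then have "T w \<in> F (D + 2 * L)" unfolding Tw F_def using w
   by (auto simp: F_def mult_2 add.assoc intro!: convergent_series_add convergent_series_mult conv_f conv_g)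
  moreover have "w \<in> CS \<times> CS" unfolding w(1) S_def using w
   by (auto simp: F_def intro!: convergent_series_add convergent_series_mult convergent_series_diff conv_f conv_g)
  ultimately show "w \<in> K" unfolding K_def by blast
 next
  fix w assume w: "w \<in> K"
  obtain p q where pq: "w = (p, q)" by (cases w)
  have c: "convergent_series p" "convergent_series q" "hge (D + 2 * L) (p * f + q * g)"
   using w unfolding K_def pq T_def F_def by auto
  have "D + 2 * L = (D + L) + L" by simp
  then obtain h where h: "convergent_series h" "hge (D + L) (p - h * g)" "hge (D + L) (q + h * f)"
   using koszul_exact[of "D + L" p q] c(3) by metis
  have "w = (p - h * g, q + h * f) + S h" unfolding pq S_def by simp
  moreover have "(p - h * g, q + h * f) \<in> ?U" unfolding F_def using h c
   by (auto intro!: convergent_series_add convergent_series_mult convergent_series_diff conv_f conv_g)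
  ultimately show "w \<in> {z + S h | z h. z \<in> ?U \<and> h \<in> CS}" using h(1) by blast
 qed
 finally have UK: "fs2.rel_dim ?U K (H_count D)" .
 have "K \<subseteq> CS \<times> CS" unfolding K_def by blast
 from fs2.rel_dim_diff[OF U UK this] have le1: "H_count D <= H_count (D + L) + H_count (D + L)"
  and K: "fs2.rel_dim K (CS \<times> CS) (H_count (D + L) + H_count (D + L) - H_count D)" by auto
 have Z: "fs.rel_dim (F (D + 2 * L)) {z + T w | z w. z \<in> F (D + 2 * L) \<and> w \<in> CS \<times> CS} (H_count (D + L) + H_count (D + L) - H_count D)"
  by (rule fs21.rel_dim_image[OF linear_T subspace_F K]) (auto simp: K_def)
 have eq: "{z + T w | z w. z \<in> F (D + 2 * L) \<and> w \<in> CS \<times> CS} = {z + w | z w. z \<in> F (D + 2 * L) \<and> w \<in> I0}"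
  unfolding T_def I0_def by fastforce
 have "{z + w | z w. z \<in> F (D + 2 * L) \<and> w \<in> I0} \<subseteq> CS"
  using conv_ideal_conv[OF conv_ideal_I0] unfolding F_def by (auto intro!: convergent_series_add)
 from fs.rel_dim_diff[OF rel_dim_F Z[unfolded eq] this]
 have "H_count (D + L) + H_count (D + L) - H_count D <= H_count (D + 2 * L)"
  "fs.rel_dim {z + w | z w. z \<in> F (D + 2 * L) \<and> w \<in> I0} CS (H_count (D + 2 * L) - (H_count (D + L) + H_count (D + L) - H_count D))" by auto
 moreover have "int (H_count (D + 2 * L)) - 2 * int (H_count (D + L)) + int (H_count D) = int M"
  using H_count_second_difference[of D] by (simp add: M_def)
 ultimately have "H_count (D + 2 * L) - (H_count (D + L) + H_count (D + L) - H_count D) = M" using le1 by linarith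
 with \<open>fs.rel_dim _ CS _\<close> show ?thesis by (simp only:)
qed

text \<open>The nested spaces I0 + F (D + 2 L) have the same codimension M for all D, so they
  coincide. Series of sufficiently high level are combinations of the monomials of degree 2 L with
  coefficients in the maximal ideal; these monomials lie in F (2 L), and Nakayama's lemma puts them
  into I0.\<close>

lemma F_subset_I0: "F (2 * L) \<subseteq> I0"
proof -
 have sub: "F (2 * L) \<subseteq> {z + w | z w. z \<in> F (D + 2 * L) \<and> w \<in> I0}" for D
 proof -
  let ?S = "%D. {z + w | z w. z \<in> F (D + 2 * L) \<and> w \<in> I0}"
  have "F (D + 2 * L) \<subseteq> F (0 + 2 * L)" unfolding F_def using hge_mono[of "D + 2 * L" _ "0 + 2 * L"] by auto
  then have sub0: "?S D \<subseteq> ?S 0" by blast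
  have "fs.rel_dim (?S D) (?S 0) (M - M)"
   by (rule fs.rel_dim_diff_upper[OF rel_dim_F_I0[of D] rel_dim_F_I0[of 0] sub0, THEN conjunct2])
  then have "?S 0 = ?S D" unfolding diff_self_eq_0 by (rule fs.rel_dim_0D)
  moreover have "F (2 * L) \<subseteq> ?S 0"
  proof
   fix p assume "p \<in> F (2 * L)"
   then have "p = p + 0" "p \<in> F (0 + 2 * L)" "0 \<in> I0" using conv_ideal_0[OF conv_ideal_I0] by simp_all
   then show "p \<in> ?S 0" by (intro CollectI exI conjI)
  qed
  ultimately show ?thesis by (simp only:)
 qed
 obtain e where e: "e \<in> newton_edges c" using edges_nonempty by blast
 \<comment> \<open>A linear bound of the level by the degree, so that a high level forces a high
   degree.\<close>
 define \<kappa> where "\<kappa> = W e * (edge_n e + edge_m e)"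
 have \<kappa>: "H x y <= \<kappa> * (x + y)" for x y
 proof -
  have "H x y <= W e * edge_wt e x y" by (rule H_le[OF e])
  also have "\<dots> <= W e * ((edge_n e + edge_m e) * (x + y))" unfolding edge_wt_def
   by (intro mult_le_mono2) (simp add: algebra_simps)
  finally show ?thesis unfolding \<kappa>_def by (simp add: mult.assoc)
 qed
 define d where "d = 2 * L"
 define \<phi> :: "nat => 'k fps fps" where "\<phi> = (%i. mon i (d - i))"
 have inj: "inj_on \<phi> {..d}"
 proof (rule inj_onI)
  fix i j assume "\<phi> i = \<phi> j"
  then have "cf (\<phi> i) i (d - i) = cf (\<phi> j) i (d - i)" by simp
  then show "i = j" unfolding \<phi>_def cf_mon by (auto split: if_splits)
 qed
 \<comment> \<open>Above level \<kappa> d all coefficients up to degree d vanish, degree d itself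
   included; the latter puts the multipliers into the maximal ideal.\<close>
 have dec: "\<exists>w. (\<forall>i\<le>d. convergent_series (w i) \<and> cf (w i) 0 0 = 0) \<and> p = (\<Sum>i\<le>d. w i * \<phi> i)"
  if p: "p \<in> F (\<kappa> * d + 1 + 2 * L)" for p
 proof -
  have z: "cf p a b = 0" if "a + b <= d" for a b
  proof -
   have "H a b <= \<kappa> * d" using \<kappa>[of a b] that by (meson le_trans mult_le_mono2)
   then show ?thesis using p unfolding F_def hge_def by auto
  qed
  have "convergent_series p" using p unfolding F_def by simp
  moreover have "cf p a b = 0" if "a + b < d" for a b using z[of a b] that by simp
  ultimately obtain w where "\<forall>i\<le>d. convergent_series (w i) \<and> cf (w i) 0 0 = cf p i (d - i)" "p = (\<Sum>i\<le>d. w i * mon i (d - i))"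
   using homogeneous_decomposition[of p d] by blast
  then show ?thesis using z unfolding \<phi>_def by (intro exI[of _ w]) auto
 qed
 have "\<phi> ` {..d} \<subseteq> I0"
 proof (rule nakayama[OF conv_ideal_I0])
  show "finite (\<phi> ` {..d})" by simp
  fix u assume "u \<in> \<phi> ` {..d}"
  then obtain i where i: "i <= d" "u = \<phi> i" by blast
  have "u \<in> F (2 * L)" unfolding i(2) \<phi>_def F_def hge_def
  proof (intro CollectI conjI allI impI)
   fix x y assume H: "H x y < 2 * L"
   show "cf (mon i (d - i)) x y = (0 :: 'k)" using H_ge_degree[of x y] H i(1) by (auto simp: cf_mon d_def)
  qed (simp add: convergent_series_mon)
  then obtain z w where zw: "u = z + w" "z \<in> F (\<kappa> * d + 1 + 2 * L)" "w \<in> I0" using sub by blast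
  obtain v where v: "\<forall>i\<le>d. convergent_series (v i) \<and> cf (v i) 0 0 = 0" "z = (\<Sum>i\<le>d. v i * \<phi> i)"
   using dec[OF zw(2)] by blast
  \<comment> \<open>Reindexing from exponents to the monomials themselves, the form over which
    \<open>nakayama\<close> sums.\<close>
  define v' where "v' = (%x. v (the_inv_into {..d} \<phi> x))"
  have v': "v' (\<phi> i) = v i" if "i <= d" for i unfolding v'_def using the_inv_into_f_f[OF inj] that by simp
  have "(\<Sum>x\<in>\<phi> ` {..d}. v' x * x) = z" unfolding v(2) sum.reindex[OF inj] by (intro sum.cong) (auto simp: v')
  then have "u = w + (\<Sum>x\<in>\<phi> ` {..d}. v' x * x)" using zw(1) by simp
  moreover have "\<forall>x\<in>\<phi> ` {..d}. convergent_series (v' x) \<and> cf (v' x) 0 0 = 0" using v(1) v' by auto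
  ultimately show "\<exists>i\<in>I0. \<exists>w. (\<forall>x\<in>\<phi> ` {..d}. convergent_series (w x) \<and> cf (w x) 0 0 = 0) \<and> u = i + (\<Sum>x\<in>\<phi> ` {..d}. w x * x)"
   using zw(3) by blast
 qed
 then have "F (\<kappa> * d + 1 + 2 * L) \<subseteq> I0"
 proof (intro subsetI)
  fix p assume sub: "\<phi> ` {..d} \<subseteq> I0" and "p \<in> F (\<kappa> * d + 1 + 2 * L)"
  then obtain w where w: "\<forall>i\<le>d. convergent_series (w i) \<and> cf (w i) 0 0 = 0" "p = (\<Sum>i\<le>d. w i * \<phi> i)" using dec by blast
  show "p \<in> I0" unfolding w(2) using w(1) sub by (intro conv_ideal_sum[OF conv_ideal_I0] conv_ideal_mult[OF conv_ideal_I0]) auto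
 qed
 note tail = this
 show ?thesis
 proof
  fix p assume "p \<in> F (2 * L)"
  then obtain z w where "p = z + w" "z \<in> F (\<kappa> * d + 1 + 2 * L)" "w \<in> I0" using sub[of "\<kappa> * d + 1"] by blast
  then show "p \<in> I0" using tail conv_ideal_add[OF conv_ideal_I0] by blast
 qed
qed

lemma rel_dim_I0: "fs.rel_dim I0 CS M"
proof -
 have "{z + w | z w. z \<in> F (0 + 2 * L) \<and> w \<in> I0} = I0"
 proof (intro equalityI subsetI)
  fix u assume "u \<in> {z + w | z w. z \<in> F (0 + 2 * L) \<and> w \<in> I0}"
  then show "u \<in> I0" using F_subset_I0 conv_ideal_add[OF conv_ideal_I0] by auto
 next
  fix u assume "u \<in> I0"
  moreover have "0 \<in> F (0 + 2 * L)" using fs.subspace_0[OF subspace_F] .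
  ultimately show "u \<in> {z + w | z w. z \<in> F (0 + 2 * L) \<and> w \<in> I0}" by force
 qed
 then show ?thesis using rel_dim_F_I0[of 0] by simp
qed

end

section \<open>Dividing the generators by x and y\<close>

definition transp :: "'k::zero fps fps => 'k fps fps" where
 "transp p = Abs_fps (%i. Abs_fps (%j. cf p j i))"

lemma cf_transp [simp]: "cf (transp p) i j = cf p j i" by (simp add: transp_def)

lemma transp_transp [simp]: "transp (transp p) = p" by (rule cf_eqI) simp

lemma transp_mult: "transp (p * q) = transp p * (transp q :: 'k::comm_ring_1 fps fps)"
 by (rule cf_eqI, unfold cf_mult cf_transp, rule sum.swap)

lemma transp_add: "transp (p + q) = transp p + (transp q :: 'k::comm_ring_1 fps fps)"
 by (rule cf_eqI) simp

lemma transp_mon: "transp (mon a b) = mon b a"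
 by (rule cf_eqI) (auto simp: cf_mon)

lemma nrm_transp: "nrm \<rho> K (transp p) = nrm \<rho> K p"
 unfolding nrm_def fps_nrm_def sum_distrib_right cf_transp
 by (subst sum.swap) (simp add: mult_ac)

lemma convergent_series_transp: "convergent_series p ==> convergent_series (transp p)"
 unfolding convergent_series_iff nrm_transp .

text \<open>On x = 0 the series \<open>q\<close> is y^k times a unit, so \<open>p\<close> is a
  multiple of it there; the difference vanishes on x = 0 and is therefore divisible by x.\<close>

lemma x_decomposition:
 fixes p q :: "'k :: {real_normed_field, euclidean_space} fps fps"
 assumes p: "convergent_series p" "\<And>j. j < k ==> cf p 0 j = 0"
  and q: "convergent_series q" "\<And>j. j < k ==> cf q 0 j = 0" "cf q 0 k ~= 0"
 shows "\<exists>u v. convergent_series u \<and> convergent_series v \<and> p = mon 1 0 * u + v * q"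
proof -
 \<comment> \<open>The restriction to x = 0 with y^k cancelled, regarded again as a double
   series.\<close>
 define red where "red w = Abs_fps (%i. Abs_fps (%j. if i = 0 then cf w 0 (j + k) else 0))" for w :: "'k fps fps"
 have conv: "convergent_series (red w)" if "convergent_series w" for w
  by (rule convergent_series_shift[OF that, of _ 0 k]) (auto simp: red_def)
 have row: "fps_nth w 0 = fps_X ^ k * fps_nth (red w) 0" if "\<And>j. j < k ==> cf w 0 j = 0" for w
  by (rule fps_ext) (auto simp: fps_X_power_mult_nth red_def that)
 obtain e where e: "convergent_series e" "red q * e = 1"
  using series_unit[OF conv[OF q(1)]] q(3) by (auto simp: red_def)
 define v where "v = red p * e"
 define d where "d = p - v * q"
 define u where "u = Abs_fps (%i. fps_nth d (Suc i))"
 have v: "convergent_series v" unfolding v_def by (intro convergent_series_mult conv p e)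
 have d: "convergent_series d" unfolding d_def by (intro convergent_series_diff convergent_series_mult p q v)
 have u: "convergent_series u" by (rule convergent_series_shift[OF d, of _ 1 0]) (simp add: u_def)
 have e0: "fps_nth (red q) 0 * fps_nth e 0 = 1" using arg_cong[OF e(2), of "%w. fps_nth w 0"] by simp
 have "fps_nth (v * q) 0 = fps_nth (red p) 0 * fps_nth e 0 * (fps_X ^ k * fps_nth (red q) 0)"
  unfolding v_def by (simp add: row[OF q(2)])
 also have "\<dots> = fps_X ^ k * fps_nth (red p) 0 * (fps_nth (red q) 0 * fps_nth e 0)" by (simp only: mult_ac)
 also have "\<dots> = fps_nth p 0" unfolding e0 using row[OF p(2)] by simp
 finally have d0: "fps_nth d 0 = 0" by (simp add: d_def)
 have "d = mon 1 0 * u"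
 proof (rule cf_eqI)
  fix a b show "cf d a b = cf (mon 1 0 * u) a b" unfolding cf_mon_mult using d0 by (cases a) (auto simp: u_def)
 qed
 then have "p = mon 1 0 * u + v * q" unfolding d_def by (simp add: algebra_simps)
 then show ?thesis using u v by blast
qed

lemma y_decomposition:
 fixes p q :: "'k :: {real_normed_field, euclidean_space} fps fps"
 assumes p: "convergent_series p" "\<And>j. j < k ==> cf p j 0 = 0"
  and q: "convergent_series q" "\<And>j. j < k ==> cf q j 0 = 0" "cf q k 0 ~= 0"
 shows "\<exists>u v. convergent_series u \<and> convergent_series v \<and> p = mon 0 1 * u + v * q"
proof -
 obtain u v where uv: "convergent_series u" "convergent_series v" "transp p = mon 1 0 * u + v * transp q"
  using x_decomposition[of "transp p" k "transp q"] convergent_series_transp p q by auto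
 have "p = transp (mon 1 0 * u + v * transp q)" unfolding uv(3)[symmetric] by simp
 also have "\<dots> = mon 0 1 * transp u + transp v * q" by (simp add: transp_add transp_mult transp_mon)
 finally show ?thesis using uv convergent_series_transp by blast
qed

context newton_milnor
begin

text \<open>The ideal (G_x, y G_y), halfway between \<open>I0\<close> and the Jacobian ideal, so
  that x and y are divided out one after the other.\<close>

definition I1 :: "'k fps fps set" where "I1 = {u * Gx + v * g | u v. convergent_series u \<and> convergent_series v}"
definition J where "J = {u * Gx + v * Gy | u v. convergent_series u \<and> convergent_series v}"

text \<open>After multiplication by x, a relation p G_x = u f + v g becomes a syzygy of (f, g), so p
  - x u is a multiple of g modulo any finite level; on x = 0 the series g starts at the y-intercept.
  The converse divides p by g modulo x.\<close>

lemma mult_Gx_in_I0: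
 assumes p: "convergent_series p"
 shows "p * Gx \<in> I0 \<longleftrightarrow> (\<forall>j<y_intercept c. cf p 0 j = 0)"
proof
 assume "p * Gx \<in> I0"
 then obtain u v where uv: "p * Gx = u * f + v * g" "convergent_series u" "convergent_series v" unfolding I0_def by blast
 have "p * f = mon 1 0 * (p * Gx)" unfolding f_eq by (simp only: mult_ac)
 also have "\<dots> = mon 1 0 * u * f + mon 1 0 * v * g" unfolding uv(1) by (simp add: algebra_simps)
 finally have 0: "(p - mon 1 0 * u) * f + (- (mon 1 0 * v)) * g = 0" by (simp add: algebra_simps)
 show "\<forall>j<y_intercept c. cf p 0 j = 0"
 proof (intro allI impI)
  fix j assume j: "j < y_intercept c"
  \<comment> \<open>A level just above that of y^j is enough to control the coefficient of
    y^j.\<close>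
  obtain h where h: "hge (Suc (H 0 j)) (p - mon 1 0 * u - h * g)"
   using koszul_exact[of "Suc (H 0 j)" "p - mon 1 0 * u" "- (mon 1 0 * v)"] unfolding 0 using hge_zero by blast
  have "cf (p - mon 1 0 * u - h * g) 0 j = 0" using h unfolding hge_def by blast
  moreover have "cf (mon 1 0 * u) 0 j = 0" unfolding cf_mon_mult by simp
  moreover have "cf (h * g) 0 j = 0" unfolding cf_mult
  proof (intro sum.neutral ballI)
   fix i l assume "i \<in> {..0 :: nat}" "l \<in> {..j}"
   then have "c 0 (j - l) = 0" using j y_intercept(2)[of "j - l"] by force
   then show "cf h i l * cf g (0 - i) (j - l) = 0" by (simp add: cf_g)
  qed
  ultimately show "cf p 0 j = 0" by simp
 qed
next
 assume z: "\<forall>j<y_intercept c. cf p 0 j = 0"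
 have "cf g 0 j = 0" if "j < y_intercept c" for j using y_intercept(2)[of j] that by (force simp: cf_g)
 moreover have "cf g 0 (y_intercept c) ~= 0" using y_intercept(1,3) by (simp add: cf_g)
 ultimately obtain u v where uv: "convergent_series u" "convergent_series v" "p = mon 1 0 * u + v * g"
  using x_decomposition[OF p _ conv_g, of "y_intercept c"] z by blast
 have "p * Gx = u * f + (v * Gx) * g" unfolding uv(3) f_eq by (simp add: algebra_simps)
 then show "p * Gx \<in> I0" unfolding I0_def using uv convergent_series_mult[OF uv(2) conv_Gx] by blast
qed

text \<open>The same argument after multiplication by x y. On y = 0 the series f starts at the
  x-intercept, and the factor x in front of \<open>p\<close> lowers the bound by one.\<close>

lemma mult_Gy_in_I1:
 assumes p: "convergent_series p"
 shows "p * Gy \<in> I1 \<longleftrightarrow> (\<forall>j<x_intercept c - 1. cf p j 0 = 0)"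
proof
 assume "p * Gy \<in> I1"
 then obtain u v where uv: "p * Gy = u * Gx + v * g" "convergent_series u" "convergent_series v" unfolding I1_def by blast
 have "mon 1 0 * p * g = mon 1 0 * mon 0 1 * (p * Gy)" unfolding g_eq by (simp only: mult_ac)
 also have "\<dots> = mon 0 1 * u * f + mon 1 0 * mon 0 1 * v * g" unfolding uv(1) f_eq by (simp add: algebra_simps)
 finally have 0: "(- (mon 0 1 * u)) * f + (mon 1 0 * p - mon 1 0 * mon 0 1 * v) * g = 0" by (simp add: algebra_simps)
 show "\<forall>j<x_intercept c - 1. cf p j 0 = 0"
 proof (intro allI impI)
  fix j assume j: "j < x_intercept c - 1"
  obtain h where h: "hge (Suc (H (Suc j) 0)) (mon 1 0 * p - mon 1 0 * mon 0 1 * v + h * f)"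
   using koszul_exact[of "Suc (H (Suc j) 0)" "- (mon 0 1 * u)" "mon 1 0 * p - mon 1 0 * mon 0 1 * v"] unfolding 0 using hge_zero by blast
  have "cf (mon 1 0 * p - mon 1 0 * mon 0 1 * v + h * f) (Suc j) 0 = 0" using h unfolding hge_def by blast
  moreover have "cf (mon 1 0 * p) (Suc j) 0 = cf p j 0" unfolding cf_mon_mult by simp
  moreover have "cf (mon 1 0 * mon 0 1 * v) (Suc j) 0 = 0" unfolding mon_mult cf_mon_mult by simp
  moreover have "cf (h * f) (Suc j) 0 = 0" unfolding cf_mult
  proof (intro sum.neutral ballI)
   fix i l assume "i \<in> {..Suc j}" "l \<in> {..0 :: nat}"
   then have "c (Suc j - i) 0 = 0" using j x_intercept(2)[of "Suc j - i"] by force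
   then show "cf h i l * cf f (Suc j - i) (0 - l) = 0" by (simp add: cf_f)
  qed
  ultimately show "cf p j 0 = 0" by simp
 qed
next
 assume z: "\<forall>j<x_intercept c - 1. cf p j 0 = 0"
 have "cf Gx j 0 = 0" if "j < x_intercept c - 1" for j using x_intercept(2)[of "Suc j"] that by (force simp: cf_Gx)
 moreover have "cf Gx (x_intercept c - 1) 0 ~= 0" using x_intercept(1,3) by (simp add: cf_Gx del: of_nat_Suc)
 ultimately obtain u v where uv: "convergent_series u" "convergent_series v" "p = mon 0 1 * u + v * Gx"
  using y_decomposition[OF p _ conv_Gx, of "x_intercept c - 1"] z by blast
 have "p * Gy = (v * Gy) * Gx + u * g" unfolding uv(3) g_eq by (simp add: algebra_simps)
 then show "p * Gy \<in> I1" unfolding I1_def using uv convergent_series_mult[OF uv(2) conv_Gy] by blast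
qed

lemma linear_mult: "Vector_Spaces.linear fscale fscale (%p. p * q)"
 by (rule fs11.linearI) (simp_all add: algebra_simps fscale_mult)

text \<open>Multiplication by G_x identifies the series modulo x and y^b, b the y-intercept, with I1
  modulo I0.\<close>

lemma rel_dim_I0_I1: "fs.rel_dim I0 I1 (y_intercept c)"
proof -
 let ?\<Omega> = "{0 :: nat} \<times> {..<y_intercept c}"
 have 1: "fs.rel_dim {p \<in> CS. \<forall>x y. (x, y) \<in> ?\<Omega> --> cf p x y = 0} CS (card ?\<Omega>)"
  by (rule rel_dim_coefficients) simp
 have "fs.rel_dim I0 {z + p * Gx | z p. z \<in> I0 \<and> p \<in> CS} (card ?\<Omega>)"
 proof (rule fs11.rel_dim_image[OF linear_mult _ 1])
  show "fs.subspace I0" using fs.rel_dim_subspace[OF rel_dim_I0] by blast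
  show "p * Gx \<in> I0 \<longleftrightarrow> p \<in> {p \<in> CS. \<forall>x y. (x, y) \<in> ?\<Omega> --> cf p x y = 0}" if "p \<in> CS" for p
   using mult_Gx_in_I0[of p] that by auto
 qed
 moreover have "{z + p * Gx | z p. z \<in> I0 \<and> p \<in> CS} = I1"
 proof (intro equalityI subsetI)
  fix w assume "w \<in> {z + p * Gx | z p. z \<in> I0 \<and> p \<in> CS}"
  then obtain u v p where w: "w = (u * f + v * g) + p * Gx" "convergent_series u" "convergent_series v" "convergent_series p"
   unfolding I0_def by blast
  have "w = (u * mon 1 0 + p) * Gx + v * g" unfolding w(1) f_eq by (simp add: algebra_simps)
  moreover have "convergent_series (u * mon 1 0 + p)"
   using w by (intro convergent_series_add convergent_series_mult convergent_series_mon)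
  ultimately show "w \<in> I1" unfolding I1_def using w(3) by blast
 next
  fix w assume "w \<in> I1"
  then obtain u v where w: "w = u * Gx + v * g" "convergent_series u" "convergent_series v" unfolding I1_def by blast
  have "w = (0 * f + v * g) + u * Gx" unfolding w(1) by simp
  moreover have "0 * f + v * g \<in> I0" unfolding I0_def using w(3) convergent_series_0 by blast
  ultimately show "w \<in> {z + p * Gx | z p. z \<in> I0 \<and> p \<in> CS}" using w(2) by blast
 qed
 ultimately show ?thesis by (simp add: card_cartesian_product)
qed

lemma rel_dim_I1_J: "fs.rel_dim I1 J (x_intercept c - 1)"
proof -
 let ?\<Omega> = "{..<x_intercept c - 1} \<times> {0 :: nat}"
 have 1: "fs.rel_dim {p \<in> CS. \<forall>x y. (x, y) \<in> ?\<Omega> --> cf p x y = 0} CS (card ?\<Omega>)"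
  by (rule rel_dim_coefficients) simp
 have "fs.rel_dim I1 {z + p * Gy | z p. z \<in> I1 \<and> p \<in> CS} (card ?\<Omega>)"
 proof (rule fs11.rel_dim_image[OF linear_mult _ 1])
  show "fs.subspace I1" using fs.rel_dim_subspace[OF rel_dim_I0_I1] by blast
  show "p * Gy \<in> I1 \<longleftrightarrow> p \<in> {p \<in> CS. \<forall>x y. (x, y) \<in> ?\<Omega> --> cf p x y = 0}" if "p \<in> CS" for p
   using mult_Gy_in_I1[of p] that by auto
 qed
 moreover have "{z + p * Gy | z p. z \<in> I1 \<and> p \<in> CS} = J"
 proof (intro equalityI subsetI)
  fix w assume "w \<in> {z + p * Gy | z p. z \<in> I1 \<and> p \<in> CS}"
  then obtain u v p where w: "w = (u * Gx + v * g) + p * Gy" "convergent_series u" "convergent_series v" "convergent_series p"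
   unfolding I1_def by blast
  have "w = u * Gx + (v * mon 0 1 + p) * Gy" unfolding w(1) g_eq by (simp add: algebra_simps)
  moreover have "convergent_series (v * mon 0 1 + p)"
   using w by (intro convergent_series_add convergent_series_mult convergent_series_mon)
  ultimately show "w \<in> J" unfolding J_def using w(2) by blast
 next
  fix w assume "w \<in> J"
  then obtain u v where w: "w = u * Gx + v * Gy" "convergent_series u" "convergent_series v" unfolding J_def by blast
  have "w = (u * Gx + 0 * g) + v * Gy" unfolding w(1) by simp
  moreover have "u * Gx + 0 * g \<in> I1" unfolding I1_def using w(2) convergent_series_0 by blast
  ultimately show "w \<in> {z + p * Gy | z p. z \<in> I1 \<and> p \<in> CS}" using w(3) by blast
 qed
 ultimately show ?thesis by (simp add: card_cartesian_product)
qed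

lemma rel_dim_J:
 "x_intercept c + y_intercept c - 1 <= M" "fs.rel_dim J CS (M - (x_intercept c + y_intercept c - 1))"
proof -
 have IJ: "fs.rel_dim I0 J (y_intercept c + (x_intercept c - 1))" by (rule fs.rel_dim_trans[OF rel_dim_I1_J rel_dim_I0_I1])
 have "J \<subseteq> CS" unfolding J_def by (auto intro!: convergent_series_add convergent_series_mult conv_Gx conv_Gy)
 from fs.rel_dim_diff[OF rel_dim_I0 IJ this] x_intercept(3)
 show "x_intercept c + y_intercept c - 1 <= M" "fs.rel_dim J CS (M - (x_intercept c + y_intercept c - 1))"
  by (auto simp: add.commute)
qed

end

section \<open>The quotient ring and the Milnor number\<close>

lemma convergent_ring_simps [simp]:
 "carrier convergent_ring = {f. convergent_series f}" "mult convergent_ring = (*)" "one convergent_ring = 1"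
 "zero convergent_ring = 0" "add convergent_ring = (+)"
 by (simp_all add: convergent_ring_def)

lemma cring_convergent_ring: "cring (convergent_ring :: 'k :: {real_normed_field, euclidean_space} fps fps ring)"
proof (rule cringI)
 show "abelian_group (convergent_ring :: 'k fps fps ring)"
 proof (rule abelian_groupI)
  fix x :: "'k fps fps" assume "x \<in> carrier convergent_ring"
  then show "\<exists>y\<in>carrier convergent_ring. y \<oplus>\<^bsub>convergent_ring\<^esub> x = \<zero>\<^bsub>convergent_ring\<^esub>"
   by (intro bexI[of _ "- x"]) (auto simp: convergent_series_uminus)
 qed (auto simp: convergent_series_add convergent_series_0 add_ac)
 show "Group.comm_monoid (convergent_ring :: 'k fps fps ring)"
  by (rule comm_monoidI) (auto simp: convergent_series_mult convergent_series_1 mult_ac)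
qed (auto simp: algebra_simps)

lemma a_r_coset_convergent: "J +>\<^bsub>convergent_ring\<^esub> a = {j + a | j. j \<in> J}"
 by (auto simp: a_r_coset_def')

text \<open>Each step of the chain adjoins one line modulo J, which is one \<open>Suc_dim\<close>
  step over the field of constants; the chain starts at J, the zero coset.\<close>

lemma dimension_quotient:
 fixes J :: "'k :: {real_normed_field, euclidean_space} fps fps set"
 assumes J: "ideal J convergent_ring" and dim: "fs.rel_dim J W n" and W: "W \<subseteq> CS"
 shows "ring.dimension (convergent_ring Quot J) n
   ((%a. J +>\<^bsub>convergent_ring\<^esub> fps_const (fps_const a)) ` UNIV) ((%a. J +>\<^bsub>convergent_ring\<^esub> a) ` W)"
proof -
 interpret J: ideal J "convergent_ring :: 'k fps fps ring" by (rule J)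
 let ?Q = "convergent_ring Quot J"
 interpret Q: ring ?Q by (rule J.quotient_is_ring)
 define cs where "cs = (%a. J +>\<^bsub>convergent_ring\<^esub> a)"
 have sub: "fs.subspace J" using fs.rel_dim_subspace[OF dim] by blast
 have JC: "J \<subseteq> CS" using fs.rel_dim_subspace[OF dim] W by blast
 have cs: "cs a = {j + a | j. j \<in> J}" for a unfolding cs_def a_r_coset_convergent ..
 have cs_eq: "cs a = cs b \<longleftrightarrow> a - b \<in> J" for a b
 proof
  assume "cs a = cs b"
  moreover have "0 + a \<in> cs a" unfolding cs using fs.subspace_0[OF sub] by blast
  ultimately obtain j where "a = j + b" "j \<in> J" unfolding cs by auto
  then show "a - b \<in> J" by simp
 next
  assume ab: "a - b \<in> J"
  show "cs a = cs b"
  proof (intro equalityI subsetI)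
   fix x assume "x \<in> cs a"
   then obtain j where "x = j + a" "j \<in> J" unfolding cs by blast
   then have "x = (j + (a - b)) + b" "j + (a - b) \<in> J" using fs.subspace_add[OF sub _ ab] by auto
   then show "x \<in> cs b" unfolding cs by blast
  next
   fix x assume "x \<in> cs b"
   then obtain j where "x = j + b" "j \<in> J" unfolding cs by blast
   then have "x = (j - (a - b)) + a" "j - (a - b) \<in> J" using fs.subspace_diff[OF sub _ ab] by auto
   then show "x \<in> cs a" unfolding cs by blast
  qed
 qed
 have carr: "cs a \<in> carrier ?Q" if "convergent_series a" for a
  using that unfolding FactRing_def A_RCOSETS_def' cs_def by auto
 have mult: "cs a \<otimes>\<^bsub>?Q\<^esub> cs b = cs (a * b)" if "convergent_series a" "convergent_series b" for a b
  using J.rcoset_mult_add[of a b] that unfolding FactRing_def cs_def by simp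
 have add: "cs a \<oplus>\<^bsub>?Q\<^esub> cs b = cs (a + b)" if "convergent_series a" "convergent_series b" for a b
  using J.a_rcos_sum[of a b] that unfolding FactRing_def cs_def by simp
 have zero: "\<zero>\<^bsub>?Q\<^esub> = J" unfolding FactRing_def by simp
 let ?K = "(%a. cs (fps_const (fps_const a))) ` UNIV"
 have "W \<subseteq> CS ==> Q.dimension n ?K (cs ` W)"
  using dim
 proof (induction rule: fs.rel_dim.induct)
  case rel_dim_0
  have "cs 0 = J" unfolding cs by simp
  have "cs ` J = {\<zero>\<^bsub>?Q\<^esub>}"
  proof -
   have "cs a = J" if "a \<in> J" for a
   proof -
    have "cs a = cs 0" unfolding cs_eq using that by simp
    then show ?thesis using \<open>cs 0 = J\<close> by simp
   qed
   then show ?thesis unfolding zero using fs.subspace_0[OF sub] by auto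
  qed
  then show ?case by simp
 next
  case (rel_dim_Suc W n v)
  note subW = fs.rel_dim_subspace[OF rel_dim_Suc(1)]
  have WL: "W \<subseteq> fs.line_sum W v" and vL: "v \<in> fs.line_sum W v"
  proof -
   show "W \<subseteq> fs.line_sum W v" by (auto simp: fs.line_sum_iff intro!: exI[of _ 0])
   have "v - fscale 1 v \<in> W" using subW fs.subspace_0[of W] by simp
   then show "v \<in> fs.line_sum W v" unfolding fs.line_sum_iff by blast
  qed
  have conv: "convergent_series v" "\<And>w. w \<in> W ==> convergent_series w" using rel_dim_Suc(4) WL vL by auto
  have IH: "Q.dimension n ?K (cs ` W)" using rel_dim_Suc WL by blast
  have notin: "cs v \<notin> cs ` W"
  proof
   assume "cs v \<in> cs ` W"
   then obtain w where w: "w \<in> W" "cs v = cs w" by blast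
   then have "v - w \<in> W" using cs_eq subW by blast
   then have "(v - w) + w \<in> W" using w(1) subW fs.subspace_add by blast
   then show False using rel_dim_Suc(2) by simp
  qed
  have "Q.line_extension ?K (cs v) (cs ` W) = cs ` fs.line_sum W v"
  proof (intro equalityI subsetI)
   fix u assume "u \<in> Q.line_extension ?K (cs v) (cs ` W)"
   then obtain k w where u: "u = cs (fps_const (fps_const k)) \<otimes>\<^bsub>?Q\<^esub> cs v \<oplus>\<^bsub>?Q\<^esub> cs w" "w \<in> W"
    unfolding Q.line_extension_mem_iff by blast
   have "u = cs (w + fscale k v)" unfolding u(1) fscale_def using conv u(2)
    by (simp add: mult add convergent_series_const convergent_series_mult add.commute)
   then show "u \<in> cs ` fs.line_sum W v" unfolding fs.line_sum_def using u(2) by blast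
  next
   fix u assume "u \<in> cs ` fs.line_sum W v"
   then obtain k w where u: "u = cs (w + fscale k v)" "w \<in> W" unfolding fs.line_sum_def by blast
   have "u = cs (fps_const (fps_const k)) \<otimes>\<^bsub>?Q\<^esub> cs v \<oplus>\<^bsub>?Q\<^esub> cs w" unfolding u(1) fscale_def using conv u(2)
    by (simp add: mult add convergent_series_const convergent_series_mult add.commute)
   then show "u \<in> Q.line_extension ?K (cs v) (cs ` W)" unfolding Q.line_extension_mem_iff using u(2) by blast
  qed
  then show ?case using Q.Suc_dim[OF carr[OF conv(1)] notin IH] by simp
 qed
 with W show ?thesis unfolding cs_def by blast
qed

context newton_milnor
begin

lemma jacobian_ideal_eq: "jacobian_ideal c = J" and ideal_J: "ideal J convergent_ring"
proof -
 interpret R: cring "convergent_ring :: 'k fps fps ring" by (rule cring_convergent_ring)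
 have JC: "J \<subseteq> CS" unfolding J_def by (auto intro!: convergent_series_add convergent_series_mult conv_Gx conv_Gy)
 have mult: "x * a \<in> J" if "a \<in> J" "convergent_series x" for a x
 proof -
  obtain u v where a: "a = u * Gx + v * Gy" "convergent_series u" "convergent_series v" using \<open>a \<in> J\<close> unfolding J_def by blast
  have "x * a = (x * u) * Gx + (x * v) * Gy" unfolding a(1) by (simp add: algebra_simps)
  then show ?thesis unfolding J_def using a that(2) convergent_series_mult by blast
 qed
 have add: "a + b \<in> J" if abJ: "a \<in> J" "b \<in> J" for a b
 proof -
  obtain u v u' v' where ab: "a = u * Gx + v * Gy" "convergent_series u" "convergent_series v"
   "b = u' * Gx + v' * Gy" "convergent_series u'" "convergent_series v'" using abJ unfolding J_def by blast
  have "a + b = (u + u') * Gx + (v + v') * Gy" unfolding ab(1,4) by (simp add: algebra_simps)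
  then show ?thesis unfolding J_def using ab convergent_series_add by blast
 qed
 show idJ: "ideal J convergent_ring"
 proof (rule idealI)
  show "ring (convergent_ring :: 'k fps fps ring)" by (rule R.ring_axioms)
  show "subgroup J (add_monoid convergent_ring)"
  proof (rule group.subgroupI)
   show "group (add_monoid (convergent_ring :: 'k fps fps ring))" by (rule R.add.group_axioms)
   show "J \<subseteq> carrier (add_monoid convergent_ring)" using JC by simp
   have "0 * Gx + 0 * Gy \<in> J" unfolding J_def using convergent_series_0 by blast
   then show "J ~= {}" by blast
   show "inv\<^bsub>add_monoid convergent_ring\<^esub> a \<in> J" if "a \<in> J" for a
   proof -
    have "- 1 * a \<in> J" using mult[OF that, of "- 1"] convergent_series_uminus[OF convergent_series_1] by simp
    moreover have "inv\<^bsub>add_monoid convergent_ring\<^esub> a = - 1 * a"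
     using JC that calculation group.inv_equality[OF R.add.group_axioms, of "- 1 * a" a] by auto
    ultimately show ?thesis by simp
   qed
   show "a \<otimes>\<^bsub>add_monoid convergent_ring\<^esub> b \<in> J" if "a \<in> J" "b \<in> J" for a b using add[OF that] by simp
  qed
  show "x \<otimes>\<^bsub>convergent_ring\<^esub> a \<in> J" "a \<otimes>\<^bsub>convergent_ring\<^esub> x \<in> J" if "a \<in> J" "x \<in> carrier convergent_ring" for a x
   using mult[of a x] that by (simp_all add: mult.commute)
 qed
 have GxJ: "Gx \<in> J" "Gy \<in> J"
 proof -
  have "Gx = 1 * Gx + 0 * Gy" "Gy = 0 * Gx + 1 * Gy" by simp_all
  then show "Gx \<in> J" "Gy \<in> J" unfolding J_def using convergent_series_0 convergent_series_1 by blast+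
 qed
 show "jacobian_ideal c = J"
  unfolding jacobian_ideal_def genideal_def Gx_def[symmetric] Gy_def[symmetric]
 proof (intro equalityI Inter_greatest Inter_lower)
  show "J \<in> {I. ideal I convergent_ring \<and> {Gx, Gy} \<subseteq> I}" using idJ GxJ by blast
  fix I assume "I \<in> {I. ideal I convergent_ring \<and> {Gx, Gy} \<subseteq> I}"
  then have I: "ideal I convergent_ring" "Gx \<in> I" "Gy \<in> I" by auto
  interpret I: ideal I "convergent_ring :: 'k fps fps ring" by (rule I(1))
  show "J \<subseteq> I"
  proof
   fix w assume "w \<in> J"
   then obtain u v where w: "w = u * Gx + v * Gy" "convergent_series u" "convergent_series v" unfolding J_def by blast
   have "u * Gx \<in> I" "v * Gy \<in> I" using I.I_l_closed[OF I(2), of u] I.I_l_closed[OF I(3), of v] w by auto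
   then show "w \<in> I" unfolding w(1) using I.a_closed by simp
  qed
 qed
qed

lemma milnor_number: "has_milnor_number c (M - (x_intercept c + y_intercept c - 1))"
proof -
 have "carrier (convergent_ring Quot J) = (%a. J +>\<^bsub>convergent_ring\<^esub> a) ` CS"
  unfolding FactRing_def A_RCOSETS_def' by auto
 then show ?thesis unfolding has_milnor_number_def jacobian_ideal_eq
  using dimension_quotient[OF ideal_J rel_dim_J(2) subset_refl] by simp
qed

end

section \<open>From edges back to segments, and the curve count\<close>

lemma has_power_series_at_origin:
 fixes G :: "'k :: {real_normed_field, euclidean_space} \<times> 'k => 'k"
 assumes "has_power_series_at_0 G c"
 shows "G (0, 0) = c 0 0"
proof -
 let ?f = "%(\<alpha>, \<beta>). c \<alpha> \<beta> * 0 ^ \<alpha> * 0 ^ \<beta>"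
 have "(?f has_sum G (0, 0)) UNIV"
  using eventually_nhds_x_imp_x[OF assms[unfolded has_power_series_at_0_def]] by simp
 moreover have "(?f has_sum G (0, 0)) UNIV \<longleftrightarrow> (?f has_sum G (0, 0)) {(0, 0)}"
  by (rule has_sum_cong_neutral) (auto simp: power_0_left split: if_splits)
 moreover have "(?f has_sum (\<Sum>x\<in>{(0, 0)}. ?f x)) {(0, 0)}" by (rule has_sum_finite) simp
 ultimately have "G (0, 0) = (\<Sum>x\<in>{(0, 0)}. ?f x)" using has_sum_unique by blast
 then show ?thesis by simp
qed

definition edge_segment :: "edge => (real ^ 2) set" where
 "edge_segment e = closed_segment (lattice_point (fst (fst e)) (snd (fst e))) (lattice_point (fst (snd e)) (snd (snd e)))"

lemma newton_edgesE:
 assumes "e \<in> newton_edges c"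
 obtains a1 b1 a2 b2 where "e = ((a1, b1), (a2, b2))"
  "newton_edge_locale c a1 b1 a2 b2 (edge_r e) (edge_n e) (edge_m e) (edge_N e) e"
 using assms unfolding newton_edges_def newton_edge_locale_def by blast

lemma endpoints_edge_segment:
 assumes "e \<in> newton_edges c" shows "endpoints (edge_segment e) = e"
proof -
 obtain a1 b1 a2 b2 where e: "e = ((a1, b1), (a2, b2))" and L: "newton_edge c a1 b1 a2 b2"
  using assms unfolding newton_edges_def by blast
 show ?thesis using endpoints_closed_segment[OF newton_edge_basic(3,4)[OF L]] by (simp add: edge_segment_def e)
qed

lemma newton_segments_edges:
 assumes "convenient c" shows "bij_betw edge_segment (newton_edges c) (newton_segments c)"
 unfolding bij_betw_def
proof
 show "inj_on edge_segment (newton_edges c)" by (rule inj_on_inverseI) (rule endpoints_edge_segment)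
 show "edge_segment ` newton_edges c = newton_segments c"
  unfolding newton_segments_eq[OF assms] newton_edges_def edge_segment_def by force
qed

lemma seg_edge:
 assumes "e \<in> newton_edges c"
 shows "seg_r (edge_segment e) = edge_r e" "seg_n (edge_segment e) = edge_n e" "seg_m (edge_segment e) = edge_m e"
  "seg_N (edge_segment e) = edge_N e"
  "left_\<alpha> (edge_segment e) = fst (fst e)" "left_\<beta> (edge_segment e) = snd (fst e)"
  "right_\<alpha> (edge_segment e) = fst (snd e)" "right_\<beta> (edge_segment e) = snd (snd e)"
 by (simp_all add: seg_r_def seg_n_def seg_m_def seg_N_def seg_p_def seg_q_def left_\<alpha>_def left_\<beta>_def
   right_\<alpha>_def right_\<beta>_def endpoints_edge_segment[OF assms] edge_r_def edge_n_def edge_m_def edge_N_def edge_wt_def)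

lemma seg_poly_edge:
 fixes c :: "nat => nat => 'k::field"
 assumes "e \<in> newton_edges c"
 shows "seg_poly c (edge_segment e) = homog (edge_r e) (edge_poly c e)"
proof -
 obtain a1 b1 a2 b2 where e: "e = ((a1, b1), (a2, b2))"
  and L: "newton_edge_locale c a1 b1 a2 b2 (edge_r e) (edge_n e) (edge_m e) (edge_N e) e"
  using newton_edgesE[OF assms] .
 have f: "fst (fst e) = a1" "snd (fst e) = b1" by (simp_all add: e)
 show ?thesis unfolding seg_poly_def homog_def seg_edge[OF assms] f atLeast0AtMost
  by (intro sum.cong refl) (simp add: newton_edge_poly(1)[OF L])
qed

text \<open>Triangles at the origin are measured by determinants: r N for the two endpoints and N
  for neighbouring points.\<close>

lemma edge_areas:
 assumes "e \<in> newton_edges c"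
 shows "2 * segment_area (edge_segment e) = real (edge_r e * edge_N e)"
  and "l < edge_r e ==> 2 * elementary_area (edge_segment e) l = real (edge_N e)"
  and "max (seg_p (edge_segment e)) (seg_q (edge_segment e)) = edge_r e * max (edge_m e) (edge_n e)"
  and "max (edge_m e) (edge_n e) <= edge_N e"
proof -
 obtain a1 b1 a2 b2 where e: "e = ((a1, b1), (a2, b2))"
  and L: "newton_edge_locale c a1 b1 a2 b2 (edge_r e) (edge_n e) (edge_m e) (edge_N e) e"
  using newton_edgesE[OF assms] .
 define r n m N where "r = edge_r e" and "n = edge_n e" and "m = edge_m e" and "N = edge_N e"
 interpret newton_edge_locale c a1 b1 a2 b2 r n m N e using L unfolding r_def n_def m_def N_def .
 have f: "fst (fst e) = a1" "snd (fst e) = b1" "fst (snd e) = a2" "snd (snd e) = b2" by (simp_all add: e)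
 have tri: "2 * measure lborel (convex hull {0, lattice_point x y, lattice_point x' y'}) = \<bar>real x' * real y - real x * real y'\<bar>" for x y x' y'
  using content_triangle[of 0 "lattice_point x y" "lattice_point x' y'"] by (simp add: lattice_point_def)
 have "real a2 * real b1 - real a1 * real b2 = real (r * N)"
  unfolding a2 N(1) using arg_cong[OF b1, of real] by (simp add: algebra_simps)
 then show "2 * segment_area (edge_segment e) = real (edge_r e * edge_N e)"
  unfolding segment_area_def seg_edge[OF assms] f tri r_def N_def by simp
 show "2 * elementary_area (edge_segment e) l = real (edge_N e)" if l: "l < edge_r e"
 proof -
  have "l * n + n <= r * n" using l mult_le_mono1[of "Suc l" r n] by (simp add: r_def)
  then have "l * n + n <= b1" using b1 by linarith
  then obtain y where y: "b1 = l * n + n + y" using le_iff_add by blast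
  have "real (a1 + Suc l * m) * real (b1 - l * n) - real (a1 + l * m) * real (b1 - Suc l * n) = real N"
  proof -
   have "b1 - l * n = n + y" "b1 - Suc l * n = y" using y by simp_all
   moreover have "real N = real n * real a1 + real m * (real l * real n + real n + real y)" unfolding N(1) y by simp
   ultimately show ?thesis by (simp add: algebra_simps)
  qed
  then show ?thesis
   unfolding elementary_area_def point_on_segment_def seg_edge[OF assms] f tri n_def[symmetric] m_def[symmetric] N_def[symmetric]
   by simp
 qed
 have "seg_p (edge_segment e) = r * n" "seg_q (edge_segment e) = r * m"
  unfolding seg_p_def seg_q_def seg_edge[OF assms] f using a2 b1 by simp_all
 then show "max (seg_p (edge_segment e)) (seg_q (edge_segment e)) = edge_r e * max (edge_m e) (edge_n e)"
  by (simp add: r_def n_def m_def nat_mult_max_right max.commute)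
 have "0 < a2" "0 < b1" using pos a2 b1 by simp_all
 then have "n <= n * a2" "m <= m * b1" by simp_all
 then have "n <= N" "m <= N" using N by linarith+
 then show "max (edge_m e) (edge_n e) <= edge_N e" unfolding n_def m_def N_def by simp
qed

text \<open>Curves sorted by the root t of the edge polynomial; a linear factor with coefficients a
  and b has root - b / a.\<close>

definition root_curves ::
  "('k :: {real_normed_field, euclidean_space} \<times> 'k => 'k) => edge => 'k => ('k fps \<times> 'k fps) set" where
 "root_curves G e t = {z. solution_curve G z \<and> (\<exists>v w. v ~= 0 \<and> w ~= 0 \<and> v ^ edge_m e = t * w ^ edge_n e \<and>
   weighted_curve (edge_n e) (edge_m e) v w z)}"

locale newton_germ = newton_polygon c
 for c :: "nat => nat => 'k :: {real_normed_field, euclidean_space}" +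
 fixes G :: "'k \<times> 'k => 'k"
 assumes G: "has_power_series_at_0 G c"
begin

text \<open>Two pairs (v, w) belonging to the same root differ by factors s^n and s^m with a common
  s, by coprimality. Rescaling the parameter by s turns one curve into the unique curve of the other
  pair, so all of them have one orbit.\<close>

lemma simple_root_curves:
 assumes e: "e \<in> newton_edges c" and root: "poly (edge_poly c e) t = 0" and simple: "poly (pderiv (edge_poly c e)) t ~= 0"
 shows "v ~= 0 ==> w ~= 0 ==> v ^ edge_m e = t * w ^ edge_n e ==> \<exists>z. solution_curve G z \<and> weighted_curve (edge_n e) (edge_m e) v w z"
  and "z \<in> root_curves G e t ==> has_minimal_regularity_degree G z (edge_N e - max (edge_m e) (edge_n e))"
  and "z \<in> root_curves G e t ==> z' \<in> root_curves G e t ==> (z, z') \<in> same_orbit"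
  and "root_curves G e t ~= {}"
  and "t ~= 0"
proof -
 obtain a1 b1 a2 b2 where L: "newton_edge_locale c a1 b1 a2 b2 (edge_r e) (edge_n e) (edge_m e) (edge_N e) e"
  using newton_edgesE[OF e] by metis
 define n m N where "n = edge_n e" and "m = edge_m e" and "N = edge_N e"
 interpret E: newton_edge_locale c a1 b1 a2 b2 "edge_r e" n m N e using L unfolding n_def m_def N_def .
 have supp: "\<And>\<alpha> \<beta>. c \<alpha> \<beta> ~= 0 ==> N <= n * \<alpha> + m * \<beta>" by (rule E.support_ge)
 have nm: "n <= N" "m <= N" using edge_areas(4)[OF e] by (simp_all add: n_def m_def N_def)
 have form: "edge_form n m N c v w = 0" "edge_form n m N (%\<alpha> \<beta>. of_nat \<alpha> * c \<alpha> \<beta>) v w ~= 0"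
   "edge_form n m N (%\<alpha> \<beta>. of_nat \<beta> * c \<alpha> \<beta>) v w ~= 0" if "v ~= 0" "w ~= 0" "v ^ m = t * w ^ n" for v w
 proof -
  have "v ^ m / w ^ n = t" using that by simp
  then show "edge_form n m N c v w = 0" "edge_form n m N (%\<alpha> \<beta>. of_nat \<alpha> * c \<alpha> \<beta>) v w ~= 0"
   "edge_form n m N (%\<alpha> \<beta>. of_nat \<beta> * c \<alpha> \<beta>) v w ~= 0"
   using newton_edge_form_root[OF E.newton_edge_locale_axioms that(1,2)] root simple by simp_all
 qed
 have ex: "\<exists>z. solution_curve G z \<and> weighted_curve n m v w z" if vw: "v ~= 0" "w ~= 0" "v ^ m = t * w ^ n" for v w
 proof -
  obtain z where z: "weighted_curve n m v w z" "fps_conv_radius (fst z) > 0" "fps_conv_radius (snd z) > 0" "subst2 c (fst z) (snd z) = 0"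
   using edge_form_zero_curve(2)[OF E.pos(2,3) supp form[OF vw] has_power_series_imp_convergent[OF G]] by blast
  obtain V W where "z = (fps_X ^ n * V, fps_X ^ m * W)" using z(1) by (rule weighted_curveE)
  then have "fps_nth (fst z) 0 = 0" "fps_nth (snd z) 0 = 0" using E.pos by simp_all
  then show ?thesis using z solution_curve_iff[OF G] by blast
 qed
 then show "v ~= 0 ==> w ~= 0 ==> v ^ edge_m e = t * w ^ edge_n e ==> \<exists>z. solution_curve G z \<and> weighted_curve (edge_n e) (edge_m e) v w z"
  unfolding n_def m_def .
 show t0: "t ~= 0" using newton_edge_poly(3)[OF L] root by auto
 show "root_curves G e t ~= {}"
 proof -
  obtain v w where vw: "v ~= 0" "w ~= 0" "v ^ m = t * w ^ n" using coprime_power_solution[OF t0 E.coprime] by blast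
  then show ?thesis using ex[OF vw] unfolding root_curves_def n_def m_def by blast
 qed
 have curve: "\<exists>v w. v ~= 0 \<and> w ~= 0 \<and> v ^ m = t * w ^ n \<and> weighted_curve n m v w z \<and> fps_conv_radius (fst z) > 0 \<and> fps_conv_radius (snd z) > 0 \<and> subst2 c (fst z) (snd z) = 0"
  if "z \<in> root_curves G e t" for z
  using that unfolding root_curves_def n_def m_def solution_curve_iff[OF G] by blast
 show "has_minimal_regularity_degree G z (edge_N e - max (edge_m e) (edge_n e))" if zr: "z \<in> root_curves G e t"
 proof -
  obtain v w where vw: "v ~= 0" "w ~= 0" "v ^ m = t * w ^ n"
   and z: "weighted_curve n m v w z" "fps_conv_radius (fst z) > 0" "fps_conv_radius (snd z) > 0"
   using curve[OF zr] by blast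
  show ?thesis using weighted_curve_regularity[OF G E.pos(2,3) nm supp form(2,3)[OF vw] z]
   unfolding n_def m_def N_def by (simp add: max.commute)
 qed
 show "(z, z') \<in> same_orbit" if zz: "z \<in> root_curves G e t" "z' \<in> root_curves G e t"
 proof -
  obtain v w where vw: "v ~= 0" "w ~= 0" "v ^ m = t * w ^ n"
   and z: "weighted_curve n m v w z" "subst2 c (fst z) (snd z) = 0"
   using curve[OF zz(1)] by blast
  obtain v' w' where vw': "v' ~= 0" "w' ~= 0" "v' ^ m = t * w' ^ n"
   and z': "weighted_curve n m v' w' z'" "subst2 c (fst z') (snd z') = 0"
   using curve[OF zz(2)] by blast
  have "(v' / v) ^ m = (w' / w) ^ n" using vw vw' t0 by (simp add: power_divide)
  moreover have "v' / v ~= 0" "w' / w ~= 0" using vw vw' by simp_all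
  ultimately obtain s where s: "s ~= 0" "v' / v = s ^ n" "w' / w = s ^ m" using coprime_power_scale[OF _ _ _ E.coprime] by blast
  have v': "s ^ n * v = v'" and w': "s ^ m * w = w'" using s(2,3)[symmetric] vw by simp_all
  let ?L = "fps_const s * fps_X :: 'k fps"
  let ?z = "(fst z oo ?L, snd z oo ?L)"
  have "subst2 c (fst ?z) (snd ?z) = 0"
   unfolding fst_conv snd_conv subst2_compose_linear z(2) by (rule fps_ext) (simp only: fps_compose_linear, simp)
  moreover have "weighted_curve n m v' w' ?z" using weighted_curve_rescale[OF z(1), of s] unfolding v' w' .
  ultimately have "?z = z'"
   using edge_form_zero_curve(1)[OF E.pos(2,3) supp form[OF vw'], of ?z z'] z' by blast
  then show ?thesis using same_orbit_rescale[OF s(1), of z] by simp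
 qed
qed

text \<open>The orbit determines the slope n / m of the edge, and parallel edges coincide; it also
  determines the limit v^m / w^n, which is t.\<close>

lemma root_curves_orbit:
 assumes e: "e \<in> newton_edges c" "e' \<in> newton_edges c"
  and root: "poly (edge_poly c e) t = 0" "poly (pderiv (edge_poly c e)) t ~= 0"
  and z: "z \<in> root_curves G e t" "z' \<in> root_curves G e' t'"
 shows "(z, z') \<in> same_orbit \<longleftrightarrow> e = e' \<and> t = t'"
proof
 assume "e = e' \<and> t = t'"
 then show "(z, z') \<in> same_orbit" using simple_root_curves(3)[OF e(1) root] z by blast
next
 assume orb: "(z, z') \<in> same_orbit"
 obtain a1 b1 a2 b2 where e1: "e = ((a1, b1), (a2, b2))" and L: "newton_edge_locale c a1 b1 a2 b2 (edge_r e) (edge_n e) (edge_m e) (edge_N e) e"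
  using newton_edgesE[OF e(1)] .
 obtain a1' b1' a2' b2' where e1': "e' = ((a1', b1'), (a2', b2'))" and L': "newton_edge_locale c a1' b1' a2' b2' (edge_r e') (edge_n e') (edge_m e') (edge_N e') e'"
  using newton_edgesE[OF e(2)] .
 define r n m where "r = edge_r e" and "n = edge_n e" and "m = edge_m e"
 define r' n' m' where "r' = edge_r e'" and "n' = edge_n e'" and "m' = edge_m e'"
 interpret E: newton_edge_locale c a1 b1 a2 b2 r n m "edge_N e" e using L unfolding r_def n_def m_def .
 interpret E': newton_edge_locale c a1' b1' a2' b2' r' n' m' "edge_N e'" e' using L' unfolding r'_def n'_def m'_def .
 obtain v w where vw: "v ~= 0" "w ~= 0" "v ^ m = t * w ^ n"
  and zc: "weighted_curve n m v w z" "fps_conv_radius (fst z) > 0" "fps_conv_radius (snd z) > 0"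
  using z(1) unfolding root_curves_def solution_curve_def n_def m_def by blast
 obtain v' w' where vw': "v' ~= 0" "w' ~= 0" "v' ^ m' = t' * w' ^ n'"
  and zc': "weighted_curve n' m' v' w' z'" "fps_conv_radius (fst z') > 0" "fps_conv_radius (snd z') > 0"
  using z(2) unfolding root_curves_def solution_curve_def n'_def m'_def by blast
 have eq: "m' * n = n' * m" and quot: "v ^ m / w ^ n = v' ^ m / w' ^ n"
  using same_orbit_weighted_curves[OF zc vw(1,2) zc' vw'(1,2) E.pos(2,3) E'.pos(2,3) orb] by blast+
 have int1: "int b1 - int b2 = int r * int n" "int a2 - int a1 = int r * int m" unfolding E.b1 E.a2 by simp_all
 have int2: "int b1' - int b2' = int r' * int n'" "int a2' - int a1' = int r' * int m'" unfolding E'.b1 E'.a2 by simp_all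
 have "int m' * int n = int n' * int m" using eq by (metis of_nat_mult)
 then have "(int b1 - int b2) * (int a2' - int a1') = (int b1' - int b2') * (int a2 - int a1)"
  unfolding int1 int2 by (simp add: mult_ac)
 from edge_eq_if_parallel[OF E.edge E'.edge this] have ee: "e = e'" unfolding e1 e1' by simp
 then have "n' = n" "m' = m" unfolding n_def n'_def m_def m'_def by simp_all
 then have "t = t'" using quot vw vw' by simp
 then show "e = e' \<and> t = t'" using ee by simp
qed

lemma linear_factor_root:
 assumes e: "e \<in> newton_edges c" and a: "a ~= 0" and s: "simple_linear_factor a b (seg_poly c (edge_segment e))"
 shows "poly (edge_poly c e) (- b / a) = 0" "poly (pderiv (edge_poly c e)) (- b / a) ~= 0"
proof -
 obtain a1 b1 a2 b2 where L: "newton_edge_locale c a1 b1 a2 b2 (edge_r e) (edge_n e) (edge_m e) (edge_N e) e"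
  using newton_edgesE[OF e] by metis
 note newton_edge_poly(2)[OF L] newton_edge_locale.pos(1)[OF L]
 from simple_linear_factor_homog[OF this a s[unfolded seg_poly_edge[OF e]]]
 show "poly (edge_poly c e) (- b / a) = 0" "poly (pderiv (edge_poly c e)) (- b / a) ~= 0" .
qed

lemma linear_factor_solution: "a ~= 0 ==> a * V + b * W = 0 \<longleftrightarrow> V = - b / a * W" for a b V W :: 'k
proof -
 assume a: "a ~= 0"
 have "V = - b / a * W \<longleftrightarrow> V = (- (b * W)) / a" by simp
 also have "\<dots> \<longleftrightarrow> V * a + b * W = 0" unfolding nonzero_eq_divide_eq[OF a] eq_neg_iff_add_eq_0 ..
 finally show "a * V + b * W = 0 \<longleftrightarrow> V = - b / a * W" by (simp only: mult.commute[of V a])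
qed

lemma split_roots:
 assumes e: "e \<in> newton_edges c" and s: "splits_simply (seg_poly c (edge_segment e))"
 shows "poly (edge_poly c e) t = 0 ==> \<exists>a b. a ~= 0 \<and> b ~= 0 \<and> t = - b / a \<and> simple_linear_factor a b (seg_poly c (edge_segment e))"
  and "poly (edge_poly c e) t = 0 ==> poly (pderiv (edge_poly c e)) t ~= 0"
  and "card {t. poly (edge_poly c e) t = 0} = edge_r e"
proof -
 obtain a1 b1 a2 b2 where L: "newton_edge_locale c a1 b1 a2 b2 (edge_r e) (edge_n e) (edge_m e) (edge_N e) e"
  using newton_edgesE[OF e] by metis
 note H = splits_simply_homog[OF newton_edge_poly(2)[OF L] newton_edge_locale.pos(1)[OF L] newton_edge_poly(3)[OF L] s[unfolded seg_poly_edge[OF e]]]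
 show "poly (edge_poly c e) t = 0 ==> \<exists>a b. a ~= 0 \<and> b ~= 0 \<and> t = - b / a \<and> simple_linear_factor a b (seg_poly c (edge_segment e))"
  unfolding seg_poly_edge[OF e] by (rule H(1))
 show "poly (edge_poly c e) t = 0 ==> poly (pderiv (edge_poly c e)) t ~= 0" by (rule H(2))
 show "card {t. poly (edge_poly c e) t = 0} = edge_r e" by (rule H(3))
qed

text \<open>A linear factor gives a root, and conversely the splitting provides for every root a
  factor with both coefficients nonzero.\<close>

lemma segment_curves_eq:
 assumes e: "e \<in> newton_edges c" and s: "splits_simply (seg_poly c (edge_segment e))"
 shows "segment_curves G c (edge_segment e) = (\<Union>t\<in>{t. poly (edge_poly c e) t = 0}. root_curves G e t)"
proof -
 have lf: "leading_form (edge_segment e) v w z \<longleftrightarrow> weighted_curve (edge_n e) (edge_m e) v w z" if "solution_curve G z" for v w z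
  using leading_form_iff[of z "edge_segment e" v w] that unfolding solution_curve_def seg_edge[OF e] by blast
 show ?thesis
 proof (intro equalityI subsetI)
  fix z assume "z \<in> segment_curves G c (edge_segment e)"
  then obtain a b v w where z: "solution_curve G z" "a ~= 0" "simple_linear_factor a b (seg_poly c (edge_segment e))"
   "v ~= 0" "w ~= 0" "a * v ^ edge_m e + b * w ^ edge_n e = 0" "leading_form (edge_segment e) v w z"
   unfolding segment_curves_def seg_edge[OF e] by blast
  have "z \<in> root_curves G e (- b / a)"
   unfolding root_curves_def mem_Collect_eq
   by (rule conjI[OF z(1)], rule exI[of _ v], rule exI[of _ w],
     intro conjI z(4,5) iffD1[OF linear_factor_solution[OF z(2)] z(6)] iffD1[OF lf[OF z(1)] z(7)])
  then show "z \<in> (\<Union>t\<in>{t. poly (edge_poly c e) t = 0}. root_curves G e t)"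
   using linear_factor_root(1)[OF e z(2,3)] by blast
 next
  fix z assume "z \<in> (\<Union>t\<in>{t. poly (edge_poly c e) t = 0}. root_curves G e t)"
  then obtain t v w where t: "poly (edge_poly c e) t = 0"
   and z: "solution_curve G z" "v ~= 0" "w ~= 0" "v ^ edge_m e = t * w ^ edge_n e" "weighted_curve (edge_n e) (edge_m e) v w z"
   unfolding root_curves_def by blast
  obtain a b where ab: "a ~= 0" "b ~= 0" "t = - b / a" "simple_linear_factor a b (seg_poly c (edge_segment e))"
   using split_roots(1)[OF e s t] by blast
  have S: "a * v ^ edge_m e + b * w ^ edge_n e = 0" by (rule iffD2[OF linear_factor_solution[OF ab(1)] z(4)[unfolded ab(3)]])
  show "z \<in> segment_curves G c (edge_segment e)"
   unfolding segment_curves_def seg_edge[OF e] mem_Collect_eq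
   by (rule conjI[OF z(1)], rule exI[of _ a], rule exI[of _ b], rule exI[of _ v], rule exI[of _ w],
     intro conjI ab(1,2,4) z(2,3) S iffD2[OF lf[OF z(1)] z(5)])
 qed
qed

text \<open>Orbit classes correspond to pairs of an edge and a root. A single edge for
  \<open>D\<close> serves the count on one segment, the set of all edges the total count.\<close>

lemma card_orbits:
 assumes D: "D \<subseteq> newton_edges c" and s: "\<And>e. e \<in> D ==> splits_simply (seg_poly c (edge_segment e))"
 shows "card ((\<Union>e\<in>D. segment_curves G c (edge_segment e)) // same_orbit) = (\<Sum>e\<in>D. edge_r e)"
proof -
 let ?R = "%e. {t. poly (edge_poly c e) t = 0}"
 let ?I = "Sigma D ?R"
 have fin: "finite D" using D finite_newton_edges finite_subset by blast
 have finR: "finite (?R e)" if eD: "e \<in> D" for e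
 proof (rule card_ge_0_finite)
  have eN: "e \<in> newton_edges c" by (rule subsetD[OF D eD])
  obtain a1 b1 a2 b2 where L: "newton_edge_locale c a1 b1 a2 b2 (edge_r e) (edge_n e) (edge_m e) (edge_N e) e"
   using newton_edgesE[OF eN] by metis
  show "0 < card (?R e)" unfolding split_roots(3)[OF eN s[OF eD]] by (rule newton_edge_locale.pos(1)[OF L])
 qed
 have seq: "segment_curves G c (edge_segment e) = (\<Union>t\<in>?R e. root_curves G e t)" if eD: "e \<in> D" for e
  by (rule segment_curves_eq[OF subsetD[OF D eD] s[OF eD]])
 have "(\<Union>e\<in>D. segment_curves G c (edge_segment e)) = (\<Union>e\<in>D. \<Union>t\<in>?R e. root_curves G e t)"
  by (rule SUP_cong[OF refl seq])
 also have "\<dots> = (\<Union>x\<in>?I. root_curves G (fst x) (snd x))"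
 proof (intro equalityI subsetI)
  fix z assume "z \<in> (\<Union>e\<in>D. \<Union>t\<in>?R e. root_curves G e t)"
  then obtain e t where "e \<in> D" "t \<in> ?R e" "z \<in> root_curves G e t" by (elim UN_E) (rule that; assumption)
  then show "z \<in> (\<Union>x\<in>?I. root_curves G (fst x) (snd x))" by (intro UN_I[of "(e, t)"]) (auto simp only: fst_conv snd_conv mem_Sigma_iff)
 next
  fix z assume "z \<in> (\<Union>x\<in>?I. root_curves G (fst x) (snd x))"
  then obtain x where "x \<in> ?I" "z \<in> root_curves G (fst x) (snd x)" by (elim UN_E) (rule that; assumption)
  then show "z \<in> (\<Union>e\<in>D. \<Union>t\<in>?R e. root_curves G e t)" by (intro UN_I[of "fst x"] UN_I[of "snd x"]) (auto simp only: mem_Sigma_iff split_paired_all fst_conv snd_conv)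
 qed
 finally have "(\<Union>e\<in>D. segment_curves G c (edge_segment e)) = (\<Union>x\<in>?I. root_curves G (fst x) (snd x))" .
 moreover have "card ((\<Union>x\<in>?I. root_curves G (fst x) (snd x)) // same_orbit) = card ?I"
 proof (rule card_quotient_family[OF equiv_same_orbit])
  fix x assume "x \<in> ?I"
  then obtain e t where x: "x = (e, t)" "e \<in> D" "poly (edge_poly c e) t = 0" by auto
  then have e: "e \<in> newton_edges c" using D by blast
  show "root_curves G (fst x) (snd x) ~= {}"
   using simple_root_curves(4)[OF e x(3) split_roots(2)[OF e s[OF x(2)] x(3)]] by (simp add: x(1))
 next
  fix x y z z' assume "x \<in> ?I" "y \<in> ?I" and z: "z \<in> root_curves G (fst x) (snd x)" "z' \<in> root_curves G (fst y) (snd y)"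
  then obtain e t e' t' where x: "x = (e, t)" "e \<in> D" "poly (edge_poly c e) t = 0" and y: "y = (e', t')" "e' \<in> D" by auto
  then have e: "e \<in> newton_edges c" "e' \<in> newton_edges c" using D by blast+
  show "(z, z') \<in> same_orbit \<longleftrightarrow> x = y"
   using root_curves_orbit[OF e x(3) split_roots(2)[OF e(1) s[OF x(2)] x(3)], of z z' t'] z by (simp add: x(1) y(1))
 qed
 moreover have "card ?I = (\<Sum>e\<in>D. card (?R e))" using fin finR by (intro card_SigmaI) auto
 moreover have "\<dots> = (\<Sum>e\<in>D. edge_r e)" by (intro sum.cong refl split_roots(3) s subsetD[OF D])
 ultimately show ?thesis by simp
qed

lemma edge_part_i:
 assumes e: "e \<in> newton_edges c" and ab: "a ~= 0" "b ~= 0" "simple_linear_factor a b (seg_poly c (edge_segment e))"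
 shows "\<exists>v w. v ~= 0 \<and> w ~= 0 \<and> a * v ^ edge_m e + b * w ^ edge_n e = 0"
  and "v ~= 0 ==> w ~= 0 ==> a * v ^ edge_m e + b * w ^ edge_n e = 0 ==>
   \<exists>z. solution_curve G z \<and> leading_form (edge_segment e) v w z \<and>
    has_minimal_regularity_degree G z (edge_N e - max (edge_m e) (edge_n e))"
proof -
 note root = linear_factor_root[OF e ab(1,3)]
 have t0: "- b / a ~= 0" using ab by simp
 obtain a1 b1 a2 b2 where L: "newton_edge_locale c a1 b1 a2 b2 (edge_r e) (edge_n e) (edge_m e) (edge_N e) e"
  using newton_edgesE[OF e] by metis
 show "\<exists>v w. v ~= 0 \<and> w ~= 0 \<and> a * v ^ edge_m e + b * w ^ edge_n e = 0"
  unfolding linear_factor_solution[OF ab(1)]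
  by (rule coprime_power_solution[OF t0 newton_edge_locale.coprime[OF L]])
 assume vw: "v ~= 0" "w ~= 0" "a * v ^ edge_m e + b * w ^ edge_n e = 0"
 note vw' = vw(3)[unfolded linear_factor_solution[OF ab(1)]]
 obtain z where z: "solution_curve G z" "weighted_curve (edge_n e) (edge_m e) v w z"
  using simple_root_curves(1)[OF e root vw(1,2) vw'] by blast
 have "z \<in> root_curves G e (- b / a)" unfolding root_curves_def mem_Collect_eq
  by (rule conjI[OF z(1)], rule exI[of _ v], rule exI[of _ w], intro conjI vw(1,2) vw' z(2))
 then have "has_minimal_regularity_degree G z (edge_N e - max (edge_m e) (edge_n e))"
  by (rule simple_root_curves(2)[OF e root])
 moreover have "leading_form (edge_segment e) v w z"
  using leading_form_iff[of z "edge_segment e" v w] z unfolding solution_curve_def seg_edge[OF e] by blast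
 ultimately show "\<exists>z. solution_curve G z \<and> leading_form (edge_segment e) v w z \<and>
    has_minimal_regularity_degree G z (edge_N e - max (edge_m e) (edge_n e))" using z(1) by blast
qed

lemma edge_regularity:
 assumes e: "e \<in> newton_edges c" and s: "splits_simply (seg_poly c (edge_segment e))" and z: "z \<in> segment_curves G c (edge_segment e)"
 shows "has_minimal_regularity_degree G z (edge_N e - max (edge_m e) (edge_n e))"
proof -
 obtain t where t: "poly (edge_poly c e) t = 0" "z \<in> root_curves G e t" using z unfolding segment_curves_eq[OF e s] by blast
 show ?thesis by (rule simple_root_curves(2)[OF e t(1) split_roots(2)[OF e s t(1)] t(2)])
qed

text \<open>The Milnor number is M minus both intercepts plus 1, and \<open>sum_edges_max\<close>
  rewrites the intercepts through the maxima and the order.\<close>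

lemma milnor_number_split:
 assumes s: "\<And>e. e \<in> newton_edges c ==> splits_simply (seg_poly c (edge_segment e))"
 shows "\<exists>\<mu>. has_milnor_number c \<mu> \<and>
  int \<mu> = (\<Sum>e\<in>newton_edges c. int (edge_r e) * (int (edge_N e) - int (max (edge_m e) (edge_n e)))) - int (series_order c) + 1"
proof -
 have A: "card {t. poly (edge_poly c e) t = 0} = edge_r e" if eN: "e \<in> newton_edges c" for e
  by (rule split_roots(3)[OF eN s[OF eN]])
 have B: "poly (pderiv (edge_poly c e)) t ~= 0" if eN: "e \<in> newton_edges c" "poly (edge_poly c e) t = 0" for e t
  by (rule split_roots(2)[OF eN(1) s[OF eN(1)] eN(2)])
 have split: "newton_split c" by (intro newton_split.intro newton_split_axioms.intro newton_polygon_axioms A B)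
 have "newton_milnor c"
  by (intro newton_milnor.intro newton_milnor_axioms.intro split has_power_series_imp_convergent[OF G])
 then interpret newton_milnor c .
 have "(\<Sum>((a1,b1),(a2,b2))\<in>newton_edges c. int (max (b1 - b2) (a2 - a1))) = (\<Sum>e\<in>newton_edges c. int (edge_r e) * int (max (edge_m e) (edge_n e)))"
 proof (intro sum.cong refl)
  fix e assume e: "e \<in> newton_edges c"
  have "(%((a1, b1), (a2, b2)). int (max (b1 - b2) (a2 - a1))) e = int (max (seg_p (edge_segment e)) (seg_q (edge_segment e)))"
   unfolding seg_p_def seg_q_def seg_edge[OF e] by (simp add: case_prod_beta)
  then show "(%((a1, b1), (a2, b2)). int (max (b1 - b2) (a2 - a1))) e = int (edge_r e) * int (max (edge_m e) (edge_n e))"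
   unfolding edge_areas(3)[OF e] by (simp only: of_nat_mult)
 qed
 then have mx: "(\<Sum>e\<in>newton_edges c. int (edge_r e) * int (max (edge_m e) (edge_n e))) + int (series_order c) = int (x_intercept c) + int (y_intercept c)"
  using sum_edges_max by simp
 have M: "int M = (\<Sum>e\<in>newton_edges c. int (edge_r e) * int (edge_N e))" unfolding M_def by simp
 have sum: "(\<Sum>e\<in>newton_edges c. int (edge_r e) * (int (edge_N e) - int (max (edge_m e) (edge_n e))))
   = int M - (\<Sum>e\<in>newton_edges c. int (edge_r e) * int (max (edge_m e) (edge_n e)))"
  unfolding M right_diff_distrib sum_subtractf ..
 \<comment> \<open>Together with \<open>rel_dim_J\<close> this makes the truncated subtractions
   exact.\<close>
 have "1 <= x_intercept c" using x_intercept(3) by simp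
 then have "int (M - (x_intercept c + y_intercept c - 1)) = int M - (int (x_intercept c) + int (y_intercept c)) + 1"
  using rel_dim_J(1) by linarith
 then have "int (M - (x_intercept c + y_intercept c - 1)) = (\<Sum>e\<in>newton_edges c. int (edge_r e) * (int (edge_N e) - int (max (edge_m e) (edge_n e)))) - int (series_order c) + 1"
  unfolding sum using mx by linarith
 then show ?thesis using milnor_number by blast
qed

end

theorem corollary4:
  fixes G :: "'k :: {real_normed_field, euclidean_space} \<times> 'k \<Rightarrow> 'k"
    and c :: "nat \<Rightarrow> nat \<Rightarrow> 'k"
    and \<tau> :: nat
    and S :: "nat \<Rightarrow> (real ^ 2) set"
  assumes "has_power_series_at_0 G c"
    and "G (0, 0) = 0"
    and "convenient c"
    and "\<tau> \<ge> 1"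
    and "bij_betw S {1..\<tau>} (newton_segments c)"
  shows
    "(\<forall>i\<in>{1..\<tau>}. \<forall>a b.
        a \<noteq> 0 \<and> b \<noteq> 0 \<and> simple_linear_factor a b (seg_poly c (S i)) \<longrightarrow>
        (\<exists>v\<^sub>0 w\<^sub>0. v\<^sub>0 \<noteq> 0 \<and> w\<^sub>0 \<noteq> 0 \<and> a * v\<^sub>0 ^ seg_m (S i) + b * w\<^sub>0 ^ seg_n (S i) = 0) \<and>
        (\<forall>v\<^sub>0 w\<^sub>0. v\<^sub>0 \<noteq> 0 \<and> w\<^sub>0 \<noteq> 0 \<and> a * v\<^sub>0 ^ seg_m (S i) + b * w\<^sub>0 ^ seg_n (S i) = 0 \<longrightarrow>
          (\<exists>z k. solution_curve G z \<and> leading_form (S i) v\<^sub>0 w\<^sub>0 z \<and>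
             has_minimal_regularity_degree G z k \<and>
             int k = int (seg_N (S i)) - int (max (seg_m (S i)) (seg_n (S i))) \<and>
             (\<forall>l<seg_r (S i).
                real k = 2 * elementary_area (S i) l - real (max (seg_m (S i)) (seg_n (S i))))))) \<and>
     (\<forall>i\<in>{1..\<tau>}. splits_simply (seg_poly c (S i)) \<longrightarrow>
        card (segment_curves G c (S i) // same_orbit) = seg_r (S i) \<and>
        (\<exists>k. (\<forall>z\<in>segment_curves G c (S i). has_minimal_regularity_degree G z k) \<and>
             int k = int (seg_N (S i)) - int (max (seg_m (S i)) (seg_n (S i))) \<and>
             real (seg_r (S i) * k) =
               2 * segment_area (S i) - real (max (seg_p (S i)) (seg_q (S i))))) \<and>
     ((\<forall>i\<in>{1..\<tau>}. splits_simply (seg_poly c (S i))) \<longrightarrow>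
        card ((\<Union>i\<in>{1..\<tau>}. segment_curves G c (S i)) // same_orbit) = (\<Sum>i=1..\<tau>. seg_r (S i)) \<and>
        (\<exists>\<mu>. has_milnor_number c \<mu> \<and>
             int \<mu> = (\<Sum>i=1..\<tau>. int (seg_r (S i)) *
                        (int (seg_N (S i)) - int (max (seg_m (S i)) (seg_n (S i)))))
                      - int (series_order c) + 1))"
proof -
 have c00: "c 0 0 = 0" using has_power_series_at_origin[OF assms(1)] assms(2) by simp
 interpret newton_germ c G by unfold_locales (rule assms(3) c00 assms(1))+
 note bij = newton_segments_edges[OF assms(3)]
 \<comment> \<open>The given enumeration of the segments, transported to the edges as pairs of
   endpoints.\<close>
 define g where "g = the_inv_into (newton_edges c) edge_segment \<circ> S"
 have "bij_betw g {1..\<tau>} (newton_edges c)"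
  unfolding g_def by (rule bij_betw_trans[OF assms(5) bij_betw_the_inv_into[OF bij]])
 note g = this
 have ge: "g i \<in> newton_edges c" if "i \<in> {1..\<tau>}" for i using g that by (rule bij_betw_apply)
 have Sg: "S i = edge_segment (g i)" if "i \<in> {1..\<tau>}" for i
  unfolding g_def o_def using bij_betw_apply[OF assms(5) that] f_the_inv_into_f_bij_betw[OF bij] by simp
 have i: "(\<exists>v\<^sub>0 w\<^sub>0. v\<^sub>0 ~= 0 \<and> w\<^sub>0 ~= 0 \<and> a * v\<^sub>0 ^ seg_m (S i) + b * w\<^sub>0 ^ seg_n (S i) = 0) \<and>
    (\<forall>v\<^sub>0 w\<^sub>0. v\<^sub>0 ~= 0 \<and> w\<^sub>0 ~= 0 \<and> a * v\<^sub>0 ^ seg_m (S i) + b * w\<^sub>0 ^ seg_n (S i) = 0 -->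
     (\<exists>z k. solution_curve G z \<and> leading_form (S i) v\<^sub>0 w\<^sub>0 z \<and>
       has_minimal_regularity_degree G z k \<and>
       int k = int (seg_N (S i)) - int (max (seg_m (S i)) (seg_n (S i))) \<and>
       (\<forall>l<seg_r (S i).
        real k = 2 * elementary_area (S i) l - real (max (seg_m (S i)) (seg_n (S i))))))"
  if it: "i \<in> {1..\<tau>}" and ab: "a ~= 0 \<and> b ~= 0 \<and> simple_linear_factor a b (seg_poly c (S i))" for i a b
  unfolding Sg[OF it] seg_edge[OF ge[OF it]]
 proof (intro conjI allI impI)
  let ?k = "edge_N (g i) - max (edge_m (g i)) (edge_n (g i))"
  have ab': "a ~= 0" "b ~= 0" "simple_linear_factor a b (seg_poly c (edge_segment (g i)))" using ab unfolding Sg[OF it] by blast+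
  show "\<exists>v\<^sub>0 w\<^sub>0. v\<^sub>0 ~= 0 \<and> w\<^sub>0 ~= 0 \<and> a * v\<^sub>0 ^ edge_m (g i) + b * w\<^sub>0 ^ edge_n (g i) = 0"
   by (rule edge_part_i(1)[OF ge[OF it] ab'])
  fix v\<^sub>0 w\<^sub>0 assume P: "v\<^sub>0 ~= 0 \<and> w\<^sub>0 ~= 0 \<and> a * v\<^sub>0 ^ edge_m (g i) + b * w\<^sub>0 ^ edge_n (g i) = 0"
  note vw = conjunct1[OF P] conjunct1[OF conjunct2[OF P]] conjunct2[OF conjunct2[OF P]]
  obtain z where z: "solution_curve G z" "leading_form (edge_segment (g i)) v\<^sub>0 w\<^sub>0 z" "has_minimal_regularity_degree G z ?k"
   using edge_part_i(2)[OF ge[OF it] ab' vw] by (elim exE conjE) (rule that; assumption)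
  have 1: "int ?k = int (edge_N (g i)) - int (max (edge_m (g i)) (edge_n (g i)))"
   by (rule of_nat_diff[OF edge_areas(4)[OF ge[OF it]]])
  have 2: "real ?k = 2 * elementary_area (edge_segment (g i)) l - real (max (edge_m (g i)) (edge_n (g i)))" if "l < edge_r (g i)" for l
   unfolding edge_areas(2)[OF ge[OF it] that] by (rule of_nat_diff[OF edge_areas(4)[OF ge[OF it]]])
  show "\<exists>z k. solution_curve G z \<and> leading_form (edge_segment (g i)) v\<^sub>0 w\<^sub>0 z \<and>
       has_minimal_regularity_degree G z k \<and>
       int k = int (edge_N (g i)) - int (max (edge_m (g i)) (edge_n (g i))) \<and>
       (\<forall>l<edge_r (g i). real k = 2 * elementary_area (edge_segment (g i)) l - real (max (edge_m (g i)) (edge_n (g i))))"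
   by (rule exI[of _ z], rule exI[of _ ?k], intro conjI allI impI z 1 2)
 qed
 have ii: "card (segment_curves G c (S i) // same_orbit) = seg_r (S i) \<and>
    (\<exists>k. (\<forall>z\<in>segment_curves G c (S i). has_minimal_regularity_degree G z k) \<and>
       int k = int (seg_N (S i)) - int (max (seg_m (S i)) (seg_n (S i))) \<and>
       real (seg_r (S i) * k) =
        2 * segment_area (S i) - real (max (seg_p (S i)) (seg_q (S i))))"
  if it: "i \<in> {1..\<tau>}" and "splits_simply (seg_poly c (S i))" for i
  unfolding Sg[OF it] seg_edge[OF ge[OF it]]
 proof
  let ?e = "g i"
  let ?k = "edge_N ?e - max (edge_m ?e) (edge_n ?e)"
  have s: "splits_simply (seg_poly c (edge_segment ?e))" using that(2) unfolding Sg[OF it] .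
  have "card ((\<Union>e\<in>{?e}. segment_curves G c (edge_segment e)) // same_orbit) = (\<Sum>e\<in>{?e}. edge_r e)"
  proof (rule card_orbits)
   show "{?e} \<subseteq> newton_edges c" using ge[OF it] by simp
   show "splits_simply (seg_poly c (edge_segment e))" if "e \<in> {?e}" for e using that s by simp
  qed
  then show "card (segment_curves G c (edge_segment ?e) // same_orbit) = edge_r ?e" by simp
  have 1: "int ?k = int (edge_N ?e) - int (max (edge_m ?e) (edge_n ?e))"
   by (rule of_nat_diff[OF edge_areas(4)[OF ge[OF it]]])
  have 2: "real (edge_r ?e * ?k) = 2 * segment_area (edge_segment ?e) - real (max (seg_p (edge_segment ?e)) (seg_q (edge_segment ?e)))"
   unfolding edge_areas(1,3)[OF ge[OF it]] diff_mult_distrib2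
   by (rule of_nat_diff) (intro mult_le_mono2 edge_areas(4)[OF ge[OF it]])
  have 3: "\<forall>z\<in>segment_curves G c (edge_segment ?e). has_minimal_regularity_degree G z ?k"
   using edge_regularity[OF ge[OF it] s] by blast
  show "\<exists>k. (\<forall>z\<in>segment_curves G c (edge_segment ?e). has_minimal_regularity_degree G z k) \<and>
       int k = int (edge_N ?e) - int (max (edge_m ?e) (edge_n ?e)) \<and>
       real (edge_r ?e * k) = 2 * segment_area (edge_segment ?e) - real (max (seg_p (edge_segment ?e)) (seg_q (edge_segment ?e)))"
   by (rule exI[of _ ?k], intro conjI 1 2 3)
 qed
 have iii: "card ((\<Union>i\<in>{1..\<tau>}. segment_curves G c (S i)) // same_orbit) = (\<Sum>i=1..\<tau>. seg_r (S i)) \<and>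
    (\<exists>\<mu>. has_milnor_number c \<mu> \<and>
       int \<mu> = (\<Sum>i=1..\<tau>. int (seg_r (S i)) *
            (int (seg_N (S i)) - int (max (seg_m (S i)) (seg_n (S i)))))
           - int (series_order c) + 1)"
  if "\<forall>i\<in>{1..\<tau>}. splits_simply (seg_poly c (S i))"
 proof -
  have img: "g ` {1..\<tau>} = newton_edges c" using g by (rule bij_betw_imp_surj_on)
  have s: "splits_simply (seg_poly c (edge_segment e))" if eN: "e \<in> newton_edges c" for e
  proof -
   obtain i where it: "e = g i" "i \<in> {1..\<tau>}" using eN unfolding img[symmetric] by (elim imageE) (rule that; assumption)
   show ?thesis using bspec[OF \<open>\<forall>i\<in>{1..\<tau>}. splits_simply (seg_poly c (S i))\<close> it(2)] unfolding Sg[OF it(2)] it(1) .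
  qed
  have "(\<Union>i\<in>{1..\<tau>}. segment_curves G c (S i)) = (\<Union>i\<in>{1..\<tau>}. segment_curves G c (edge_segment (g i)))"
   by (rule SUP_cong[OF refl]) (simp only: Sg)
  also have "\<dots> = (\<Union>e\<in>newton_edges c. segment_curves G c (edge_segment e))" unfolding img[symmetric] image_image ..
  finally have U: "(\<Union>i\<in>{1..\<tau>}. segment_curves G c (S i)) = (\<Union>e\<in>newton_edges c. segment_curves G c (edge_segment e))" .
  have r: "(\<Sum>i=1..\<tau>. seg_r (S i)) = (\<Sum>e\<in>newton_edges c. edge_r e)"
   unfolding sum.reindex_bij_betw[OF g, symmetric] by (intro sum.cong refl) (simp only: Sg seg_edge[OF ge])
  have w: "(\<Sum>i=1..\<tau>. int (seg_r (S i)) * (int (seg_N (S i)) - int (max (seg_m (S i)) (seg_n (S i)))))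
    = (\<Sum>e\<in>newton_edges c. int (edge_r e) * (int (edge_N e) - int (max (edge_m e) (edge_n e))))"
   unfolding sum.reindex_bij_betw[OF g, symmetric] by (intro sum.cong refl) (simp only: Sg seg_edge[OF ge])
  show ?thesis unfolding U r w by (intro conjI card_orbits[OF subset_refl s] milnor_number_split[OF s])
 qed
 show ?thesis
  apply (rule conjI)
   apply (intro ballI allI impI)
   apply (rule i; assumption)
  apply (rule conjI)
   apply (intro ballI impI)
   apply (rule ii; assumption)
  apply (rule impI)
  apply (rule iii; assumption)
  done
qed

end
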